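(* Let $F$ be an algebraically closed field of characteristic zero and let $A$ be a finite-dimensional, nonnilpotent fundamental $F$-algebra with polynomial codimension growth. Assume that $s_A=2$. Then $A\sim_T B(A)$, where $B(A)$ is the detector algebra of $A$ defined in the context. That is, there exist $\varepsilon_1,\varepsilon_{1^*},\varepsilon_2,\varepsilon_4,\varepsilon_{4^*},\varepsilon_5,\varepsilon_6\in\{0,1\}$ (namely the parameters defining $B(A)$) such that $$A\sim_T A_1^{\varepsilon_1}\oplus(A_1^* )^{\varepsilon_{1^*}}\oplus A_2^{\varepsilon_2}\oplus A_4^{\varepsilon_4}\oplus(A_4^* )^{\varepsilon_{4^*}}\oplus A_5^{\varepsilon_5}\oplus A_6^{\varepsilon_6},$$ where $\varepsilon_2+\varepsilon_4+\varepsilon_{4^*}+\varepsilon_5+\varepsilon_6\ge 1$.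
   Context: All algebras are associative, not necessarily unital. $F\langle X\rangle$ is the free associative algebra on $X=\{x_1,x_2,\dots\}$ (polynomials without constant term), $\operatorname{Id}(A)$ is the ideal of polynomial identities of $A$, and $A\sim_T B$ means $\operatorname{Id}(A)=\operatorname{Id}(B)$. $P_n$ is the space of multilinear polynomials in $x_1,\dots,x_n$, $c_n(A)=\dim_F P_n/(P_n\cap\operatorname{Id}(A))$; $A$ has polynomial codimension growth if $c_n(A)\le an^b$ for some constants $a,b>0$ and all $n\ge1$. For finite-dimensional $A$, $J(A)$ is the Jacobson radical and $s_A=\min\{s\ge0\mid J(A)^{s+1}=\{0\}\}$. Fundamental algebras. Fix a Wedderburn--Malcev decomposition $A=\overline A+J(A)$, $\overline A=A^{(1)}\oplus\cdots\oplus A^{(q)}$ with $A^{(i)}$ simple. Let $r=\dim_F J(A)$, let $A'=\overline A*F\langle y_1,\dots,y_r\rangle$ (free product), $I$ the ideal of $A'$ generated by all evaluations in $A'$ of polynomials in $\operatorname{Id}(A)$, $\mathcal A=A'/I$, $K$ the ideal of $\mathcal A$ generated by the images of $y_1,\dots,y_r$, and $\mathcal A_{s_A}=\mathcal A/K^{s_A}$ (with $K^0=\mathcal A$, so $\mathcal A_0=\{0\}$). For $1\le i\le q$ let $B_i=\bigl(\bigoplus_{j\ne i}A^{(j)}\bigr)+J(A)$. A finite-dimensional algebra $A$ is fundamental if it is simple or $\operatorname{Id}(A)\subsetneq\bigl(\bigcap_{i=1}^q\operatorname{Id}(B_i)\bigr)\cap\operatorname{Id}(\mathcal A_{s_A})$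 (an empty intersection being $F\langle X\rangle$). Known fact needed to make sense of $B(A)$: a finite-dimensional, nonnilpotent fundamental algebra of polynomial codimension growth over an algebraically closed field of characteristic zero has a Wedderburn--Malcev decomposition $A=F+J$ with $J=J(A)$ and one-dimensional semisimple part $F$, whose identity element is denoted $1_F$ (possibly $J=\{0\}$; $1_F$ need not be an identity of $A$). Detector algebra. Let $A=F+J$ be a Wedderburn--Malcev decomposition of a finite-dimensional algebra $A$ with $J=J(A)$ its Jacobson radical and with one-dimensional semisimple part $F$, whose identity element is $1_F$, and suppose $J^3=\{0\}$. For $i,k\in\{0,1\}$ put $J_{ik}=\{a\in J\mid 1_Fa=ia,\ a1_F=ka\}$, so that $J=J_{10}+J_{01}+J_{00}+J_{11}$ is a direct sum of vector spaces. For subspaces $U,V$, $UV$ is the span of products $uv$ and $[U,V]$ the span of commutators $uv-vu$. Put $P_4=J_{10}J_{00}$, $P_{4^*}=J_{00}J_{01}$, $P_5=J_{01}J_{10}$, $P_6=J_{10}J_{01}$, $C=[J_{11},J_{11}]$. For a subspace $U$ let $\delta(U)=1$ if $U\ne\{0\}$ and $\delta(U)=0$ otherwise, and set $\varepsilon_1=\delta(J_{10})$, $\varepsilon_{1^*}=\delta(J_{01})$, $\varepsilon_2=\delta(C)$, $\varepsilon_4=\delta(P_4)$, $\varepsilon_{4^*}=\delta(P_{4^*})$, $\varepsilon_5=\delta(P_5)$, $\varepsilon_6=\delta(P_6)$. Writing $M^{1}$ for a summand $M$ that occurs and $M^0$ for an omitted one, $$B(A)=A_1^{\varepsilon_1}\oplus(A_1^*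 )^{\varepsilon_{1^*}}\oplus A_2^{\varepsilon_2}\oplus A_4^{\varepsilon_4}\oplus(A_4^* )^{\varepsilon_{4^*}}\oplus A_5^{\varepsilon_5}\oplus A_6^{\varepsilon_6}.$$ Model algebras ($e_{ij}$ matrix units): in $2\times2$ matrices, $A_1=Fe_{11}+Fe_{12}$, $A_1^*=Fe_{22}+Fe_{12}$; in $3\times3$ matrices, $A_2=F(e_{11}+e_{22}+e_{33})+Fe_{12}+Fe_{13}+Fe_{23}$, $A_4=Fe_{11}+Fe_{12}+Fe_{13}+Fe_{23}$, $A_4^*=Fe_{33}+Fe_{12}+Fe_{13}+Fe_{23}$, $A_5=Fe_{22}+Fe_{12}+Fe_{13}+Fe_{23}$, $A_6=F(e_{11}+e_{33})+Fe_{12}+Fe_{13}+Fe_{23}$. *)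

theory Defs
  imports
    "HOL-Algebra.QuotRing"
    "HOL-Algebra.Chinese_Remainder"
    "Jordan_Normal_Form.VS_Connect"
    "HOL-Library.Poly_Mapping"
begin

section \<open>Associative algebras, not necessarily unital\<close>

text \<open>
  An \<open>F\<close>-algebra is a HOL-Algebra \<^typ>\<open>('f, 'a) module\<close> record over \<^const>\<open>class_ring\<close>, the scalar
  field being the type \<open>'f\<close>. The record has a field \<open>one\<close>, but no definition below depends on its
  value and nothing is assumed about it. Subalgebras are obtained by replacing the carrier.
\<close>

locale assoc_algebra = vectorspace class_ring A
  for A :: "('f :: field, 'a) module" (structure) +
  assumes mult_closed: "\<lbrakk>x \<in> carrier A; y \<in> carrier A\<rbrakk> \<Longrightarrow> x \<otimes> y \<in> carrier A"
    and mult_assoc: "\<lbrakk>x \<in> carrier A; y \<in> carrier A; z \<in> carrier A\<rbrakk>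
      \<Longrightarrow> (x \<otimes> y) \<otimes> z = x \<otimes> (y \<otimes> z)"
    and mult_add_left: "\<lbrakk>x \<in> carrier A; y \<in> carrier A; z \<in> carrier A\<rbrakk>
      \<Longrightarrow> (x \<oplus> y) \<otimes> z = x \<otimes> z \<oplus> y \<otimes> z"
    and mult_add_right: "\<lbrakk>x \<in> carrier A; y \<in> carrier A; z \<in> carrier A\<rbrakk>
      \<Longrightarrow> z \<otimes> (x \<oplus> y) = z \<otimes> x \<oplus> z \<otimes> y"
    and mult_smult_left: "\<lbrakk>x \<in> carrier A; y \<in> carrier A\<rbrakk>
      \<Longrightarrow> (c \<odot> x) \<otimes> y = c \<odot> (x \<otimes> y)"
    and mult_smult_right: "\<lbrakk>x \<in> carrier A; y \<in> carrier A\<rbrakk>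
      \<Longrightarrow> x \<otimes> (c \<odot> y) = c \<odot> (x \<otimes> y)"

abbreviation fspan :: "('f :: field, 'a) module \<Rightarrow> 'a set \<Rightarrow> 'a set" where
  "fspan A \<equiv> LinearCombinations.module.span class_ring A"

abbreviation fdim :: "('f :: field, 'a) module \<Rightarrow> nat" where
  "fdim A \<equiv> vectorspace.dim class_ring A"

abbreviation finite_dimensional :: "('f :: field, 'a) module \<Rightarrow> bool" where
  "finite_dimensional A \<equiv> vectorspace.fin_dim class_ring A"

definition subspace_mult :: "('f :: field, 'a) module \<Rightarrow> 'a set \<Rightarrow> 'a set \<Rightarrow> 'a set" where
  "subspace_mult A U V = fspan A (U <#>\<^bsub>A\<^esub> V)"

definition subspace_comm :: "('f :: field, 'a) module \<Rightarrow> 'a set \<Rightarrow> 'a set \<Rightarrow> 'a set" where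
  "subspace_comm A U V = fspan A {u \<otimes>\<^bsub>A\<^esub> v \<ominus>\<^bsub>A\<^esub> v \<otimes>\<^bsub>A\<^esub> u | u v. u \<in> U \<and> v \<in> V}"

text \<open>The zeroth power is the whole algebra, which need not satisfy \<open>K\<^sup>0 K = K\<close>; hence the
  separate clause for \<open>K\<^sup>1\<close>.\<close>

fun ideal_power :: "('f :: field, 'a) module \<Rightarrow> 'a set \<Rightarrow> nat \<Rightarrow> 'a set" where
  "ideal_power A K 0 = carrier A"
| "ideal_power A K (Suc 0) = K"
| "ideal_power A K (Suc (Suc n)) = subspace_mult A (ideal_power A K (Suc n)) K"

definition nilpotent_algebra :: "('f :: field, 'a) module \<Rightarrow> bool" where
  "nilpotent_algebra A \<longleftrightarrow> (\<exists>n\<ge>1. ideal_power A (carrier A) n = {\<zero>\<^bsub>A\<^esub>})"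

definition left_ideal :: "('f :: field, 'a) module \<Rightarrow> 'a set \<Rightarrow> bool" where
  "left_ideal A L \<longleftrightarrow> subspace class_ring L A \<and> (\<forall>a\<in>carrier A. \<forall>x\<in>L. a \<otimes>\<^bsub>A\<^esub> x \<in> L)"

definition alg_ideal :: "('f :: field, 'a) module \<Rightarrow> 'a set \<Rightarrow> bool" where
  "alg_ideal A I \<longleftrightarrow> subspace class_ring I A \<and>
     (\<forall>a\<in>carrier A. \<forall>x\<in>I. a \<otimes>\<^bsub>A\<^esub> x \<in> I \<and> x \<otimes>\<^bsub>A\<^esub> a \<in> I)"

definition generated_ideal :: "('f :: field, 'a) module \<Rightarrow> 'a set \<Rightarrow> 'a set" where
  "generated_ideal A S = alg_ideal A hull S"

definition simple_algebra :: "('f :: field, 'a) module \<Rightarrow> bool" where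
  "simple_algebra A \<longleftrightarrow> (\<exists>x\<in>carrier A. \<exists>y\<in>carrier A. x \<otimes>\<^bsub>A\<^esub> y \<noteq> \<zero>\<^bsub>A\<^esub>) \<and>
     (\<forall>I. alg_ideal A I \<longrightarrow> I = {\<zero>\<^bsub>A\<^esub>} \<or> I = carrier A)"

definition quotient_algebra ::
  "('f :: field, 'a) module \<Rightarrow> 'a set \<Rightarrow> ('f, 'a set) module" where
  "quotient_algebra A I = ring.extend (A Quot I)
     (module.fields (\<lambda>c X. \<Union>x\<in>X. I +>\<^bsub>A\<^esub> (c \<odot>\<^bsub>A\<^esub> x)))"

definition direct_sum ::
  "('f :: field, 'a) module \<Rightarrow> ('f, 'b) module \<Rightarrow> ('f, 'a \<times> 'b) module" (infixr \<open>\<boxplus>\<close> 65) where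
  "A \<boxplus> B = ring.extend (RDirProd A B)
     (module.fields (\<lambda>c (x, y). (c \<odot>\<^bsub>A\<^esub> x, c \<odot>\<^bsub>B\<^esub> y)))"


section \<open>The Jacobson radical\<close>

text \<open>The Jacobson radical of an algebra without unit: the intersection of the maximal modular
  left ideals, and the whole algebra if there are none. A left ideal \<open>L\<close> is modular if some \<open>e\<close> is
  a right unit modulo \<open>L\<close>.\<close>

definition modular_left_ideal :: "('f :: field, 'a) module \<Rightarrow> 'a set \<Rightarrow> bool" where
  "modular_left_ideal A L \<longleftrightarrow> left_ideal A L \<and>
     (\<exists>e\<in>carrier A. \<forall>x\<in>carrier A. x \<ominus>\<^bsub>A\<^esub> x \<otimes>\<^bsub>A\<^esub> e \<in> L)"

definition maximal_modular_left_ideal :: "('f :: field, 'a) module \<Rightarrow> 'a set \<Rightarrow> bool" where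
  "maximal_modular_left_ideal A L \<longleftrightarrow> modular_left_ideal A L \<and> L \<noteq> carrier A \<and>
     (\<forall>M. left_ideal A M \<and> L \<subseteq> M \<longrightarrow> M = L \<or> M = carrier A)"

definition jacobson_radical :: "('f :: field, 'a) module \<Rightarrow> 'a set" where
  "jacobson_radical A = carrier A \<inter> \<Inter> {L. maximal_modular_left_ideal A L}"

definition s_index :: "('f :: field, 'a) module \<Rightarrow> nat" where
  "s_index A = (LEAST s. ideal_power A (jacobson_radical A) (Suc s) = {\<zero>\<^bsub>A\<^esub>})"


section \<open>Free algebras and polynomial identities\<close>

text \<open>Lists under concatenation are the free monoid, written additively so that the convolution
  product of \<^typ>\<open>'x list \<Rightarrow>\<^sub>0 'f\<close> is the product of noncommutative polynomials.\<close>

instantiation list :: (type) monoid_add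
begin

definition zero_list :: "'a list" where "zero_list = []"

definition plus_list :: "'a list \<Rightarrow> 'a list \<Rightarrow> 'a list" where "plus_list = (@)"

instance
  by standard (simp_all add: zero_list_def plus_list_def)

end

definition free_algebra :: "'x set \<Rightarrow> ('f :: field, 'x list \<Rightarrow>\<^sub>0 'f) module" where
  "free_algebra X = \<lparr>
     carrier = {p. \<forall>w\<in>Poly_Mapping.keys p. w \<noteq> [] \<and> set w \<subseteq> X},
     mult = (*), one = 1, zero = 0, add = (+),
     smult = (\<lambda>c. Poly_Mapping.map ((*) c))\<rparr>"

definition gen :: "'x \<Rightarrow> 'x list \<Rightarrow>\<^sub>0 'f :: field" where
  "gen x = Poly_Mapping.single [x] 1"

text \<open>\<open>F\<langle>X\<rangle>\<close>, whose variables \<open>x\<^sub>1, x\<^sub>2, \<dots>\<close> are numbered from \<open>0\<close> here.\<close>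

abbreviation FX :: "('f :: field, nat list \<Rightarrow>\<^sub>0 'f) module" where
  "FX \<equiv> free_algebra UNIV"

text \<open>Only nonempty words occur in elements of \<^const>\<open>free_algebra\<close>; the first clause is a dummy.\<close>

fun word_product :: "('f :: field, 'a) module \<Rightarrow> 'a list \<Rightarrow> 'a" where
  "word_product A [] = \<zero>\<^bsub>A\<^esub>"
| "word_product A [a] = a"
| "word_product A (a # b # w) = a \<otimes>\<^bsub>A\<^esub> word_product A (b # w)"

definition evaluate ::
  "('f :: field, 'a) module \<Rightarrow> ('x \<Rightarrow> 'a) \<Rightarrow> ('x list \<Rightarrow>\<^sub>0 'f) \<Rightarrow> 'a" where
  "evaluate A \<phi> p =
     (\<Oplus>\<^bsub>A\<^esub>w\<in>Poly_Mapping.keys p. Poly_Mapping.lookup p w \<odot>\<^bsub>A\<^esub> word_product A (map \<phi> w))"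

definition identities :: "('f :: field, 'a) module \<Rightarrow> (nat list \<Rightarrow>\<^sub>0 'f) set" where
  "identities A = {p \<in> carrier FX. \<forall>\<phi> \<in> UNIV \<rightarrow> carrier A. evaluate A \<phi> p = \<zero>\<^bsub>A\<^esub>}"

definition T_equivalent ::
  "('f :: field, 'a) module \<Rightarrow> ('f, 'b) module \<Rightarrow> bool" (infix \<open>\<sim>\<^sub>T\<close> 50) where
  "A \<sim>\<^sub>T B \<longleftrightarrow> identities A = identities B"

definition multilinear :: "nat \<Rightarrow> (nat list \<Rightarrow>\<^sub>0 'f :: field) set" where
  "multilinear n = {p. \<forall>w\<in>Poly_Mapping.keys p. distinct w \<and> set w = {..<n}}"

text \<open>The quotient is only used as a vector space; its multiplication is meaningless.\<close>

definition codimension :: "('f :: field, 'a) module \<Rightarrow> nat \<Rightarrow> nat" where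
  "codimension A n =
     fdim (quotient_algebra (FX\<lparr>carrier := multilinear n\<rparr>) (multilinear n \<inter> identities A))"

definition polynomial_growth :: "('f :: field, 'a) module \<Rightarrow> bool" where
  "polynomial_growth A \<longleftrightarrow>
     (\<exists>a b :: real. a > 0 \<and> b > 0 \<and> (\<forall>n\<ge>1. real (codimension A n) \<le> a * real n powr b))"


section \<open>Fundamental algebras\<close>

text \<open>\<open>\<C>\<close> is the set of simple summands of the semisimple part.\<close>

definition semisimple_part :: "('f :: field, 'a) module \<Rightarrow> 'a set set \<Rightarrow> 'a set" where
  "semisimple_part A \<C> = fspan A (\<Union>\<C>)"

definition wedderburn_malcev :: "('f :: field, 'a) module \<Rightarrow> 'a set set \<Rightarrow> bool" where
  "wedderburn_malcev A \<C> \<longleftrightarrow> finite \<C> \<and>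
     (\<forall>S\<in>\<C>. subspace class_ring S A \<and> S <#>\<^bsub>A\<^esub> S \<subseteq> S \<and> simple_algebra (A\<lparr>carrier := S\<rparr>)) \<and>
     (\<forall>S\<in>\<C>. \<forall>T\<in>\<C>. S \<noteq> T \<longrightarrow> S <#>\<^bsub>A\<^esub> T \<subseteq> {\<zero>\<^bsub>A\<^esub>}) \<and>
     (\<forall>S\<in>\<C>. S \<inter> fspan A (\<Union>(\<C> - {S})) = {\<zero>\<^bsub>A\<^esub>}) \<and>
     semisimple_part A \<C> \<inter> jacobson_radical A = {\<zero>\<^bsub>A\<^esub>} \<and>
     fspan A (semisimple_part A \<C> \<union> jacobson_radical A) = carrier A"

definition omit_summand ::
  "('f :: field, 'a) module \<Rightarrow> 'a set set \<Rightarrow> 'a set \<Rightarrow> ('f, 'a) module" where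
  "omit_summand A \<C> S = A\<lparr>carrier := fspan A (\<Union>(\<C> - {S}) \<union> jacobson_radical A)\<rparr>"

text \<open>The free product (coproduct of nonunital algebras) of \<open>A\<close> and \<open>B\<close>: the free algebra on the
  disjoint union of both carriers modulo the relations which make the two canonical maps
  algebra homomorphisms.\<close>

definition hom_relations ::
  "('f :: field, 'a) module \<Rightarrow> ('a \<Rightarrow> 'x) \<Rightarrow> ('x list \<Rightarrow>\<^sub>0 'f) set" where
  "hom_relations A \<iota> =
     {gen (\<iota> (a \<oplus>\<^bsub>A\<^esub> b)) - (gen (\<iota> a) + gen (\<iota> b)) | a b. a \<in> carrier A \<and> b \<in> carrier A} \<union>
     {gen (\<iota> (c \<odot>\<^bsub>A\<^esub> a)) - Poly_Mapping.map ((*) c) (gen (\<iota> a)) | c a. a \<in> carrier A} \<union>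
     {gen (\<iota> (a \<otimes>\<^bsub>A\<^esub> b)) - gen (\<iota> a) * gen (\<iota> b) | a b. a \<in> carrier A \<and> b \<in> carrier A}"

type_synonym ('f, 'a, 'b) free_product = "(('a + 'b) list \<Rightarrow>\<^sub>0 'f) set"

definition free_product_base ::
  "('f :: field, 'a) module \<Rightarrow> ('f, 'b) module \<Rightarrow> ('f, ('a + 'b) list \<Rightarrow>\<^sub>0 'f) module" where
  "free_product_base A B = free_algebra (Inl ` carrier A \<union> Inr ` carrier B)"

definition free_product_relations ::
  "('f :: field, 'a) module \<Rightarrow> ('f, 'b) module \<Rightarrow> (('a + 'b) list \<Rightarrow>\<^sub>0 'f) set" where
  "free_product_relations A B = generated_ideal (free_product_base A B)
     (hom_relations A Inl \<union> hom_relations B Inr)"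

definition free_product ::
  "('f :: field, 'a) module \<Rightarrow> ('f, 'b) module \<Rightarrow> ('f, ('f, 'a, 'b) free_product) module" where
  "free_product A B = quotient_algebra (free_product_base A B) (free_product_relations A B)"

definition free_product_inr ::
  "('f :: field, 'a) module \<Rightarrow> ('f, 'b) module \<Rightarrow> 'b \<Rightarrow> ('f, 'a, 'b) free_product" where
  "free_product_inr A B b = free_product_relations A B +>\<^bsub>free_product_base A B\<^esub> gen (Inr b)"

text \<open>The algebras \<open>A'\<close>, \<open>\<A> = A' / I\<close> and \<open>\<A> / K\<^sup>s\<close>, with \<open>y\<^sub>1, \<dots>, y\<^sub>r\<close> numbered from \<open>0\<close>.\<close>

definition radical_variables :: "('f :: field, 'a) module \<Rightarrow> nat set" where
  "radical_variables A = {..<fdim (A\<lparr>carrier := jacobson_radical A\<rparr>)}"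

definition algebra_A' ::
  "('f :: field, 'a) module \<Rightarrow> 'a set set \<Rightarrow> ('f, ('f, 'a, nat list \<Rightarrow>\<^sub>0 'f) free_product) module" where
  "algebra_A' A \<C> =
     free_product (A\<lparr>carrier := semisimple_part A \<C>\<rparr>) (free_algebra (radical_variables A))"

definition evaluation_ideal ::
  "('f :: field, 'a) module \<Rightarrow> 'a set set \<Rightarrow> ('f, 'a, nat list \<Rightarrow>\<^sub>0 'f) free_product set" where
  "evaluation_ideal A \<C> = generated_ideal (algebra_A' A \<C>)
     {evaluate (algebra_A' A \<C>) \<phi> p | \<phi> p. p \<in> identities A \<and> \<phi> \<in> UNIV \<rightarrow> carrier (algebra_A' A \<C>)}"

definition algebra_calA ::
  "('f :: field, 'a) module \<Rightarrow> 'a set set \<Rightarrow>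
     ('f, ('f, 'a, nat list \<Rightarrow>\<^sub>0 'f) free_product set) module" where
  "algebra_calA A \<C> = quotient_algebra (algebra_A' A \<C>) (evaluation_ideal A \<C>)"

definition ideal_K ::
  "('f :: field, 'a) module \<Rightarrow> 'a set set \<Rightarrow>
     ('f, 'a, nat list \<Rightarrow>\<^sub>0 'f) free_product set set" where
  "ideal_K A \<C> = generated_ideal (algebra_calA A \<C>)
     {evaluation_ideal A \<C> +>\<^bsub>algebra_A' A \<C>\<^esub>
        free_product_inr (A\<lparr>carrier := semisimple_part A \<C>\<rparr>) (free_algebra (radical_variables A))
          (gen i) | i. i \<in> radical_variables A}"

definition algebra_calA_mod ::
  "('f :: field, 'a) module \<Rightarrow> 'a set set \<Rightarrow> nat \<Rightarrow>
     ('f, ('f, 'a, nat list \<Rightarrow>\<^sub>0 'f) free_product set set) module" where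
  "algebra_calA_mod A \<C> s =
     quotient_algebra (algebra_calA A \<C>) (ideal_power (algebra_calA A \<C>) (ideal_K A \<C>) s)"

text \<open>The condition does not depend on the decomposition, by the Wedderburn--Malcev theorem. For
  \<open>\<C> = {}\<close> the intersection over \<open>\<C>\<close> is \<^const>\<open>UNIV\<close> instead of \<open>F\<langle>X\<rangle>\<close>, which makes no
  difference because \<^const>\<open>identities\<close> consists of elements of \<open>F\<langle>X\<rangle>\<close>.\<close>

definition fundamental :: "('f :: field, 'a) module \<Rightarrow> bool" where
  "fundamental A \<longleftrightarrow> simple_algebra A \<or>
     (\<exists>\<C>. wedderburn_malcev A \<C> \<and>
       identities A \<subset> (\<Inter>S\<in>\<C>. identities (omit_summand A \<C> S)) \<inter> identities (algebra_calA_mod A \<C> (s_index A)))"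


section \<open>The model algebras\<close>

definition matrix_unit :: "nat \<Rightarrow> nat \<Rightarrow> nat \<Rightarrow> 'f :: field mat" where
  "matrix_unit n i j = mat n n (\<lambda>(a, b). if Suc a = i \<and> Suc b = j then 1 else 0)"

abbreviation E2 :: "nat \<Rightarrow> nat \<Rightarrow> 'f :: field mat" where "E2 \<equiv> matrix_unit 2"
abbreviation E3 :: "nat \<Rightarrow> nat \<Rightarrow> 'f :: field mat" where "E3 \<equiv> matrix_unit 3"

definition matrix_subalgebra :: "nat \<Rightarrow> 'f mat set \<Rightarrow> ('f :: field, 'f mat) module" where
  "matrix_subalgebra n B =
     (module_mat TYPE('f) n n)\<lparr>carrier := fspan (module_mat TYPE('f) n n) B\<rparr>"

definition A1 :: "('f :: field, 'f mat) module" where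
  "A1 = matrix_subalgebra 2 {E2 1 1, E2 1 2}"

definition A1_star :: "('f :: field, 'f mat) module" where
  "A1_star = matrix_subalgebra 2 {E2 2 2, E2 1 2}"

definition A2 :: "('f :: field, 'f mat) module" where
  "A2 = matrix_subalgebra 3 {E3 1 1 + E3 2 2 + E3 3 3, E3 1 2, E3 1 3, E3 2 3}"

definition A4 :: "('f :: field, 'f mat) module" where
  "A4 = matrix_subalgebra 3 {E3 1 1, E3 1 2, E3 1 3, E3 2 3}"

definition A4_star :: "('f :: field, 'f mat) module" where
  "A4_star = matrix_subalgebra 3 {E3 3 3, E3 1 2, E3 1 3, E3 2 3}"

definition A5 :: "('f :: field, 'f mat) module" where
  "A5 = matrix_subalgebra 3 {E3 2 2, E3 1 2, E3 1 3, E3 2 3}"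

definition A6 :: "('f :: field, 'f mat) module" where
  "A6 = matrix_subalgebra 3 {E3 1 1 + E3 3 3, E3 1 2, E3 1 3, E3 2 3}"


section \<open>The detector algebra\<close>

text \<open>\<open>A = F + J\<close> is a Wedderburn--Malcev decomposition with one-dimensional semisimple part whose
  identity element is \<open>e\<close>.\<close>

definition one_dim_decomposition :: "('f :: field, 'a) module \<Rightarrow> 'a \<Rightarrow> bool" where
  "one_dim_decomposition A e \<longleftrightarrow>
     (\<exists>S. wedderburn_malcev A {S} \<and> fdim (A\<lparr>carrier := S\<rparr>) = 1 \<and>
       e \<in> S \<and> (\<forall>x\<in>S. e \<otimes>\<^bsub>A\<^esub> x = x \<and> x \<otimes>\<^bsub>A\<^esub> e = x))"

definition peirce :: "('f :: field, 'a) module \<Rightarrow> 'a \<Rightarrow> nat \<Rightarrow> nat \<Rightarrow> 'a set" where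
  "peirce A e i k =
     {a \<in> jacobson_radical A. e \<otimes>\<^bsub>A\<^esub> a = of_nat i \<odot>\<^bsub>A\<^esub> a \<and> a \<otimes>\<^bsub>A\<^esub> e = of_nat k \<odot>\<^bsub>A\<^esub> a}"

definition delta :: "('f :: field, 'a) module \<Rightarrow> 'a set \<Rightarrow> nat" where
  "delta A U = (if U \<noteq> {\<zero>\<^bsub>A\<^esub>} then 1 else 0)"

definition eps1 :: "('f :: field, 'a) module \<Rightarrow> 'a \<Rightarrow> nat" where
  "eps1 A e = delta A (peirce A e 1 0)"

definition eps1_star :: "('f :: field, 'a) module \<Rightarrow> 'a \<Rightarrow> nat" where
  "eps1_star A e = delta A (peirce A e 0 1)"

definition eps2 :: "('f :: field, 'a) module \<Rightarrow> 'a \<Rightarrow> nat" where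
  "eps2 A e = delta A (subspace_comm A (peirce A e 1 1) (peirce A e 1 1))"

definition eps4 :: "('f :: field, 'a) module \<Rightarrow> 'a \<Rightarrow> nat" where
  "eps4 A e = delta A (subspace_mult A (peirce A e 1 0) (peirce A e 0 0))"

definition eps4_star :: "('f :: field, 'a) module \<Rightarrow> 'a \<Rightarrow> nat" where
  "eps4_star A e = delta A (subspace_mult A (peirce A e 0 0) (peirce A e 0 1))"

definition eps5 :: "('f :: field, 'a) module \<Rightarrow> 'a \<Rightarrow> nat" where
  "eps5 A e = delta A (subspace_mult A (peirce A e 0 1) (peirce A e 1 0))"

definition eps6 :: "('f :: field, 'a) module \<Rightarrow> 'a \<Rightarrow> nat" where
  "eps6 A e = delta A (subspace_mult A (peirce A e 1 0) (peirce A e 0 1))"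

text \<open>\<open>M\<^sup>\<epsilon>\<close>: a summand is omitted by replacing it with the zero subalgebra.\<close>

definition optional_summand :: "nat \<Rightarrow> ('f :: field, 'a) module \<Rightarrow> ('f, 'a) module" where
  "optional_summand \<epsilon> M = (if \<epsilon> = 0 then M\<lparr>carrier := {\<zero>\<^bsub>M\<^esub>}\<rparr> else M)"

definition detector_algebra :: "('f :: field, 'a) module \<Rightarrow> 'a \<Rightarrow>
    ('f, 'f mat \<times> 'f mat \<times> 'f mat \<times> 'f mat \<times> 'f mat \<times> 'f mat \<times> 'f mat) module" where
  "detector_algebra A e =
     optional_summand (eps1 A e) A1 \<boxplus> optional_summand (eps1_star A e) A1_star \<boxplus>
     optional_summand (eps2 A e) A2 \<boxplus> optional_summand (eps4 A e) A4 \<boxplus>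
     optional_summand (eps4_star A e) A4_star \<boxplus> optional_summand (eps5 A e) A5 \<boxplus>
     optional_summand (eps6 A e) A6"

end

theory Submission
  imports Defs "HOL-Computational_Algebra.Polynomial"
begin

text \<open>Every polynomial \<open>f\<close> is evaluated at \<open>x \<mapsto> \<alpha>\<^sub>x 1\<^sub>F + u\<^sub>x + v\<^sub>x + w\<^sub>x + z\<^sub>x\<close>, with the last four terms in
  \<open>J\<^sub>1\<^sub>1\<close>, \<open>J\<^sub>1\<^sub>0\<close>, \<open>J\<^sub>0\<^sub>1\<close> and \<open>J\<^sub>0\<^sub>0\<close>. Since \<open>J\<^sup>3 = 0\<close>, the value of a word under a linear functional is a
  sum of entries of products of upper triangular \<open>3 \<times> 3\<close> matrices whose diagonals are \<open>\<alpha>\<close> or \<open>0\<close>. The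
  models are exactly the algebras of such matrices, so \<open>Id(A)\<close> and \<open>Id(B(A))\<close> are cut out by the
  vanishing of the same entries, once some parameter belonging to \<open>J\<^sup>2\<close> is nonzero.

  Polynomial growth excludes the upper triangular \<open>2 \<times> 2\<close> matrices from \<open>A\<close>. Hence the simple components
  are one-dimensional and pairwise unlinked, and fundamentality leaves only one of them. It
  also yields \<open>f \<in> Id(J) - Id(A)\<close> with \<open>f(A) \<subseteq> J\<^sup>2\<close>, which could not exist if all products
  \<open>[J\<^sub>1\<^sub>1, J\<^sub>1\<^sub>1]\<close>, \<open>J\<^sub>1\<^sub>0J\<^sub>0\<^sub>0\<close>, \<open>J\<^sub>0\<^sub>0J\<^sub>0\<^sub>1\<close>, \<open>J\<^sub>0\<^sub>1J\<^sub>1\<^sub>0\<close>, \<open>J\<^sub>1\<^sub>0J\<^sub>0\<^sub>1\<close> were zero.\<close>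

section \<open>Vector spaces\<close>

text \<open>Several products in \<open>J\<^sup>2\<close> are not seen by any parameter.
  \<open>J11 J10\<close> and \<open>J01 J11\<close> take care of themselves: an entry with one
  off-diagonal factor that vanishes for all \<alpha> still vanishes at \<alpha> + t\<beta>, and the
  coefficient of t is the entry with two factors. Products inside \<open>J00\<close> are the real
  obstacle. They see the part of degree two of a polynomial, and every 3 x 3 model kills this part,
  because its bilinear entry may be taken at \<alpha> = 0. So the claim that one of the five product
  parameters is nonzero is needed for the equivalence and is not a mere supplement to it. Inside
  \<open>J11\<close> the second coefficient of the diagonal entry makes the form alternating;
  symmetric products then drop out in characteristic zero, and only commutators count. Linear
  functionals replace coordinates throughout: applied to values in \<open>A\<close> they give
  scalars that can be compared with matrix entries. The radical is defined by modular left ideals,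
  so its ideal property, quasi-regularity and nilpotency have to be derived before
  \<open>s_index A = 2\<close> can be read as \<open>J\<^sup>3 = 0\<close>.\<close>

locale fvectorspace = vectorspace class_ring A
  for A :: "('f :: field, 'a) module" (structure)
begin

lemma smult_in [simp, intro]: "x \<in> carrier A \<Longrightarrow> c \<odot> x \<in> carrier A"
  by (simp add: smult_closed)

lemma smult_add: "\<lbrakk>x \<in> carrier A; y \<in> carrier A\<rbrakk> \<Longrightarrow> c \<odot> (x \<oplus> y) = c \<odot> x \<oplus> c \<odot> y"
  by (simp add: smult_r_distr)

lemma add_smult: "x \<in> carrier A \<Longrightarrow> (c + d) \<odot> x = c \<odot> x \<oplus> d \<odot> x"
  using smult_l_distr[of c d x] by simp

lemma mult_smult: "x \<in> carrier A \<Longrightarrow> (c * d) \<odot> x = c \<odot> (d \<odot> x)"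
  using smult_assoc1[of c d x] by simp

lemma one_smult [simp]: "x \<in> carrier A \<Longrightarrow> 1 \<odot> x = x"
  using smult_one[of x] by simp

lemma zero_smult [simp]: "x \<in> carrier A \<Longrightarrow> 0 \<odot> x = \<zero>"
  using lmult_0[of x] by simp

lemma smult_zero [simp]: "c \<odot> \<zero> = \<zero>"
  using rmult_0[of c] by simp

lemma uminus_smult: "x \<in> carrier A \<Longrightarrow> (- c) \<odot> x = \<ominus> (c \<odot> x)"
  by (rule M.minus_equality[symmetric]) (simp_all only: add_smult[symmetric] smult_in add.left_inverse zero_smult)

lemma neg_eq_smult: "x \<in> carrier A \<Longrightarrow> \<ominus> x = (- 1) \<odot> x"
  using uminus_smult[of x 1] by (simp only: one_smult)

lemmas group_norm = a_minus_def M.minus_add M.a_ac M.r_neg M.l_neg M.r_neg1 M.r_neg2 M.minus_minus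

lemma diff_add_cancel: "\<lbrakk>x \<in> carrier A; y \<in> carrier A\<rbrakk> \<Longrightarrow> (x \<ominus> y) \<oplus> y = x"
  by (simp add: a_minus_def M.a_assoc M.l_neg)

lemma add_diff_cancel_left: "\<lbrakk>x \<in> carrier A; y \<in> carrier A\<rbrakk> \<Longrightarrow> (x \<oplus> y) \<ominus> x = y"
  by (simp add: a_minus_def M.a_assoc M.r_neg M.a_comm[of x y])

lemma diff_eq_zero_iff: "\<lbrakk>x \<in> carrier A; y \<in> carrier A\<rbrakk> \<Longrightarrow> x \<ominus> y = \<zero> \<longleftrightarrow> x = y"
  by (rule M.minus_other_side)

lemma smult_minus: "\<lbrakk>x \<in> carrier A; y \<in> carrier A\<rbrakk> \<Longrightarrow> c \<odot> (x \<ominus> y) = c \<odot> x \<ominus> c \<odot> y"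
proof -
  assume xy: "x \<in> carrier A" "y \<in> carrier A"
  have "c \<odot> (\<ominus> y) = \<ominus> (c \<odot> y)"
    using xy mult_smult[of y c "-1"] mult_smult[of y "-1" c]
    by (simp add: neg_eq_smult[of y] neg_eq_smult[of "c \<odot> y"])
  then show ?thesis using xy by (simp add: a_minus_def smult_add)
qed

lemma smult_eq_zero_iff: "x \<in> carrier A \<Longrightarrow> c \<odot> x = \<zero> \<longleftrightarrow> c = 0 \<or> x = \<zero>"
proof
  assume x: "x \<in> carrier A" and z: "c \<odot> x = \<zero>"
  show "c = 0 \<or> x = \<zero>"
  proof (rule ccontr)
    assume n: "\<not> (c = 0 \<or> x = \<zero>)"
    have "x = (inverse c * c) \<odot> x" using n x by simp
    also have "\<dots> = \<zero>" using z x by (simp only: mult_smult smult_zero)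
    finally show False using n by simp
  qed
qed auto

lemma subspace_iff:
  "subspace class_ring W A \<longleftrightarrow> W \<subseteq> carrier A \<and> \<zero> \<in> W \<and> (\<forall>x\<in>W. \<forall>y\<in>W. x \<oplus> y \<in> W)
     \<and> (\<forall>c. \<forall>x\<in>W. c \<odot> x \<in> W)"
proof -
  have "vectorspace class_ring A" "module class_ring A" by unfold_locales
  then show ?thesis
    by (auto simp: subspace_def submodule_def)
qed

lemma subspaceI [intro?]:
  "\<lbrakk>W \<subseteq> carrier A; \<zero> \<in> W; \<And>x y. \<lbrakk>x \<in> W; y \<in> W\<rbrakk> \<Longrightarrow> x \<oplus> y \<in> W;
    \<And>c x. x \<in> W \<Longrightarrow> c \<odot> x \<in> W\<rbrakk> \<Longrightarrow> subspace class_ring W A"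
  by (simp add: subspace_iff)

lemma subspaceD:
  assumes "subspace class_ring W A"
  shows "W \<subseteq> carrier A" "\<And>x. x \<in> W \<Longrightarrow> x \<in> carrier A" "\<zero> \<in> W"
    "\<And>x y. \<lbrakk>x \<in> W; y \<in> W\<rbrakk> \<Longrightarrow> x \<oplus> y \<in> W" "\<And>c x. x \<in> W \<Longrightarrow> c \<odot> x \<in> W"
    "\<And>x. x \<in> W \<Longrightarrow> \<ominus> x \<in> W"
    "\<And>x y. \<lbrakk>x \<in> W; y \<in> W\<rbrakk> \<Longrightarrow> x \<ominus> y \<in> W"
proof -
  show W: "W \<subseteq> carrier A" "\<zero> \<in> W" "\<And>x y. \<lbrakk>x \<in> W; y \<in> W\<rbrakk> \<Longrightarrow> x \<oplus> y \<in> W"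
      "\<And>c x. x \<in> W \<Longrightarrow> c \<odot> x \<in> W"
    using assms unfolding subspace_iff by auto
  then show "x \<in> carrier A" if "x \<in> W" for x using that by auto
  show neg: "\<ominus> x \<in> W" if "x \<in> W" for x
    using W(4)[of x "-1"] neg_eq_smult[of x] that W(1) by auto
  show "x \<ominus> y \<in> W" if "x \<in> W" "y \<in> W" for x y
    using W(3)[OF that(1) neg[OF that(2)]] by (simp only: a_minus_def)
qed

lemma subspace_carrier: "subspace class_ring (carrier A) A"
  by (auto simp: subspace_iff)

lemma subspace_zero: "subspace class_ring {\<zero>} A"
  by (auto simp: subspace_iff)

lemma fspan_subspace: "S \<subseteq> carrier A \<Longrightarrow> subspace class_ring (fspan A S) A"
  by (rule span_is_subspace)

lemma fspan_superset: "S \<subseteq> carrier A \<Longrightarrow> S \<subseteq> fspan A S"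
  by (rule in_own_span)

lemma fspan_base: "\<lbrakk>S \<subseteq> carrier A; x \<in> S\<rbrakk> \<Longrightarrow> x \<in> fspan A S"
  using fspan_superset by blast

lemma fspan_minimal: "\<lbrakk>subspace class_ring W A; S \<subseteq> W\<rbrakk> \<Longrightarrow> fspan A S \<subseteq> W"
  by (rule span_is_subset) (auto simp: subspace_def)

lemma fspan_closed: "S \<subseteq> carrier A \<Longrightarrow> fspan A S \<subseteq> carrier A"
  by (rule fspan_minimal[OF subspace_carrier])

lemma fspan_mono: "\<lbrakk>S \<subseteq> T; T \<subseteq> carrier A\<rbrakk> \<Longrightarrow> fspan A S \<subseteq> fspan A T"
  by (meson fspan_minimal fspan_subspace fspan_superset order_trans)

lemma fspan_of_subspace: "subspace class_ring W A \<Longrightarrow> fspan A W = W"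
  by (meson fspan_minimal fspan_superset order_antisym order_refl subspaceD(1))

lemma fspan_empty: "fspan A {} = {\<zero>}"
  by (rule span_empty)

lemma fspan_zero: "S \<subseteq> {\<zero>} \<Longrightarrow> fspan A S = {\<zero>}"
  by (metis fspan_empty fspan_of_subspace subset_singletonD subspace_zero)

lemma fspan_singleton:
  assumes x: "x \<in> carrier A"
  shows "fspan A {x} = range (\<lambda>c. c \<odot> x)"
proof
  show "fspan A {x} \<subseteq> range (\<lambda>c. c \<odot> x)"
  proof (rule fspan_minimal[OF subspaceI])
    show "\<zero> \<in> range (\<lambda>c. c \<odot> x)" using x by (auto intro!: image_eqI[of _ _ 0])
    show "{x} \<subseteq> range (\<lambda>c. c \<odot> x)" using x by (auto intro!: image_eqI[of _ _ 1])
  qed (use x in \<open>auto simp flip: add_smult mult_smult\<close>)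
  show "range (\<lambda>c. c \<odot> x) \<subseteq> fspan A {x}"
    using subspaceD(5)[OF fspan_subspace fspan_base] x by auto
qed

lemma fspan_induct [consumes 2, case_names base zero add smult]:
  assumes "x \<in> fspan A S" "S \<subseteq> carrier A"
    and "\<And>x. x \<in> S \<Longrightarrow> P x" "P \<zero>"
    and "\<And>x y. \<lbrakk>x \<in> carrier A; y \<in> carrier A; P x; P y\<rbrakk> \<Longrightarrow> P (x \<oplus> y)"
    and "\<And>c x. \<lbrakk>x \<in> carrier A; P x\<rbrakk> \<Longrightarrow> P (c \<odot> x)"
  shows "P x"
proof -
  have "subspace class_ring {x \<in> carrier A. P x} A"
    by (rule subspaceI) (use assms in auto)
  then have "fspan A S \<subseteq> {x \<in> carrier A. P x}"
    by (rule fspan_minimal) (use assms in auto)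
  with assms(1) show ?thesis by auto
qed

lemma fspan_Un_subspaces:
  assumes "subspace class_ring U A" "subspace class_ring W A" "x \<in> fspan A (U \<union> W)"
  obtains u w where "u \<in> U" "w \<in> W" "x = u \<oplus> w"
proof -
  note U = subspaceD[OF assms(1)] and W = subspaceD[OF assms(2)]
  have "subspace class_ring {u \<oplus> w | u w. u \<in> U \<and> w \<in> W} A"
  proof (rule subspaceI)
    show "\<zero> \<in> {u \<oplus> w | u w. u \<in> U \<and> w \<in> W}"
      using U(3) W(3) by (auto intro!: exI[of _ \<zero>])
  next
    fix x y assume "x \<in> {u \<oplus> w | u w. u \<in> U \<and> w \<in> W}" "y \<in> {u \<oplus> w | u w. u \<in> U \<and> w \<in> W}"
    then obtain u w u' w' where *: "u \<in> U" "w \<in> W" "u' \<in> U" "w' \<in> W" "x = u \<oplus> w" "y = u' \<oplus> w'"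
      by blast
    moreover have "x \<oplus> y = (u \<oplus> u') \<oplus> (w \<oplus> w')"
      using * U(2) W(2) by (simp add: M.a_ac)
    ultimately show "x \<oplus> y \<in> {u \<oplus> w | u w. u \<in> U \<and> w \<in> W}"
      using U(4) W(4) by blast
  next
    fix c x assume "x \<in> {u \<oplus> w | u w. u \<in> U \<and> w \<in> W}"
    then obtain u w where *: "u \<in> U" "w \<in> W" "x = u \<oplus> w" by blast
    then have "c \<odot> x = c \<odot> u \<oplus> c \<odot> w" using U(2) W(2) by (simp add: smult_add)
    then show "c \<odot> x \<in> {u \<oplus> w | u w. u \<in> U \<and> w \<in> W}" using * U(5) W(5) by blast
  qed (use U(2) W(2) in auto)
  then have "fspan A (U \<union> W) \<subseteq> {u \<oplus> w | u w. u \<in> U \<and> w \<in> W}"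
  proof (rule fspan_minimal, intro subsetI)
    fix x assume "x \<in> U \<union> W"
    then show "x \<in> {u \<oplus> w | u w. u \<in> U \<and> w \<in> W}"
    proof
      assume "x \<in> U" then show ?thesis using U(2) W(3)
        by (intro CollectI exI[of _ x] exI[of _ \<zero>]) simp
    next
      assume "x \<in> W" then show ?thesis using W(2) U(3)
        by (intro CollectI exI[of _ \<zero>] exI[of _ x]) simp
    qed
  qed
  with assms(3) that show ?thesis by blast
qed

text \<open>The dimension of a subspace, expressed through independent sets of the ambient space so
  that subspaces can be compared without changing the carrier. It serves as a measure for extremal
  choices.\<close>

definition indep_rank :: "'a set \<Rightarrow> nat" where
  "indep_rank W = Max {card B | B. B \<subseteq> W \<and> finite B \<and> lin_indpt B}"

text \<open>A largest independent set of \<open>U\<close> spans a space inside \<open>U\<close>, so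
  adding a vector of \<open>W\<close> outside \<open>U\<close> keeps it independent. Independent
  sets have at most \<open>dim\<close> elements, hence the maxima exist.\<close>

lemma indep_rank_strict_mono:
  assumes fd: fin_dim and U: "subspace class_ring U A" and W: "subspace class_ring W A"
    and UW: "U \<subset> W"
  shows "indep_rank U < indep_rank W" "indep_rank W \<le> dim"
proof -
  note Uc = subspaceD[OF U] and Wc = subspaceD[OF W]
  have bounded: "{card B | B. B \<subseteq> X \<and> finite B \<and> lin_indpt B} \<subseteq> {..dim}" if "X \<subseteq> carrier A" for X
    using li_le_dim[OF fd] that by blast
  have ne: "{card B | B. B \<subseteq> X \<and> finite B \<and> lin_indpt B} \<noteq> {}" for X
    by (auto intro!: exI[of _ "{}"] simp: lin_dep_def)
  have finU: "finite {card B | B. B \<subseteq> U \<and> finite B \<and> lin_indpt B}"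
    and finW: "finite {card B | B. B \<subseteq> W \<and> finite B \<and> lin_indpt B}"
    using finite_subset[OF bounded[OF Uc(1)]] finite_subset[OF bounded[OF Wc(1)]] by auto
  show "indep_rank W \<le> dim"
    unfolding indep_rank_def using finW ne bounded[OF Wc(1)] by (subst Max_le_iff) auto
  from Max_in[OF finU ne] obtain B where B: "B \<subseteq> U" "finite B" "lin_indpt B" "card B = indep_rank U"
    unfolding indep_rank_def by fastforce
  from UW obtain v where v: "v \<in> W" "v \<notin> U" by blast
  have "fspan A B \<subseteq> U" using U B(1) by (rule fspan_minimal)
  then have "v \<notin> fspan A B" "v \<notin> B" using v B(1) by auto
  then have "lin_indpt (B \<union> {v})"
    using lin_dep_iff_in_span[of B v] B v Uc(1) Wc(2) by (metis order_trans)
  moreover have "B \<union> {v} \<subseteq> W" "finite (B \<union> {v})" using B UW v by auto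
  ultimately have "card (B \<union> {v}) \<le> indep_rank W"
    unfolding indep_rank_def using finW by (intro Max_ge) auto
  moreover have "card (B \<union> {v}) = Suc (card B)" using B(2) \<open>v \<notin> B\<close> by simp
  ultimately show "indep_rank U < indep_rank W" using B(4) by simp
qed

text \<open>Descending chain condition: a member of least \<open>indep_rank\<close> cannot properly
  contain another one. It yields stationary powers of the radical, minimal left ideals and
  annihilating polynomials.\<close>

lemma minimal_subspace:
  assumes fd: fin_dim and X: "X \<in> \<F>" and sub: "\<And>W. W \<in> \<F> \<Longrightarrow> subspace class_ring W A"
  obtains M where "M \<in> \<F>" "\<And>W. \<lbrakk>W \<in> \<F>; W \<subseteq> M\<rbrakk> \<Longrightarrow> W = M"
proof -
  define M where "M = arg_min indep_rank (\<lambda>W. W \<in> \<F>)"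
  have M: "M \<in> \<F>" "\<And>W. W \<in> \<F> \<Longrightarrow> indep_rank M \<le> indep_rank W"
    using arg_min_nat_lemma[of "\<lambda>W. W \<in> \<F>" X indep_rank, OF X] unfolding M_def by blast+
  show ?thesis
  proof (rule that[OF M(1)])
    fix W assume W: "W \<in> \<F>" "W \<subseteq> M"
    show "W = M"
    proof (rule ccontr)
      assume "W \<noteq> M"
      then have "indep_rank W < indep_rank M"
        using W by (intro indep_rank_strict_mono(1)[OF fd sub[OF W(1)] sub[OF M(1)]]) auto
      with M(2)[OF W(1)] show False by simp
    qed
  qed
qed

text \<open>Ascending chain condition, by minimising \<open>dim - indep_rank W\<close>. As the rank
  never exceeds \<open>dim\<close>, the truncated subtraction still reverses strict
  inequalities.\<close>

lemma maximal_subspace: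
  assumes fd: fin_dim and X: "X \<in> \<F>" and sub: "\<And>W. W \<in> \<F> \<Longrightarrow> subspace class_ring W A"
  obtains M where "M \<in> \<F>" "X \<subseteq> M" "\<And>W. \<lbrakk>W \<in> \<F>; M \<subseteq> W\<rbrakk> \<Longrightarrow> W = M"
proof -
  define P where "P = (\<lambda>W. W \<in> \<F> \<and> X \<subseteq> W)"
  define M where "M = arg_min (\<lambda>W. dim - indep_rank W) P"
  have "P X" using X by (simp add: P_def)
  then have M: "P M" "\<And>W. P W \<Longrightarrow> dim - indep_rank M \<le> dim - indep_rank W"
    using arg_min_nat_lemma[of P X "\<lambda>W. dim - indep_rank W", OF \<open>P X\<close>] unfolding M_def by blast+
  show ?thesis
  proof (rule that)
    fix W assume W: "W \<in> \<F>" "M \<subseteq> W"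
    show "W = M"
    proof (rule ccontr)
      assume "W \<noteq> M"
      then have "M \<subset> W" using W(2) by blast
      moreover have "subspace class_ring M A" using sub M(1) by (simp add: P_def)
      ultimately have "indep_rank M < indep_rank W" "indep_rank W \<le> dim"
        using indep_rank_strict_mono[OF fd _ sub[OF W(1)]] by blast+
      moreover have "P W" using W M(1) by (auto simp: P_def)
      ultimately show False using M(2)[of W] by simp
    qed
  qed (use M(1) in \<open>auto simp: P_def\<close>)
qed

end

section \<open>Linear functionals on finite-dimensional spaces\<close>

definition linear_functional :: "('f :: field, 'a) module \<Rightarrow> ('a \<Rightarrow> 'f) \<Rightarrow> bool" where
  "linear_functional A \<psi> \<longleftrightarrow>
     (\<forall>x\<in>carrier A. \<forall>y\<in>carrier A. \<psi> (x \<oplus>\<^bsub>A\<^esub> y) = \<psi> x + \<psi> y) \<and>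
     (\<forall>c. \<forall>x\<in>carrier A. \<psi> (c \<odot>\<^bsub>A\<^esub> x) = c * \<psi> x)"

context fvectorspace begin

lemma linear_functionalD:
  assumes "linear_functional A \<psi>"
  shows "\<And>x y. \<lbrakk>x \<in> carrier A; y \<in> carrier A\<rbrakk> \<Longrightarrow> \<psi> (x \<oplus> y) = \<psi> x + \<psi> y"
    "\<And>c x. x \<in> carrier A \<Longrightarrow> \<psi> (c \<odot> x) = c * \<psi> x"
    "\<psi> \<zero> = 0"
    "\<And>x. x \<in> carrier A \<Longrightarrow> \<psi> (\<ominus> x) = - \<psi> x"
    "\<And>x y. \<lbrakk>x \<in> carrier A; y \<in> carrier A\<rbrakk> \<Longrightarrow> \<psi> (x \<ominus> y) = \<psi> x - \<psi> y"
proof -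
  show add: "\<psi> (x \<oplus> y) = \<psi> x + \<psi> y" if "x \<in> carrier A" "y \<in> carrier A" for x y
    using assms that by (simp add: linear_functional_def)
  show sm: "\<psi> (c \<odot> x) = c * \<psi> x" if "x \<in> carrier A" for c x
    using assms that by (simp add: linear_functional_def)
  show "\<psi> \<zero> = 0" using sm[of \<zero> 0] by simp
  show neg: "\<psi> (\<ominus> x) = - \<psi> x" if "x \<in> carrier A" for x
    using sm[of x "-1"] neg_eq_smult[of x] that by simp
  show "\<psi> (x \<ominus> y) = \<psi> x - \<psi> y" if "x \<in> carrier A" "y \<in> carrier A" for x y
    using that add[of x "\<ominus> y"] neg[of y] by (simp add: a_minus_def)
qed

lemma linear_functional_finsum:
  assumes "linear_functional A \<psi>" "f \<in> I \<rightarrow> carrier A"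
  shows "\<psi> (\<Oplus>\<^bsub>A\<^esub>i\<in>I. f i) = (\<Sum>i\<in>I. \<psi> (f i))"
  using assms(2) by (induction I rule: infinite_finite_induct)
    (auto simp: linear_functionalD[OF assms(1)] Pi_def)

text \<open>A maximal subspace containing \<open>W\<close> but not \<open>y\<close> is a hyperplane.\<close>

lemma separating_functional:
  assumes fd: fin_dim and W: "subspace class_ring W A" and y: "y \<in> carrier A" "y \<notin> W"
  obtains \<psi> where "linear_functional A \<psi>" "\<psi> y = 1" "\<And>x. x \<in> W \<Longrightarrow> \<psi> x = 0"
proof -
  obtain M where M: "subspace class_ring M A" "y \<notin> M" "W \<subseteq> M"
    and max: "\<And>V. \<lbrakk>subspace class_ring V A; y \<notin> V; M \<subseteq> V\<rbrakk> \<Longrightarrow> V = M"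
  proof (rule maximal_subspace[OF fd, of W "{V. subspace class_ring V A \<and> y \<notin> V}"])
    fix M assume M: "M \<in> {V. subspace class_ring V A \<and> y \<notin> V}" "W \<subseteq> M"
      "\<And>V. \<lbrakk>V \<in> {V. subspace class_ring V A \<and> y \<notin> V}; M \<subseteq> V\<rbrakk> \<Longrightarrow> V = M"
    show thesis by (rule that[of M]) (use M in auto)
  qed (use W y in auto)
  note Mc = subspaceD[OF M(1)]
  have ex: "\<exists>c. \<exists>m\<in>M. x = c \<odot> y \<oplus> m" if x: "x \<in> carrier A" for x
  proof (cases "x \<in> M")
    case True then show ?thesis using x y by (auto intro!: exI[of _ 0] bexI[of _ x])
  next
    case False
    let ?X = "fspan A {x}"
    have xX: "x \<in> ?X" using x by (auto intro: fspan_base)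
    have X: "?X = range (\<lambda>c. c \<odot> x)" by (rule fspan_singleton[OF x])
    have sub: "subspace class_ring ?X A" using x by (intro fspan_subspace) auto
    have in_c: "?X \<union> M \<subseteq> carrier A" using subspaceD(1)[OF sub] Mc(1) by blast
    \<comment> \<open>Adding \<open>x\<close> to the maximal \<open>M\<close> must bring in
      \<open>y\<close>; solving the resulting relation for \<open>x\<close> puts it into
      \<open>Fy + M\<close>.\<close>
    have "y \<in> fspan A (?X \<union> M)"
    proof (rule ccontr)
      assume "y \<notin> fspan A (?X \<union> M)"
      then have "fspan A (?X \<union> M) = M"
        using max[OF fspan_subspace[OF in_c]] fspan_superset[OF in_c] by blast
      then show False using False xX fspan_superset[OF in_c] by blast
    qed
    then obtain c m where cm: "m \<in> M" "y = c \<odot> x \<oplus> m"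
      using fspan_Un_subspaces[OF sub M(1)] X by (metis imageE)
    have "c \<noteq> 0" using cm M(2) Mc(2) x by auto
    have "inverse c \<odot> y \<oplus> (- inverse c) \<odot> m = x"
      using \<open>c \<noteq> 0\<close> x y(1) Mc(2)[OF cm(1)] unfolding cm(2)
      by (simp add: smult_add uminus_smult M.a_assoc M.r_neg flip: mult_smult)
    then show ?thesis using Mc(5)[OF cm(1)] by metis
  qed
  have uniq: "c = d" if "m \<in> M" "n \<in> M" "c \<odot> y \<oplus> m = d \<odot> y \<oplus> n" for c d m n
  proof (rule ccontr)
    assume "c \<noteq> d"
    have mn: "m \<in> carrier A" "n \<in> carrier A" using that Mc by auto
    have "(c - d) \<odot> y = (c \<odot> y \<oplus> m) \<ominus> (d \<odot> y \<oplus> m)"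
      using y mn add_smult[of y c "- d"]
      by (simp add: uminus_smult group_norm)
    also have "\<dots> = (d \<odot> y \<oplus> n) \<ominus> (d \<odot> y \<oplus> m)" using that by simp
    also have "\<dots> = n \<ominus> m"
      using y mn by (simp add: group_norm)
    finally have "(c - d) \<odot> y \<in> M" using that Mc(7) by simp
    then have "inverse (c - d) \<odot> ((c - d) \<odot> y) \<in> M" by (rule Mc(5))
    then show False using \<open>c \<noteq> d\<close> y M(2) by (simp flip: mult_smult)
  qed
  \<comment> \<open>The coefficient of \<open>y\<close> in the decomposition
    \<open>A = Fy + M\<close>, well defined by \<open>uniq\<close>.\<close>
  define \<psi> where "\<psi> x = (THE c. \<exists>m\<in>M. x = c \<odot> y \<oplus> m)" for x
  have \<psi>: "\<psi> (c \<odot> y \<oplus> m) = c" if "m \<in> M" for c m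
    unfolding \<psi>_def using that uniq by (intro the_equality) auto
  show ?thesis
  proof (rule that)
    have "\<psi> (x \<oplus> z) = \<psi> x + \<psi> z" if "x \<in> carrier A" "z \<in> carrier A" for x z
    proof -
      obtain c m d n where *: "m \<in> M" "n \<in> M" "x = c \<odot> y \<oplus> m" "z = d \<odot> y \<oplus> n"
        using ex \<open>x \<in> carrier A\<close> \<open>z \<in> carrier A\<close> by meson
      have "x \<oplus> z = (c + d) \<odot> y \<oplus> (m \<oplus> n)"
        using * Mc(2) y by (simp add: add_smult M.a_ac)
      then show ?thesis using * \<psi> Mc(4) by metis
    qed
    moreover have "\<psi> (a \<odot> x) = a * \<psi> x" if "x \<in> carrier A" for a x
    proof -
      obtain c m where *: "m \<in> M" "x = c \<odot> y \<oplus> m" using ex \<open>x \<in> carrier A\<close> by meson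
      have "a \<odot> x = (a * c) \<odot> y \<oplus> a \<odot> m"
        using * Mc(2) y by (simp add: smult_add mult_smult)
      then show ?thesis using * \<psi> Mc(5) by metis
    qed
    ultimately show "linear_functional A \<psi>" by (simp add: linear_functional_def)
    show "\<psi> y = 1" using \<psi>[of \<zero> 1] Mc(3) y by simp
    fix x assume "x \<in> W"
    then show "\<psi> x = 0" using \<psi>[of x 0] M(3) Mc(2) y by auto
  qed
qed

lemma functionals_separate:
  assumes fd: fin_dim and x: "x \<in> carrier A" "x \<noteq> \<zero>"
  obtains \<psi> where "linear_functional A \<psi>" "\<psi> x = 1"
  using separating_functional[OF fd subspace_zero x(1)] x(2) by blast

text \<open>Functionals separate points, so an equation in \<open>A\<close> becomes a family of
  scalar equations. In this form values of polynomials are compared with matrix entries.\<close>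

lemma eq_if_functionals_agree:
  assumes fd: fin_dim and xy: "x \<in> carrier A" "y \<in> carrier A"
    and eq: "\<And>\<psi>. linear_functional A \<psi> \<Longrightarrow> \<psi> x = \<psi> y"
  shows "x = y"
proof (rule ccontr)
  assume "x \<noteq> y"
  then have "x \<ominus> y \<noteq> \<zero>" using xy by (simp add: diff_eq_zero_iff)
  then obtain \<psi> where \<psi>: "linear_functional A \<psi>" "\<psi> (x \<ominus> y) = 1"
    using functionals_separate[OF fd] xy by blast
  then show False using linear_functionalD(5)[OF \<psi>(1) xy] eq[OF \<psi>(1)] by simp
qed

end

section \<open>Associative algebras\<close>

sublocale assoc_algebra \<subseteq> fvectorspace A by unfold_locales

context assoc_algebra begin

declare mult_closed [simp, intro]

lemma mult_zero_left [simp]: "x \<in> carrier A \<Longrightarrow> \<zero> \<otimes> x = \<zero>"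
  using mult_smult_left[of \<zero> x 0] by simp

lemma mult_zero_right [simp]: "x \<in> carrier A \<Longrightarrow> x \<otimes> \<zero> = \<zero>"
  using mult_smult_right[of x \<zero> 0] by simp

lemma mult_neg_left: "\<lbrakk>x \<in> carrier A; y \<in> carrier A\<rbrakk> \<Longrightarrow> (\<ominus> x) \<otimes> y = \<ominus> (x \<otimes> y)"
  using mult_smult_left[of x y "-1"] neg_eq_smult[of x] neg_eq_smult[of "x \<otimes> y"] by simp

lemma mult_neg_right: "\<lbrakk>x \<in> carrier A; y \<in> carrier A\<rbrakk> \<Longrightarrow> x \<otimes> (\<ominus> y) = \<ominus> (x \<otimes> y)"
  using mult_smult_right[of x y "-1"] neg_eq_smult[of y] neg_eq_smult[of "x \<otimes> y"] by simp

lemma mult_minus_left: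
  "\<lbrakk>x \<in> carrier A; y \<in> carrier A; z \<in> carrier A\<rbrakk> \<Longrightarrow> (x \<ominus> y) \<otimes> z = x \<otimes> z \<ominus> y \<otimes> z"
  by (simp add: a_minus_def mult_add_left mult_neg_left)

lemma mult_minus_right:
  "\<lbrakk>x \<in> carrier A; y \<in> carrier A; z \<in> carrier A\<rbrakk> \<Longrightarrow> z \<otimes> (x \<ominus> y) = z \<otimes> x \<ominus> z \<otimes> y"
  by (simp add: a_minus_def mult_add_right mult_neg_right)

lemmas bilinear = mult_add_left mult_add_right mult_smult_left mult_smult_right
  mult_minus_left mult_minus_right mult_neg_left mult_neg_right

lemma minus_self [simp]: "x \<in> carrier A \<Longrightarrow> x \<ominus> x = \<zero>"
  by (simp add: diff_eq_zero_iff)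

lemma minus_zero [simp]: "x \<in> carrier A \<Longrightarrow> x \<ominus> \<zero> = x"
  by (simp add: a_minus_def)

lemma prod_in_subspace_mult:
  "\<lbrakk>U \<subseteq> carrier A; V \<subseteq> carrier A; u \<in> U; v \<in> V\<rbrakk> \<Longrightarrow> u \<otimes> v \<in> subspace_mult A U V"
  unfolding subspace_mult_def by (rule fspan_base) (auto simp: set_mult_def)

lemma subspace_mult_subspace:
  "\<lbrakk>U \<subseteq> carrier A; V \<subseteq> carrier A\<rbrakk> \<Longrightarrow> subspace class_ring (subspace_mult A U V) A"
  unfolding subspace_mult_def by (rule fspan_subspace) (auto simp: set_mult_def)

lemma subspace_mult_minimal:
  "\<lbrakk>subspace class_ring W A; \<And>u v. \<lbrakk>u \<in> U; v \<in> V\<rbrakk> \<Longrightarrow> u \<otimes> v \<in> W\<rbrakk> \<Longrightarrow> subspace_mult A U V \<subseteq> W"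
  unfolding subspace_mult_def by (rule fspan_minimal) (auto simp: set_mult_def)

lemma subspace_mult_eq_zero_iff:
  assumes "U \<subseteq> carrier A" "V \<subseteq> carrier A"
  shows "subspace_mult A U V = {\<zero>} \<longleftrightarrow> (\<forall>u\<in>U. \<forall>v\<in>V. u \<otimes> v = \<zero>)"
proof
  assume "subspace_mult A U V = {\<zero>}"
  then show "\<forall>u\<in>U. \<forall>v\<in>V. u \<otimes> v = \<zero>" using prod_in_subspace_mult[OF assms] by blast
next
  assume "\<forall>u\<in>U. \<forall>v\<in>V. u \<otimes> v = \<zero>"
  then show "subspace_mult A U V = {\<zero>}"
    unfolding subspace_mult_def by (intro fspan_zero) (auto simp: set_mult_def)
qed

lemma fspan_mult_closed:
  assumes G: "G \<subseteq> carrier A" "\<And>x y. \<lbrakk>x \<in> G; y \<in> G\<rbrakk> \<Longrightarrow> x \<otimes> y \<in> fspan A G"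
    and xy: "x \<in> fspan A G" "y \<in> fspan A G"
  shows "x \<otimes> y \<in> fspan A G"
proof -
  note S = subspaceD[OF fspan_subspace[OF G(1)]]
  have left: "a \<otimes> y \<in> fspan A G" if a: "a \<in> G" for a
    using xy(2) G(1)
  proof (induction y rule: fspan_induct)
    case (base b)
    then show ?case using G(2) a by blast
  qed (use a G(1) S in \<open>auto simp: mult_add_right mult_smult_right\<close>)
  show ?thesis
    using xy(1) G(1)
  proof (induction x rule: fspan_induct)
    case (base a)
    then show ?case by (rule left)
  qed (use xy(2) S in \<open>auto simp: mult_add_left mult_smult_left\<close>)
qed

lemma linear_functional_mult_left:
  "\<lbrakk>linear_functional A \<psi>; a \<in> carrier A\<rbrakk> \<Longrightarrow> linear_functional A (\<lambda>x. \<psi> (a \<otimes> x))"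
  using linear_functionalD[of \<psi>] by (simp add: linear_functional_def bilinear)

lemma linear_functional_mult_right:
  "\<lbrakk>linear_functional A \<psi>; a \<in> carrier A\<rbrakk> \<Longrightarrow> linear_functional A (\<lambda>x. \<psi> (x \<otimes> a))"
  using linear_functionalD[of \<psi>] by (simp add: linear_functional_def bilinear)

lemma linear_functional_diff:
  "\<lbrakk>linear_functional A \<psi>; linear_functional A \<phi>\<rbrakk> \<Longrightarrow> linear_functional A (\<lambda>x. \<psi> x - \<phi> x)"
  by (simp add: linear_functional_def algebra_simps)

lemma left_idealI:
  "\<lbrakk>subspace class_ring L A; \<And>a x. \<lbrakk>a \<in> carrier A; x \<in> L\<rbrakk> \<Longrightarrow> a \<otimes> x \<in> L\<rbrakk> \<Longrightarrow> left_ideal A L"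
  by (simp add: left_ideal_def)

lemma left_idealD:
  assumes "left_ideal A L"
  shows "subspace class_ring L A" "\<And>a x. \<lbrakk>a \<in> carrier A; x \<in> L\<rbrakk> \<Longrightarrow> a \<otimes> x \<in> L"
  using assms by (auto simp: left_ideal_def)

lemma alg_idealI:
  "\<lbrakk>subspace class_ring L A; \<And>a x. \<lbrakk>a \<in> carrier A; x \<in> L\<rbrakk> \<Longrightarrow> a \<otimes> x \<in> L;
    \<And>a x. \<lbrakk>a \<in> carrier A; x \<in> L\<rbrakk> \<Longrightarrow> x \<otimes> a \<in> L\<rbrakk> \<Longrightarrow> alg_ideal A L"
  by (simp add: alg_ideal_def)

lemma alg_idealD:
  assumes "alg_ideal A L"
  shows "subspace class_ring L A" "\<And>a x. \<lbrakk>a \<in> carrier A; x \<in> L\<rbrakk> \<Longrightarrow> a \<otimes> x \<in> L"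
    "\<And>a x. \<lbrakk>a \<in> carrier A; x \<in> L\<rbrakk> \<Longrightarrow> x \<otimes> a \<in> L"
  using assms by (auto simp: alg_ideal_def)

lemma left_ideal_carrier: "left_ideal A (carrier A)"
  by (auto intro!: left_idealI subspace_carrier)

lemma left_multiples_left_ideal:
  assumes J: "left_ideal A J" and x: "x \<in> carrier A"
  shows "left_ideal A ((\<lambda>j. j \<otimes> x) ` J)"
proof -
  note Jc = subspaceD[OF left_idealD(1)[OF J]]
  have "subspace class_ring ((\<lambda>j. j \<otimes> x) ` J) A"
  proof (rule subspaceI)
    show "\<zero> \<in> (\<lambda>j. j \<otimes> x) ` J" using Jc(3) x by (auto intro!: image_eqI[of _ _ \<zero>])
    show "y \<oplus> z \<in> (\<lambda>j. j \<otimes> x) ` J" if yz: "y \<in> (\<lambda>j. j \<otimes> x) ` J" "z \<in> (\<lambda>j. j \<otimes> x) ` J" for y z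
    proof -
      obtain i j where ij: "y = i \<otimes> x" "z = j \<otimes> x" "i \<in> J" "j \<in> J" using yz by blast
      then have "y \<oplus> z = (i \<oplus> j) \<otimes> x" using x Jc(2) by (simp add: bilinear)
      then show ?thesis using ij Jc(4) by blast
    qed
    show "c \<odot> y \<in> (\<lambda>j. j \<otimes> x) ` J" if y: "y \<in> (\<lambda>j. j \<otimes> x) ` J" for c y
    proof -
      obtain i where i: "y = i \<otimes> x" "i \<in> J" using y by blast
      then have "c \<odot> y = (c \<odot> i) \<otimes> x" using x Jc(2) by (simp add: bilinear)
      then show ?thesis using i Jc(5) by blast
    qed
  qed (use Jc(2) x in auto)
  moreover have "a \<otimes> (j \<otimes> x) \<in> (\<lambda>j. j \<otimes> x) ` J" if "a \<in> carrier A" "j \<in> J" for a j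
    using mult_assoc[of a j x] left_idealD(2)[OF J, of a j] Jc(2)[of j] that x by (metis imageI)
  ultimately show ?thesis by (auto intro!: left_idealI)
qed

subsection \<open>The Jacobson radical\<close>

lemma radical_subset: "jacobson_radical A \<subseteq> carrier A"
  by (simp add: jacobson_radical_def)

lemma radical_left_ideal: "left_ideal A (jacobson_radical A)"
proof -
  have sub: "left_ideal A L" if "maximal_modular_left_ideal A L" for L
    using that by (simp add: maximal_modular_left_ideal_def modular_left_ideal_def)
  have "subspace class_ring (jacobson_radical A) A"
    by (rule subspaceI)
      (use subspaceD[OF left_idealD(1)[OF sub]] in \<open>auto simp: jacobson_radical_def\<close>)
  then show ?thesis
    by (rule left_idealI) (use left_idealD(2)[OF sub] in \<open>auto simp: jacobson_radical_def\<close>)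
qed

lemmas radical_subspace = left_idealD(1)[OF radical_left_ideal]

lemma radical_in: "x \<in> jacobson_radical A \<Longrightarrow> x \<in> carrier A"
  using radical_subset by blast

text \<open>If \<open>L\<close> is maximal modular and \<open>Aa \<not>\<subseteq> L\<close>, then \<open>A \<rightarrow> A/L, x \<mapsto> xa + L\<close> is onto the simple
  module \<open>A/L\<close>, so its kernel is again maximal modular.\<close>

lemma radical_mult_right:
  assumes x: "x \<in> jacobson_radical A" and a: "a \<in> carrier A"
  shows "x \<otimes> a \<in> jacobson_radical A"
proof -
  have xA: "x \<in> carrier A" using x by (rule radical_in)
  have "x \<otimes> a \<in> L" if L: "maximal_modular_left_ideal A L" for L
  proof (cases "\<forall>y\<in>carrier A. y \<otimes> a \<in> L")
    case True then show ?thesis using xA by blast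
  next
    case False
    then obtain b where b: "b \<in> carrier A" "b \<otimes> a \<notin> L" by blast
    have Lid: "left_ideal A L" and max: "\<And>M. \<lbrakk>left_ideal A M; L \<subseteq> M\<rbrakk> \<Longrightarrow> M = L \<or> M = carrier A"
      using L by (auto simp: maximal_modular_left_ideal_def modular_left_ideal_def)
    note Lc = subspaceD[OF left_idealD(1)[OF Lid]]
    define M where "M = {y \<in> carrier A. y \<otimes> a \<in> L}"
    \<comment> \<open>\<open>Na + L\<close> is a left ideal that contains \<open>L\<close> and the
      element \<open>na\<close> outside \<open>L\<close>, so maximality of \<open>L\<close> makes it
      all of \<open>A\<close>. This is surjectivity onto \<open>A/L\<close>.\<close>
    have sum: "carrier A = {n \<otimes> a \<oplus> l | n l. n \<in> N \<and> l \<in> L}" (is "_ = ?S")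
      if N: "left_ideal A N" and n: "n \<in> N" "n \<otimes> a \<notin> L" for N n
    proof -
      note Nc = subspaceD[OF left_idealD(1)[OF N]]
      have S: "left_ideal A ?S"
      proof (rule left_idealI[OF subspaceI])
        show "?S \<subseteq> carrier A" using Nc(2) Lc(2) a by auto
        show "\<zero> \<in> ?S" using Nc(3) Lc(3) a by (auto intro!: exI[of _ \<zero>])
      next
        fix y z assume "y \<in> ?S" "z \<in> ?S"
        then obtain m l m' l' where *: "m \<in> N" "l \<in> L" "m' \<in> N" "l' \<in> L"
          "y = m \<otimes> a \<oplus> l" "z = m' \<otimes> a \<oplus> l'" by blast
        then have "y \<oplus> z = (m \<oplus> m') \<otimes> a \<oplus> (l \<oplus> l')"
          using Nc(2) Lc(2) a by (simp add: bilinear M.a_ac)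
        then show "y \<oplus> z \<in> ?S" using * Nc(4) Lc(4) by blast
      next
        fix c y assume "y \<in> ?S"
        then obtain m l where *: "m \<in> N" "l \<in> L" "y = m \<otimes> a \<oplus> l" by blast
        then have "c \<odot> y = (c \<odot> m) \<otimes> a \<oplus> c \<odot> l"
          using Nc(2) Lc(2) a by (simp add: bilinear smult_add)
        then show "c \<odot> y \<in> ?S" using * Nc(5) Lc(5) by blast
      next
        fix c y assume c: "c \<in> carrier A" and "y \<in> ?S"
        then obtain m l where *: "m \<in> N" "l \<in> L" "y = m \<otimes> a \<oplus> l" by blast
        then have "c \<otimes> y = (c \<otimes> m) \<otimes> a \<oplus> c \<otimes> l"
          using Nc(2) Lc(2) a c by (simp add: bilinear mult_assoc)
        then show "c \<otimes> y \<in> ?S" using * c left_idealD(2)[OF N] left_idealD(2)[OF Lid] by blast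
      qed
      have "L \<subseteq> ?S"
      proof
        fix l assume "l \<in> L" then show "l \<in> ?S"
          using Nc(3) Lc(2) a by (intro CollectI exI[of _ \<zero>] exI[of _ l]) simp
      qed
      moreover have "n \<otimes> a \<in> ?S"
        using n Nc(2) Lc(3) a by (intro CollectI exI[of _ n] exI[of _ \<zero>]) simp
      ultimately show ?thesis using max[OF S] n by blast
    qed
    have M: "left_ideal A M"
      unfolding M_def
      by (rule left_idealI[OF subspaceI])
        (use a Lc left_idealD(2)[OF Lid] in \<open>auto simp: bilinear mult_assoc\<close>)
    note Mc = subspaceD[OF left_idealD(1)[OF M]]
    \<comment> \<open>For \<open>N = A\<close> this writes \<open>a\<close> as
      \<open>ea + l\<close>. Such an \<open>e\<close> is a right unit modulo \<open>M\<close>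
      because \<open>(y - ye)a = yl\<close> lies in \<open>L\<close>.\<close>
    obtain e l where e: "e \<in> carrier A" "l \<in> L" "a = e \<otimes> a \<oplus> l"
      using sum[OF left_ideal_carrier b] a by blast
    have "\<forall>y\<in>carrier A. y \<ominus> y \<otimes> e \<in> M"
    proof
      fix y assume y: "y \<in> carrier A"
      have "(y \<ominus> y \<otimes> e) \<otimes> a = y \<otimes> a \<ominus> y \<otimes> (e \<otimes> a)"
        using y e(1) a by (simp add: bilinear mult_assoc)
      also have "y \<otimes> a = y \<otimes> (e \<otimes> a \<oplus> l)" using e(3) by simp
      also have "\<dots> \<ominus> y \<otimes> (e \<otimes> a) = y \<otimes> l"
        using y e(1) a Lc(2)[OF e(2)] mult_add_right[of "e \<otimes> a" l y]
          add_diff_cancel_left[of "y \<otimes> (e \<otimes> a)" "y \<otimes> l"] by simp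
      also have "\<dots> \<in> L" using y e(2) left_idealD(2)[OF Lid] by blast
      finally show "y \<ominus> y \<otimes> e \<in> M" using y e(1) by (simp add: M_def)
    qed
    then have "modular_left_ideal A M" using M e(1) by (auto simp: modular_left_ideal_def)
    moreover have "M \<noteq> carrier A" using b by (auto simp: M_def)
    moreover have "N = M \<or> N = carrier A" if N: "left_ideal A N" "M \<subseteq> N" for N
    proof (cases "N \<subseteq> M")
      case False
      then obtain n where n: "n \<in> N" "n \<otimes> a \<notin> L"
        using subspaceD(1)[OF left_idealD(1)[OF N(1)]] by (auto simp: M_def)
      note Nc = subspaceD[OF left_idealD(1)[OF N(1)]]
      have "y \<in> N" if y: "y \<in> carrier A" for y
      proof -
        have "y \<otimes> a \<in> carrier A" using y a by simp
        then obtain m l where *: "m \<in> N" "l \<in> L" "y \<otimes> a = m \<otimes> a \<oplus> l"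
          using sum[OF N(1) n] by blast
        have "(y \<ominus> m) \<otimes> a = l"
          using * y a Nc(2) Lc(2) by (simp add: bilinear group_norm)
        then have "y \<ominus> m \<in> N" using N(2) * y Nc(2) by (auto simp: M_def)
        moreover have "y = (y \<ominus> m) \<oplus> m" using diff_add_cancel * y Nc(2) by metis
        ultimately show "y \<in> N" using *(1) Nc(4) by metis
      qed
      then show ?thesis using Nc(1) by blast
    qed (use N in blast)
    ultimately have "maximal_modular_left_ideal A M" by (simp add: maximal_modular_left_ideal_def)
    then have "x \<in> M" using x by (simp add: jacobson_radical_def)
    then show ?thesis by (simp add: M_def)
  qed
  then show ?thesis using xA a by (simp add: jacobson_radical_def)
qed

lemma radical_ideal: "alg_ideal A (jacobson_radical A)"
  using radical_left_ideal radical_mult_right by (auto intro!: alg_idealI dest: left_idealD)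

text \<open>The left ideal \<open>A(1 - n)\<close>, written without a unit as the set of all
  \<open>a - an\<close>, has \<open>n\<close> as right unit modulo it. Were it proper, a maximal
  modular left ideal above it would contain \<open>n\<close> and hence everything. So
  \<open>n = a - an\<close> for some \<open>a\<close>, and then
  \<open>x = nx = ax - a(nx) = 0\<close>.\<close>

lemma radical_quasi_regular:
  assumes fd: fin_dim and n: "n \<in> jacobson_radical A" and x: "x \<in> carrier A" "n \<otimes> x = x"
  shows "x = \<zero>"
proof -
  have nA: "n \<in> carrier A" using n by (rule radical_in)
  define L where "L = (\<lambda>a. a \<ominus> a \<otimes> n) ` carrier A"
  have L: "left_ideal A L"
  proof (rule left_idealI[OF subspaceI])
    show "L \<subseteq> carrier A" using nA by (auto simp: L_def)
    show "\<zero> \<in> L" using nA by (auto simp: L_def intro!: image_eqI[of _ _ \<zero>])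
    fix y z assume "y \<in> L" "z \<in> L"
    then obtain a b where *: "a \<in> carrier A" "b \<in> carrier A" "y = a \<ominus> a \<otimes> n" "z = b \<ominus> b \<otimes> n"
      by (auto simp: L_def)
    have "y \<oplus> z = (a \<oplus> b) \<ominus> (a \<oplus> b) \<otimes> n" using * nA by (simp add: bilinear group_norm)
    then show "y \<oplus> z \<in> L" using * by (auto simp: L_def)
  next
    fix c y assume "y \<in> L"
    then obtain a where *: "a \<in> carrier A" "y = a \<ominus> a \<otimes> n" by (auto simp: L_def)
    have "c \<odot> y = c \<odot> a \<ominus> (c \<odot> a) \<otimes> n" using * nA by (simp add: bilinear smult_minus)
    then show "c \<odot> y \<in> L" using * by (auto simp: L_def)
  next
    fix b y assume b: "b \<in> carrier A" and "y \<in> L"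
    then obtain a where *: "a \<in> carrier A" "y = a \<ominus> a \<otimes> n" by (auto simp: L_def)
    have "b \<otimes> y = (b \<otimes> a) \<ominus> (b \<otimes> a) \<otimes> n" using * b nA by (simp add: bilinear mult_assoc)
    then show "b \<otimes> y \<in> L" using * b by (auto simp: L_def)
  qed
  have "L = carrier A"
  proof (rule ccontr)
    assume ne: "L \<noteq> carrier A"
    let ?F = "{M. left_ideal A M \<and> M \<noteq> carrier A \<and> L \<subseteq> M}"
    have "L \<in> ?F" using L ne by simp
    then obtain M where M: "M \<in> ?F" "\<And>N. \<lbrakk>N \<in> ?F; M \<subseteq> N\<rbrakk> \<Longrightarrow> N = M"
      by (rule maximal_subspace[OF fd]) (auto dest: left_idealD(1))
    have mod: "modular_left_ideal A M"
      using M(1) nA by (auto simp: modular_left_ideal_def L_def)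
    have "maximal_modular_left_ideal A M"
      unfolding maximal_modular_left_ideal_def
    proof (intro conjI allI impI mod)
      show "M \<noteq> carrier A" using M(1) by simp
      fix N assume N: "left_ideal A N \<and> M \<subseteq> N"
      then show "N = M \<or> N = carrier A" using M(1) M(2)[of N] by auto
    qed
    then have nM: "n \<in> M" using n by (simp add: jacobson_radical_def)
    have Mi: "left_ideal A M" using M(1) by simp
    note Mc = subspaceD[OF left_idealD(1)[OF Mi]]
    have "a \<in> M" if a: "a \<in> carrier A" for a
    proof -
      have "a \<ominus> a \<otimes> n \<in> M" using M(1) a by (auto simp: L_def)
      then have "(a \<ominus> a \<otimes> n) \<oplus> a \<otimes> n \<in> M" using left_idealD(2)[OF Mi a nM] Mc(4) by blast
      then show ?thesis using a nA by (simp add: diff_add_cancel)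
    qed
    then show False using M(1) Mc(1) by blast
  qed
  then obtain a where a: "a \<in> carrier A" "n = a \<ominus> a \<otimes> n" using nA by (auto simp: L_def)
  have "x = (a \<ominus> a \<otimes> n) \<otimes> x" using a(2) x(2) by simp
  also have "\<dots> = a \<otimes> x \<ominus> a \<otimes> (n \<otimes> x)" using a(1) nA x(1) by (simp add: bilinear mult_assoc)
  also have "\<dots> = \<zero>" using a(1) x by simp
  finally show ?thesis .
qed

lemma radical_power_subspace: "n \<ge> 1 \<Longrightarrow> subspace class_ring (ideal_power A (jacobson_radical A) n) A"
proof (induction n rule: dec_induct)
  case (step n)
  then obtain k where k: "n = Suc k" by (cases n) auto
  show ?case using step.IH subspaceD(1) radical_subset unfolding k
    by (auto intro!: subspace_mult_subspace)
qed (simp add: radical_subspace)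

lemma radical_power_Suc: "n \<ge> 1 \<Longrightarrow>
   ideal_power A (jacobson_radical A) (Suc n) =
   subspace_mult A (ideal_power A (jacobson_radical A) n) (jacobson_radical A)"
  by (cases n) auto

lemma radical_power_decreasing:
  "n \<ge> 1 \<Longrightarrow> ideal_power A (jacobson_radical A) (Suc n) \<subseteq> ideal_power A (jacobson_radical A) n"
proof (induction n rule: dec_induct)
  case base
  show ?case unfolding radical_power_Suc[OF order_refl]
    by (rule subspace_mult_minimal) (use radical_subspace radical_mult_right radical_in in auto)
next
  case (step n)
  then have n: "n \<ge> 1" by simp
  show ?case
    unfolding radical_power_Suc[OF n] radical_power_Suc[of "Suc n", OF le_SucI[OF n]]
  proof (rule subspace_mult_minimal)
    let ?P = "ideal_power A (jacobson_radical A) n"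
    note sub = subspaceD(1)[OF radical_power_subspace[OF n]]
    show "subspace class_ring (subspace_mult A ?P (jacobson_radical A)) A"
      using sub radical_subset by (rule subspace_mult_subspace)
    fix u v assume "u \<in> subspace_mult A ?P (jacobson_radical A)" and v: "v \<in> jacobson_radical A"
    then have "u \<in> ?P" using step.IH radical_power_Suc[OF n] by blast
    then show "u \<otimes> v \<in> subspace_mult A ?P (jacobson_radical A)"
      using sub radical_subset v by (intro prod_in_subspace_mult)
  qed
qed

text \<open>If \<open>J\<close> is not nilpotent, then \<open>N = J\<^sup>n = NJ \<noteq> 0\<close> for some \<open>n\<close>. A left ideal \<open>L\<close> minimal with \<open>NL \<noteq> 0\<close> then has the
  form \<open>Jx\<close> with \<open>x \<in> L\<close>, whence \<open>x = jx\<close> with \<open>j \<in> J\<close>.\<close>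

lemma radical_nilpotent:
  assumes fd: fin_dim
  obtains n where "n \<ge> 1" "ideal_power A (jacobson_radical A) n = {\<zero>}"
proof -
  let ?J = "jacobson_radical A"
  let ?P = "ideal_power A ?J"
  obtain N where N: "N \<in> ?P ` {1..}" "\<And>W. \<lbrakk>W \<in> ?P ` {1..}; W \<subseteq> N\<rbrakk> \<Longrightarrow> W = N"
    by (rule minimal_subspace[OF fd, of "?P 1" "?P ` {1..}"]) (rule image_eqI[OF refl], simp, auto intro: radical_power_subspace)
  then obtain n where n: "n \<ge> 1" "N = ?P n" by auto
  have "?P (Suc n) = N" by (rule N(2)) (use n radical_power_decreasing in auto)
  then have NJ: "N = subspace_mult A N ?J" using n radical_power_Suc by simp
  have Nsub: "subspace class_ring N A" using n radical_power_subspace by simp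
  note Nc = subspaceD[OF Nsub]
  have "N = {\<zero>}"
  proof (rule ccontr)
    assume "N \<noteq> {\<zero>}"
    then obtain a j where aj: "a \<in> N" "j \<in> ?J" "a \<otimes> j \<noteq> \<zero>"
      using NJ subspace_mult_eq_zero_iff[OF Nc(1) radical_subset] by metis
    let ?F = "{L. left_ideal A L \<and> (\<exists>a\<in>N. \<exists>l\<in>L. a \<otimes> l \<noteq> \<zero>)}"
    have "carrier A \<in> ?F" using aj radical_in left_ideal_carrier by blast
    then obtain L where L: "L \<in> ?F" "\<And>W. \<lbrakk>W \<in> ?F; W \<subseteq> L\<rbrakk> \<Longrightarrow> W = L"
      by (rule minimal_subspace[OF fd]) (auto dest: left_idealD(1))
    then obtain b x where b: "left_ideal A L" "b \<in> N" "x \<in> L" "b \<otimes> x \<noteq> \<zero>" by blast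
    have x: "x \<in> carrier A" using subspaceD(2)[OF left_idealD(1)[OF b(1)] b(3)] .
    let ?L = "(\<lambda>j. j \<otimes> x) ` ?J"
    have "\<exists>a\<in>N. \<exists>l\<in>?L. a \<otimes> l \<noteq> \<zero>"
    proof (rule ccontr)
      assume "\<not> ?thesis"
      then have z: "a \<otimes> (j \<otimes> x) = \<zero>" if "a \<in> N" "j \<in> ?J" for a j using that by blast
      \<comment> \<open>If \<open>N\<close> killed \<open>Jx\<close>, then \<open>NJ\<close> would
        kill \<open>x\<close>; as \<open>NJ = N\<close>, this contradicts the choice of
        \<open>b\<close> in \<open>N\<close> with \<open>bx\<close> nonzero.\<close>
      have "subspace class_ring {y \<in> carrier A. y \<otimes> x = \<zero>} A"
        by (rule subspaceI) (use x in \<open>auto simp: bilinear\<close>)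
      then have "subspace_mult A N ?J \<subseteq> {y \<in> carrier A. y \<otimes> x = \<zero>}"
        by (rule subspace_mult_minimal) (use z x Nc(2) radical_in in \<open>auto simp: mult_assoc\<close>)
      then show False using b NJ by blast
    qed
    moreover have "?L \<subseteq> L" using left_idealD(2)[OF b(1)] b(3) radical_in by blast
    ultimately have "?L = L"
      using L(2)[of ?L] left_multiples_left_ideal[OF radical_left_ideal x] by blast
    then have "x \<in> ?L" using b(3) by blast
    then obtain j where "j \<in> ?J" "j \<otimes> x = x" by (elim imageE) simp
    then have "x = \<zero>" using radical_quasi_regular[OF fd _ x] by blast
    then show False using b Nc(2) by auto
  qed
  then show ?thesis using n that by blast
qed

lemma nilpotent_if_radical_is_all:
  "\<lbrakk>fin_dim; jacobson_radical A = carrier A\<rbrakk> \<Longrightarrow> nilpotent_algebra A"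
  unfolding nilpotent_algebra_def by (rule radical_nilpotent) auto

text \<open>Nilpotency of the radical is what gives the \<open>LEAST\<close> in
  \<open>s_index\<close> a witness.\<close>

lemma s_index_power:
  assumes fin_dim shows "ideal_power A (jacobson_radical A) (Suc (s_index A)) = {\<zero>}"
proof -
  obtain n where "n \<ge> 1" "ideal_power A (jacobson_radical A) n = {\<zero>}"
    by (rule radical_nilpotent[OF assms])
  then have "\<exists>s. ideal_power A (jacobson_radical A) (Suc s) = {\<zero>}"
    by (intro exI[of _ "n - 1"]) simp
  then show ?thesis unfolding s_index_def by (rule LeastI_ex)
qed

lemma radical_cube_zero:
  assumes fd: fin_dim and s: "s_index A = 2"
    and "x \<in> jacobson_radical A" "y \<in> jacobson_radical A" "z \<in> jacobson_radical A"
  shows "(x \<otimes> y) \<otimes> z = \<zero>"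
proof -
  have "subspace_mult A (subspace_mult A (jacobson_radical A) (jacobson_radical A)) (jacobson_radical A) = {\<zero>}"
    using s_index_power[OF fd] s by (simp add: numeral_2_eq_2)
  moreover have "x \<otimes> y \<in> subspace_mult A (jacobson_radical A) (jacobson_radical A)"
    using assms radical_subset by (intro prod_in_subspace_mult)
  ultimately show ?thesis
    using subspace_mult_eq_zero_iff[OF subspaceD(1)[OF subspace_mult_subspace[OF radical_subset radical_subset]]
        radical_subset] assms(5) by blast
qed

end

section \<open>Homomorphisms, quotients and evaluations\<close>

lemma fvectorspaceI:
  fixes V :: "('f :: field, 'a) module"
  assumes "\<zero>\<^bsub>V\<^esub> \<in> carrier V"
    and "\<And>v w. \<lbrakk>v \<in> carrier V; w \<in> carrier V\<rbrakk> \<Longrightarrow> v \<oplus>\<^bsub>V\<^esub> w \<in> carrier V"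
    and "\<And>c v. v \<in> carrier V \<Longrightarrow> c \<odot>\<^bsub>V\<^esub> v \<in> carrier V"
    and "\<And>v w. \<lbrakk>v \<in> carrier V; w \<in> carrier V\<rbrakk> \<Longrightarrow> v \<oplus>\<^bsub>V\<^esub> w = w \<oplus>\<^bsub>V\<^esub> v"
    and "\<And>v w x. \<lbrakk>v \<in> carrier V; w \<in> carrier V; x \<in> carrier V\<rbrakk>
      \<Longrightarrow> (v \<oplus>\<^bsub>V\<^esub> w) \<oplus>\<^bsub>V\<^esub> x = v \<oplus>\<^bsub>V\<^esub> (w \<oplus>\<^bsub>V\<^esub> x)"
    and "\<And>v. v \<in> carrier V \<Longrightarrow> v \<oplus>\<^bsub>V\<^esub> \<zero>\<^bsub>V\<^esub> = v"
    and "\<And>v. v \<in> carrier V \<Longrightarrow> v \<oplus>\<^bsub>V\<^esub> (- 1) \<odot>\<^bsub>V\<^esub> v = \<zero>\<^bsub>V\<^esub>"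
    and "\<And>a b v. v \<in> carrier V \<Longrightarrow> (a * b) \<odot>\<^bsub>V\<^esub> v = a \<odot>\<^bsub>V\<^esub> (b \<odot>\<^bsub>V\<^esub> v)"
    and "\<And>v. v \<in> carrier V \<Longrightarrow> 1 \<odot>\<^bsub>V\<^esub> v = v"
    and "\<And>a b v. v \<in> carrier V \<Longrightarrow> (a + b) \<odot>\<^bsub>V\<^esub> v = a \<odot>\<^bsub>V\<^esub> v \<oplus>\<^bsub>V\<^esub> b \<odot>\<^bsub>V\<^esub> v"
    and "\<And>a v w. \<lbrakk>v \<in> carrier V; w \<in> carrier V\<rbrakk>
      \<Longrightarrow> a \<odot>\<^bsub>V\<^esub> (v \<oplus>\<^bsub>V\<^esub> w) = a \<odot>\<^bsub>V\<^esub> v \<oplus>\<^bsub>V\<^esub> a \<odot>\<^bsub>V\<^esub> w"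
  shows "fvectorspace V"
proof -
  have "vectorspace class_ring V"
  proof (rule vs_criteria)
    show "\<forall>v\<in>carrier V. \<exists>n\<in>carrier V. v \<oplus>\<^bsub>V\<^esub> n = \<zero>\<^bsub>V\<^esub>"
      using assms(3,7) by blast
    show "\<forall>v w. v \<in> carrier V \<and> w \<in> carrier V \<longrightarrow> v \<oplus>\<^bsub>V\<^esub> w = w \<oplus>\<^bsub>V\<^esub> v"
      using assms(4) by blast
  qed (auto simp: assms(1-3,5-) class_field)
  then show ?thesis by (simp add: fvectorspace_def)
qed

definition linear_hom :: "('f :: field, 'a) module \<Rightarrow> ('f, 'b) module \<Rightarrow> ('a \<Rightarrow> 'b) \<Rightarrow> bool" where
  "linear_hom A B h \<longleftrightarrow> (\<forall>x\<in>carrier A. h x \<in> carrier B) \<and>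
     (\<forall>x\<in>carrier A. \<forall>y\<in>carrier A. h (x \<oplus>\<^bsub>A\<^esub> y) = h x \<oplus>\<^bsub>B\<^esub> h y) \<and>
     (\<forall>c. \<forall>x\<in>carrier A. h (c \<odot>\<^bsub>A\<^esub> x) = c \<odot>\<^bsub>B\<^esub> h x)"

definition alg_hom :: "('f :: field, 'a) module \<Rightarrow> ('f, 'b) module \<Rightarrow> ('a \<Rightarrow> 'b) \<Rightarrow> bool" where
  "alg_hom A B h \<longleftrightarrow> linear_hom A B h \<and>
     (\<forall>x\<in>carrier A. \<forall>y\<in>carrier A. h (x \<otimes>\<^bsub>A\<^esub> y) = h x \<otimes>\<^bsub>B\<^esub> h y)"

lemma linear_homI:
  "\<lbrakk>\<And>x. x \<in> carrier A \<Longrightarrow> h x \<in> carrier B;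
    \<And>x y. \<lbrakk>x \<in> carrier A; y \<in> carrier A\<rbrakk> \<Longrightarrow> h (x \<oplus>\<^bsub>A\<^esub> y) = h x \<oplus>\<^bsub>B\<^esub> h y;
    \<And>c x. x \<in> carrier A \<Longrightarrow> h (c \<odot>\<^bsub>A\<^esub> x) = c \<odot>\<^bsub>B\<^esub> h x\<rbrakk> \<Longrightarrow> linear_hom A B h"
  by (simp add: linear_hom_def)

lemma linear_homD:
  assumes "linear_hom A B h"
  shows "\<And>x. x \<in> carrier A \<Longrightarrow> h x \<in> carrier B"
    "\<And>x y. \<lbrakk>x \<in> carrier A; y \<in> carrier A\<rbrakk> \<Longrightarrow> h (x \<oplus>\<^bsub>A\<^esub> y) = h x \<oplus>\<^bsub>B\<^esub> h y"
    "\<And>c x. x \<in> carrier A \<Longrightarrow> h (c \<odot>\<^bsub>A\<^esub> x) = c \<odot>\<^bsub>B\<^esub> h x"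
  using assms by (auto simp: linear_hom_def)

lemma alg_homI:
  "\<lbrakk>linear_hom A B h;
    \<And>x y. \<lbrakk>x \<in> carrier A; y \<in> carrier A\<rbrakk> \<Longrightarrow> h (x \<otimes>\<^bsub>A\<^esub> y) = h x \<otimes>\<^bsub>B\<^esub> h y\<rbrakk> \<Longrightarrow> alg_hom A B h"
  by (simp add: alg_hom_def)

lemma alg_homD:
  assumes "alg_hom A B h"
  shows "linear_hom A B h"
    "\<And>x y. \<lbrakk>x \<in> carrier A; y \<in> carrier A\<rbrakk> \<Longrightarrow> h (x \<otimes>\<^bsub>A\<^esub> y) = h x \<otimes>\<^bsub>B\<^esub> h y"
  using assms by (auto simp: alg_hom_def)

context
  fixes A :: "('f :: field, 'a) module" and B :: "('f, 'b) module" and h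
  assumes A: "fvectorspace A" and B: "fvectorspace B" and h: "linear_hom A B h"
begin

interpretation A: fvectorspace A by (rule A)
interpretation B: fvectorspace B by (rule B)

lemma linear_hom_zero: "h \<zero>\<^bsub>A\<^esub> = \<zero>\<^bsub>B\<^esub>"
  using linear_homD(3)[OF h, of "\<zero>\<^bsub>A\<^esub>" 0] linear_homD(1)[OF h, of "\<zero>\<^bsub>A\<^esub>"] by simp

lemma linear_hom_finsum:
  "f \<in> I \<rightarrow> carrier A \<Longrightarrow> h (\<Oplus>\<^bsub>A\<^esub>i\<in>I. f i) = (\<Oplus>\<^bsub>B\<^esub>i\<in>I. h (f i))"
proof (induction I rule: infinite_finite_induct)
  case (insert i I)
  have "h (\<Oplus>\<^bsub>A\<^esub>j\<in>insert i I. f j) = h (f i \<oplus>\<^bsub>A\<^esub> (\<Oplus>\<^bsub>A\<^esub>j\<in>I. f j))"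
    using insert.hyps insert.prems by (subst A.M.finsum_insert) auto
  also have "\<dots> = h (f i) \<oplus>\<^bsub>B\<^esub> (\<Oplus>\<^bsub>B\<^esub>j\<in>I. h (f j))"
    using insert linear_homD(2)[OF h, of "f i" "\<Oplus>\<^bsub>A\<^esub>j\<in>I. f j"]
    by (auto simp: Pi_def)
  also have "\<dots> = (\<Oplus>\<^bsub>B\<^esub>j\<in>insert i I. h (f j))"
    using insert.hyps insert.prems linear_homD(1)[OF h] by (subst B.M.finsum_insert) auto
  finally show ?case .
qed (simp_all add: linear_hom_zero)

lemma linear_hom_minus:
  assumes x: "x \<in> carrier A" and y: "y \<in> carrier A"
  shows "h (x \<ominus>\<^bsub>A\<^esub> y) = h x \<ominus>\<^bsub>B\<^esub> h y"
proof -
  have "h (x \<oplus>\<^bsub>A\<^esub> (- 1) \<odot>\<^bsub>A\<^esub> y) = h x \<oplus>\<^bsub>B\<^esub> (- 1) \<odot>\<^bsub>B\<^esub> h y"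
    using linear_homD(2)[OF h x, of "(- 1) \<odot>\<^bsub>A\<^esub> y"] linear_homD(3)[OF h y, of "-1"] y
    by (simp only: A.smult_in)
  then show ?thesis
    using A.neg_eq_smult[OF y] B.neg_eq_smult[OF linear_homD(1)[OF h y]] by (simp only: a_minus_def)
qed

lemma linear_hom_vimage_subspace:
  assumes W: "subspace class_ring W B"
  shows "subspace class_ring {x \<in> carrier A. h x \<in> W} A"
  using B.subspaceD[OF W]
  by (intro A.subspaceI) (auto simp: linear_homD[OF h] linear_hom_zero)

end

subsection \<open>Subalgebras\<close>

lemma (in fvectorspace) subspace_fvectorspace:
  "subspace class_ring S A \<Longrightarrow> fvectorspace (A\<lparr>carrier := S\<rparr>)"
  unfolding fvectorspace_def by (rule subspace_is_vs)

lemma (in assoc_algebra) subalgebra: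
  assumes S: "subspace class_ring S A" and m: "\<And>x y. \<lbrakk>x \<in> S; y \<in> S\<rbrakk> \<Longrightarrow> x \<otimes> y \<in> S"
  shows "assoc_algebra (A\<lparr>carrier := S\<rparr>)"
proof -
  interpret S: fvectorspace "A\<lparr>carrier := S\<rparr>" by (rule subspace_fvectorspace[OF S])
  note Sc = subspaceD(2)[OF S]
  show ?thesis
    by unfold_locales (use m Sc in \<open>auto simp: bilinear mult_assoc\<close>)
qed

lemma inclusion_alg_hom:
  "S \<subseteq> carrier A \<Longrightarrow> alg_hom (A\<lparr>carrier := S\<rparr>) A (\<lambda>x. x)"
  by (auto simp: alg_hom_def linear_hom_def)

lemma (in assoc_algebra) ideal_subalgebra:
  "alg_ideal A S \<Longrightarrow> assoc_algebra (A\<lparr>carrier := S\<rparr>)"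
  by (rule subalgebra) (auto dest: alg_idealD subspaceD(2))

subsection \<open>Quotients\<close>

context fvectorspace begin

context
  fixes W assumes W: "subspace class_ring W A"
begin

lemma coset_eq_iff:
  assumes "x \<in> carrier A" "y \<in> carrier A"
  shows "W +> x = W +> y \<longleftrightarrow> x \<ominus> y \<in> W"
proof
  note Wc = subspaceD[OF W]
  assume eq: "W +> x = W +> y"
  have "x \<in> W +> x" using Wc(3) assms by (auto simp: a_r_coset_def' intro!: bexI[of _ \<zero>])
  then obtain w where "w \<in> W" "x = w \<oplus> y" using eq by (auto simp: a_r_coset_def')
  then show "x \<ominus> y \<in> W" using Wc(2) assms by (simp add: a_minus_def M.a_assoc M.r_neg)
next
  note Wc = subspaceD[OF W]
  assume d: "x \<ominus> y \<in> W"
  have sub: "W +> u \<subseteq> W +> v" if "u \<ominus> v \<in> W" "u \<in> carrier A" "v \<in> carrier A" for u v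
  proof
    fix z assume "z \<in> W +> u"
    then obtain w where w: "w \<in> W" "z = w \<oplus> u" by (auto simp: a_r_coset_def')
    then have "z = (w \<oplus> (u \<ominus> v)) \<oplus> v"
      using that Wc(2) diff_add_cancel[of u v] M.a_assoc[of w "u \<ominus> v" v] by simp
    then show "z \<in> W +> v" using Wc(4)[OF w(1) that(1)] by (auto simp: a_r_coset_def')
  qed
  have "y \<ominus> x = \<ominus> (x \<ominus> y)" using assms by (simp add: group_norm)
  then have "y \<ominus> x \<in> W" using Wc(6)[OF d] by simp
  then show "W +> x = W +> y" using sub d assms by blast
qed

lemma coset_self: "x \<in> carrier A \<Longrightarrow> x \<in> W +> x"
  using subspaceD(3)[OF W] by (auto simp: a_r_coset_def' intro!: bexI[of _ \<zero>])

lemma coset_mem: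
  assumes "x \<in> carrier A" "a \<in> W +> x" shows "a \<in> carrier A" "W +> a = W +> x"
proof -
  obtain w where w: "w \<in> W" "a = w \<oplus> x" using assms(2) by (auto simp: a_r_coset_def')
  then show a: "a \<in> carrier A" using assms(1) subspaceD(2)[OF W] by simp
  have "a \<ominus> x = w" using w assms(1) subspaceD(2)[OF W] by (simp add: a_minus_def M.a_assoc M.r_neg)
  then show "W +> a = W +> x" using w a assms(1) by (simp add: coset_eq_iff)
qed

text \<open>Operations on cosets are defined as unions over representatives. Once the set does not
  depend on the representative, the union collapses to a single member.\<close>

lemma coset_UN:
  assumes "x \<in> carrier A" "\<And>a. a \<in> W +> x \<Longrightarrow> F a = F x"
  shows "(\<Union>a\<in>W +> x. F a) = F x"
  using assms coset_self by blast

lemma quotient_carrier: "carrier (quotient_algebra A W) = (\<lambda>x. W +> x) ` carrier A"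
  by (auto simp: quotient_algebra_def ring.defs module.defs FactRing_def A_RCOSETS_def')

lemma quotient_zero: "\<zero>\<^bsub>quotient_algebra A W\<^esub> = W" "W = W +> \<zero>"
proof -
  show "W = W +> \<zero>" using subspaceD(2)[OF W] by (auto simp: a_r_coset_def')
qed (simp add: quotient_algebra_def ring.defs module.defs FactRing_def)

lemma quotient_add:
  assumes "x \<in> carrier A" "y \<in> carrier A"
  shows "(W +> x) \<oplus>\<^bsub>quotient_algebra A W\<^esub> (W +> y) = W +> (x \<oplus> y)"
proof -
  note Wc = subspaceD[OF W]
  have 1: "(a \<oplus> x) \<oplus> (b \<oplus> y) = (a \<oplus> b) \<oplus> (x \<oplus> y)" if "a \<in> W" "b \<in> W" for a b
    using that assms Wc(2) by (simp add: M.a_ac)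
  have 2: "a \<oplus> (x \<oplus> y) = (a \<oplus> x) \<oplus> (\<zero> \<oplus> y)" if "a \<in> W" for a
    using that assms Wc(2) by (simp add: M.a_ac)
  have "set_add A W W = W"
    unfolding set_add_def' using Wc(2-4) by (auto intro!: bexI[of _ \<zero>])
  show ?thesis
  proof (simp add: quotient_algebra_def ring.defs module.defs FactRing_def, intro equalityI subsetI)
    fix z assume "z \<in> set_add A (W +> x) (W +> y)"
    then obtain a b where "a \<in> W" "b \<in> W" "z = (a \<oplus> x) \<oplus> (b \<oplus> y)"
      by (auto simp: set_add_def' a_r_coset_def')
    then show "z \<in> W +> (x \<oplus> y)" using 1 Wc(4) by (auto simp: a_r_coset_def')
  next
    fix z assume "z \<in> W +> (x \<oplus> y)"
    then obtain a where "a \<in> W" "z = a \<oplus> (x \<oplus> y)" by (auto simp: a_r_coset_def')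
    then show "z \<in> set_add A (W +> x) (W +> y)"
      using 2 Wc(3) by (auto simp: set_add_def' a_r_coset_def')
  qed
qed

lemma quotient_smult:
  assumes x: "x \<in> carrier A"
  shows "c \<odot>\<^bsub>quotient_algebra A W\<^esub> (W +> x) = W +> (c \<odot> x)"
proof -
  have "W +> (c \<odot> a) = W +> (c \<odot> x)" if a: "a \<in> W +> x" for a
  proof -
    have aA: "a \<in> carrier A" and "a \<ominus> x \<in> W" using coset_mem[OF x a] coset_eq_iff x by auto
    then have "c \<odot> (a \<ominus> x) \<in> W" using subspaceD(5)[OF W] by blast
    then show ?thesis using aA x by (simp add: coset_eq_iff smult_minus)
  qed
  then have "(\<Union>a\<in>W +> x. W +> (c \<odot> a)) = W +> (c \<odot> x)" by (rule coset_UN[OF x])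
  then show ?thesis by (simp add: quotient_algebra_def ring.defs module.defs FactRing_def)
qed

lemma quotient_fvectorspace: "fvectorspace (quotient_algebra A W)"
proof (rule fvectorspaceI)
  let ?Q = "quotient_algebra A W"
  note q = quotient_carrier quotient_add quotient_smult
  show "\<zero>\<^bsub>?Q\<^esub> \<in> carrier ?Q" using quotient_zero by (auto simp: quotient_carrier)
  fix v assume v: "v \<in> carrier ?Q"
  then obtain x where x: "x \<in> carrier A" "v = W +> x" by (auto simp: quotient_carrier)
  show "v \<oplus>\<^bsub>?Q\<^esub> \<zero>\<^bsub>?Q\<^esub> = v"
    unfolding quotient_zero(1) x(2)
    using quotient_add[OF x(1) M.zero_closed] quotient_zero(2) x(1) by simp
  show "v \<oplus>\<^bsub>?Q\<^esub> (- 1) \<odot>\<^bsub>?Q\<^esub> v = \<zero>\<^bsub>?Q\<^esub>"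
    using x(1) quotient_zero by (simp add: x(2) q flip: neg_eq_smult) (simp add: M.r_neg)
  show "c \<odot>\<^bsub>?Q\<^esub> v \<in> carrier ?Q" for c using x by (simp add: q)
  show "(a * b) \<odot>\<^bsub>?Q\<^esub> v = a \<odot>\<^bsub>?Q\<^esub> (b \<odot>\<^bsub>?Q\<^esub> v)" for a b using x by (simp add: q mult_smult)
  show "1 \<odot>\<^bsub>?Q\<^esub> v = v" using x by (simp add: q)
  show "(a + b) \<odot>\<^bsub>?Q\<^esub> v = a \<odot>\<^bsub>?Q\<^esub> v \<oplus>\<^bsub>?Q\<^esub> b \<odot>\<^bsub>?Q\<^esub> v" for a b using x by (simp add: q add_smult)
  fix w assume "w \<in> carrier ?Q"
  then obtain y where y: "y \<in> carrier A" "w = W +> y" by (auto simp: quotient_carrier)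
  show "v \<oplus>\<^bsub>?Q\<^esub> w \<in> carrier ?Q" using x y by (simp add: q)
  show "v \<oplus>\<^bsub>?Q\<^esub> w = w \<oplus>\<^bsub>?Q\<^esub> v" using x y by (simp add: q M.a_comm)
  show "a \<odot>\<^bsub>?Q\<^esub> (v \<oplus>\<^bsub>?Q\<^esub> w) = a \<odot>\<^bsub>?Q\<^esub> v \<oplus>\<^bsub>?Q\<^esub> a \<odot>\<^bsub>?Q\<^esub> w" for a
    using x y by (simp add: q smult_add)
  fix u assume "u \<in> carrier ?Q"
  then obtain z where z: "z \<in> carrier A" "u = W +> z" by (auto simp: quotient_carrier)
  show "(v \<oplus>\<^bsub>?Q\<^esub> w) \<oplus>\<^bsub>?Q\<^esub> u = v \<oplus>\<^bsub>?Q\<^esub> (w \<oplus>\<^bsub>?Q\<^esub> u)" using x y z by (simp add: q M.a_assoc)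
qed

lemma quotient_linear_hom: "linear_hom A (quotient_algebra A W) (\<lambda>x. W +> x)"
  by (simp add: linear_hom_def quotient_carrier quotient_add quotient_smult)

lemma quotient_lift:
  assumes h: "linear_hom A B h" and B: "fvectorspace B" and W0: "\<And>w. w \<in> W \<Longrightarrow> h w = \<zero>\<^bsub>B\<^esub>"
  obtains h' where "linear_hom (quotient_algebra A W) B h'" "\<And>x. x \<in> carrier A \<Longrightarrow> h' (W +> x) = h x"
proof -
  interpret B: fvectorspace B by (rule B)
  have A: "fvectorspace A" by unfold_locales
  \<comment> \<open>An arbitrary representative is chosen; two of them differ by an element of
    \<open>W\<close>, which \<open>h\<close> kills.\<close>
  define h' where "h' X = h (SOME x. x \<in> carrier A \<and> X = W +> x)" for X
  have h': "h' (W +> x) = h x" if x: "x \<in> carrier A" for x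
  proof -
    define y where "y = (SOME y. y \<in> carrier A \<and> W +> x = W +> y)"
    have y: "y \<in> carrier A" "W +> x = W +> y"
      using someI[of "\<lambda>y. y \<in> carrier A \<and> W +> x = W +> y" x] x by (auto simp: y_def)
    then have "h (x \<ominus> y) = \<zero>\<^bsub>B\<^esub>" using x coset_eq_iff W0 by blast
    then have "h x \<ominus>\<^bsub>B\<^esub> h y = \<zero>\<^bsub>B\<^esub>" using linear_hom_minus[OF A B h x y(1)] by simp
    then have "h x = h y" using B.diff_eq_zero_iff linear_homD(1)[OF h] x y(1) by blast
    then show ?thesis by (simp add: h'_def y_def)
  qed
  have "linear_hom (quotient_algebra A W) B h'"
    by (rule linear_homI)
      (auto simp: quotient_carrier quotient_add quotient_smult h' linear_homD[OF h])
  then show ?thesis using h' that by blast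
qed

end
end

context assoc_algebra begin

context
  fixes I assumes I: "alg_ideal A I"
begin

lemmas ideal_sub = alg_idealD(1)[OF I]

lemma quotient_mult:
  assumes x: "x \<in> carrier A" and y: "y \<in> carrier A"
  shows "(I +> x) \<otimes>\<^bsub>quotient_algebra A I\<^esub> (I +> y) = I +> (x \<otimes> y)"
proof -
  have "I +> (a \<otimes> b) = I +> (x \<otimes> y)" if ab: "a \<in> I +> x" "b \<in> I +> y" for a b
  proof -
    have a: "a \<in> carrier A" "a \<ominus> x \<in> I"
      using coset_mem[OF ideal_sub x ab(1)] coset_eq_iff[OF ideal_sub] x by auto
    have b: "b \<in> carrier A" "b \<ominus> y \<in> I"
      using coset_mem[OF ideal_sub y ab(2)] coset_eq_iff[OF ideal_sub] y by auto
    have "a \<otimes> (b \<ominus> y) \<oplus> (a \<ominus> x) \<otimes> y \<in> I"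
      using a b y alg_idealD[OF I] subspaceD(4)[OF ideal_sub] by blast
    moreover have "a \<otimes> (b \<ominus> y) \<oplus> (a \<ominus> x) \<otimes> y = a \<otimes> b \<ominus> x \<otimes> y"
      using a(1) b(1) x y by (simp add: bilinear group_norm)
    ultimately show ?thesis using a b x y by (simp add: coset_eq_iff[OF ideal_sub])
  qed
  then have "(\<Union>a\<in>I +> x. \<Union>b\<in>I +> y. I +> (a \<otimes> b)) = I +> (x \<otimes> y)"
    using coset_self[OF ideal_sub] x y by blast
  then show ?thesis
    by (simp add: quotient_algebra_def ring.defs module.defs FactRing_def rcoset_mult_def)
qed

lemma quotient_assoc_algebra: "assoc_algebra (quotient_algebra A I)"
proof -
  let ?Q = "quotient_algebra A I"
  interpret Q: fvectorspace ?Q by (rule quotient_fvectorspace[OF ideal_sub])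
  note q = quotient_add[OF ideal_sub] quotient_smult[OF ideal_sub] quotient_mult
  have car: "\<exists>y\<in>carrier A. x = I +> y" if "x \<in> carrier ?Q" for x
    using that by (auto simp: quotient_carrier[OF ideal_sub])
  have inc: "I +> x \<in> carrier ?Q" if "x \<in> carrier A" for x
    using that by (auto simp: quotient_carrier[OF ideal_sub])
  show ?thesis
  proof unfold_locales
    fix x assume "x \<in> carrier ?Q"
    then obtain x' where x: "x' \<in> carrier A" "x = I +> x'" using car by blast
    fix y assume "y \<in> carrier ?Q"
    then obtain y' where y: "y' \<in> carrier A" "y = I +> y'" using car by blast
    show "x \<otimes>\<^bsub>?Q\<^esub> y \<in> carrier ?Q" using x y inc by (simp add: q)
    show "(c \<odot>\<^bsub>?Q\<^esub> x) \<otimes>\<^bsub>?Q\<^esub> y = c \<odot>\<^bsub>?Q\<^esub> (x \<otimes>\<^bsub>?Q\<^esub> y)" for c using x y by (simp add: q bilinear)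
    show "x \<otimes>\<^bsub>?Q\<^esub> (c \<odot>\<^bsub>?Q\<^esub> y) = c \<odot>\<^bsub>?Q\<^esub> (x \<otimes>\<^bsub>?Q\<^esub> y)" for c using x y by (simp add: q bilinear)
    fix z assume "z \<in> carrier ?Q"
    then obtain z' where z: "z' \<in> carrier A" "z = I +> z'" using car by blast
    show "(x \<otimes>\<^bsub>?Q\<^esub> y) \<otimes>\<^bsub>?Q\<^esub> z = x \<otimes>\<^bsub>?Q\<^esub> (y \<otimes>\<^bsub>?Q\<^esub> z)" using x y z by (simp add: q mult_assoc)
    show "(x \<oplus>\<^bsub>?Q\<^esub> y) \<otimes>\<^bsub>?Q\<^esub> z = x \<otimes>\<^bsub>?Q\<^esub> z \<oplus>\<^bsub>?Q\<^esub> y \<otimes>\<^bsub>?Q\<^esub> z" using x y z by (simp add: q bilinear)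
    show "z \<otimes>\<^bsub>?Q\<^esub> (x \<oplus>\<^bsub>?Q\<^esub> y) = z \<otimes>\<^bsub>?Q\<^esub> x \<oplus>\<^bsub>?Q\<^esub> z \<otimes>\<^bsub>?Q\<^esub> y" using x y z by (simp add: q bilinear)
  qed
qed

lemma quotient_alg_hom: "alg_hom A (quotient_algebra A I) (\<lambda>x. I +> x)"
  by (simp add: alg_hom_def quotient_linear_hom[OF ideal_sub] quotient_mult)

lemma quotient_alg_lift:
  assumes h: "alg_hom A B h" and B: "assoc_algebra B" and I0: "\<And>x. x \<in> I \<Longrightarrow> h x = \<zero>\<^bsub>B\<^esub>"
  obtains h' where "alg_hom (quotient_algebra A I) B h'" "\<And>x. x \<in> carrier A \<Longrightarrow> h' (I +> x) = h x"
proof -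
  interpret B: assoc_algebra B by (rule B)
  have Bv: "fvectorspace B" by unfold_locales
  obtain h' where h': "linear_hom (quotient_algebra A I) B h'" "\<And>x. x \<in> carrier A \<Longrightarrow> h' (I +> x) = h x"
    using quotient_lift[OF ideal_sub alg_homD(1)[OF h] Bv I0] by blast
  have "alg_hom (quotient_algebra A I) B h'"
    by (rule alg_homI[OF h'(1)])
      (auto simp: quotient_carrier[OF ideal_sub] quotient_mult h'(2) alg_homD(2)[OF h])
  then show ?thesis using h' that by blast
qed

end

lemma vimage_ideal:
  assumes B: "assoc_algebra B" and h: "alg_hom A B h" and I: "alg_ideal B I"
  shows "alg_ideal A {x \<in> carrier A. h x \<in> I}"
proof -
  interpret B: assoc_algebra B by (rule B)
  have fv: "fvectorspace A" "fvectorspace B" by unfold_locales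
  show ?thesis
    by (rule alg_idealI[OF linear_hom_vimage_subspace[OF fv alg_homD(1)[OF h] B.alg_idealD(1)[OF I]]])
      (auto simp: alg_homD(2)[OF h] B.alg_idealD(2,3)[OF I] linear_homD(1)[OF alg_homD(1)[OF h]])
qed

lemma zero_ideal: "alg_ideal A {\<zero>}"
  by (rule alg_idealI[OF subspace_zero]) auto

lemma carrier_ideal: "alg_ideal A (carrier A)"
  by (rule alg_idealI[OF subspace_carrier]) auto

lemma generated_ideal:
  assumes S: "S \<subseteq> carrier A"
  shows "alg_ideal A (generated_ideal A S)" "S \<subseteq> generated_ideal A S"
    "\<And>I. \<lbrakk>alg_ideal A I; S \<subseteq> I\<rbrakk> \<Longrightarrow> generated_ideal A S \<subseteq> I"
proof -
  show "S \<subseteq> generated_ideal A S" by (simp add: generated_ideal_def hull_subset)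
  show "generated_ideal A S \<subseteq> I" if "alg_ideal A I" "S \<subseteq> I" for I
    using that by (simp add: generated_ideal_def hull_minimal)
  have car: "\<Inter>{I. alg_ideal A I \<and> S \<subseteq> I} \<subseteq> carrier A" using S carrier_ideal by blast
  show "alg_ideal A (generated_ideal A S)"
    unfolding generated_ideal_def hull_def
  proof (rule alg_idealI[OF subspaceI])
    note s = subspaceD[OF alg_idealD(1)]
    let ?I = "\<Inter>{t. alg_ideal A t \<and> S \<subseteq> t}"
    show "?I \<subseteq> carrier A" by (rule car)
    show "\<zero> \<in> ?I" using s(3) by auto
    show "x \<oplus> y \<in> ?I" if "x \<in> ?I" "y \<in> ?I" for x y using s(4) that by auto
    show "c \<odot> x \<in> ?I" if "x \<in> ?I" for c x using s(5) that by auto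
    show "a \<otimes> x \<in> ?I" if "a \<in> carrier A" "x \<in> ?I" for a x using alg_idealD(2) that by auto
    show "x \<otimes> a \<in> ?I" if "a \<in> carrier A" "x \<in> ?I" for a x using alg_idealD(3) that by auto
  qed
qed

text \<open>By \<open>a(uv) = (au)v\<close> and \<open>(uv)a = u(va)\<close> the left factor absorbs
  from the left and the right factor from the right. The one-sided form applies to a minimal left
  ideal times the whole algebra.\<close>

lemma left_right_ideal_mult:
  assumes I: "left_ideal A I" and J: "subspace class_ring J A" "\<And>a x. \<lbrakk>a \<in> carrier A; x \<in> J\<rbrakk> \<Longrightarrow> x \<otimes> a \<in> J"
  shows "alg_ideal A (subspace_mult A I J)"
proof -
  note Ic = subspaceD(1,2)[OF left_idealD(1)[OF I]] and Jc = subspaceD(1,2)[OF J(1)]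
  let ?P = "subspace_mult A I J"
  have P: "subspace class_ring ?P A" using Ic(1) Jc(1) by (rule subspace_mult_subspace)
  have "subspace class_ring {x \<in> carrier A. \<forall>a\<in>carrier A. a \<otimes> x \<in> ?P \<and> x \<otimes> a \<in> ?P} A"
    by (rule subspaceI) (use subspaceD[OF P] in \<open>auto simp: bilinear\<close>)
  then have "?P \<subseteq> {x \<in> carrier A. \<forall>a\<in>carrier A. a \<otimes> x \<in> ?P \<and> x \<otimes> a \<in> ?P}"
  proof (rule subspace_mult_minimal)
    fix u v assume uv: "u \<in> I" "v \<in> J"
    have "a \<otimes> (u \<otimes> v) \<in> ?P" if a: "a \<in> carrier A" for a
      using mult_assoc[of a u v] prod_in_subspace_mult[OF Ic(1) Jc(1) left_idealD(2)[OF I a uv(1)] uv(2)]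
        a Ic(2)[OF uv(1)] Jc(2)[OF uv(2)] by simp
    moreover have "(u \<otimes> v) \<otimes> a \<in> ?P" if a: "a \<in> carrier A" for a
      using mult_assoc[of u v a] prod_in_subspace_mult[OF Ic(1) Jc(1) uv(1) J(2)[OF a uv(2)]]
        a Ic(2)[OF uv(1)] Jc(2)[OF uv(2)] by simp
    ultimately show "u \<otimes> v \<in> {x \<in> carrier A. \<forall>a\<in>carrier A. a \<otimes> x \<in> ?P \<and> x \<otimes> a \<in> ?P}"
      using Ic(2)[OF uv(1)] Jc(2)[OF uv(2)] by simp
  qed
  then show ?thesis by (intro alg_idealI[OF P]) auto
qed

lemma ideal_mult_ideal:
  assumes I: "alg_ideal A I" and J: "alg_ideal A J"
  shows "alg_ideal A (subspace_mult A I J)"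
  by (rule left_right_ideal_mult)
    (use alg_idealD[OF I] alg_idealD[OF J] in \<open>auto intro: left_idealI\<close>)

end

section \<open>Noncommutative polynomials and their evaluation\<close>

lemma monomial_induct [consumes 1, case_names zero add]:
  fixes p :: "'a \<Rightarrow>\<^sub>0 'b :: monoid_add"
  assumes "Poly_Mapping.keys p \<subseteq> S" "P 0"
    and "\<And>q w c. \<lbrakk>Poly_Mapping.keys q \<subseteq> S; w \<in> S; P q\<rbrakk> \<Longrightarrow> P (q + Poly_Mapping.single w c)"
  shows "P p"
  using assms(1)
proof (induction p rule: update_induct)
  case (update q w c)
  have eq: "Poly_Mapping.update w c q = q + Poly_Mapping.single w c"
    using update(1) by (intro poly_mapping_eqI) (auto simp: lookup_update lookup_add lookup_single when_def in_keys_iff)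
  have "Poly_Mapping.keys (Poly_Mapping.update w c q) = insert w (Poly_Mapping.keys q)"
    using update(2) by (auto simp: in_keys_iff lookup_update split: if_splits)
  then have "Poly_Mapping.keys q \<subseteq> S" "w \<in> S" using update.prems by auto
  then show ?case using update.IH assms(3) unfolding eq by blast
qed (rule assms(2))

lemma lookup_scale [simp]:
  fixes p :: "'a \<Rightarrow>\<^sub>0 'f :: field"
  shows "Poly_Mapping.lookup (Poly_Mapping.map ((*) c) p) w = c * Poly_Mapping.lookup p w"
  by (simp add: map.rep_eq when_def)

lemma scale_single [simp]:
  fixes c d :: "'f :: field"
  shows "Poly_Mapping.map ((*) c) (Poly_Mapping.single w d) = Poly_Mapping.single w (c * d)"
  by (intro poly_mapping_eqI) (simp add: lookup_single when_def)

lemma scale_zero [simp]: "Poly_Mapping.map ((*) c) 0 = (0 :: 'a \<Rightarrow>\<^sub>0 'f :: field)"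
  by (simp add: poly_mapping_eq_iff fun_eq_iff)

lemma scale_mult_left:
  fixes p q :: "'x list \<Rightarrow>\<^sub>0 'f :: field"
  shows "Poly_Mapping.map ((*) c) p * q = Poly_Mapping.map ((*) c) (p * q)"
  by (simp add: mult_map_scale_conv_mult mult.assoc)

lemma scale_add:
  fixes p q :: "'x \<Rightarrow>\<^sub>0 'f :: field"
  shows "Poly_Mapping.map ((*) c) (p + q) = Poly_Mapping.map ((*) c) p + Poly_Mapping.map ((*) c) q"
  by (intro poly_mapping_eqI) (simp add: lookup_add algebra_simps)

lemma single_mult_scale:
  fixes q :: "'x list \<Rightarrow>\<^sub>0 'f :: field"
  shows "Poly_Mapping.single w d * Poly_Mapping.map ((*) c) q = Poly_Mapping.map ((*) c) (Poly_Mapping.single w d * q)"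
proof (induction q rule: monomial_induct[OF subset_UNIV])
  case (2 q v e)
  then show ?case by (simp add: scale_add distrib_left mult_single mult.left_commute)
qed simp

lemma scale_mult_right:
  fixes p q :: "'x list \<Rightarrow>\<^sub>0 'f :: field"
  shows "p * Poly_Mapping.map ((*) c) q = Poly_Mapping.map ((*) c) (p * q)"
proof (induction p rule: monomial_induct[OF subset_UNIV])
  case (2 p v e)
  then show ?case by (simp add: scale_add distrib_right single_mult_scale)
qed simp

lemma keys_scale: "Poly_Mapping.keys (Poly_Mapping.map ((*) c) p) \<subseteq> Poly_Mapping.keys (p :: 'a \<Rightarrow>\<^sub>0 'f :: field)"
  by (auto simp: in_keys_iff)

lemma free_algebra_simps [simp]:
  "carrier (free_algebra X) = {p. \<forall>w\<in>Poly_Mapping.keys p. w \<noteq> [] \<and> set w \<subseteq> X}"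
  "mult (free_algebra X) = (*)" "zero (free_algebra X) = 0" "add (free_algebra X) = (+)"
  "smult (free_algebra X) = (\<lambda>c. Poly_Mapping.map ((*) c))"
  by (simp_all add: free_algebra_def)

text \<open>The set \<open>S\<close> of allowed words is arbitrary because it is instantiated both
  with the nonempty words over \<open>X\<close> and with the multilinear words.\<close>

lemma word_support_vectorspace:
  "fvectorspace ((free_algebra X :: ('f :: field, 'x list \<Rightarrow>\<^sub>0 'f) module)\<lparr>carrier := {p. Poly_Mapping.keys p \<subseteq> S}\<rparr>)"
proof (rule fvectorspaceI)
qed (use keys_add keys_scale in \<open>force simp: poly_mapping_eq_iff fun_eq_iff lookup_add algebra_simps\<close>)+

lemma free_algebra_assoc: "assoc_algebra (free_algebra X :: ('f :: field, 'x list \<Rightarrow>\<^sub>0 'f) module)"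
proof -
  interpret fvectorspace "free_algebra X :: ('f, 'x list \<Rightarrow>\<^sub>0 'f) module"
    using word_support_vectorspace[of "{w. w \<noteq> [] \<and> set w \<subseteq> X}" X]
    by (simp add: free_algebra_def subset_eq)
  show ?thesis
  proof unfold_locales
    fix p q :: "'x list \<Rightarrow>\<^sub>0 'f" assume p: "p \<in> carrier (free_algebra X)" and q: "q \<in> carrier (free_algebra X)"
    have "w \<noteq> [] \<and> set w \<subseteq> X" if w: "w \<in> Poly_Mapping.keys (p * q)" for w
    proof -
      obtain u v where "u \<in> Poly_Mapping.keys p" "v \<in> Poly_Mapping.keys q" "w = u @ v"
        using subsetD[OF keys_mult[of p q] w] by (auto simp: plus_list_def)
      then show ?thesis using p q by auto
    qed
    then show "p \<otimes>\<^bsub>free_algebra X\<^esub> q \<in> carrier (free_algebra X)" by simp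
  qed (simp_all add: mult.assoc distrib_left distrib_right scale_mult_left scale_mult_right)
qed

lemma gen_in_free_algebra: "x \<in> X \<Longrightarrow> gen x \<in> carrier (free_algebra X)"
  by (simp add: gen_def)

context assoc_algebra begin

lemma word_product_Cons: "w \<noteq> [] \<Longrightarrow> word_product A (a # w) = a \<otimes> word_product A w"
  by (cases w) auto

lemma word_product_closed: "(\<And>x. x \<in> set w \<Longrightarrow> x \<in> carrier A) \<Longrightarrow> word_product A w \<in> carrier A"
proof (induction w)
  case (Cons a w)
  then show ?case by (cases "w = []") (simp_all add: word_product_Cons)
qed simp

lemma word_product_append:
  assumes "\<And>x. x \<in> set (v @ w) \<Longrightarrow> x \<in> carrier A" "v \<noteq> []" "w \<noteq> []"
  shows "word_product A (v @ w) = word_product A v \<otimes> word_product A w"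
  using assms
proof (induction v)
  case (Cons a v)
  then show ?case
    by (cases "v = []") (auto simp: word_product_Cons mult_assoc word_product_closed)
qed simp

context
  fixes \<phi> :: "'x \<Rightarrow> 'a" assumes \<phi>: "\<And>x. \<phi> x \<in> carrier A"
begin

lemma word_closed [simp]: "word_product A (map \<phi> w) \<in> carrier A"
  by (rule word_product_closed) (auto simp: \<phi>)

lemma evaluate_superset:
  assumes "finite W" "Poly_Mapping.keys p \<subseteq> W"
  shows "evaluate A \<phi> p = (\<Oplus>\<^bsub>A\<^esub>w\<in>W. Poly_Mapping.lookup p w \<odot> word_product A (map \<phi> w))"
  unfolding evaluate_def
  by (rule M.add.finprod_mono_neutral_cong_left) (use assms in \<open>auto simp: in_keys_iff\<close>)

lemma evaluate_closed [simp]: "evaluate A \<phi> p \<in> carrier A"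
  unfolding evaluate_def by (rule M.finsum_closed) auto

lemma evaluate_zero [simp]: "evaluate A \<phi> 0 = \<zero>"
  by (simp add: evaluate_def)

lemma evaluate_add: "evaluate A \<phi> (p + q) = evaluate A \<phi> p \<oplus> evaluate A \<phi> q"
proof -
  let ?W = "Poly_Mapping.keys p \<union> Poly_Mapping.keys q"
  have "evaluate A \<phi> (p + q) = (\<Oplus>\<^bsub>A\<^esub>w\<in>?W. Poly_Mapping.lookup p w \<odot> word_product A (map \<phi> w)
      \<oplus> Poly_Mapping.lookup q w \<odot> word_product A (map \<phi> w))"
    using keys_add[of p q] by (subst evaluate_superset[of ?W]) (auto simp: lookup_add add_smult)
  also have "\<dots> = evaluate A \<phi> p \<oplus> evaluate A \<phi> q"
    by (subst M.finsum_addf) (auto simp: evaluate_superset[of ?W])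
  finally show ?thesis .
qed

lemma evaluate_single [simp]: "evaluate A \<phi> (Poly_Mapping.single w c) = c \<odot> word_product A (map \<phi> w)"
proof -
  have "evaluate A \<phi> (Poly_Mapping.single w c) =
      (\<Oplus>\<^bsub>A\<^esub>v\<in>{w}. Poly_Mapping.lookup (Poly_Mapping.single w c) v \<odot> word_product A (map \<phi> v))"
    by (rule evaluate_superset) auto
  also have "\<dots> = c \<odot> word_product A (map \<phi> w)"
    by (subst M.finsum_insert) auto
  finally show ?thesis .
qed

lemma evaluate_gen [simp]: "evaluate A \<phi> (gen x) = \<phi> x"
  by (simp add: gen_def \<phi>)

lemma evaluate_scale: "evaluate A \<phi> (Poly_Mapping.map ((*) c) p) = c \<odot> evaluate A \<phi> p"
proof (induction p rule: monomial_induct[OF subset_UNIV])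
  case (2 p v e)
  then show ?case by (simp add: scale_add evaluate_add smult_add mult_smult)
qed simp

text \<open>Nonempty words are required since \<open>word_product\<close> sends the empty word to
  zero, so that a constant term would not act as a unit.\<close>

lemma evaluate_mult:
  assumes p: "\<forall>w\<in>Poly_Mapping.keys p. w \<noteq> []" and q: "\<forall>w\<in>Poly_Mapping.keys q. w \<noteq> []"
  shows "evaluate A \<phi> (p * q) = evaluate A \<phi> p \<otimes> evaluate A \<phi> q"
proof -
  have single: "evaluate A \<phi> (Poly_Mapping.single v c * q) = (c \<odot> word_product A (map \<phi> v)) \<otimes> evaluate A \<phi> q"
    if v: "v \<noteq> []" for v c
  proof -
    have "Poly_Mapping.keys q \<subseteq> {w. w \<noteq> []}" using q by auto
    then show ?thesis
    proof (induction q rule: monomial_induct)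
      case (add q w d)
      have "word_product A (map \<phi> (v @ w)) = word_product A (map \<phi> v) \<otimes> word_product A (map \<phi> w)"
        using word_product_append[of "map \<phi> v" "map \<phi> w"] v add.hyps \<phi> by auto
      moreover have "c \<odot> (d \<odot> x) = d \<odot> (c \<odot> x)" if "x \<in> carrier A" for x
        using that by (simp add: mult.commute flip: mult_smult)
      ultimately show ?case
        using add by (simp add: distrib_left evaluate_add mult_single plus_list_def bilinear mult_smult)
    qed simp
  qed
  have "Poly_Mapping.keys p \<subseteq> {w. w \<noteq> []}" using p by auto
  then show ?thesis
  proof (induction p rule: monomial_induct)
    case (add p v c)
    then show ?case by (simp add: distrib_right evaluate_add single bilinear)
  qed simp
qed

lemma evaluate_alg_hom: "alg_hom (free_algebra X) A (evaluate A \<phi>)"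
  by (rule alg_homI[OF linear_homI]) (auto simp: evaluate_add evaluate_scale evaluate_mult)

lemma linear_functional_evaluate:
  assumes "linear_functional A \<psi>"
  shows "\<psi> (evaluate A \<phi> p) =
    (\<Sum>w\<in>Poly_Mapping.keys p. Poly_Mapping.lookup p w * \<psi> (word_product A (map \<phi> w)))"
  unfolding evaluate_def
  by (subst linear_functional_finsum[OF assms]) (auto simp: linear_functionalD[OF assms])

end

end

lemma alg_hom_word_product:
  assumes A: "assoc_algebra A" and B: "assoc_algebra B" and h: "alg_hom A B h"
    and "\<And>x. x \<in> set w \<Longrightarrow> x \<in> carrier A"
  shows "h (word_product A w) = word_product B (map h w)"
  using assms(4)
proof (induction w)
  case Nil
  show ?case using linear_hom_zero[of A B h] A B alg_homD(1)[OF h]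
    by (simp add: assoc_algebra_def fvectorspace_def)
next
  case (Cons a w)
  then show ?case
    by (cases "w = []") (simp_all add: assoc_algebra.word_product_Cons[OF A] assoc_algebra.word_product_Cons[OF B]
        alg_homD(2)[OF h] assoc_algebra.word_product_closed[OF A])
qed

lemma alg_hom_evaluate:
  assumes A: "assoc_algebra A" and B: "assoc_algebra B" and h: "alg_hom A B h"
    and \<phi>: "\<And>x. \<phi> x \<in> carrier A"
  shows "h (evaluate A \<phi> p) = evaluate B (\<lambda>x. h (\<phi> x)) p"
proof -
  interpret A: assoc_algebra A by (rule A)
  interpret B: assoc_algebra B by (rule B)
  have fv: "fvectorspace A" "fvectorspace B" by unfold_locales
  note hl = alg_homD(1)[OF h]
  have "h (evaluate A \<phi> p) =
      (\<Oplus>\<^bsub>B\<^esub>w\<in>Poly_Mapping.keys p. h (Poly_Mapping.lookup p w \<odot>\<^bsub>A\<^esub> word_product A (map \<phi> w)))"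
    unfolding evaluate_def by (rule linear_hom_finsum[OF fv hl]) (simp add: A.word_closed[OF \<phi>])
  also have "\<dots> = evaluate B (\<lambda>x. h (\<phi> x)) p"
  proof -
    have eq: "h (c \<odot>\<^bsub>A\<^esub> word_product A (map \<phi> w)) = c \<odot>\<^bsub>B\<^esub> word_product B (map (\<lambda>x. h (\<phi> x)) w)" for c w
      using linear_homD(3)[OF hl A.word_closed[of \<phi> w, OF \<phi>], of c] alg_hom_word_product[OF A B h, of "map \<phi> w"] \<phi>
      by (fastforce simp: comp_def)
    show ?thesis unfolding evaluate_def eq ..
  qed
  finally show ?thesis .
qed

lemma identitiesD:
  "\<lbrakk>p \<in> identities A; \<And>n. \<phi> n \<in> carrier A\<rbrakk> \<Longrightarrow> evaluate A \<phi> p = \<zero>\<^bsub>A\<^esub>"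
  by (auto simp: identities_def)

lemma identities_iff:
  "p \<in> identities A \<longleftrightarrow> p \<in> carrier FX \<and> (\<forall>\<phi>. (\<forall>n. \<phi> n \<in> carrier A) \<longrightarrow> evaluate A \<phi> p = \<zero>\<^bsub>A\<^esub>)"
  by (auto simp: identities_def)

lemma evaluate_subalgebra:
  assumes "assoc_algebra A" "assoc_algebra (A\<lparr>carrier := S\<rparr>)" "S \<subseteq> carrier A" "\<And>x. \<phi> x \<in> S"
  shows "evaluate (A\<lparr>carrier := S\<rparr>) \<phi> p = evaluate A \<phi> p"
  using alg_hom_evaluate[OF assms(2,1) inclusion_alg_hom[OF assms(3)], of \<phi>] assms(4) by simp

subsection \<open>Direct sums\<close>

lemma direct_sum_simps [simp]:
  "carrier (A \<boxplus> B) = carrier A \<times> carrier B"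
  "mult (A \<boxplus> B) = (\<lambda>(x, y) (x', y'). (x \<otimes>\<^bsub>A\<^esub> x', y \<otimes>\<^bsub>B\<^esub> y'))"
  "add (A \<boxplus> B) = (\<lambda>(x, y) (x', y'). (x \<oplus>\<^bsub>A\<^esub> x', y \<oplus>\<^bsub>B\<^esub> y'))"
  "zero (A \<boxplus> B) = (\<zero>\<^bsub>A\<^esub>, \<zero>\<^bsub>B\<^esub>)"
  "smult (A \<boxplus> B) = (\<lambda>c (x, y). (c \<odot>\<^bsub>A\<^esub> x, c \<odot>\<^bsub>B\<^esub> y))"
  by (simp_all add: direct_sum_def RDirProd_def DirProd_def monoid.defs ring.defs module.defs)

lemma direct_sum_assoc_algebra:
  assumes A: "assoc_algebra A" and B: "assoc_algebra B"
  shows "assoc_algebra (A \<boxplus> B)"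
proof -
  interpret A: assoc_algebra A by (rule A)
  interpret B: assoc_algebra B by (rule B)
  interpret fvectorspace "A \<boxplus> B"
    by (rule fvectorspaceI)
      (auto simp: A.M.a_ac B.M.a_ac A.mult_smult B.mult_smult
        A.add_smult B.add_smult A.smult_add B.smult_add A.M.r_neg B.M.r_neg
        simp flip: A.neg_eq_smult B.neg_eq_smult)
  show ?thesis
    by unfold_locales (auto simp: A.bilinear B.bilinear A.mult_assoc B.mult_assoc)
qed

lemma identities_direct_sum:
  fixes A :: "('f :: field, 'a) module" and B :: "('f, 'b) module"
  assumes A: "assoc_algebra A" and B: "assoc_algebra B"
  shows "identities (A \<boxplus> B) = identities A \<inter> identities B"
proof -
  note AB = direct_sum_assoc_algebra[OF A B]
  interpret A: assoc_algebra A by (rule A)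
  interpret B: assoc_algebra B by (rule B)
  have h: "alg_hom (A \<boxplus> B) A fst" "alg_hom (A \<boxplus> B) B snd"
    by (auto simp: alg_hom_def linear_hom_def)
  have ev: "evaluate (A \<boxplus> B) \<phi> p = (evaluate A (\<lambda>n. fst (\<phi> n)) p, evaluate B (\<lambda>n. snd (\<phi> n)) p)"
    if "\<And>n. \<phi> n \<in> carrier (A \<boxplus> B)" for \<phi> :: "nat \<Rightarrow> 'a \<times> 'b" and p
    using alg_hom_evaluate[OF AB A h(1), of \<phi> p] alg_hom_evaluate[OF AB B h(2), of \<phi> p] that
    by (simp add: prod_eq_iff)
  show ?thesis
  proof (intro equalityI subsetI IntI)
    fix p assume p: "p \<in> identities (A \<boxplus> B)"
    then have pF: "p \<in> carrier FX" by (simp add: identities_iff)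
    have "evaluate A \<phi> p = \<zero>\<^bsub>A\<^esub>" if "\<And>n. \<phi> n \<in> carrier A" for \<phi>
      using identitiesD[OF p, of "\<lambda>n. (\<phi> n, \<zero>\<^bsub>B\<^esub>)"] ev[of "\<lambda>n. (\<phi> n, \<zero>\<^bsub>B\<^esub>)" p] that by simp
    then show "p \<in> identities A" using pF by (simp add: identities_iff)
    have "evaluate B \<phi> p = \<zero>\<^bsub>B\<^esub>" if "\<And>n. \<phi> n \<in> carrier B" for \<phi>
      using identitiesD[OF p, of "\<lambda>n. (\<zero>\<^bsub>A\<^esub>, \<phi> n)"] ev[of "\<lambda>n. (\<zero>\<^bsub>A\<^esub>, \<phi> n)" p] that by simp
    then show "p \<in> identities B" using pF by (simp add: identities_iff)
  next
    fix p assume p: "p \<in> identities A \<inter> identities B"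
    have "evaluate (A \<boxplus> B) \<phi> p = \<zero>\<^bsub>A \<boxplus> B\<^esub>" if \<phi>: "\<And>n. \<phi> n \<in> carrier (A \<boxplus> B)" for \<phi>
    proof -
      have "fst (\<phi> n) \<in> carrier A" "snd (\<phi> n) \<in> carrier B" for n using \<phi>[of n] by auto
      then show ?thesis using p ev[of \<phi> p, OF \<phi>] identitiesD[of p A] identitiesD[of p B] by simp
    qed
    then show "p \<in> identities (A \<boxplus> B)" using p by (simp add: identities_iff)
  qed
qed

lemma zero_subalgebra: "assoc_algebra A \<Longrightarrow> assoc_algebra (A\<lparr>carrier := {\<zero>\<^bsub>A\<^esub>}\<rparr>)"
  by (rule assoc_algebra.ideal_subalgebra) (auto intro: assoc_algebra.zero_ideal)

lemma identities_zero_subalgebra: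
  fixes A :: "('f :: field, 'a) module"
  assumes A: "assoc_algebra A"
  shows "identities (A\<lparr>carrier := {\<zero>\<^bsub>A\<^esub>}\<rparr>) = carrier FX"
proof -
  interpret Z: assoc_algebra "A\<lparr>carrier := {\<zero>\<^bsub>A\<^esub>}\<rparr>" by (rule zero_subalgebra[OF A])
  have "evaluate (A\<lparr>carrier := {\<zero>\<^bsub>A\<^esub>}\<rparr>) \<phi> p = \<zero>\<^bsub>A\<^esub>" if "\<And>n. \<phi> n = \<zero>\<^bsub>A\<^esub>" for \<phi> :: "nat \<Rightarrow> 'a" and p
    using Z.evaluate_closed[of \<phi> p] that by simp
  then show ?thesis by (auto simp: identities_iff simp del: free_algebra_simps)
qed

section \<open>Words in a triangular algebra\<close>

text \<open>The entries of a product of upper triangular \<open>3 \<times> 3\<close> matrices with diagonals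
  \<open>(a\<^sub>x, b\<^sub>x, c\<^sub>x)\<close>; the products of an entry \<open>(1,2)\<close> and an entry \<open>(2,3)\<close> are replaced by an
  arbitrary matrix \<open>\<Gamma>\<close>.\<close>

fun diag_entry :: "('x \<Rightarrow> 'f :: field) \<Rightarrow> 'x list \<Rightarrow> 'f" where
  "diag_entry a [] = 1"
| "diag_entry a (x # w) = a x * diag_entry a w"

fun linear_entry :: "('x \<Rightarrow> 'f :: field) \<Rightarrow> ('x \<Rightarrow> 'f) \<Rightarrow> ('x \<Rightarrow> 'f) \<Rightarrow> 'x list \<Rightarrow> 'f" where
  "linear_entry a b \<beta> [] = 0"
| "linear_entry a b \<beta> (x # w) = a x * linear_entry a b \<beta> w + \<beta> x * diag_entry b w"

fun bilinear_entry :: "('x \<Rightarrow> 'f :: field) \<Rightarrow> ('x \<Rightarrow> 'f) \<Rightarrow> ('x \<Rightarrow> 'f) \<Rightarrow> ('x \<Rightarrow> 'x \<Rightarrow> 'f) \<Rightarrow> 'x list \<Rightarrow> 'f" where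
  "bilinear_entry a b c \<Gamma> [] = 0"
| "bilinear_entry a b c \<Gamma> (x # w) = a x * bilinear_entry a b c \<Gamma> w + linear_entry b c (\<Gamma> x) w"

definition word_sum :: "('x list \<Rightarrow>\<^sub>0 'f :: field) \<Rightarrow> ('x list \<Rightarrow> 'f) \<Rightarrow> 'f" where
  "word_sum p F = (\<Sum>w\<in>Poly_Mapping.keys p. Poly_Mapping.lookup p w * F w)"

lemma diag_entry_zero: "w \<noteq> [] \<Longrightarrow> diag_entry (\<lambda>_. 0) w = 0"
  by (cases w) auto

lemma linear_entry_add:
  "linear_entry a b (\<lambda>i. \<beta> i + \<gamma> i) w = linear_entry a b \<beta> w + linear_entry a b \<gamma> w"
  by (induction w) (auto simp: algebra_simps)

lemma linear_entry_scale: "linear_entry a b (\<lambda>i. c * \<beta> i) w = c * linear_entry a b \<beta> w"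
  by (induction w) (auto simp: algebra_simps)

lemma linear_entry_scale': "linear_entry a b (\<lambda>i. \<beta> i * c) w = c * linear_entry a b \<beta> w"
  using linear_entry_scale[of a b c \<beta> w] by (simp add: mult.commute)

lemma linear_entry_zero [simp]: "linear_entry a b (\<lambda>_. 0) w = 0"
  by (induction w) auto

lemma bilinear_entry_add:
  "bilinear_entry a b c (\<lambda>i j. \<Gamma> i j + \<Delta> i j) w = bilinear_entry a b c \<Gamma> w + bilinear_entry a b c \<Delta> w"
  by (induction w) (auto simp: algebra_simps linear_entry_add)

lemma bilinear_entry_scale:
  "bilinear_entry a b c (\<lambda>i j. d * \<Gamma> i j) w = d * bilinear_entry a b c \<Gamma> w"
  by (induction w) (auto simp: algebra_simps linear_entry_scale)

lemma bilinear_entry_zero [simp]: "bilinear_entry a b c (\<lambda>_ _. 0) w = 0"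
  by (induction w) auto

lemma bilinear_entry_sum:
  "bilinear_entry a b c (\<lambda>i j. \<Sum>k\<in>K. \<Gamma> k i j) w = (\<Sum>k\<in>K. bilinear_entry a b c (\<Gamma> k) w)"
  by (induction K rule: infinite_finite_induct) (auto simp: bilinear_entry_add)

lemma linear_entry_cong:
  "(\<And>i. i \<in> set w \<Longrightarrow> \<beta> i = \<gamma> i) \<Longrightarrow> linear_entry a b \<beta> w = linear_entry a b \<gamma> w"
  by (induction w) auto

lemma bilinear_entry_cong:
  "(\<And>i j. \<lbrakk>i \<in> set w; j \<in> set w\<rbrakk> \<Longrightarrow> \<Gamma> i j = \<Delta> i j) \<Longrightarrow> bilinear_entry a b c \<Gamma> w = bilinear_entry a b c \<Delta> w"
proof (induction w)
  case (Cons x w)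
  then show ?case by (simp add: linear_entry_cong[of w "\<Gamma> x" "\<Delta> x"])
qed simp

lemma word_sum_add: "word_sum p (\<lambda>w. F w + K w) = word_sum p F + word_sum p K"
  by (simp add: word_sum_def distrib_left sum.distrib)

lemma word_sum_scale: "word_sum p (\<lambda>w. c * F w) = c * word_sum p F"
  by (simp add: word_sum_def sum_distrib_left mult.left_commute)

lemma word_sum_scale': "word_sum p (\<lambda>w. F w * c) = word_sum p F * c"
  by (simp add: word_sum_def sum_distrib_right mult.assoc)

lemma word_sum_sum: "word_sum p (\<lambda>w. \<Sum>k\<in>K. F k w) = (\<Sum>k\<in>K. word_sum p (F k))"
  by (simp add: word_sum_def sum_distrib_left sum.swap[of _ _ K])

lemma word_sum_zero [simp]: "word_sum p (\<lambda>_. 0) = 0"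
  by (simp add: word_sum_def)

lemma word_sum_bilinear_add: "word_sum p (bilinear_entry a b c (\<lambda>i j. \<Gamma> i j + \<Delta> i j)) =
    word_sum p (bilinear_entry a b c \<Gamma>) + word_sum p (bilinear_entry a b c \<Delta>)"
  by (simp add: word_sum_def bilinear_entry_add distrib_left sum.distrib)

lemma word_sum_bilinear_scale: "word_sum p (bilinear_entry a b c (\<lambda>i j. d * \<Gamma> i j)) =
    d * word_sum p (bilinear_entry a b c \<Gamma>)"
  by (simp add: word_sum_def bilinear_entry_scale sum_distrib_left mult.left_commute)

lemma word_sum_cong: "(\<And>w. w \<in> Poly_Mapping.keys p \<Longrightarrow> F w = K w) \<Longrightarrow> word_sum p F = word_sum p K"
  by (simp add: word_sum_def)

section \<open>Bilinear entries and tensors of rank one\<close>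

definition letters :: "('x list \<Rightarrow>\<^sub>0 'f :: zero) \<Rightarrow> 'x set" where
  "letters p = (\<Union>w\<in>Poly_Mapping.keys p. set w)"

lemma finite_letters [simp]: "finite (letters p)"
  by (simp add: letters_def)

abbreviation tensor :: "('x \<Rightarrow> 'f :: field) \<Rightarrow> ('x \<Rightarrow> 'f) \<Rightarrow> 'x \<Rightarrow> 'x \<Rightarrow> 'f" where
  "tensor \<beta> \<gamma> \<equiv> (\<lambda>i j. \<beta> i * \<gamma> j)"

definition kronecker :: "'x \<Rightarrow> 'x \<Rightarrow> 'f :: field" where
  "kronecker k i = (if i = k then 1 else 0)"

text \<open>On the letters of \<open>p\<close>, \<Gamma> is the sum of the rank one tensors built
  from its rows, and the entry is linear in \<Gamma>. Only finitely many letters occur in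
  \<open>p\<close>, hence the finite sum.\<close>

lemma word_sum_bilinear_expand:
  "word_sum p (bilinear_entry a b c \<Gamma>) =
    (\<Sum>k\<in>letters p. word_sum p (bilinear_entry a b c (tensor (kronecker k) (\<Gamma> k))))"
proof -
  have "word_sum p (bilinear_entry a b c \<Gamma>) =
      word_sum p (\<lambda>w. \<Sum>k\<in>letters p. bilinear_entry a b c (tensor (kronecker k) (\<Gamma> k)) w)"
  proof (rule word_sum_cong)
    fix w assume w: "w \<in> Poly_Mapping.keys p"
    have "bilinear_entry a b c \<Gamma> w = bilinear_entry a b c (\<lambda>i j. \<Sum>k\<in>letters p. tensor (kronecker k) (\<Gamma> k) i j) w"
    proof (rule bilinear_entry_cong)
      fix i j assume "i \<in> set w" "j \<in> set w"
      then have "i \<in> letters p" using w by (auto simp: letters_def)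
      then show "\<Gamma> i j = (\<Sum>k\<in>letters p. tensor (kronecker k) (\<Gamma> k) i j)"
        by (simp add: kronecker_def if_distrib[of "\<lambda>x. x * _"] cong: if_cong)
    qed
    then show "bilinear_entry a b c \<Gamma> w = (\<Sum>k\<in>letters p. bilinear_entry a b c (tensor (kronecker k) (\<Gamma> k)) w)"
      by (simp add: bilinear_entry_sum)
  qed
  then show ?thesis by (simp add: word_sum_sum)
qed

text \<open>Substituting matrices only produces tensors of rank one, whereas functionals of products
  produce an arbitrary \<Gamma>; this bridges the two.\<close>

lemma word_sum_bilinear_eq_zeroI:
  assumes "\<And>\<beta> \<gamma>. word_sum p (bilinear_entry a b c (tensor \<beta> \<gamma>)) = 0"
  shows "word_sum p (bilinear_entry a b c \<Gamma>) = 0"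
  by (subst word_sum_bilinear_expand) (simp add: assms)

text \<open>Polarisation: the form is expanded at \<beta> + \<gamma>.\<close>

lemma alternating_bilinear:
  assumes "\<And>\<beta>. word_sum p (bilinear_entry a b c (tensor \<beta> \<beta>)) = 0"
  shows "word_sum p (bilinear_entry a b c (tensor \<beta> \<gamma>)) = - word_sum p (bilinear_entry a b c (tensor \<gamma> \<beta>))"
proof -
  let ?S = "\<lambda>\<beta> \<gamma>. word_sum p (bilinear_entry a b c (tensor \<beta> \<gamma>))"
  have "0 = word_sum p (bilinear_entry a b c (tensor (\<lambda>i. \<beta> i + \<gamma> i) (\<lambda>i. \<beta> i + \<gamma> i)))"
    using assms by simp
  also have "tensor (\<lambda>i. \<beta> i + \<gamma> i) (\<lambda>i. \<beta> i + \<gamma> i) =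
      (\<lambda>i j. (tensor \<beta> \<beta> i j + tensor \<beta> \<gamma> i j) + (tensor \<gamma> \<beta> i j + tensor \<gamma> \<gamma> i j))"
    by (intro ext) (simp add: algebra_simps)
  also have "word_sum p (bilinear_entry a b c \<dots>) = (?S \<beta> \<beta> + ?S \<beta> \<gamma>) + (?S \<gamma> \<beta> + ?S \<gamma> \<gamma>)"
    by (simp only: word_sum_bilinear_add)
  finally show ?thesis using assms by (simp add: eq_neg_iff_add_eq_0)
qed

text \<open>Pairing an alternating form with symmetric coefficients \<Gamma> gives a double sum that
  changes sign when its indices are exchanged. It equals its own negative and vanishes in
  characteristic zero. This is why a commutative \<open>J11\<close> contributes nothing.\<close>

lemma word_sum_symmetric_eq_zero:
  fixes p :: "'x list \<Rightarrow>\<^sub>0 'f :: field_char_0"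
  assumes alt: "\<And>\<beta>. word_sum p (bilinear_entry a b c (tensor \<beta> \<beta>)) = 0"
    and sym: "\<And>i j. \<Gamma> i j = \<Gamma> j i"
  shows "word_sum p (bilinear_entry a b c \<Gamma>) = 0"
proof -
  let ?B = "\<lambda>k l. word_sum p (bilinear_entry a b c (tensor (kronecker k) (kronecker l)))"
  have "word_sum p (bilinear_entry a b c (tensor (kronecker k) (\<Gamma> k))) = (\<Sum>l\<in>letters p. \<Gamma> k l * ?B k l)" for k
  proof -
    have "word_sum p (bilinear_entry a b c (tensor (kronecker k) (\<Gamma> k))) =
        - word_sum p (bilinear_entry a b c (tensor (\<Gamma> k) (kronecker k)))"
      by (rule alternating_bilinear[OF alt])
    also have "word_sum p (bilinear_entry a b c (tensor (\<Gamma> k) (kronecker k))) =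
        (\<Sum>l\<in>letters p. word_sum p (bilinear_entry a b c (\<lambda>i j. \<Gamma> k l * tensor (kronecker l) (kronecker k) i j)))"
      by (subst word_sum_bilinear_expand) (simp add: mult.left_commute)
    also have "\<dots> = (\<Sum>l\<in>letters p. \<Gamma> k l * ?B l k)"
      by (intro sum.cong refl word_sum_bilinear_scale)
    also have "- \<dots> = (\<Sum>l\<in>letters p. \<Gamma> k l * ?B k l)"
    proof -
      have "?B l k = - ?B k l" for l by (rule alternating_bilinear[OF alt])
      then show ?thesis by (simp add: sum_negf)
    qed
    finally show ?thesis .
  qed
  then have S: "word_sum p (bilinear_entry a b c \<Gamma>) = (\<Sum>k\<in>letters p. \<Sum>l\<in>letters p. \<Gamma> k l * ?B k l)"
    by (subst word_sum_bilinear_expand) simp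
  also have "\<dots> = (\<Sum>l\<in>letters p. \<Sum>k\<in>letters p. \<Gamma> k l * ?B k l)" by (rule sum.swap)
  also have "\<dots> = (\<Sum>l\<in>letters p. \<Sum>k\<in>letters p. - (\<Gamma> l k * ?B l k))"
  proof (intro sum.cong refl)
    fix k l
    have "?B k l = - ?B l k" by (rule alternating_bilinear[OF alt])
    then show "\<Gamma> k l * ?B k l = - (\<Gamma> l k * ?B l k)" using sym[of k l] by simp
  qed
  also have "\<dots> = - word_sum p (bilinear_entry a b c \<Gamma>)" unfolding S by (simp add: sum_negf)
  finally show ?thesis by simp
qed

subsection \<open>Derivatives of vanishing entries\<close>

text \<open>Replacing a diagonal \<open>a\<close> by \<open>a + t\<beta>\<close> turns an entry into a polynomial in \<open>t\<close>, whose further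
  coefficients are entries with more off-diagonal factors.\<close>

fun diag_poly :: "('x \<Rightarrow> 'f :: field) \<Rightarrow> ('x \<Rightarrow> 'f) \<Rightarrow> 'x list \<Rightarrow> 'f poly" where
  "diag_poly a \<beta> [] = 1"
| "diag_poly a \<beta> (x # w) = [:a x, \<beta> x:] * diag_poly a \<beta> w"

fun left_poly :: "('x \<Rightarrow> 'f :: field) \<Rightarrow> ('x \<Rightarrow> 'f) \<Rightarrow> ('x \<Rightarrow> 'f) \<Rightarrow> ('x \<Rightarrow> 'f) \<Rightarrow> 'x list \<Rightarrow> 'f poly" where
  "left_poly a \<beta> c \<gamma> [] = 0"
| "left_poly a \<beta> c \<gamma> (x # w) = [:a x, \<beta> x:] * left_poly a \<beta> c \<gamma> w + [:\<gamma> x * diag_entry c w:]"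

fun right_poly :: "('x \<Rightarrow> 'f :: field) \<Rightarrow> ('x \<Rightarrow> 'f) \<Rightarrow> ('x \<Rightarrow> 'f) \<Rightarrow> ('x \<Rightarrow> 'f) \<Rightarrow> 'x list \<Rightarrow> 'f poly" where
  "right_poly c a \<beta> \<gamma> [] = 0"
| "right_poly c a \<beta> \<gamma> (x # w) = Polynomial.smult (c x) (right_poly c a \<beta> \<gamma> w) + Polynomial.smult (\<gamma> x) (diag_poly a \<beta> w)"

lemma poly_diag_poly: "poly (diag_poly a \<beta> w) t = diag_entry (\<lambda>x. a x + t * \<beta> x) w"
  by (induction w) (auto simp: algebra_simps)

lemma poly_left_poly: "poly (left_poly a \<beta> c \<gamma> w) t = linear_entry (\<lambda>x. a x + t * \<beta> x) c \<gamma> w"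
  by (induction w) (auto simp: algebra_simps)

lemma poly_right_poly: "poly (right_poly c a \<beta> \<gamma> w) t = linear_entry c (\<lambda>x. a x + t * \<beta> x) \<gamma> w"
  by (induction w) (auto simp: poly_diag_poly)

lemma coeff_diag_poly:
  "coeff (diag_poly a \<beta> w) 0 = diag_entry a w"
  "coeff (diag_poly a \<beta> w) (Suc 0) = linear_entry a a \<beta> w"
  "coeff (diag_poly a \<beta> w) (Suc (Suc 0)) = bilinear_entry a a a (tensor \<beta> \<beta>) w"
  by (induction w) (auto simp: linear_entry_scale)

lemma coeff_left_poly:
  "coeff (left_poly a \<beta> c \<gamma> w) 0 = linear_entry a c \<gamma> w"
  "coeff (left_poly a \<beta> c \<gamma> w) (Suc 0) = bilinear_entry a a c (tensor \<beta> \<gamma>) w"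
  by (induction w) (auto simp: linear_entry_scale)

lemma coeff_right_poly: "coeff (right_poly c a \<beta> \<gamma> w) (Suc 0) = bilinear_entry c a a (tensor \<gamma> \<beta>) w"
  by (induction w) (auto simp: linear_entry_scale coeff_diag_poly)

text \<open>Summed over the words of \<open>p\<close> with their coefficients, the polynomials
  \<open>Q w\<close> form one polynomial in t that vanishes at every point. A field of
  characteristic zero is infinite, so all its coefficients are zero.\<close>

lemma word_sum_coeff_eq_zero:
  fixes p :: "'x list \<Rightarrow>\<^sub>0 'f :: field_char_0"
  assumes "\<And>t. word_sum p (\<lambda>w. poly (Q w) t) = 0"
  shows "word_sum p (\<lambda>w. coeff (Q w) n) = 0"
proof -
  let ?R = "\<Sum>w\<in>Poly_Mapping.keys p. Polynomial.smult (Poly_Mapping.lookup p w) (Q w)"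
  have "poly ?R t = 0" for t using assms by (simp add: word_sum_def poly_sum)
  then have "?R = 0" by (simp add: poly_all_0_iff_0 flip: poly_all_0_iff_0)
  then have "coeff ?R n = 0" by simp
  then show ?thesis by (simp add: word_sum_def coeff_sum)
qed

definition diag_vanish :: "('x list \<Rightarrow>\<^sub>0 'f :: field) \<Rightarrow> bool" where
  "diag_vanish p \<longleftrightarrow> (\<forall>\<alpha>. word_sum p (diag_entry \<alpha>) = 0)"

text \<open>\<open>P\<close> and \<open>Q\<close> stand for 1 or 0 and switch the common diagonal
  \<alpha> on or off, mirroring left and right multiplication by \<open>e\<close> on a Peirce
  corner.\<close>

definition linear_vanish :: "'f \<Rightarrow> 'f \<Rightarrow> ('x list \<Rightarrow>\<^sub>0 'f :: field) \<Rightarrow> bool" where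
  "linear_vanish P Q p \<longleftrightarrow> (\<forall>\<alpha> \<beta>. word_sum p (linear_entry (\<lambda>x. P * \<alpha> x) (\<lambda>x. Q * \<alpha> x) \<beta>) = 0)"

definition bilinear_vanish :: "'f \<Rightarrow> 'f \<Rightarrow> 'f \<Rightarrow> ('x list \<Rightarrow>\<^sub>0 'f :: field) \<Rightarrow> bool" where
  "bilinear_vanish P Q R p \<longleftrightarrow>
     (\<forall>\<alpha> \<Gamma>. word_sum p (bilinear_entry (\<lambda>x. P * \<alpha> x) (\<lambda>x. Q * \<alpha> x) (\<lambda>x. R * \<alpha> x) \<Gamma>) = 0)"

text \<open>These are the coefficients of t and of its square after \<alpha> is replaced by \<alpha>
  + t\<beta>. The second one covers tensors with equal factors: the form attached to
  \<open>J11\<close> becomes alternating, not zero.\<close>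

lemma diag_vanish_linear:
  fixes p :: "'x list \<Rightarrow>\<^sub>0 'f :: field_char_0"
  assumes "diag_vanish p"
  shows "word_sum p (linear_entry \<alpha> \<alpha> \<beta>) = 0" "word_sum p (bilinear_entry \<alpha> \<alpha> \<alpha> (tensor \<beta> \<beta>)) = 0"
proof -
  have "word_sum p (\<lambda>w. poly (diag_poly \<alpha> \<beta> w) t) = 0" for t
    using assms by (simp add: poly_diag_poly diag_vanish_def)
  note coeffs = word_sum_coeff_eq_zero[OF this]
  show "word_sum p (linear_entry \<alpha> \<alpha> \<beta>) = 0"
    using coeffs[of "Suc 0"] by (simp add: coeff_diag_poly)
  show "word_sum p (bilinear_entry \<alpha> \<alpha> \<alpha> (tensor \<beta> \<beta>)) = 0"
    using coeffs[of "Suc (Suc 0)"] by (simp add: coeff_diag_poly)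
qed

text \<open>Differentiating the entry in its left diagonal inserts a factor from \<open>J11\<close>
  in front of the factor from \<open>J10\<close>. Products \<open>J11 J10\<close> are thus
  controlled by \<open>J10\<close> alone.\<close>

lemma linear_vanish_left:
  fixes p :: "'x list \<Rightarrow>\<^sub>0 'f :: field_char_0"
  assumes "linear_vanish 1 0 p"
  shows "bilinear_vanish 1 1 0 p"
  unfolding bilinear_vanish_def
proof (intro allI, rule word_sum_bilinear_eq_zeroI)
  fix \<alpha> \<beta> \<gamma> :: "'x \<Rightarrow> 'f"
  have "word_sum p (linear_entry (\<lambda>x. \<alpha> x + t * \<beta> x) (\<lambda>_. 0) \<gamma>) = 0" for t
    using assms[unfolded linear_vanish_def, rule_format, of "\<lambda>x. \<alpha> x + t * \<beta> x" \<gamma>] by simp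
  then have "word_sum p (\<lambda>w. poly (left_poly \<alpha> \<beta> (\<lambda>_. 0) \<gamma> w) t) = 0" for t
    by (simp add: poly_left_poly)
  from word_sum_coeff_eq_zero[OF this, of "Suc 0"]
  show "word_sum p (bilinear_entry (\<lambda>x. 1 * \<alpha> x) (\<lambda>x. 1 * \<alpha> x) (\<lambda>x. 0 * \<alpha> x) (tensor \<beta> \<gamma>)) = 0"
    by (simp add: coeff_left_poly)
qed

text \<open>The mirror image: the diagonal on the right is varied, which appends a factor from
  \<open>J11\<close> to one from \<open>J01\<close>.\<close>

lemma linear_vanish_right:
  fixes p :: "'x list \<Rightarrow>\<^sub>0 'f :: field_char_0"
  assumes "linear_vanish 0 1 p"
  shows "bilinear_vanish 0 1 1 p"
  unfolding bilinear_vanish_def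
proof (intro allI, rule word_sum_bilinear_eq_zeroI)
  fix \<alpha> \<gamma> \<beta> :: "'x \<Rightarrow> 'f"
  have "word_sum p (linear_entry (\<lambda>_. 0) (\<lambda>x. \<alpha> x + t * \<beta> x) \<gamma>) = 0" for t
    using assms[unfolded linear_vanish_def, rule_format, of "\<lambda>x. \<alpha> x + t * \<beta> x" \<gamma>] by simp
  then have "word_sum p (\<lambda>w. poly (right_poly (\<lambda>_. 0) \<alpha> \<beta> \<gamma> w) t) = 0" for t
    by (simp add: poly_right_poly)
  from word_sum_coeff_eq_zero[OF this, of "Suc 0"]
  show "word_sum p (bilinear_entry (\<lambda>x. 0 * \<alpha> x) (\<lambda>x. 1 * \<alpha> x) (\<lambda>x. 1 * \<alpha> x) (tensor \<gamma> \<beta>)) = 0"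
    by (simp add: coeff_right_poly)
qed

text \<open>The choice \<alpha> = 0 makes all three diagonals zero whatever \<open>P\<close>,
  \<open>Q\<close> and \<open>R\<close> are. What remains reads off the words of length two, which
  is all that products inside \<open>J00\<close> see; one vanishing entry of any type suffices for
  them.\<close>

lemma bilinear_vanish_zero:
  assumes "bilinear_vanish P Q R p"
  shows "word_sum p (bilinear_entry (\<lambda>_. 0) (\<lambda>_. 0) (\<lambda>_. 0) \<Gamma>) = 0"
  using assms[unfolded bilinear_vanish_def, rule_format, of "\<lambda>_. 0" \<Gamma>] by simp

section \<open>Words in an algebra with a Peirce decomposition\<close>

text \<open>The ideal \<open>J\<close> is a parameter that isolates what is used of the radical: its
  cube is zero and \<open>A = Fe + J\<close>. Since \<open>e\<close> lies outside \<open>J\<close>,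
  it is a nonzero idempotent.\<close>

locale peirce_algebra = assoc_algebra A
  for A :: "('f :: field, 'a) module" (structure) +
  fixes e :: 'a and J :: "'a set"
  assumes e_in [simp]: "e \<in> carrier A" and e_idem: "e \<otimes> e = e"
    and J_ideal: "alg_ideal A J" and e_notin: "e \<notin> J"
    and decomp: "\<And>x. x \<in> carrier A \<Longrightarrow> \<exists>c. \<exists>j\<in>J. x = c \<odot> e \<oplus> j"
    and cube: "\<And>x y z. \<lbrakk>x \<in> J; y \<in> J; z \<in> J\<rbrakk> \<Longrightarrow> (x \<otimes> y) \<otimes> z = \<zero>"
begin

lemmas J_subspace = alg_idealD(1)[OF J_ideal]

lemma J_in [simp]: "x \<in> J \<Longrightarrow> x \<in> carrier A"
  using subspaceD(2)[OF J_subspace] .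

definition J11 where "J11 = {a \<in> J. e \<otimes> a = a \<and> a \<otimes> e = a}"
definition J10 where "J10 = {a \<in> J. e \<otimes> a = a \<and> a \<otimes> e = \<zero>}"
definition J01 where "J01 = {a \<in> J. e \<otimes> a = \<zero> \<and> a \<otimes> e = a}"
definition J00 where "J00 = {a \<in> J. e \<otimes> a = \<zero> \<and> a \<otimes> e = \<zero>}"

lemmas corner_defs = J11_def J10_def J01_def J00_def

lemma corner_in:
  "x \<in> J11 \<Longrightarrow> x \<in> carrier A" "x \<in> J10 \<Longrightarrow> x \<in> carrier A"
  "x \<in> J01 \<Longrightarrow> x \<in> carrier A" "x \<in> J00 \<Longrightarrow> x \<in> carrier A"
  by (auto simp: corner_defs)

lemma corner_J:
  "x \<in> J11 \<Longrightarrow> x \<in> J" "x \<in> J10 \<Longrightarrow> x \<in> J" "x \<in> J01 \<Longrightarrow> x \<in> J" "x \<in> J00 \<Longrightarrow> x \<in> J"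
  by (auto simp: corner_defs)

lemma cube': "\<lbrakk>x \<in> J; y \<in> J; z \<in> J\<rbrakk> \<Longrightarrow> x \<otimes> (y \<otimes> z) = \<zero>"
  using cube[of x y z] mult_assoc[of x y z] by simp

lemma peirce_decomposition:
  assumes x: "x \<in> carrier A"
  obtains c u v w z where "u \<in> J11" "v \<in> J10" "w \<in> J01" "z \<in> J00"
    "x = c \<odot> e \<oplus> (u \<oplus> (v \<oplus> (w \<oplus> z)))"
proof -
  obtain c j where j: "j \<in> J" "x = c \<odot> e \<oplus> j" using decomp[OF x] by blast
  note I = alg_idealD(2,3)[OF J_ideal e_in] and S = subspaceD(7)[OF J_subspace]
  have ee: "e \<otimes> (e \<otimes> y) = e \<otimes> y" "(y \<otimes> e) \<otimes> e = y \<otimes> e" if "y \<in> carrier A" for y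
    using mult_assoc[of e e y] mult_assoc[of y e e] e_idem that by simp_all
  \<comment> \<open>These are \<open>eje\<close>, \<open>ej(1 - e)\<close>, \<open>(1 - e)je\<close>
    and \<open>(1 - e)j(1 - e)\<close>, multiplied out because \<open>A\<close> may lack a
    unit.\<close>
  let ?u = "e \<otimes> (j \<otimes> e)" and ?v = "e \<otimes> j \<ominus> e \<otimes> (j \<otimes> e)" and ?w = "j \<otimes> e \<ominus> e \<otimes> (j \<otimes> e)"
  let ?z = "(j \<ominus> e \<otimes> j) \<ominus> (j \<otimes> e \<ominus> e \<otimes> (j \<otimes> e))"
  have J: "e \<otimes> j \<in> J" "j \<otimes> e \<in> J" "?u \<in> J" using I j by auto
  have ue: "(e \<otimes> (j \<otimes> e)) \<otimes> e = e \<otimes> (j \<otimes> e)" "(e \<otimes> j) \<otimes> e = e \<otimes> (j \<otimes> e)"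
    using j ee by (simp_all add: mult_assoc)
  have "?u \<in> J11" using J j ee ue by (simp add: J11_def)
  moreover have "?v \<in> J10" using J j ee ue S by (simp add: J10_def bilinear)
  moreover have "?w \<in> J01" using J j ee ue S by (simp add: J01_def bilinear)
  moreover have "?z \<in> J00" using J j ee ue S by (simp add: J00_def bilinear)
  moreover have "j = ?u \<oplus> (?v \<oplus> (?w \<oplus> ?z))"
  proof -
    have "?w \<oplus> ?z = j \<ominus> e \<otimes> j"
      using j diff_add_cancel[of "j \<ominus> e \<otimes> j" ?w] by (simp add: M.a_comm)
    moreover have "?v \<oplus> (j \<ominus> e \<otimes> j) = j \<ominus> ?u"
      using j by (simp add: group_norm)
    moreover have "?u \<oplus> (j \<ominus> ?u) = j"
      using j diff_add_cancel[of j ?u] by (simp add: M.a_comm)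
    ultimately show ?thesis by simp
  qed
  ultimately show ?thesis using that j(2) by metis
qed

text \<open>Both come from \<open>(xe)y = x(ey)\<close>: the inner Peirce indices of the two factors
  do not match.\<close>

lemma middle_zero:
  assumes "x \<in> carrier A" "y \<in> carrier A"
  shows "\<lbrakk>x \<otimes> e = \<zero>; e \<otimes> y = y\<rbrakk> \<Longrightarrow> x \<otimes> y = \<zero>"
    "\<lbrakk>x \<otimes> e = x; e \<otimes> y = \<zero>\<rbrakk> \<Longrightarrow> x \<otimes> y = \<zero>"
  using mult_assoc[of x e y] assms by simp_all

lemma corner_mult_zero:
  "\<lbrakk>x \<in> J10; y \<in> J11\<rbrakk> \<Longrightarrow> x \<otimes> y = \<zero>" "\<lbrakk>x \<in> J10; y \<in> J10\<rbrakk> \<Longrightarrow> x \<otimes> y = \<zero>"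
  "\<lbrakk>x \<in> J00; y \<in> J11\<rbrakk> \<Longrightarrow> x \<otimes> y = \<zero>" "\<lbrakk>x \<in> J00; y \<in> J10\<rbrakk> \<Longrightarrow> x \<otimes> y = \<zero>"
  "\<lbrakk>x \<in> J11; y \<in> J01\<rbrakk> \<Longrightarrow> x \<otimes> y = \<zero>" "\<lbrakk>x \<in> J01; y \<in> J01\<rbrakk> \<Longrightarrow> x \<otimes> y = \<zero>"
  "\<lbrakk>x \<in> J11; y \<in> J00\<rbrakk> \<Longrightarrow> x \<otimes> y = \<zero>" "\<lbrakk>x \<in> J01; y \<in> J00\<rbrakk> \<Longrightarrow> x \<otimes> y = \<zero>"
  using middle_zero[of x y] by (simp_all add: corner_defs)

lemma corner_e:
  "x \<in> J11 \<Longrightarrow> e \<otimes> x = x" "x \<in> J11 \<Longrightarrow> x \<otimes> e = x"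
  "x \<in> J10 \<Longrightarrow> e \<otimes> x = x" "x \<in> J10 \<Longrightarrow> x \<otimes> e = \<zero>"
  "x \<in> J01 \<Longrightarrow> e \<otimes> x = \<zero>" "x \<in> J01 \<Longrightarrow> x \<otimes> e = x"
  "x \<in> J00 \<Longrightarrow> e \<otimes> x = \<zero>" "x \<in> J00 \<Longrightarrow> x \<otimes> e = \<zero>"
  by (auto simp: corner_defs)

text \<open>Induction on the word with \<psi> arbitrary: the first letter is absorbed into the
  functional that multiplies by \<open>\<phi> x\<close> on the left and then applies \<psi>, and its
  values on the corners reproduce the recursions of the entries. The eight bilinear terms are the
  pairs of corners with matching inner indices; longer products die in the cube of
  \<open>J\<close>.\<close>

lemma functional_word_product:
  assumes \<psi>: "linear_functional A \<psi>"
    and u: "\<And>x. u x \<in> J11" and v: "\<And>x. v x \<in> J10" and w: "\<And>x. w x \<in> J01" and z: "\<And>x. z x \<in> J00"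
    and \<phi>: "\<And>x. \<phi> x = \<alpha> x \<odot> e \<oplus> (u x \<oplus> (v x \<oplus> (w x \<oplus> z x)))" and ws: "ws \<noteq> []"
  shows "\<psi> (word_product A (map \<phi> ws)) = diag_entry \<alpha> ws * \<psi> e
    + linear_entry \<alpha> \<alpha> (\<lambda>x. \<psi> (u x)) ws + linear_entry \<alpha> (\<lambda>_. 0) (\<lambda>x. \<psi> (v x)) ws
    + linear_entry (\<lambda>_. 0) \<alpha> (\<lambda>x. \<psi> (w x)) ws + linear_entry (\<lambda>_. 0) (\<lambda>_. 0) (\<lambda>x. \<psi> (z x)) ws
    + bilinear_entry \<alpha> \<alpha> \<alpha> (\<lambda>x y. \<psi> (u x \<otimes> u y)) ws
    + bilinear_entry \<alpha> \<alpha> (\<lambda>_. 0) (\<lambda>x y. \<psi> (u x \<otimes> v y)) ws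
    + bilinear_entry \<alpha> (\<lambda>_. 0) \<alpha> (\<lambda>x y. \<psi> (v x \<otimes> w y)) ws
    + bilinear_entry \<alpha> (\<lambda>_. 0) (\<lambda>_. 0) (\<lambda>x y. \<psi> (v x \<otimes> z y)) ws
    + bilinear_entry (\<lambda>_. 0) \<alpha> \<alpha> (\<lambda>x y. \<psi> (w x \<otimes> u y)) ws
    + bilinear_entry (\<lambda>_. 0) \<alpha> (\<lambda>_. 0) (\<lambda>x y. \<psi> (w x \<otimes> v y)) ws
    + bilinear_entry (\<lambda>_. 0) (\<lambda>_. 0) \<alpha> (\<lambda>x y. \<psi> (z x \<otimes> w y)) ws
    + bilinear_entry (\<lambda>_. 0) (\<lambda>_. 0) (\<lambda>_. 0) (\<lambda>x y. \<psi> (z x \<otimes> z y)) ws"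
  using \<psi> ws
proof (induction ws arbitrary: \<psi>)
  case (Cons x ws)
  note lf = linear_functionalD[OF Cons.prems(1)]
  note car [simp] = corner_in(1)[OF u] corner_in(2)[OF v] corner_in(3)[OF w] corner_in(4)[OF z]
  have \<phi>x: "\<phi> y \<in> carrier A" for y by (simp add: \<phi>)
  show ?case
  proof (cases "ws = []")
    case True
    then show ?thesis by (simp add: \<phi> lf)
  next
    case False
    let ?\<psi> = "\<lambda>y. \<psi> (\<phi> x \<otimes> y)"
    have lf': "linear_functional A ?\<psi>" by (rule linear_functional_mult_left[OF Cons.prems(1) \<phi>x])
    have expand: "\<phi> x \<otimes> y = \<alpha> x \<odot> (e \<otimes> y) \<oplus> (u x \<otimes> y \<oplus> (v x \<otimes> y \<oplus> (w x \<otimes> y \<oplus> z x \<otimes> y)))"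
      if "y \<in> carrier A" for y
      using that by (simp add: \<phi> bilinear)
    note zero = corner_mult_zero(1)[OF v u] corner_mult_zero(2)[OF v v] corner_mult_zero(3)[OF z u]
      corner_mult_zero(4)[OF z v] corner_mult_zero(5)[OF u w] corner_mult_zero(6)[OF w w]
      corner_mult_zero(7)[OF u z] corner_mult_zero(8)[OF w z]
    note ce = corner_e(1,2)[OF u] corner_e(3,4)[OF v] corner_e(5,6)[OF w] corner_e(7,8)[OF z]
    note inJ = corner_J(1)[OF u] corner_J(2)[OF v] corner_J(3)[OF w] corner_J(4)[OF z]
    \<comment> \<open>A product of two radical elements survives a further factor only through the
      \<open>e\<close> part of the letter, as all other parts lie in \<open>J\<close>.\<close>
    have e3: "?\<psi> (a \<otimes> b) = \<alpha> x * \<psi> (e \<otimes> (a \<otimes> b))" if ab: "a \<in> J" "b \<in> J" for a b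
      using ab inJ by (simp add: expand cube' lf)
    have "?\<psi> e = \<alpha> x * \<psi> e + \<psi> (u x) + \<psi> (w x)"
      by (simp add: expand e_idem ce lf)
    moreover have "?\<psi> (u y) = \<alpha> x * \<psi> (u y) + (\<psi> (u x \<otimes> u y) + \<psi> (w x \<otimes> u y))" for y
      by (simp add: expand ce zero lf)
    moreover have "?\<psi> (v y) = \<alpha> x * \<psi> (v y) + (\<psi> (u x \<otimes> v y) + \<psi> (w x \<otimes> v y))" for y
      by (simp add: expand ce zero lf)
    moreover have "?\<psi> (w y) = \<psi> (v x \<otimes> w y) + \<psi> (z x \<otimes> w y)" for y
      by (simp add: expand ce zero lf)
    moreover have "?\<psi> (z y) = \<psi> (v x \<otimes> z y) + \<psi> (z x \<otimes> z y)" for y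
      by (simp add: expand ce zero lf)
    moreover have "?\<psi> (u y \<otimes> b) = \<alpha> x * \<psi> (u y \<otimes> b)" "?\<psi> (v y \<otimes> b) = \<alpha> x * \<psi> (v y \<otimes> b)"
      "?\<psi> (w y \<otimes> b) = 0" "?\<psi> (z y \<otimes> b) = 0" if "b \<in> J" for y b
      using that e3 inJ by (simp_all add: ce lf flip: mult_assoc)
    ultimately show ?thesis
      using Cons.IH[OF lf' False] False inJ
      by (simp add: word_product_Cons linear_entry_add linear_entry_scale bilinear_entry_scale
          diag_entry_zero algebra_simps)
  qed
qed simp

end

lemma linear_entry_zero_fun [simp]: "linear_entry a b (\<lambda>_. 0) = (\<lambda>_. 0)"
  by (rule ext) simp

lemma bilinear_entry_zero_fun [simp]: "bilinear_entry a b c (\<lambda>_ _. 0) = (\<lambda>_. 0)"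
  by (intro ext) simp

section \<open>Identities of an algebra with a Peirce decomposition\<close>

locale fin_dim_peirce_algebra = peirce_algebra A e J
  for A :: "('f :: field_char_0, 'a) module" (structure) and e J +
  assumes fd: fin_dim
begin

lemma functional_evaluate:
  fixes \<psi> :: "'a \<Rightarrow> 'f" and p :: "nat list \<Rightarrow>\<^sub>0 'f"
  assumes \<psi>: "linear_functional A \<psi>"
    and u: "\<And>x. u x \<in> J11" and v: "\<And>x. v x \<in> J10" and w: "\<And>x. w x \<in> J01" and z: "\<And>x. z x \<in> J00"
    and p: "p \<in> carrier FX"
  shows "\<psi> (evaluate A (\<lambda>x. \<alpha> x \<odot> e \<oplus> (u x \<oplus> (v x \<oplus> (w x \<oplus> z x)))) p) = word_sum p (diag_entry \<alpha>) * \<psi> e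
    + word_sum p (linear_entry \<alpha> \<alpha> (\<lambda>x. \<psi> (u x))) + word_sum p (linear_entry \<alpha> (\<lambda>_. 0) (\<lambda>x. \<psi> (v x)))
    + word_sum p (linear_entry (\<lambda>_. 0) \<alpha> (\<lambda>x. \<psi> (w x))) + word_sum p (linear_entry (\<lambda>_. 0) (\<lambda>_. 0) (\<lambda>x. \<psi> (z x)))
    + word_sum p (bilinear_entry \<alpha> \<alpha> \<alpha> (\<lambda>x y. \<psi> (u x \<otimes> u y)))
    + word_sum p (bilinear_entry \<alpha> \<alpha> (\<lambda>_. 0) (\<lambda>x y. \<psi> (u x \<otimes> v y)))
    + word_sum p (bilinear_entry \<alpha> (\<lambda>_. 0) \<alpha> (\<lambda>x y. \<psi> (v x \<otimes> w y)))
    + word_sum p (bilinear_entry \<alpha> (\<lambda>_. 0) (\<lambda>_. 0) (\<lambda>x y. \<psi> (v x \<otimes> z y)))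
    + word_sum p (bilinear_entry (\<lambda>_. 0) \<alpha> \<alpha> (\<lambda>x y. \<psi> (w x \<otimes> u y)))
    + word_sum p (bilinear_entry (\<lambda>_. 0) \<alpha> (\<lambda>_. 0) (\<lambda>x y. \<psi> (w x \<otimes> v y)))
    + word_sum p (bilinear_entry (\<lambda>_. 0) (\<lambda>_. 0) \<alpha> (\<lambda>x y. \<psi> (z x \<otimes> w y)))
    + word_sum p (bilinear_entry (\<lambda>_. 0) (\<lambda>_. 0) (\<lambda>_. 0) (\<lambda>x y. \<psi> (z x \<otimes> z y)))"
proof -
  let ?\<phi> = "\<lambda>x. \<alpha> x \<odot> e \<oplus> (u x \<oplus> (v x \<oplus> (w x \<oplus> z x)))"
  have \<phi>: "?\<phi> x \<in> carrier A" for x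
    using corner_in(1)[OF u] corner_in(2)[OF v] corner_in(3)[OF w] corner_in(4)[OF z] by simp
  have "\<psi> (evaluate A ?\<phi> p) = word_sum p (\<lambda>ws. \<psi> (word_product A (map ?\<phi> ws)))"
    unfolding word_sum_def by (rule linear_functional_evaluate[OF \<phi> \<psi>])
  moreover have "ws \<noteq> []" if "ws \<in> Poly_Mapping.keys p" for ws using that p by auto
  note word_sum_cong[of p, OF functional_word_product[of \<psi> u v w z ?\<phi> \<alpha>, OF \<psi> u v w z refl this]]
  ultimately show ?thesis by (simp only: word_sum_add word_sum_scale')
qed

lemma zero_corner: "\<zero> \<in> J11" "\<zero> \<in> J10" "\<zero> \<in> J01" "\<zero> \<in> J00"
  using subspaceD(3)[OF J_subspace] by (auto simp: corner_defs)

lemma bilinear_cases: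
  assumes "bilinear_vanish P Q R p \<or> (\<forall>x y. \<Gamma> x y = 0)"
  shows "word_sum p (bilinear_entry (\<lambda>x. P * \<alpha> x) (\<lambda>x. Q * \<alpha> x) (\<lambda>x. R * \<alpha> x) \<Gamma>) = 0"
proof -
  have "\<Gamma> = (\<lambda>_ _. 0)" if "\<forall>x y. \<Gamma> x y = 0" using that by blast
  then show ?thesis using assms by (auto simp: bilinear_vanish_def)
qed

lemma linear_cases:
  assumes "linear_vanish P Q p \<or> (\<forall>x. \<beta> x = 0)"
  shows "word_sum p (linear_entry (\<lambda>x. P * \<alpha> x) (\<lambda>x. Q * \<alpha> x) \<beta>) = 0"
proof -
  have "\<beta> = (\<lambda>_. 0)" if "\<forall>x. \<beta> x = 0" using that by blast
  then show ?thesis using assms by (auto simp: linear_vanish_def)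
qed

text \<open>By \<open>functional_evaluate\<close> a value is a sum of entries, and each is zero for
  a reason of its own. Products from \<open>J11 J10\<close> and \<open>J01 J11\<close> follow from
  \<open>l10\<close> and \<open>l01\<close>. The condition \<open>b000\<close> speaks of values of
  functionals because in one use it comes from a vanishing entry and in the other from an identity
  of \<open>J\<close>.\<close>

lemma identity_criterion:
  fixes p :: "nat list \<Rightarrow>\<^sub>0 'f"
  assumes p: "p \<in> carrier FX" and diag: "diag_vanish p"
    and l10: "J10 = {\<zero>} \<or> linear_vanish 1 0 p" and l01: "J01 = {\<zero>} \<or> linear_vanish 0 1 p"
    and b111: "(\<forall>x\<in>J11. \<forall>y\<in>J11. x \<otimes> y = y \<otimes> x) \<or> bilinear_vanish 1 1 1 p"
    and b100: "(\<forall>x\<in>J10. \<forall>y\<in>J00. x \<otimes> y = \<zero>) \<or> bilinear_vanish 1 0 0 p"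
    and b001: "(\<forall>x\<in>J00. \<forall>y\<in>J01. x \<otimes> y = \<zero>) \<or> bilinear_vanish 0 0 1 p"
    and b010: "(\<forall>x\<in>J01. \<forall>y\<in>J10. x \<otimes> y = \<zero>) \<or> bilinear_vanish 0 1 0 p"
    and b101: "(\<forall>x\<in>J10. \<forall>y\<in>J01. x \<otimes> y = \<zero>) \<or> bilinear_vanish 1 0 1 p"
    and b000: "\<And>\<psi> z. \<lbrakk>linear_functional A \<psi>; \<And>x. z x \<in> J00\<rbrakk> \<Longrightarrow>
      word_sum p (bilinear_entry (\<lambda>_. 0) (\<lambda>_. 0) (\<lambda>_. 0) (\<lambda>x y. \<psi> (z x \<otimes> z y))) = 0"
  shows "p \<in> identities A"
proof -
  have "evaluate A \<phi> p = \<zero>" if \<phi>: "\<And>n. \<phi> n \<in> carrier A" for \<phi>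
  proof (rule eq_if_functionals_agree[OF fd evaluate_closed[OF \<phi>] M.zero_closed])
    fix \<psi> :: "'a \<Rightarrow> 'f" assume \<psi>: "linear_functional A \<psi>"
    note lf = linear_functionalD[OF \<psi>]
    have "\<forall>n. \<exists>c u v w z. u \<in> J11 \<and> v \<in> J10 \<and> w \<in> J01 \<and> z \<in> J00 \<and> \<phi> n = c \<odot> e \<oplus> (u \<oplus> (v \<oplus> (w \<oplus> z)))"
      using peirce_decomposition[OF \<phi>] by metis
    then obtain \<alpha> u v w z where c: "\<And>n. u n \<in> J11" "\<And>n. v n \<in> J10" "\<And>n. w n \<in> J01" "\<And>n. z n \<in> J00"
      and eq: "\<And>n. \<phi> n = \<alpha> n \<odot> e \<oplus> (u n \<oplus> (v n \<oplus> (w n \<oplus> z n)))" by metis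
    have "word_sum p (diag_entry \<alpha>) = 0" using diag by (simp add: diag_vanish_def)
    moreover have "word_sum p (linear_entry \<alpha> \<alpha> \<beta>) = 0" for \<beta> by (rule diag_vanish_linear[OF diag])
    moreover have "word_sum p (linear_entry \<alpha> (\<lambda>_. 0) (\<lambda>x. \<psi> (v x))) = 0"
    proof -
      have "linear_vanish 1 0 p \<or> (\<forall>x. \<psi> (v x) = 0)" using l10 c(2) lf(3) by (metis singletonD)
      from linear_cases[OF this] show ?thesis by simp
    qed
    moreover have "word_sum p (linear_entry (\<lambda>_. 0) \<alpha> (\<lambda>x. \<psi> (w x))) = 0"
    proof -
      have "linear_vanish 0 1 p \<or> (\<forall>x. \<psi> (w x) = 0)" using l01 c(3) lf(3) by (metis singletonD)
      from linear_cases[OF this] show ?thesis by simp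
    qed
    moreover have "word_sum p (linear_entry (\<lambda>_. 0) (\<lambda>_. 0) (\<lambda>x. \<psi> (z x))) = 0"
      by (rule diag_vanish_linear[OF diag])
    moreover have "word_sum p (bilinear_entry \<alpha> \<alpha> \<alpha> (\<lambda>x y. \<psi> (u x \<otimes> u y))) = 0"
      using b111
    proof
      assume "\<forall>x\<in>J11. \<forall>y\<in>J11. x \<otimes> y = y \<otimes> x"
      then show ?thesis
        by (intro word_sum_symmetric_eq_zero[OF diag_vanish_linear(2)[OF diag]])
          (simp add: c(1))
    next
      assume "bilinear_vanish 1 1 1 p"
      then show ?thesis using bilinear_cases[of 1 1 1 p _ \<alpha>] by simp
    qed
    moreover have "word_sum p (bilinear_entry \<alpha> \<alpha> (\<lambda>_. 0) (\<lambda>x y. \<psi> (u x \<otimes> v y))) = 0"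
    proof -
      have "bilinear_vanish 1 1 0 p \<or> (\<forall>x y. \<psi> (u x \<otimes> v y) = 0)"
        using l10
      proof
        assume "J10 = {\<zero>}" then have "v y = \<zero>" for y using c(2) by blast
        then show ?thesis using corner_in(1)[OF c(1)] lf(3) by simp
      qed (simp add: linear_vanish_left)
      from bilinear_cases[OF this] show ?thesis by simp
    qed
    moreover have "word_sum p (bilinear_entry (\<lambda>_. 0) \<alpha> \<alpha> (\<lambda>x y. \<psi> (w x \<otimes> u y))) = 0"
    proof -
      have "bilinear_vanish 0 1 1 p \<or> (\<forall>x y. \<psi> (w x \<otimes> u y) = 0)"
        using l01
      proof
        assume "J01 = {\<zero>}" then have "w y = \<zero>" for y using c(3) by blast
        then show ?thesis using corner_in(1)[OF c(1)] lf(3) by simp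
      qed (simp add: linear_vanish_right)
      from bilinear_cases[OF this] show ?thesis by simp
    qed
    moreover have "word_sum p (bilinear_entry \<alpha> (\<lambda>_. 0) (\<lambda>_. 0) (\<lambda>x y. \<psi> (v x \<otimes> z y))) = 0"
    proof -
      have "bilinear_vanish 1 0 0 p \<or> (\<forall>x y. \<psi> (v x \<otimes> z y) = 0)" using b100 c lf(3) by auto
      from bilinear_cases[OF this] show ?thesis by simp
    qed
    moreover have "word_sum p (bilinear_entry \<alpha> (\<lambda>_. 0) \<alpha> (\<lambda>x y. \<psi> (v x \<otimes> w y))) = 0"
    proof -
      have "bilinear_vanish 1 0 1 p \<or> (\<forall>x y. \<psi> (v x \<otimes> w y) = 0)" using b101 c lf(3) by auto
      from bilinear_cases[OF this] show ?thesis by simp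
    qed
    moreover have "word_sum p (bilinear_entry (\<lambda>_. 0) \<alpha> (\<lambda>_. 0) (\<lambda>x y. \<psi> (w x \<otimes> v y))) = 0"
    proof -
      have "bilinear_vanish 0 1 0 p \<or> (\<forall>x y. \<psi> (w x \<otimes> v y) = 0)" using b010 c lf(3) by auto
      from bilinear_cases[OF this] show ?thesis by simp
    qed
    moreover have "word_sum p (bilinear_entry (\<lambda>_. 0) (\<lambda>_. 0) \<alpha> (\<lambda>x y. \<psi> (z x \<otimes> w y))) = 0"
    proof -
      have "bilinear_vanish 0 0 1 p \<or> (\<forall>x y. \<psi> (z x \<otimes> w y) = 0)" using b001 c lf(3) by auto
      from bilinear_cases[OF this] show ?thesis by simp
    qed
    moreover have "word_sum p (bilinear_entry (\<lambda>_. 0) (\<lambda>_. 0) (\<lambda>_. 0) (\<lambda>x y. \<psi> (z x \<otimes> z y))) = 0"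
      by (rule b000[OF \<psi> c(4)])
    moreover have "\<phi> = (\<lambda>n. \<alpha> n \<odot> e \<oplus> (u n \<oplus> (v n \<oplus> (w n \<oplus> z n))))" using eq by blast
    ultimately show "\<psi> (evaluate A \<phi> p) = \<psi> \<zero>"
      using functional_evaluate[of \<psi> u v w z p \<alpha>, OF \<psi> c p] lf(3) by simp
  qed
  then show ?thesis using p by (simp add: identities_iff del: free_algebra_simps)
qed

section \<open>What an identity of the algebra forces on the entries\<close>

lemma scale_corner:
  "x \<in> J11 \<Longrightarrow> c \<odot> x \<in> J11" "x \<in> J10 \<Longrightarrow> c \<odot> x \<in> J10"
  "x \<in> J01 \<Longrightarrow> c \<odot> x \<in> J01" "x \<in> J00 \<Longrightarrow> c \<odot> x \<in> J00"
  using subspaceD(5)[OF J_subspace] by (auto simp: corner_defs bilinear)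

context
  fixes p :: "nat list \<Rightarrow>\<^sub>0 'f" and \<psi> :: "'a \<Rightarrow> 'f"
  assumes p: "p \<in> carrier FX" and \<psi>: "linear_functional A \<psi>"
begin

lemma functional_evaluate_diag:
  "\<psi> (evaluate A (\<lambda>x. \<alpha> x \<odot> e) p) = word_sum p (diag_entry \<alpha>) * \<psi> e"
proof -
  note z = zero_corner
  show ?thesis
    using functional_evaluate[OF \<psi> z p, of \<alpha>] linear_functionalD[OF \<psi>] by simp
qed

lemma functional_evaluate_10:
  assumes v: "v \<in> J10"
  shows "\<psi> (evaluate A (\<lambda>x. \<alpha> x \<odot> e \<oplus> \<beta> x \<odot> v) p) =
    word_sum p (diag_entry \<alpha>) * \<psi> e + \<psi> v * word_sum p (linear_entry \<alpha> (\<lambda>_. 0) \<beta>)"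
  using functional_evaluate[OF \<psi> zero_corner(1) scale_corner(2)[OF v] zero_corner(3,4) p, of \<alpha> \<beta>]
    corner_in(2)[OF v] linear_functionalD[OF \<psi>]
  by (simp add: linear_entry_scale'[abs_def] word_sum_scale)

lemma functional_evaluate_01:
  assumes w: "w \<in> J01"
  shows "\<psi> (evaluate A (\<lambda>x. \<alpha> x \<odot> e \<oplus> \<beta> x \<odot> w) p) =
    word_sum p (diag_entry \<alpha>) * \<psi> e + \<psi> w * word_sum p (linear_entry (\<lambda>_. 0) \<alpha> \<beta>)"
  using functional_evaluate[OF \<psi> zero_corner(1,2) scale_corner(3)[OF w] zero_corner(4) p, of \<alpha> \<beta>]
    corner_in(3)[OF w] linear_functionalD[OF \<psi>]
  by (simp add: linear_entry_scale'[abs_def] word_sum_scale)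

end

lemma identity_diag_vanish:
  assumes p: "p \<in> identities A" shows "diag_vanish p"
  unfolding diag_vanish_def
proof
  fix \<alpha> :: "nat \<Rightarrow> 'f"
  have pF: "p \<in> carrier FX" using p by (simp add: identities_iff)
  have "e \<noteq> \<zero>" using e_notin subspaceD(3)[OF J_subspace] by auto
  then obtain \<psi> where \<psi>: "linear_functional A \<psi>" "\<psi> e = 1" using functionals_separate[OF fd] e_in by blast
  show "word_sum p (diag_entry \<alpha>) = 0"
    using functional_evaluate_diag[OF pF \<psi>(1), of \<alpha>] identitiesD[OF p, of "\<lambda>x. \<alpha> x \<odot> e"]
      linear_functionalD(3)[OF \<psi>(1)] \<psi>(2) by simp
qed

lemma identity_linear_vanish_10:
  assumes p: "p \<in> identities A" and v: "v \<in> J10" "v \<noteq> \<zero>" shows "linear_vanish 1 0 p"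
  unfolding linear_vanish_def
proof (intro allI)
  fix \<alpha> \<beta> :: "nat \<Rightarrow> 'f"
  have pF: "p \<in> carrier FX" using p by (simp add: identities_iff)
  obtain \<psi> where \<psi>: "linear_functional A \<psi>" "\<psi> v = 1" using functionals_separate[OF fd] corner_in(2) v by blast
  show "word_sum p (linear_entry (\<lambda>x. 1 * \<alpha> x) (\<lambda>x. 0 * \<alpha> x) \<beta>) = 0"
    using functional_evaluate_10[OF pF \<psi>(1) v(1), of \<alpha> \<beta>] identitiesD[OF p, of "\<lambda>x. \<alpha> x \<odot> e \<oplus> \<beta> x \<odot> v"]
      linear_functionalD(3)[OF \<psi>(1)] \<psi>(2) corner_in(2)[OF v(1)] identity_diag_vanish[OF p]
    by (simp add: diag_vanish_def)
qed

lemma identity_linear_vanish_01: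
  assumes p: "p \<in> identities A" and w: "w \<in> J01" "w \<noteq> \<zero>" shows "linear_vanish 0 1 p"
  unfolding linear_vanish_def
proof (intro allI)
  fix \<alpha> \<beta> :: "nat \<Rightarrow> 'f"
  have pF: "p \<in> carrier FX" using p by (simp add: identities_iff)
  obtain \<psi> where \<psi>: "linear_functional A \<psi>" "\<psi> w = 1" using functionals_separate[OF fd] corner_in(3) w by blast
  show "word_sum p (linear_entry (\<lambda>x. 0 * \<alpha> x) (\<lambda>x. 1 * \<alpha> x) \<beta>) = 0"
    using functional_evaluate_01[OF pF \<psi>(1) w(1), of \<alpha> \<beta>] identitiesD[OF p, of "\<lambda>x. \<alpha> x \<odot> e \<oplus> \<beta> x \<odot> w"]
      linear_functionalD(3)[OF \<psi>(1)] \<psi>(2) corner_in(3)[OF w(1)] identity_diag_vanish[OF p]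
    by (simp add: diag_vanish_def)
qed

text \<open>In each of the following cases the functional is chosen to kill the corners containing the
  other products of the two elements involved.\<close>

lemma identity_bilinear_vanish:
  assumes p: "p \<in> identities A" and \<psi>: "linear_functional A \<psi>"
    and u: "\<And>x. u x \<in> J11" and v: "\<And>x. v x \<in> J10" and w: "\<And>x. w x \<in> J01" and z: "\<And>x. z x \<in> J00"
  shows "word_sum p (bilinear_entry \<alpha> \<alpha> \<alpha> (\<lambda>x y. \<psi> (u x \<otimes> u y)))
    + word_sum p (bilinear_entry \<alpha> (\<lambda>_. 0) \<alpha> (\<lambda>x y. \<psi> (v x \<otimes> w y)))
    + word_sum p (bilinear_entry \<alpha> (\<lambda>_. 0) (\<lambda>_. 0) (\<lambda>x y. \<psi> (v x \<otimes> z y)))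
    + word_sum p (bilinear_entry (\<lambda>_. 0) \<alpha> (\<lambda>_. 0) (\<lambda>x y. \<psi> (w x \<otimes> v y)))
    + word_sum p (bilinear_entry (\<lambda>_. 0) (\<lambda>_. 0) \<alpha> (\<lambda>x y. \<psi> (z x \<otimes> w y)))
    + word_sum p (bilinear_entry (\<lambda>_. 0) (\<lambda>_. 0) (\<lambda>_. 0) (\<lambda>x y. \<psi> (z x \<otimes> z y))) = 0"
proof -
  have pF: "p \<in> carrier FX" using p by (simp add: identities_iff)
  note diag = identity_diag_vanish[OF p]
  note car = corner_in(1)[OF u] corner_in(2)[OF v] corner_in(3)[OF w] corner_in(4)[OF z]
  have l10: "linear_vanish 1 0 p \<or> (\<forall>x. v x = \<zero>)" using identity_linear_vanish_10[OF p v] by blast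
  have l01: "linear_vanish 0 1 p \<or> (\<forall>x. w x = \<zero>)" using identity_linear_vanish_01[OF p w] by blast
  have "linear_vanish 1 0 p \<or> (\<forall>x. \<psi> (v x) = 0)" using l10 linear_functionalD(3)[OF \<psi>] by auto
  from linear_cases[OF this] have "word_sum p (linear_entry \<alpha> (\<lambda>_. 0) (\<lambda>x. \<psi> (v x))) = 0" by simp
  moreover have "linear_vanish 0 1 p \<or> (\<forall>x. \<psi> (w x) = 0)" using l01 linear_functionalD(3)[OF \<psi>] by auto
  from linear_cases[OF this] have "word_sum p (linear_entry (\<lambda>_. 0) \<alpha> (\<lambda>x. \<psi> (w x))) = 0" by simp
  moreover have "bilinear_vanish 1 1 0 p \<or> (\<forall>x y. \<psi> (u x \<otimes> v y) = 0)"
    using l10 linear_functionalD(3)[OF \<psi>] linear_vanish_left car by auto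
  from bilinear_cases[OF this] have "word_sum p (bilinear_entry \<alpha> \<alpha> (\<lambda>_. 0) (\<lambda>x y. \<psi> (u x \<otimes> v y))) = 0" by simp
  moreover have "bilinear_vanish 0 1 1 p \<or> (\<forall>x y. \<psi> (w x \<otimes> u y) = 0)"
    using l01 linear_functionalD(3)[OF \<psi>] linear_vanish_right car by auto
  from bilinear_cases[OF this] have "word_sum p (bilinear_entry (\<lambda>_. 0) \<alpha> \<alpha> (\<lambda>x y. \<psi> (w x \<otimes> u y))) = 0" by simp
  moreover have "evaluate A (\<lambda>x. \<alpha> x \<odot> e \<oplus> (u x \<oplus> (v x \<oplus> (w x \<oplus> z x)))) p = \<zero>"
    using car by (intro identitiesD[OF p]) simp
  ultimately show ?thesis
    using functional_evaluate[of \<psi> u v w z p \<alpha>, OF \<psi> u v w z pF] diag diag_vanish_linear(1)[OF diag]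
      linear_functionalD(3)[OF \<psi>]
    by (simp add: diag_vanish_def)
qed

lemma identity_bilinear_vanish_100:
  assumes p: "p \<in> identities A" and v: "v \<in> J10" and z: "z \<in> J00" and ne: "v \<otimes> z \<noteq> \<zero>"
  shows "bilinear_vanish 1 0 0 p"
  unfolding bilinear_vanish_def
proof (intro allI, rule word_sum_bilinear_eq_zeroI)
  fix \<alpha> \<beta> \<gamma> :: "nat \<Rightarrow> 'f"
  note c = corner_in(2)[OF v] corner_in(4)[OF z]
  obtain \<psi>' where \<psi>': "linear_functional A \<psi>'" "\<psi>' (v \<otimes> z) = 1" using functionals_separate[OF fd] c ne by blast
  \<comment> \<open>\<open>vz\<close> lies in \<open>J10\<close> and \<open>zz\<close> in
    \<open>J00\<close>; multiplying by \<open>e\<close> on the left fixes the former and kills the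
    latter.\<close>
  let ?\<psi> = "\<lambda>x. \<psi>' (e \<otimes> x)"
  have psi0: "linear_functional A ?\<psi>" by (rule linear_functional_mult_left[OF \<psi>'(1) e_in])
  have psi1: "?\<psi> (v \<otimes> z) = 1" using \<psi>' c corner_e(3)[OF v] mult_assoc[of e v z] by simp
  have psi2: "?\<psi> (z \<otimes> z) = 0"
    using c corner_e(7)[OF z] mult_assoc[of e z z] linear_functionalD(3)[OF \<psi>'(1)] by simp
  obtain \<psi> where \<psi>: "linear_functional A \<psi>" "\<psi> (v \<otimes> z) = 1" "\<psi> (z \<otimes> z) = 0"
    by (rule that[OF psi0 psi1 psi2])
  show "word_sum p (bilinear_entry (\<lambda>x. 1 * \<alpha> x) (\<lambda>x. 0 * \<alpha> x) (\<lambda>x. 0 * \<alpha> x) (tensor \<beta> \<gamma>)) = 0"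
    using identity_bilinear_vanish[OF p \<psi>(1) zero_corner(1) scale_corner(2)[OF v] zero_corner(3) scale_corner(4)[OF z],
        of \<alpha> \<beta> \<gamma>] c \<psi>(2,3) linear_functionalD[OF \<psi>(1)]
    by (simp add: bilinear mult.commute)
qed

lemma identity_bilinear_vanish_001:
  assumes p: "p \<in> identities A" and z: "z \<in> J00" and w: "w \<in> J01" and ne: "z \<otimes> w \<noteq> \<zero>"
  shows "bilinear_vanish 0 0 1 p"
  unfolding bilinear_vanish_def
proof (intro allI, rule word_sum_bilinear_eq_zeroI)
  fix \<alpha> \<beta> \<gamma> :: "nat \<Rightarrow> 'f"
  note c = corner_in(3)[OF w] corner_in(4)[OF z]
  obtain \<psi>' where \<psi>': "linear_functional A \<psi>'" "\<psi>' (z \<otimes> w) = 1" using functionals_separate[OF fd] c ne by blast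
  let ?\<psi> = "\<lambda>x. \<psi>' (x \<otimes> e)"
  have psi0: "linear_functional A ?\<psi>" by (rule linear_functional_mult_right[OF \<psi>'(1) e_in])
  have psi1: "?\<psi> (z \<otimes> w) = 1" using \<psi>' c corner_e(6)[OF w] mult_assoc[of z w e] by simp
  have psi2: "?\<psi> (z \<otimes> z) = 0"
    using c corner_e(8)[OF z] mult_assoc[of z z e] linear_functionalD(3)[OF \<psi>'(1)] by simp
  obtain \<psi> where \<psi>: "linear_functional A \<psi>" "\<psi> (z \<otimes> w) = 1" "\<psi> (z \<otimes> z) = 0"
    by (rule that[OF psi0 psi1 psi2])
  show "word_sum p (bilinear_entry (\<lambda>x. 0 * \<alpha> x) (\<lambda>x. 0 * \<alpha> x) (\<lambda>x. 1 * \<alpha> x) (tensor \<beta> \<gamma>)) = 0"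
    using identity_bilinear_vanish[OF p \<psi>(1) zero_corner(1,2) scale_corner(3)[OF w] scale_corner(4)[OF z],
        of \<alpha> \<gamma> \<beta>] c \<psi>(2,3) linear_functionalD[OF \<psi>(1)]
    by (simp add: bilinear mult.commute)
qed

lemma identity_bilinear_vanish_101:
  assumes p: "p \<in> identities A" and v: "v \<in> J10" and w: "w \<in> J01" and ne: "v \<otimes> w \<noteq> \<zero>"
  shows "bilinear_vanish 1 0 1 p"
  unfolding bilinear_vanish_def
proof (intro allI, rule word_sum_bilinear_eq_zeroI)
  fix \<alpha> \<beta> \<gamma> :: "nat \<Rightarrow> 'f"
  note c = corner_in(2)[OF v] corner_in(3)[OF w]
  obtain \<psi>' where \<psi>': "linear_functional A \<psi>'" "\<psi>' (v \<otimes> w) = 1" using functionals_separate[OF fd] c ne by blast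
  let ?\<psi> = "\<lambda>x. \<psi>' (e \<otimes> x)"
  have psi0: "linear_functional A ?\<psi>" by (rule linear_functional_mult_left[OF \<psi>'(1) e_in])
  have psi1: "?\<psi> (v \<otimes> w) = 1" using \<psi>' c corner_e(3)[OF v] mult_assoc[of e v w] by simp
  have psi2: "?\<psi> (w \<otimes> v) = 0"
    using c corner_e(5)[OF w] mult_assoc[of e w v] linear_functionalD(3)[OF \<psi>'(1)] by simp
  obtain \<psi> where \<psi>: "linear_functional A \<psi>" "\<psi> (v \<otimes> w) = 1" "\<psi> (w \<otimes> v) = 0"
    by (rule that[OF psi0 psi1 psi2])
  show "word_sum p (bilinear_entry (\<lambda>x. 1 * \<alpha> x) (\<lambda>x. 0 * \<alpha> x) (\<lambda>x. 1 * \<alpha> x) (tensor \<beta> \<gamma>)) = 0"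
    using identity_bilinear_vanish[OF p \<psi>(1) zero_corner(1) scale_corner(2)[OF v] scale_corner(3)[OF w] zero_corner(4),
        of \<alpha> \<beta> \<gamma>] c \<psi>(2,3) linear_functionalD[OF \<psi>(1)]
    by (simp add: bilinear mult.commute)
qed

lemma identity_bilinear_vanish_010:
  assumes p: "p \<in> identities A" and w: "w \<in> J01" and v: "v \<in> J10" and ne: "w \<otimes> v \<noteq> \<zero>"
  shows "bilinear_vanish 0 1 0 p"
  unfolding bilinear_vanish_def
proof (intro allI, rule word_sum_bilinear_eq_zeroI)
  fix \<alpha> \<beta> \<gamma> :: "nat \<Rightarrow> 'f"
  note c = corner_in(2)[OF v] corner_in(3)[OF w]
  obtain \<psi>' where \<psi>': "linear_functional A \<psi>'" "\<psi>' (w \<otimes> v) = 1" using functionals_separate[OF fd] c ne by blast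
  \<comment> \<open>\<open>vw\<close> lies in \<open>J11\<close> and \<open>wv\<close> in
    \<open>J00\<close>, so this time the projection \<open>1 - e\<close> keeps \<open>wv\<close> and
    discards \<open>vw\<close>.\<close>
  let ?\<psi> = "\<lambda>x. \<psi>' x - \<psi>' (e \<otimes> x)"
  have psi0: "linear_functional A ?\<psi>"
    by (rule linear_functional_diff[OF \<psi>'(1) linear_functional_mult_left[OF \<psi>'(1) e_in]])
  have psi1: "?\<psi> (w \<otimes> v) = 1"
    using \<psi>' c corner_e(5)[OF w] mult_assoc[of e w v] linear_functionalD(3)[OF \<psi>'(1)] by simp
  have psi2: "?\<psi> (v \<otimes> w) = 0" using c corner_e(3)[OF v] mult_assoc[of e v w] by simp
  obtain \<psi> where \<psi>: "linear_functional A \<psi>" "\<psi> (w \<otimes> v) = 1" "\<psi> (v \<otimes> w) = 0"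
    by (rule that[OF psi0 psi1 psi2])
  show "word_sum p (bilinear_entry (\<lambda>x. 0 * \<alpha> x) (\<lambda>x. 1 * \<alpha> x) (\<lambda>x. 0 * \<alpha> x) (tensor \<beta> \<gamma>)) = 0"
    using identity_bilinear_vanish[OF p \<psi>(1) zero_corner(1) scale_corner(2)[OF v] scale_corner(3)[OF w] zero_corner(4),
        of \<alpha> \<gamma> \<beta>] c \<psi>(2,3) linear_functionalD[OF \<psi>(1)]
    by (simp add: bilinear mult.commute)
qed

lemma J11_add: "\<lbrakk>x \<in> J11; y \<in> J11\<rbrakk> \<Longrightarrow> x \<oplus> y \<in> J11"
  using subspaceD(4)[OF J_subspace] by (auto simp: J11_def bilinear)

text \<open>Here both products lie in \<open>J11\<close> and no projection separates them. Instead
  \<psi> takes the value 1 on the commutator. At \<beta>\<open>u\<close> + \<gamma>\<open>u'\<close>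
  the square terms vanish by alternation, and the mixed ones combine to this value times the
  entry.\<close>

lemma identity_bilinear_vanish_111:
  assumes p: "p \<in> identities A" and u: "u \<in> J11" and u': "u' \<in> J11" and ne: "u \<otimes> u' \<noteq> u' \<otimes> u"
  shows "bilinear_vanish 1 1 1 p"
  unfolding bilinear_vanish_def
proof (intro allI, rule word_sum_bilinear_eq_zeroI)
  fix \<alpha> \<beta> \<gamma> :: "nat \<Rightarrow> 'f"
  note c = corner_in(1)[OF u] corner_in(1)[OF u']
  note alt = diag_vanish_linear(2)[OF identity_diag_vanish[OF p]]
  have ne': "u \<otimes> u' \<ominus> u' \<otimes> u \<noteq> \<zero>" using ne c by (simp add: diff_eq_zero_iff)
  have "u \<otimes> u' \<ominus> u' \<otimes> u \<in> carrier A" using c by simp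
  then obtain \<psi> where \<psi>: "linear_functional A \<psi>" "\<psi> (u \<otimes> u' \<ominus> u' \<otimes> u) = 1"
    by (rule functionals_separate[OF fd _ ne'])
  note lf = linear_functionalD[OF \<psi>(1)]
  have d: "\<psi> (u \<otimes> u') - \<psi> (u' \<otimes> u) = 1" using \<psi>(2) lf c by simp
  let ?S = "\<lambda>\<Gamma>. word_sum p (bilinear_entry \<alpha> \<alpha> \<alpha> \<Gamma>)"
  have "?S (\<lambda>x y. \<psi> ((\<beta> x \<odot> u \<oplus> \<gamma> x \<odot> u') \<otimes> (\<beta> y \<odot> u \<oplus> \<gamma> y \<odot> u'))) = 0"
    using identity_bilinear_vanish[OF p \<psi>(1) J11_add[OF scale_corner(1)[OF u] scale_corner(1)[OF u']]
        zero_corner(2,3,4), of \<alpha> \<beta> \<gamma>] lf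
    by simp
  also have "(\<lambda>x y. \<psi> ((\<beta> x \<odot> u \<oplus> \<gamma> x \<odot> u') \<otimes> (\<beta> y \<odot> u \<oplus> \<gamma> y \<odot> u'))) =
    (\<lambda>x y. (\<psi> (u \<otimes> u) * tensor \<beta> \<beta> x y + \<psi> (u \<otimes> u') * tensor \<beta> \<gamma> x y)
      + (\<psi> (u' \<otimes> u) * tensor \<gamma> \<beta> x y + \<psi> (u' \<otimes> u') * tensor \<gamma> \<gamma> x y))"
    using c by (intro ext) (simp add: bilinear lf smult_add algebra_simps)
  also have "?S \<dots> = \<psi> (u \<otimes> u') * ?S (tensor \<beta> \<gamma>) + \<psi> (u' \<otimes> u) * ?S (tensor \<gamma> \<beta>)"
    by (simp only: word_sum_bilinear_add word_sum_bilinear_scale alt) simp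
  also have "?S (tensor \<gamma> \<beta>) = - ?S (tensor \<beta> \<gamma>)" by (rule alternating_bilinear[OF alt])
  finally have "(\<psi> (u \<otimes> u') - \<psi> (u' \<otimes> u)) * ?S (tensor \<beta> \<gamma>) = 0" by (simp add: algebra_simps)
  then show "word_sum p (bilinear_entry (\<lambda>x. 1 * \<alpha> x) (\<lambda>x. 1 * \<alpha> x) (\<lambda>x. 1 * \<alpha> x) (tensor \<beta> \<gamma>)) = 0"
    using d by simp
qed

end

section \<open>Identities of the model algebras\<close>

lemma module_mat_assoc_algebra: "assoc_algebra (module_mat TYPE('f :: field) n n)"
proof -
  interpret vectorspace class_ring "module_mat TYPE('f) n n" by (rule matrix_vs)
  show ?thesis
    by unfold_locales
      (auto simp: module_mat_simps assoc_mult_mat[of _ n n _ n _ n] add_mult_distrib_mat[of _ n n _ _ n]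
        mult_add_distrib_mat[of _ n n _ n _] mult_smult_assoc_mat[of _ n n _ n] mult_smult_distrib[of _ n n _ n])
qed

definition upper3 :: "'f \<Rightarrow> 'f \<Rightarrow> 'f \<Rightarrow> 'f \<Rightarrow> 'f \<Rightarrow> 'f \<Rightarrow> 'f :: field mat" where
  "upper3 a b c \<beta> \<gamma> \<delta> = mat 3 3 (\<lambda>(i, j).
     if i = j then (if i = 0 then a else if i = 1 then b else c)
     else if i = 0 \<and> j = 1 then \<beta> else if i = 1 \<and> j = 2 then \<gamma> else if i = 0 \<and> j = 2 then \<delta> else 0)"

definition upper2 :: "'f \<Rightarrow> 'f \<Rightarrow> 'f \<Rightarrow> 'f :: field mat" where
  "upper2 a b \<beta> = mat 2 2 (\<lambda>(i, j).
     if i = j then (if i = 0 then a else b) else if i = 0 \<and> j = 1 then \<beta> else 0)"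

lemma idem_mult:
  assumes "P * P = (P :: 'f :: field)" shows "P * a * (P * b) = P * (a * b)"
proof -
  have "P * a * (P * b) = (P * P) * (a * b)" by (simp add: algebra_simps)
  then show ?thesis by (simp only: assms)
qed

lemma less3_cases: "i < (3 :: nat) \<longleftrightarrow> i = 0 \<or> i = 1 \<or> i = 2" by auto
lemma less2_cases: "i < (2 :: nat) \<longleftrightarrow> i = 0 \<or> i = 1" by auto
lemma sum_less3: "(\<Sum>i = 0..<3::nat. f i) = f 0 + f 1 + (f 2 :: 'f :: field)"
  by (simp add: numeral_3_eq_3 numeral_2_eq_2)
lemma sum_less2: "(\<Sum>i = 0..<2::nat. f i) = f 0 + (f 1 :: 'f :: field)"
  by (simp add: numeral_2_eq_2)

lemma upper3_carrier [simp]: "upper3 a b c \<beta> \<gamma> \<delta> \<in> carrier_mat 3 3"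
  by (simp add: upper3_def)

lemma upper2_carrier [simp]: "upper2 a b \<beta> \<in> carrier_mat 2 2"
  by (simp add: upper2_def)

lemma upper3_add: "upper3 a b c \<beta> \<gamma> \<delta> + upper3 a' b' c' \<beta>' \<gamma>' \<delta>' =
    upper3 (a + a') (b + b') (c + c') (\<beta> + \<beta>') (\<gamma> + \<gamma>') (\<delta> + \<delta>')"
  by (rule eq_matI) (auto simp: upper3_def)

lemma upper3_smult: "k \<cdot>\<^sub>m upper3 a b c \<beta> \<gamma> \<delta> = upper3 (k * a) (k * b) (k * c) (k * \<beta>) (k * \<gamma>) (k * \<delta>)"
  by (rule eq_matI) (auto simp: upper3_def)

lemma upper3_mult: "upper3 a b c \<beta> \<gamma> \<delta> * upper3 a' b' c' \<beta>' \<gamma>' \<delta>' =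
    upper3 (a * a') (b * b') (c * c') (a * \<beta>' + \<beta> * b') (b * \<gamma>' + \<gamma> * c') (a * \<delta>' + \<beta> * \<gamma>' + \<delta> * c')"
  by (rule eq_matI) (auto simp: upper3_def scalar_prod_def sum_less3 less3_cases)

lemma upper2_add: "upper2 a b \<beta> + upper2 a' b' \<beta>' = upper2 (a + a') (b + b') (\<beta> + \<beta>')"
  by (rule eq_matI) (auto simp: upper2_def)

lemma upper2_smult: "k \<cdot>\<^sub>m upper2 a b \<beta> = upper2 (k * a) (k * b) (k * \<beta>)"
  by (rule eq_matI) (auto simp: upper2_def)

lemma upper2_mult: "upper2 a b \<beta> * upper2 a' b' \<beta>' = upper2 (a * a') (b * b') (a * \<beta>' + \<beta> * b')"
  by (rule eq_matI) (auto simp: upper2_def scalar_prod_def sum_less2 less2_cases)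

lemma upper3_zero: "0\<^sub>m 3 3 = upper3 0 0 0 0 0 0"
  by (rule eq_matI) (auto simp: upper3_def)

lemma upper2_zero: "0\<^sub>m 2 2 = upper2 0 0 0"
  by (rule eq_matI) (auto simp: upper2_def)

lemma upper3_inject: "upper3 a b c \<beta> \<gamma> \<delta> = upper3 a' b' c' \<beta>' \<gamma>' \<delta>' \<longleftrightarrow>
    a = a' \<and> b = b' \<and> c = c' \<and> \<beta> = \<beta>' \<and> \<gamma> = \<gamma>' \<and> \<delta> = \<delta>'"
proof
  assume eq: "upper3 a b c \<beta> \<gamma> \<delta> = upper3 a' b' c' \<beta>' \<gamma>' \<delta>'"
  have "upper3 a b c \<beta> \<gamma> \<delta> $$ (i, j) = upper3 a' b' c' \<beta>' \<gamma>' \<delta>' $$ (i, j)" for i j by (simp add: eq)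
  from this[of 0 0] this[of 1 1] this[of 2 2] this[of 0 1] this[of 1 2] this[of 0 2]
  show "a = a' \<and> b = b' \<and> c = c' \<and> \<beta> = \<beta>' \<and> \<gamma> = \<gamma>' \<and> \<delta> = \<delta>'" by (simp add: upper3_def)
qed simp

lemma upper2_inject: "upper2 a b \<beta> = upper2 a' b' \<beta>' \<longleftrightarrow> a = a' \<and> b = b' \<and> \<beta> = \<beta>'"
proof
  assume eq: "upper2 a b \<beta> = upper2 a' b' \<beta>'"
  have "upper2 a b \<beta> $$ (i, j) = upper2 a' b' \<beta>' $$ (i, j)" for i j by (simp add: eq)
  from this[of 0 0] this[of 1 1] this[of 0 1] show "a = a' \<and> b = b' \<and> \<beta> = \<beta>'" by (simp add: upper2_def)
qed simp

text \<open>A common form of the five 3 x 3 models, with the diagonal of the semisimple generator as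
  parameter. Each argument about them is carried out once, for idempotent \<open>P\<close>,
  \<open>Q\<close> and \<open>R\<close>.\<close>

definition model3 :: "'f \<Rightarrow> 'f \<Rightarrow> 'f \<Rightarrow> ('f :: field, 'f mat) module" where
  "model3 P Q R = matrix_subalgebra 3
     {upper3 P Q R 0 0 0, upper3 0 0 0 1 0 0, upper3 0 0 0 0 0 1, upper3 0 0 0 0 1 0}"

definition model2 :: "'f \<Rightarrow> 'f \<Rightarrow> ('f :: field, 'f mat) module" where
  "model2 P Q = matrix_subalgebra 2 {upper2 P Q 0, upper2 0 0 1}"

lemma E3_upper3:
  "E3 1 1 = upper3 1 0 0 0 0 0" "E3 2 2 = upper3 0 1 0 0 0 0" "E3 3 3 = upper3 0 0 1 0 0 0"
  "E3 1 2 = upper3 0 0 0 1 0 0" "E3 2 3 = upper3 0 0 0 0 1 0" "E3 1 3 = upper3 0 0 0 0 0 1"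
  by (rule eq_matI; auto simp: upper3_def matrix_unit_def)+

lemma E2_upper2: "E2 1 1 = upper2 1 0 0" "E2 2 2 = upper2 0 1 0" "E2 1 2 = upper2 0 0 1"
  by (rule eq_matI; auto simp: upper2_def matrix_unit_def)+

lemma models:
  "A1 = model2 1 0" "A1_star = model2 0 1" "A2 = model3 1 1 1" "A4 = model3 1 0 0"
  "A4_star = model3 0 0 1" "A5 = model3 0 1 0" "A6 = model3 1 0 1"
  unfolding A1_def A1_star_def A2_def A4_def A4_star_def A5_def A6_def model2_def model3_def
    E3_upper3 E2_upper2 upper3_add
  by simp_all

lemma matrix_subalgebra_simps [simp]:
  "carrier (matrix_subalgebra n B) = fspan (module_mat TYPE('f :: field) n n) B"
  "mult (matrix_subalgebra n B) = ((*) :: 'f mat \<Rightarrow> _)"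
  "zero (matrix_subalgebra n B) = (0\<^sub>m n n :: 'f mat)"
  "add (matrix_subalgebra n B) = ((+) :: 'f mat \<Rightarrow> _)"
  "smult (matrix_subalgebra n B) = ((\<cdot>\<^sub>m) :: 'f \<Rightarrow> _)"
  by (simp_all add: matrix_subalgebra_def module_mat_simps)

lemma model3_carrier: "carrier (model3 P Q R) = {upper3 (P * a) (Q * a) (R * a) \<beta> \<gamma> \<delta> | a \<beta> \<gamma> \<delta>. True}"
    (is "_ = ?M")
proof -
  interpret assoc_algebra "module_mat TYPE('a) 3 3" by (rule module_mat_assoc_algebra)
  let ?B = "{upper3 P Q R 0 0 0, upper3 0 0 0 1 0 0, upper3 0 0 0 0 0 1, upper3 0 0 0 0 1 0}"
  have B: "?B \<subseteq> carrier (module_mat TYPE('a) 3 3)" by (auto simp: module_mat_simps)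
  note S = subspaceD[OF fspan_subspace[OF B], unfolded module_mat_simps]
  show ?thesis
  proof (intro equalityI subsetI)
    have "subspace class_ring ?M (module_mat TYPE('a) 3 3)"
    proof (rule subspaceI)
      show "\<zero>\<^bsub>module_mat TYPE('a) 3 3\<^esub> \<in> ?M"
        by (auto simp: module_mat_simps upper3_zero upper3_inject intro!: exI[of _ 0])
    next
      fix x y assume "x \<in> ?M" "y \<in> ?M"
      then obtain a \<beta> \<gamma> \<delta> a' \<beta>' \<gamma>' \<delta>' where "x = upper3 (P * a) (Q * a) (R * a) \<beta> \<gamma> \<delta>"
        "y = upper3 (P * a') (Q * a') (R * a') \<beta>' \<gamma>' \<delta>'" by blast
      then have "x + y = upper3 (P * (a + a')) (Q * (a + a')) (R * (a + a')) (\<beta> + \<beta>') (\<gamma> + \<gamma>') (\<delta> + \<delta>')"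
        by (simp add: upper3_add distrib_left)
      then show "x \<oplus>\<^bsub>module_mat TYPE('a) 3 3\<^esub> y \<in> ?M" unfolding module_mat_simps by blast
    next
      fix c x assume "x \<in> ?M"
      then obtain a \<beta> \<gamma> \<delta> where "x = upper3 (P * a) (Q * a) (R * a) \<beta> \<gamma> \<delta>" by blast
      then have "c \<cdot>\<^sub>m x = upper3 (P * (c * a)) (Q * (c * a)) (R * (c * a)) (c * \<beta>) (c * \<gamma>) (c * \<delta>)"
        by (simp add: upper3_smult mult.left_commute)
      then show "c \<odot>\<^bsub>module_mat TYPE('a) 3 3\<^esub> x \<in> ?M" unfolding module_mat_simps by blast
    qed (auto simp: module_mat_simps)
    moreover have "?B \<subseteq> ?M"
      by (auto simp: upper3_inject intro: exI[of _ 1] exI[of _ 0])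
    ultimately have "fspan (module_mat TYPE('a) 3 3) ?B \<subseteq> ?M" by (rule fspan_minimal)
    then show "x \<in> ?M" if "x \<in> carrier (model3 P Q R)" for x using that by (auto simp: model3_def)
  next
    fix x assume "x \<in> ?M"
    then obtain a \<beta> \<gamma> \<delta> where x: "x = upper3 (P * a) (Q * a) (R * a) \<beta> \<gamma> \<delta>" by blast
    have b: "y \<in> fspan (module_mat TYPE('a) 3 3) ?B" if "y \<in> ?B" for y using fspan_base[OF B that] .
    have "a \<cdot>\<^sub>m upper3 P Q R 0 0 0 + (\<beta> \<cdot>\<^sub>m upper3 0 0 0 1 0 0 + (\<delta> \<cdot>\<^sub>m upper3 0 0 0 0 0 1 + \<gamma> \<cdot>\<^sub>m upper3 0 0 0 0 1 0))
      \<in> fspan (module_mat TYPE('a) 3 3) ?B"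
      by (intro S(4) S(5) b) simp_all
    also have "a \<cdot>\<^sub>m upper3 P Q R 0 0 0 + (\<beta> \<cdot>\<^sub>m upper3 0 0 0 1 0 0 + (\<delta> \<cdot>\<^sub>m upper3 0 0 0 0 0 1 + \<gamma> \<cdot>\<^sub>m upper3 0 0 0 0 1 0)) = x"
      by (simp add: x upper3_smult upper3_add mult.commute)
    finally show "x \<in> carrier (model3 P Q R)" by (simp add: model3_def)
  qed
qed

lemma model2_carrier: "carrier (model2 P Q) = {upper2 (P * a) (Q * a) \<beta> | a \<beta>. True}"
    (is "_ = ?M")
proof -
  interpret assoc_algebra "module_mat TYPE('a) 2 2" by (rule module_mat_assoc_algebra)
  let ?B = "{upper2 P Q 0, upper2 0 0 1}"
  have B: "?B \<subseteq> carrier (module_mat TYPE('a) 2 2)" by (auto simp: module_mat_simps)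
  note S = subspaceD[OF fspan_subspace[OF B], unfolded module_mat_simps]
  show ?thesis
  proof (intro equalityI subsetI)
    have "subspace class_ring ?M (module_mat TYPE('a) 2 2)"
    proof (rule subspaceI)
      show "\<zero>\<^bsub>module_mat TYPE('a) 2 2\<^esub> \<in> ?M"
        by (auto simp: module_mat_simps upper2_zero upper2_inject intro!: exI[of _ 0])
    next
      fix x y assume "x \<in> ?M" "y \<in> ?M"
      then obtain a \<beta> a' \<beta>' where "x = upper2 (P * a) (Q * a) \<beta>" "y = upper2 (P * a') (Q * a') \<beta>'" by blast
      then have "x + y = upper2 (P * (a + a')) (Q * (a + a')) (\<beta> + \<beta>')"
        by (simp add: upper2_add distrib_left)
      then show "x \<oplus>\<^bsub>module_mat TYPE('a) 2 2\<^esub> y \<in> ?M" unfolding module_mat_simps by blast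
    next
      fix c x assume "x \<in> ?M"
      then obtain a \<beta> where "x = upper2 (P * a) (Q * a) \<beta>" by blast
      then have "c \<cdot>\<^sub>m x = upper2 (P * (c * a)) (Q * (c * a)) (c * \<beta>)"
        by (simp add: upper2_smult mult.left_commute)
      then show "c \<odot>\<^bsub>module_mat TYPE('a) 2 2\<^esub> x \<in> ?M" unfolding module_mat_simps by blast
    qed (auto simp: module_mat_simps)
    moreover have "?B \<subseteq> ?M"
      by (auto simp: upper2_inject intro: exI[of _ 1] exI[of _ 0])
    ultimately have "fspan (module_mat TYPE('a) 2 2) ?B \<subseteq> ?M" by (rule fspan_minimal)
    then show "x \<in> ?M" if "x \<in> carrier (model2 P Q)" for x using that by (auto simp: model2_def)
  next
    fix x assume "x \<in> ?M"
    then obtain a \<beta> where x: "x = upper2 (P * a) (Q * a) \<beta>" by blast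
    have b: "y \<in> fspan (module_mat TYPE('a) 2 2) ?B" if "y \<in> ?B" for y using fspan_base[OF B that] .
    have "a \<cdot>\<^sub>m upper2 P Q 0 + \<beta> \<cdot>\<^sub>m upper2 0 0 1 \<in> fspan (module_mat TYPE('a) 2 2) ?B"
      by (intro S(4) S(5) b) simp_all
    also have "a \<cdot>\<^sub>m upper2 P Q 0 + \<beta> \<cdot>\<^sub>m upper2 0 0 1 = x"
      by (simp add: x upper2_smult upper2_add mult.commute)
    finally show "x \<in> carrier (model2 P Q)" by (simp add: model2_def)
  qed
qed

lemma matrix_subalgebra_assoc:
  assumes "B \<subseteq> carrier_mat n n"
    and "\<And>x y. \<lbrakk>x \<in> fspan (module_mat TYPE('f :: field) n n) B; y \<in> fspan (module_mat TYPE('f) n n) B\<rbrakk>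
      \<Longrightarrow> x * y \<in> fspan (module_mat TYPE('f) n n) B"
  shows "assoc_algebra (matrix_subalgebra n B :: ('f, 'f mat) module)"
proof -
  interpret assoc_algebra "module_mat TYPE('f) n n" by (rule module_mat_assoc_algebra)
  show ?thesis unfolding matrix_subalgebra_def
    using assms by (intro subalgebra fspan_subspace) (auto simp: module_mat_simps)
qed

lemma model3_simps:
  "mult (model3 P Q R) = ((*) :: 'f :: field mat \<Rightarrow> _)" "zero (model3 P Q R) = (0\<^sub>m 3 3 :: 'f mat)"
  "add (model3 P Q R) = ((+) :: 'f mat \<Rightarrow> _)" "smult (model3 P Q R) = ((\<cdot>\<^sub>m) :: 'f \<Rightarrow> _)"
  by (simp_all add: model3_def)

lemma model2_simps:
  "mult (model2 P Q) = ((*) :: 'f :: field mat \<Rightarrow> _)" "zero (model2 P Q) = (0\<^sub>m 2 2 :: 'f mat)"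
  "add (model2 P Q) = ((+) :: 'f mat \<Rightarrow> _)" "smult (model2 P Q) = ((\<cdot>\<^sub>m) :: 'f \<Rightarrow> _)"
  by (simp_all add: model2_def)

lemma model3_assoc:
  assumes "P * P = P" "Q * Q = Q" "R * R = R"
  shows "assoc_algebra (model3 P Q R)"
proof -
  have "x * y \<in> carrier (model3 P Q R)" if xy: "x \<in> carrier (model3 P Q R)" "y \<in> carrier (model3 P Q R)" for x y
  proof -
    obtain a \<beta> \<gamma> \<delta> a' \<beta>' \<gamma>' \<delta>' where "x = upper3 (P * a) (Q * a) (R * a) \<beta> \<gamma> \<delta>"
      "y = upper3 (P * a') (Q * a') (R * a') \<beta>' \<gamma>' \<delta>'" using xy unfolding model3_carrier by blast
    then have "x * y = upper3 (P * a * (P * a')) (Q * a * (Q * a')) (R * a * (R * a'))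
      (P * a * \<beta>' + \<beta> * (Q * a')) (Q * a * \<gamma>' + \<gamma> * (R * a')) (P * a * \<delta>' + \<beta> * \<gamma>' + \<delta> * (R * a'))"
      by (simp only: upper3_mult)
    also have "P * a * (P * a') = P * (a * a')"
      by (rule idem_mult[OF assms(1)])
    also have "Q * a * (Q * a') = Q * (a * a')"
      by (rule idem_mult[OF assms(2)])
    also have "R * a * (R * a') = R * (a * a')"
      by (rule idem_mult[OF assms(3)])
    finally show ?thesis unfolding model3_carrier by blast
  qed
  then show ?thesis unfolding model3_def by (intro matrix_subalgebra_assoc) auto
qed

lemma model2_assoc:
  assumes "P * P = P" "Q * Q = Q"
  shows "assoc_algebra (model2 P Q)"
proof -
  have "x * y \<in> carrier (model2 P Q)" if xy: "x \<in> carrier (model2 P Q)" "y \<in> carrier (model2 P Q)" for x y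
  proof -
    obtain a \<beta> a' \<beta>' where "x = upper2 (P * a) (Q * a) \<beta>" "y = upper2 (P * a') (Q * a') \<beta>'"
      using xy unfolding model2_carrier by blast
    then have "x * y = upper2 (P * a * (P * a')) (Q * a * (Q * a')) (P * a * \<beta>' + \<beta> * (Q * a'))"
      by (simp only: upper2_mult)
    also have "P * a * (P * a') = P * (a * a')"
      by (rule idem_mult[OF assms(1)])
    also have "Q * a * (Q * a') = Q * (a * a')"
      by (rule idem_mult[OF assms(2)])
    finally show ?thesis unfolding model2_carrier by blast
  qed
  then show ?thesis unfolding model2_def by (intro matrix_subalgebra_assoc) auto
qed

text \<open>Multiplication by the matrix of the first letter reproduces the recursions of the
  entries. The empty word is excluded since its \<open>word_product\<close> is zero while its
  \<open>diag_entry\<close> is 1. The corner entry has in addition a linear part, carried by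
  \<delta>.\<close>

lemma model3_word_product:
  "w \<noteq> [] \<Longrightarrow> word_product (model3 P Q R) (map (\<lambda>x. upper3 (a x) (b x) (c x) (\<beta> x) (\<gamma> x) (\<delta> x)) w) =
    upper3 (diag_entry a w) (diag_entry b w) (diag_entry c w) (linear_entry a b \<beta> w) (linear_entry b c \<gamma> w)
      (bilinear_entry a b c (tensor \<beta> \<gamma>) w + linear_entry a c \<delta> w)"
proof (induction w)
  case (Cons x w)
  show ?case
  proof (cases "w = []")
    case False
    then obtain y ys where "w = y # ys" by (cases w) auto
    then have "word_product (model3 P Q R) (map (\<lambda>x. upper3 (a x) (b x) (c x) (\<beta> x) (\<gamma> x) (\<delta> x)) (x # w)) =
        upper3 (a x) (b x) (c x) (\<beta> x) (\<gamma> x) (\<delta> x) *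
        word_product (model3 P Q R) (map (\<lambda>x. upper3 (a x) (b x) (c x) (\<beta> x) (\<gamma> x) (\<delta> x)) w)"
      by (simp add: model3_simps)
    then show ?thesis
      unfolding Cons.IH[OF False] by (simp add: upper3_mult linear_entry_scale upper3_inject algebra_simps)
  qed simp
qed simp

lemma model2_word_product:
  "w \<noteq> [] \<Longrightarrow> word_product (model2 P Q) (map (\<lambda>x. upper2 (a x) (b x) (\<beta> x)) w) =
    upper2 (diag_entry a w) (diag_entry b w) (linear_entry a b \<beta> w)"
proof (induction w)
  case (Cons x w)
  show ?case
  proof (cases "w = []")
    case False
    then obtain y ys where "w = y # ys" by (cases w) auto
    then have "word_product (model2 P Q) (map (\<lambda>x. upper2 (a x) (b x) (\<beta> x)) (x # w)) =
        upper2 (a x) (b x) (\<beta> x) * word_product (model2 P Q) (map (\<lambda>x. upper2 (a x) (b x) (\<beta> x)) w)"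
      by (simp add: model2_simps)
    then show ?thesis
      unfolding Cons.IH[OF False] by (simp add: upper2_mult upper2_inject algebra_simps)
  qed simp
qed simp

lemma diag_vanish_scaled:
  "diag_vanish p \<Longrightarrow> word_sum p (diag_entry (\<lambda>x. P * \<alpha> x)) = 0"
  by (simp add: diag_vanish_def)

context
  fixes p :: "nat list \<Rightarrow>\<^sub>0 'f :: field"
  assumes p: "p \<in> carrier FX"
begin

lemma words_nonempty: "w \<in> Poly_Mapping.keys p \<Longrightarrow> w \<noteq> []"
  using p by auto

lemma model3_evaluate:
  assumes "P * P = P" "Q * Q = Q" "R * R = R"
  shows "evaluate (model3 P Q R) (\<lambda>x. upper3 (P * \<alpha> x) (Q * \<alpha> x) (R * \<alpha> x) (\<beta> x) (\<gamma> x) (\<delta> x)) p =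
    (let a = \<lambda>x. P * \<alpha> x; b = \<lambda>x. Q * \<alpha> x; c = \<lambda>x. R * \<alpha> x in
      upper3 (word_sum p (diag_entry a)) (word_sum p (diag_entry b)) (word_sum p (diag_entry c))
        (word_sum p (linear_entry a b \<beta>)) (word_sum p (linear_entry b c \<gamma>))
        (word_sum p (bilinear_entry a b c (tensor \<beta> \<gamma>)) + word_sum p (linear_entry a c \<delta>)))"
proof -
  interpret assoc_algebra "model3 P Q R" by (rule model3_assoc[OF assms])
  let ?a = "\<lambda>x. P * \<alpha> x" and ?b = "\<lambda>x. Q * \<alpha> x" and ?c = "\<lambda>x. R * \<alpha> x"
  let ?\<phi> = "\<lambda>x. upper3 (?a x) (?b x) (?c x) (\<beta> x) (\<gamma> x) (\<delta> x)"
  have \<phi>: "?\<phi> x \<in> carrier (model3 P Q R)" for x by (auto simp: model3_carrier)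
  \<comment> \<open>Reading off a matrix entry is a linear functional, so it passes to the sum over
    words.\<close>
  have entries: "evaluate (model3 P Q R) ?\<phi> p $$ (i, j) =
      word_sum p (\<lambda>w. word_product (model3 P Q R) (map ?\<phi> w) $$ (i, j))" if "i < 3" "j < 3" for i j
    unfolding word_sum_def
  proof (rule linear_functional_evaluate[OF \<phi>])
    show "linear_functional (model3 P Q R) (\<lambda>X. X $$ (i, j))"
      using that by (auto simp: linear_functional_def model3_carrier model3_simps upper3_def)
  qed
  have entries': "evaluate (model3 P Q R) ?\<phi> p $$ (i, j) = word_sum p (\<lambda>w.
      upper3 (diag_entry ?a w) (diag_entry ?b w) (diag_entry ?c w) (linear_entry ?a ?b \<beta> w) (linear_entry ?b ?c \<gamma> w)
      (bilinear_entry ?a ?b ?c (tensor \<beta> \<gamma>) w + linear_entry ?a ?c \<delta> w) $$ (i, j))" if "i < 3" "j < 3" for i j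
    unfolding entries[OF that] by (rule word_sum_cong) (simp add: model3_word_product words_nonempty)
  have "evaluate (model3 P Q R) ?\<phi> p \<in> carrier (model3 P Q R)" by (rule evaluate_closed[OF \<phi>])
  then have dims: "evaluate (model3 P Q R) ?\<phi> p \<in> carrier_mat 3 3" by (auto simp: model3_carrier)
  let ?M = "upper3 (word_sum p (diag_entry ?a)) (word_sum p (diag_entry ?b)) (word_sum p (diag_entry ?c))
    (word_sum p (linear_entry ?a ?b \<beta>)) (word_sum p (linear_entry ?b ?c \<gamma>))
    (word_sum p (bilinear_entry ?a ?b ?c (tensor \<beta> \<gamma>)) + word_sum p (linear_entry ?a ?c \<delta>))"
  show ?thesis unfolding Let_def
  proof (rule eq_matI)
    fix i j assume "i < dim_row ?M" "j < dim_col ?M"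
    then have ij: "i < 3" "j < 3" by (simp_all add: upper3_def)
    show "evaluate (model3 P Q R) ?\<phi> p $$ (i, j) = ?M $$ (i, j)"
      unfolding entries'[OF ij] using ij by (auto simp: upper3_def less3_cases word_sum_add)
  qed (use dims in \<open>auto simp: upper3_def\<close>)
qed

lemma model2_evaluate:
  assumes "P * P = P" "Q * Q = Q"
  shows "evaluate (model2 P Q) (\<lambda>x. upper2 (P * \<alpha> x) (Q * \<alpha> x) (\<beta> x)) p =
      upper2 (word_sum p (diag_entry (\<lambda>x. P * \<alpha> x))) (word_sum p (diag_entry (\<lambda>x. Q * \<alpha> x)))
        (word_sum p (linear_entry (\<lambda>x. P * \<alpha> x) (\<lambda>x. Q * \<alpha> x) \<beta>))"
    (is "_ = ?M")
proof -
  interpret assoc_algebra "model2 P Q" by (rule model2_assoc[OF assms])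
  let ?a = "\<lambda>x. P * \<alpha> x" and ?b = "\<lambda>x. Q * \<alpha> x"
  let ?\<phi> = "\<lambda>x. upper2 (?a x) (?b x) (\<beta> x)"
  have \<phi>: "?\<phi> x \<in> carrier (model2 P Q)" for x by (auto simp: model2_carrier)
  have entries: "evaluate (model2 P Q) ?\<phi> p $$ (i, j) =
      word_sum p (\<lambda>w. word_product (model2 P Q) (map ?\<phi> w) $$ (i, j))" if "i < 2" "j < 2" for i j
    unfolding word_sum_def
  proof (rule linear_functional_evaluate[OF \<phi>])
    show "linear_functional (model2 P Q) (\<lambda>X. X $$ (i, j))"
      using that by (auto simp: linear_functional_def model2_carrier model2_simps upper2_def)
  qed
  have entries': "evaluate (model2 P Q) ?\<phi> p $$ (i, j) = word_sum p (\<lambda>w.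
      upper2 (diag_entry ?a w) (diag_entry ?b w) (linear_entry ?a ?b \<beta> w) $$ (i, j))" if "i < 2" "j < 2" for i j
    unfolding entries[OF that] by (rule word_sum_cong) (simp add: model2_word_product words_nonempty)
  have "evaluate (model2 P Q) ?\<phi> p \<in> carrier (model2 P Q)" by (rule evaluate_closed[OF \<phi>])
  then have dims: "evaluate (model2 P Q) ?\<phi> p \<in> carrier_mat 2 2" by (auto simp: model2_carrier)
  show ?thesis
  proof (rule eq_matI)
    fix i j assume "i < dim_row ?M" "j < dim_col ?M"
    then have ij: "i < 2" "j < 2" by (simp_all add: upper2_def)
    show "evaluate (model2 P Q) ?\<phi> p $$ (i, j) = ?M $$ (i, j)"
      unfolding entries'[OF ij] using ij by (auto simp: upper2_def less2_cases)
  qed (use dims in \<open>auto simp: upper2_def\<close>)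
qed

text \<open>The condition \<open>one\<close> makes the diagonal \<alpha> visible in some entry. In
  the corner, the linear and the bilinear part are separated by putting \<beta> = \<gamma> = 0 and
  then \<delta> = 0.\<close>

lemma model3_identity_iff:
  assumes idem: "P * P = P" "Q * Q = Q" "R * R = R" and one: "P = 1 \<or> Q = 1 \<or> R = 1"
  shows "p \<in> identities (model3 P Q R) \<longleftrightarrow> diag_vanish p \<and> linear_vanish P Q p \<and> linear_vanish Q R p \<and>
    linear_vanish P R p \<and> bilinear_vanish P Q R p"
proof -
  note ev = model3_evaluate[OF idem, unfolded Let_def]
  have "p \<in> identities (model3 P Q R) \<longleftrightarrow> (\<forall>\<alpha> \<beta> \<gamma> \<delta>.
      evaluate (model3 P Q R) (\<lambda>x. upper3 (P * \<alpha> x) (Q * \<alpha> x) (R * \<alpha> x) (\<beta> x) (\<gamma> x) (\<delta> x)) p = 0\<^sub>m 3 3)"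
  proof
    assume r: "\<forall>\<alpha> \<beta> \<gamma> \<delta>. evaluate (model3 P Q R) (\<lambda>x. upper3 (P * \<alpha> x) (Q * \<alpha> x) (R * \<alpha> x) (\<beta> x) (\<gamma> x) (\<delta> x)) p = 0\<^sub>m 3 3"
    have "evaluate (model3 P Q R) \<phi> p = 0\<^sub>m 3 3" if "\<forall>n. \<phi> n \<in> carrier (model3 P Q R)" for \<phi>
    proof -
      from that have "\<forall>n. \<exists>a b c d. \<phi> n = upper3 (P * a) (Q * a) (R * a) b c d" by (auto simp: model3_carrier)
      then obtain \<alpha> \<beta> \<gamma> \<delta> where "\<forall>n. \<phi> n = upper3 (P * \<alpha> n) (Q * \<alpha> n) (R * \<alpha> n) (\<beta> n) (\<gamma> n) (\<delta> n)" by metis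
      then have "\<phi> = (\<lambda>n. upper3 (P * \<alpha> n) (Q * \<alpha> n) (R * \<alpha> n) (\<beta> n) (\<gamma> n) (\<delta> n))" by blast
      then show ?thesis using r by simp
    qed
    then show "p \<in> identities (model3 P Q R)"
      using p by (simp add: identities_iff model3_simps del: free_algebra_simps)
  next
    assume i: "p \<in> identities (model3 P Q R)"
    show "\<forall>\<alpha> \<beta> \<gamma> \<delta>. evaluate (model3 P Q R) (\<lambda>x. upper3 (P * \<alpha> x) (Q * \<alpha> x) (R * \<alpha> x) (\<beta> x) (\<gamma> x) (\<delta> x)) p = 0\<^sub>m 3 3"
    proof (intro allI)
      fix \<alpha> \<beta> \<gamma> \<delta>
      have "upper3 (P * \<alpha> x) (Q * \<alpha> x) (R * \<alpha> x) (\<beta> x) (\<gamma> x) (\<delta> x) \<in> carrier (model3 P Q R)" for x :: nat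
        unfolding model3_carrier by blast
      from identitiesD[of p _ "\<lambda>x. upper3 (P * \<alpha> x) (Q * \<alpha> x) (R * \<alpha> x) (\<beta> x) (\<gamma> x) (\<delta> x)", OF i this]
      show "evaluate (model3 P Q R) (\<lambda>x. upper3 (P * \<alpha> x) (Q * \<alpha> x) (R * \<alpha> x) (\<beta> x) (\<gamma> x) (\<delta> x)) p = 0\<^sub>m 3 3"
        by (simp only: model3_simps)
    qed
  qed
  also have "\<dots> \<longleftrightarrow> diag_vanish p \<and> linear_vanish P Q p \<and> linear_vanish Q R p \<and> linear_vanish P R p \<and> bilinear_vanish P Q R p"
    unfolding ev upper3_zero upper3_inject
  proof (intro iffI conjI allI)
    assume r: "\<forall>\<alpha> \<beta> \<gamma> \<delta>. word_sum p (diag_entry (\<lambda>x. P * \<alpha> x)) = 0 \<and> word_sum p (diag_entry (\<lambda>x. Q * \<alpha> x)) = 0 \<and>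
       word_sum p (diag_entry (\<lambda>x. R * \<alpha> x)) = 0 \<and> word_sum p (linear_entry (\<lambda>x. P * \<alpha> x) (\<lambda>x. Q * \<alpha> x) \<beta>) = 0 \<and>
       word_sum p (linear_entry (\<lambda>x. Q * \<alpha> x) (\<lambda>x. R * \<alpha> x) \<gamma>) = 0 \<and>
       word_sum p (bilinear_entry (\<lambda>x. P * \<alpha> x) (\<lambda>x. Q * \<alpha> x) (\<lambda>x. R * \<alpha> x) (tensor \<beta> \<gamma>)) +
       word_sum p (linear_entry (\<lambda>x. P * \<alpha> x) (\<lambda>x. R * \<alpha> x) \<delta>) = 0"
    show "diag_vanish p" unfolding diag_vanish_def using r one by auto
    show "linear_vanish P Q p" "linear_vanish Q R p" unfolding linear_vanish_def using r by blast+
    show lPR: "linear_vanish P R p"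
      unfolding linear_vanish_def
    proof (intro allI)
      fix \<alpha> \<delta>
      show "word_sum p (linear_entry (\<lambda>x. P * \<alpha> x) (\<lambda>x. R * \<alpha> x) \<delta>) = 0"
        using r[rule_format, of \<alpha> "\<lambda>_. 0" "\<lambda>_. 0" \<delta>] by simp
    qed
    show "bilinear_vanish P Q R p"
      unfolding bilinear_vanish_def
    proof (intro allI, rule word_sum_bilinear_eq_zeroI)
      fix \<alpha> \<beta> \<gamma>
      show "word_sum p (bilinear_entry (\<lambda>x. P * \<alpha> x) (\<lambda>x. Q * \<alpha> x) (\<lambda>x. R * \<alpha> x) (tensor \<beta> \<gamma>)) = 0"
        using r[rule_format, of \<alpha> \<beta> \<gamma> "\<lambda>_. 0"] by simp
    qed
  qed (auto simp: diag_vanish_scaled linear_vanish_def bilinear_vanish_def)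
  finally show ?thesis .
qed

lemma model2_identity_iff:
  assumes idem: "P * P = P" "Q * Q = Q" and one: "P = 1 \<or> Q = 1"
  shows "p \<in> identities (model2 P Q) \<longleftrightarrow> diag_vanish p \<and> linear_vanish P Q p"
proof -
  note ev = model2_evaluate[OF idem]
  have "p \<in> identities (model2 P Q) \<longleftrightarrow>
      (\<forall>\<alpha> \<beta>. evaluate (model2 P Q) (\<lambda>x. upper2 (P * \<alpha> x) (Q * \<alpha> x) (\<beta> x)) p = 0\<^sub>m 2 2)"
  proof
    assume r: "\<forall>\<alpha> \<beta>. evaluate (model2 P Q) (\<lambda>x. upper2 (P * \<alpha> x) (Q * \<alpha> x) (\<beta> x)) p = 0\<^sub>m 2 2"
    have "evaluate (model2 P Q) \<phi> p = 0\<^sub>m 2 2" if "\<forall>n. \<phi> n \<in> carrier (model2 P Q)" for \<phi>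
    proof -
      from that have "\<forall>n. \<exists>a b. \<phi> n = upper2 (P * a) (Q * a) b" by (auto simp: model2_carrier)
      then obtain \<alpha> \<beta> where "\<forall>n. \<phi> n = upper2 (P * \<alpha> n) (Q * \<alpha> n) (\<beta> n)" by metis
      then have "\<phi> = (\<lambda>n. upper2 (P * \<alpha> n) (Q * \<alpha> n) (\<beta> n))" by blast
      then show ?thesis using r by simp
    qed
    then show "p \<in> identities (model2 P Q)"
      using p by (simp add: identities_iff model2_simps del: free_algebra_simps)
  next
    assume i: "p \<in> identities (model2 P Q)"
    show "\<forall>\<alpha> \<beta>. evaluate (model2 P Q) (\<lambda>x. upper2 (P * \<alpha> x) (Q * \<alpha> x) (\<beta> x)) p = 0\<^sub>m 2 2"
    proof (intro allI)
      fix \<alpha> \<beta>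
      have "upper2 (P * \<alpha> x) (Q * \<alpha> x) (\<beta> x) \<in> carrier (model2 P Q)" for x :: nat
        unfolding model2_carrier by blast
      from identitiesD[of p _ "\<lambda>x. upper2 (P * \<alpha> x) (Q * \<alpha> x) (\<beta> x)", OF i this]
      show "evaluate (model2 P Q) (\<lambda>x. upper2 (P * \<alpha> x) (Q * \<alpha> x) (\<beta> x)) p = 0\<^sub>m 2 2"
        by (simp only: model2_simps)
    qed
  qed
  also have "\<dots> \<longleftrightarrow> diag_vanish p \<and> linear_vanish P Q p"
    unfolding ev upper2_zero upper2_inject
    using one by (auto simp: diag_vanish_scaled linear_vanish_def) (auto simp: diag_vanish_def)
  finally show ?thesis .
qed

end

section \<open>The relatively free algebra of a fundamental algebra\<close>

text \<open>A maximal independent subset of \<open>W\<close> spans it, which shows that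
  \<open>fdim\<close> of the restricted structure, a least cardinality of spanning sets, is
  attained. For the radical, a spanning set of exactly this size matches the number of variables
  y.\<close>

lemma (in fvectorspace) subspace_fin_dim:
  assumes fd: fin_dim and W: "subspace class_ring W A"
  obtains B where "finite B" "B \<subseteq> W" "fspan A B = W" "card B = fdim (A\<lparr>carrier := W\<rparr>)"
proof -
  note Wc = subspaceD[OF W]
  interpret W: fvectorspace "A\<lparr>carrier := W\<rparr>" by (rule subspace_fvectorspace[OF W])
  let ?P = "\<lambda>B. B \<subseteq> W \<and> lin_indpt B"
  have "\<And>B. ?P B \<Longrightarrow> finite B \<and> card B \<le> dim" using li_le_dim[OF fd] Wc(1) by blast
  moreover have "?P {}" by (auto simp: lin_dep_def)
  ultimately obtain B where B: "finite B" "maximal B ?P" using maximal_exists[of ?P dim "{}"] by blast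
  then have B': "B \<subseteq> W" "lin_indpt B" by (auto simp: maximal_def)
  have "W \<subseteq> fspan A B"
  proof (rule ccontr)
    assume "\<not> W \<subseteq> fspan A B"
    then obtain v where v: "v \<in> W" "v \<notin> fspan A B" by blast
    have Bc: "B \<subseteq> carrier A" using B'(1) Wc(1) by blast
    have vB: "v \<notin> B" using v fspan_base[OF Bc] by blast
    then have "lin_indpt (B \<union> {v})" using lin_dep_iff_in_span[OF Bc B'(2) Wc(2)[OF v(1)] vB] v by blast
    then have "B \<union> {v} = B" using B(2) B'(1) v(1) unfolding maximal_def by blast
    then show False using vB by blast
  qed
  then have span: "fspan A B = W" using fspan_minimal[OF W B'(1)] by blast
  have sub: "submodule class_ring W A" using W by (simp add: subspace_def)
  have eq: "fspan (A\<lparr>carrier := W\<rparr>) C = fspan A C" if "C \<subseteq> W" for C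
    using span_li_not_depend(1)[OF that sub] .
  have gen: "\<exists>C. finite C \<and> card C = card B \<and> C \<subseteq> carrier (A\<lparr>carrier := W\<rparr>) \<and>
      fspan (A\<lparr>carrier := W\<rparr>) C = carrier (A\<lparr>carrier := W\<rparr>)"
    using B(1) B'(1) span eq by auto
  from LeastI[of "\<lambda>n. \<exists>C. finite C \<and> card C = n \<and> C \<subseteq> carrier (A\<lparr>carrier := W\<rparr>) \<and>
      fspan (A\<lparr>carrier := W\<rparr>) C = carrier (A\<lparr>carrier := W\<rparr>)", OF gen]
  obtain C where "finite C" "card C = fdim (A\<lparr>carrier := W\<rparr>)" "C \<subseteq> W" "fspan (A\<lparr>carrier := W\<rparr>) C = W"
    unfolding W.dim_def by auto
  then show ?thesis using that eq by metis
qed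

lemma (in fvectorspace) subspace_is_fin_dim:
  assumes fd: fin_dim and W: "subspace class_ring W A"
  shows "finite_dimensional (A\<lparr>carrier := W\<rparr>)"
proof -
  interpret W: fvectorspace "A\<lparr>carrier := W\<rparr>" by (rule subspace_fvectorspace[OF W])
  obtain B where B: "finite B" "B \<subseteq> W" "fspan A B = W" by (rule subspace_fin_dim[OF fd W])
  have "submodule class_ring W A" using W by (simp add: subspace_def)
  from span_li_not_depend(1)[OF B(2) this] B show ?thesis unfolding W.fin_dim_def by auto
qed

section \<open>From the relatively free algebra to the algebra itself\<close>

lemma free_algebra_diff:
  "\<lbrakk>p \<in> carrier (free_algebra X); q \<in> carrier (free_algebra X)\<rbrakk> \<Longrightarrow> p - q \<in> carrier (free_algebra X)"
  using keys_diff[of p q] by auto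

lemma (in assoc_algebra) evaluate_diff:
  assumes "\<And>x. \<phi> x \<in> carrier A"
  shows "evaluate A \<phi> (p - q) = evaluate A \<phi> p \<ominus> evaluate A \<phi> q"
proof -
  have "p - q = p + Poly_Mapping.map ((*) (- 1)) q"
    by (intro poly_mapping_eqI) (simp add: lookup_add lookup_minus)
  then have "evaluate A \<phi> (p - q) = evaluate A \<phi> p \<oplus> (- 1) \<odot> evaluate A \<phi> q"
    by (simp only: evaluate_add[of \<phi>, OF assms] evaluate_scale[of \<phi>, OF assms])
  also have "(- 1) \<odot> evaluate A \<phi> q = \<ominus> evaluate A \<phi> q"
    by (rule neg_eq_smult[symmetric]) (rule evaluate_closed[OF assms])
  finally show ?thesis by (simp only: a_minus_def)
qed

lemma hom_relations_closed:
  fixes B :: "('f :: field, 'b) module" and \<iota> :: "'b \<Rightarrow> 'x"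
  assumes B: "assoc_algebra B" and \<iota>: "\<iota> ` carrier B \<subseteq> X"
  shows "hom_relations B \<iota> \<subseteq> carrier (free_algebra X)"
proof -
  interpret B: assoc_algebra B by (rule B)
  let ?X = "free_algebra X :: ('f, 'x list \<Rightarrow>\<^sub>0 'f) module"
  interpret X: assoc_algebra ?X by (rule free_algebra_assoc)
  have g: "gen (\<iota> a) \<in> carrier ?X" if "a \<in> carrier B" for a
    using that \<iota> by (intro gen_in_free_algebra) auto
  have 1: "gen (\<iota> (a \<oplus>\<^bsub>B\<^esub> b)) - (gen (\<iota> a) + gen (\<iota> b)) \<in> carrier ?X"
    if "a \<in> carrier B" "b \<in> carrier B" for a b
    using free_algebra_diff[OF g[OF B.M.a_closed[OF that]] X.M.a_closed[OF g[OF that(1)] g[OF that(2)]]]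
    by (simp only: free_algebra_simps(4))
  have 2: "gen (\<iota> (c \<odot>\<^bsub>B\<^esub> a)) - Poly_Mapping.map ((*) c) (gen (\<iota> a)) \<in> carrier ?X"
    if "a \<in> carrier B" for a c
    using free_algebra_diff[OF g[OF B.smult_in[OF that]] X.smult_in[OF g[OF that], of c], of c]
    by (simp only: free_algebra_simps(5))
  have 3: "gen (\<iota> (a \<otimes>\<^bsub>B\<^esub> b)) - gen (\<iota> a) * gen (\<iota> b) \<in> carrier ?X"
    if "a \<in> carrier B" "b \<in> carrier B" for a b
    using free_algebra_diff[OF g[OF B.mult_closed[OF that]] X.mult_closed[OF g[OF that(1)] g[OF that(2)]]]
    by (simp only: free_algebra_simps(2))
  show ?thesis unfolding hom_relations_def using 1 2 3 by blast
qed

text \<open>The relations measure how far \<iota> is from being a homomorphism, so a substitution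
  that is one on \<open>B\<close> annihilates them.\<close>

lemma hom_relations_vanish:
  fixes A :: "('f :: field, 'a) module" and B :: "('f, 'b) module" and \<iota> :: "'b \<Rightarrow> 'x"
  assumes A: "assoc_algebra A" and B: "assoc_algebra B" and \<theta>: "\<And>x. \<theta> x \<in> carrier A"
    and hom: "alg_hom B A (\<lambda>b. \<theta> (\<iota> b))" and r: "r \<in> hom_relations B \<iota>"
  shows "evaluate A \<theta> r = \<zero>\<^bsub>A\<^esub>"
proof -
  interpret A: assoc_algebra A by (rule A)
  interpret B: assoc_algebra B by (rule B)
  note ev = A.evaluate_diff[of \<theta>, OF \<theta>] A.evaluate_add[of \<theta>, OF \<theta>] A.evaluate_scale[of \<theta>, OF \<theta>]
    A.evaluate_gen[of \<theta>, OF \<theta>]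
  have m: "evaluate A \<theta> (gen x * gen y) = \<theta> x \<otimes>\<^bsub>A\<^esub> \<theta> y" for x y
    using A.evaluate_mult[of \<theta> "gen x" "gen y", OF \<theta>] ev(4) by (simp add: gen_def)
  note h = linear_homD(2,3)[OF alg_homD(1)[OF hom]] alg_homD(2)[OF hom]
  show ?thesis
    using r unfolding hom_relations_def
    by (auto simp: ev m h \<theta>)
qed

locale split_algebra = assoc_algebra A
  for A :: "('f :: field, 'a) module" (structure) +
  fixes \<C> :: "'a set set"
  assumes fd: fin_dim and wm: "wedderburn_malcev A \<C>"
begin

abbreviation S where "S \<equiv> semisimple_part A \<C>"
abbreviation J where "J \<equiv> jacobson_radical A"

lemma components_subset: "\<Union>\<C> \<subseteq> carrier A"
proof (rule Union_least)
  fix T assume "T \<in> \<C>"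
  then have "subspace class_ring T A" using wm by (simp add: wedderburn_malcev_def)
  then show "T \<subseteq> carrier A" by (rule subspaceD(1))
qed

lemma S_subspace: "subspace class_ring S A"
  unfolding semisimple_part_def by (rule fspan_subspace[OF components_subset])

lemma S_mult:
  assumes "x \<in> S" "y \<in> S" shows "x \<otimes> y \<in> S"
proof -
  have "a \<otimes> b \<in> S" if ab: "a \<in> \<Union>\<C>" "b \<in> \<Union>\<C>" for a b
  proof -
    obtain T U where TU: "T \<in> \<C>" "U \<in> \<C>" "a \<in> T" "b \<in> U" using ab by blast
    have T: "T \<subseteq> S"
      using fspan_superset[OF components_subset] TU(1) unfolding semisimple_part_def by blast
    have prod: "a \<otimes> b \<in> T <#> U" using TU by (auto simp: set_mult_def)
    have "T <#> U \<subseteq> T \<or> T <#> U \<subseteq> {\<zero>}"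
      using wm TU(1,2) by (cases "T = U") (simp_all add: wedderburn_malcev_def)
    then show ?thesis
    proof
      assume "T <#> U \<subseteq> T" from subsetD[OF T subsetD[OF this prod]] show ?thesis .
    next
      assume "T <#> U \<subseteq> {\<zero>}" from subsetD[OF this prod] show ?thesis using subspaceD(3)[OF S_subspace] by simp
    qed
  qed
  from fspan_mult_closed[OF components_subset this[unfolded semisimple_part_def]]
  show ?thesis using assms unfolding semisimple_part_def by blast
qed

lemma S_assoc: "assoc_algebra (A\<lparr>carrier := S\<rparr>)"
  by (rule subalgebra[OF S_subspace S_mult])

text \<open>A spanning family with exactly \<open>fdim\<close> members can be indexed by the
  variables y. Outside the index set it is padded with zero, which makes it a total substitution
  with values in \<open>J\<close>.\<close>

lemma radical_basis:
  obtains b :: "nat \<Rightarrow> 'a" where "\<And>i. b i \<in> J" "fspan A (b ` radical_variables A) = J"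
proof -
  obtain B where B: "finite B" "B \<subseteq> J" "fspan A B = J" "card B = fdim (A\<lparr>carrier := J\<rparr>)"
    by (rule subspace_fin_dim[OF fd radical_subspace])
  obtain h where "bij_betw h {0..<card B} B" using ex_bij_betw_nat_finite[OF B(1)] by blast
  then have h: "h ` radical_variables A = B"
    using B(4) by (simp add: radical_variables_def bij_betw_def lessThan_atLeast0)
  define b where "b i = (if i \<in> radical_variables A then h i else \<zero>)" for i
  have "b ` radical_variables A = B" using h by (auto simp: b_def)
  moreover have "b i \<in> J" for i using h B(2) subspaceD(3)[OF radical_subspace] by (auto simp: b_def)
  ultimately show ?thesis using that B(3) by blast
qed

text \<open>Sending the free generators \<open>y\<^sub>i\<close> to a basis of \<open>J\<close> defines a homomorphism of \<open>\<A>\<close> onto \<open>A\<close>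
  which maps \<open>K\<close> into \<open>J\<close>.\<close>

lemma calA_hom:
  obtains h where "assoc_algebra (algebra_calA A \<C>)" "alg_hom (algebra_calA A \<C>) A h"
    "alg_ideal (algebra_calA A \<C>) (ideal_K A \<C>)" "\<And>x. x \<in> ideal_K A \<C> \<Longrightarrow> h x \<in> J"
    "\<And>x. x \<in> carrier A \<Longrightarrow> \<exists>y\<in>carrier (algebra_calA A \<C>). h y = x"
proof -
  obtain b where b: "\<And>i. b i \<in> J" "fspan A (b ` radical_variables A) = J" using radical_basis by blast
  have bA: "b i \<in> carrier A" for i using b(1) radical_in by blast
  let ?Y = "radical_variables A"
  let ?FY = "free_algebra ?Y :: ('f, nat list \<Rightarrow>\<^sub>0 'f) module"
  let ?AS = "A\<lparr>carrier := S\<rparr>"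
  let ?X = "Inl ` carrier ?AS \<union> Inr ` carrier ?FY :: ('a + (nat list \<Rightarrow>\<^sub>0 'f)) set"
  let ?base = "free_algebra ?X :: ('f, ('a + (nat list \<Rightarrow>\<^sub>0 'f)) list \<Rightarrow>\<^sub>0 'f) module"
  have base_eq: "free_product_base ?AS ?FY = ?base" by (simp add: free_product_base_def)
  have FY: "assoc_algebra ?FY" by (rule free_algebra_assoc)
  interpret base: assoc_algebra ?base by (rule free_algebra_assoc)
  have A: "assoc_algebra A" by unfold_locales
  \<comment> \<open>A letter from the semisimple part is sent to itself, a letter from the free
    algebra to the value of that polynomial at the spanning family of \<open>J\<close>. The zero
    clause makes the map total.\<close>
  define \<theta>0 where "\<theta>0 = case_sum (\<lambda>s. if s \<in> S then s else \<zero>) (evaluate A b)"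
  have \<theta>0: "\<theta>0 x \<in> carrier A" for x
    using evaluate_closed[of b, OF bA] subspaceD(2)[OF S_subspace] by (cases x) (auto simp: \<theta>0_def)
  let ?\<theta> = "evaluate A \<theta>0"
  have \<theta>: "alg_hom ?base A ?\<theta>" by (rule evaluate_alg_hom[of \<theta>0, OF \<theta>0])
  let ?rels = "hom_relations ?AS Inl \<union> hom_relations ?FY Inr :: (('a + (nat list \<Rightarrow>\<^sub>0 'f)) list \<Rightarrow>\<^sub>0 'f) set"
  have rels: "?rels \<subseteq> carrier ?base"
    using hom_relations_closed[OF S_assoc, of Inl ?X] hom_relations_closed[OF FY, of Inr ?X] by blast
  have rels0: "?\<theta> r = \<zero>" if "r \<in> ?rels" for r
    using that
  proof
    assume r: "r \<in> hom_relations ?AS Inl"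
    have "alg_hom ?AS A (\<lambda>s. \<theta>0 (Inl s))"
      using subspaceD[OF S_subspace] S_mult by (auto simp: alg_hom_def linear_hom_def \<theta>0_def)
    from hom_relations_vanish[of A ?AS \<theta>0 Inl, OF A S_assoc \<theta>0 this r] show ?thesis .
  next
    assume r: "r \<in> hom_relations ?FY Inr"
    have "alg_hom ?FY A (\<lambda>s. \<theta>0 (Inr s))"
      using evaluate_alg_hom[of b ?Y, OF bA] by (simp add: \<theta>0_def)
    from hom_relations_vanish[of A ?FY \<theta>0 Inr, OF A FY \<theta>0 this r] show ?thesis .
  qed
  let ?R = "free_product_relations ?AS ?FY"
  have R_def: "?R = generated_ideal ?base ?rels" by (simp add: free_product_relations_def base_eq)
  note R = base.generated_ideal[OF rels, folded R_def]
  \<comment> \<open>The kernel is an ideal containing the relations, hence also the ideal they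
    generate. The same pattern is used below for the evaluation ideal and, with the preimage of
    \<open>J\<close>, for \<open>K\<close>.\<close>
  have "alg_ideal ?base {x \<in> carrier ?base. ?\<theta> x \<in> {\<zero>}}"
    by (rule base.vimage_ideal[OF A \<theta> zero_ideal])
  from R(3)[OF this] have R0: "?\<theta> x = \<zero>" if "x \<in> ?R" for x using that rels0 rels by blast
  let ?A' = "algebra_A' A \<C>"
  have A'_eq: "?A' = quotient_algebra ?base ?R" by (simp add: algebra_A'_def free_product_def base_eq)
  interpret A': assoc_algebra ?A' unfolding A'_eq by (rule base.quotient_assoc_algebra[OF R(1)])
  obtain \<theta>' where \<theta>': "alg_hom ?A' A \<theta>'" "\<And>x. x \<in> carrier ?base \<Longrightarrow> \<theta>' (?R +>\<^bsub>?base\<^esub> x) = ?\<theta> x"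
    using base.quotient_alg_lift[OF R(1) \<theta> A R0] unfolding A'_eq by blast
  let ?E = "{evaluate ?A' \<phi> p | \<phi> p. p \<in> identities A \<and> \<phi> \<in> UNIV \<rightarrow> carrier ?A'}"
  have E: "?E \<subseteq> carrier ?A'" by (auto intro!: A'.evaluate_closed)
  let ?I = "evaluation_ideal A \<C>"
  note I = A'.generated_ideal[OF E, folded evaluation_ideal_def]
  have "alg_ideal ?A' {x \<in> carrier ?A'. \<theta>' x \<in> {\<zero>}}"
    by (rule A'.vimage_ideal[OF A \<theta>'(1) zero_ideal])
  \<comment> \<open>\<open>\<theta>'\<close> turns an evaluation of an identity of \<open>A\<close>
    in \<open>A'\<close> into an evaluation in \<open>A\<close>, which is zero.\<close>
  moreover have "?E \<subseteq> {x \<in> carrier ?A'. \<theta>' x \<in> {\<zero>}}"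
  proof
    fix x assume x: "x \<in> ?E"
    then obtain \<phi> p where p: "x = evaluate ?A' \<phi> p" "p \<in> identities A" "\<And>n. \<phi> n \<in> carrier ?A'" by blast
    have "\<theta>' x = evaluate A (\<lambda>n. \<theta>' (\<phi> n)) p"
      unfolding p(1) by (rule alg_hom_evaluate[OF A'.assoc_algebra_axioms A \<theta>'(1) p(3)])
    also have "\<dots> = \<zero>"
      by (rule identitiesD[OF p(2)]) (rule linear_homD(1)[OF alg_homD(1)[OF \<theta>'(1)] p(3)])
    finally show "x \<in> {x \<in> carrier ?A'. \<theta>' x \<in> {\<zero>}}" using E x by blast
  qed
  ultimately have "?I \<subseteq> {x \<in> carrier ?A'. \<theta>' x \<in> {\<zero>}}" by (rule I(3))
  then have I0: "\<theta>' x = \<zero>" if "x \<in> ?I" for x using that by blast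
  let ?C = "algebra_calA A \<C>"
  interpret C: assoc_algebra ?C unfolding algebra_calA_def by (rule A'.quotient_assoc_algebra[OF I(1)])
  obtain h where h: "alg_hom ?C A h" "\<And>x. x \<in> carrier ?A' \<Longrightarrow> h (?I +>\<^bsub>?A'\<^esub> x) = \<theta>' x"
    using A'.quotient_alg_lift[OF I(1) \<theta>'(1) A I0] unfolding algebra_calA_def by blast
  have A'_in: "?R +>\<^bsub>?base\<^esub> x \<in> carrier ?A'" if "x \<in> carrier ?base" for x
    using that unfolding A'_eq base.quotient_carrier[OF base.alg_idealD(1)[OF R(1)]] by blast
  have C_in: "?I +>\<^bsub>?A'\<^esub> x \<in> carrier ?C" if "x \<in> carrier ?A'" for x
    using that unfolding algebra_calA_def A'.quotient_carrier[OF A'.alg_idealD(1)[OF I(1)]] by blast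
  have inr_in: "gen (Inr (gen i)) \<in> carrier ?base" if "i \<in> ?Y" for i
    by (intro gen_in_free_algebra UnI2 imageI gen_in_free_algebra that)
  have inl_in: "gen (Inl s) \<in> carrier ?base" if "s \<in> S" for s
    using that by (intro gen_in_free_algebra) auto
  have inr_h: "h (?I +>\<^bsub>?A'\<^esub> (?R +>\<^bsub>?base\<^esub> gen (Inr (gen i)))) = b i" if "i \<in> ?Y" for i
    using h(2)[OF A'_in[OF inr_in[OF that]]] \<theta>'(2)[OF inr_in[OF that]] evaluate_gen[of \<theta>0, OF \<theta>0]
      evaluate_gen[of b, OF bA] by (simp add: \<theta>0_def)
  have inl_h: "h (?I +>\<^bsub>?A'\<^esub> (?R +>\<^bsub>?base\<^esub> gen (Inl s))) = s" if "s \<in> S" for s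
    using h(2)[OF A'_in[OF inl_in[OF that]]] \<theta>'(2)[OF inl_in[OF that]] evaluate_gen[of \<theta>0, OF \<theta>0] that
    by (simp add: \<theta>0_def)
  let ?G = "{?I +>\<^bsub>?A'\<^esub> free_product_inr ?AS ?FY (gen i) | i. i \<in> ?Y}"
  have G_eq: "free_product_inr ?AS ?FY (gen i) = ?R +>\<^bsub>?base\<^esub> gen (Inr (gen i))" for i
    by (simp add: free_product_inr_def base_eq)
  have G: "?G \<subseteq> carrier ?C" unfolding G_eq using C_in A'_in inr_in by blast
  note K = C.generated_ideal[OF G, folded ideal_K_def]
  have "alg_ideal ?C {x \<in> carrier ?C. h x \<in> J}" by (rule C.vimage_ideal[OF A h(1) radical_ideal])
  moreover have "?G \<subseteq> {x \<in> carrier ?C. h x \<in> J}"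
    using G inr_h b(1) unfolding G_eq by auto
  ultimately have "ideal_K A \<C> \<subseteq> {x \<in> carrier ?C. h x \<in> J}" by (rule K(3))
  moreover have "\<exists>y\<in>carrier ?C. h y = x" if x: "x \<in> carrier A" for x
  proof -
    note hl = linear_homD[OF alg_homD(1)[OF h(1)]]
    \<comment> \<open>The image of \<open>h\<close> is a subspace containing the semisimple part and
      the spanning family of \<open>J\<close>, so it is everything.\<close>
    have sub: "subspace class_ring (h ` carrier ?C) A"
    proof (rule subspaceI)
      show "h ` carrier ?C \<subseteq> carrier A" using hl(1) by blast
      show "\<zero> \<in> h ` carrier ?C"
        using linear_hom_zero[OF C.fvectorspace_axioms fvectorspace_axioms alg_homD(1)[OF h(1)]]
        by (intro image_eqI[of _ _ "\<zero>\<^bsub>?C\<^esub>"]) auto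
    next
      fix u v assume "u \<in> h ` carrier ?C" "v \<in> h ` carrier ?C"
      then obtain u' v' where "u' \<in> carrier ?C" "v' \<in> carrier ?C" "u = h u'" "v = h v'" by blast
      then show "u \<oplus> v \<in> h ` carrier ?C" using hl(2)[of u' v'] by (intro image_eqI[of _ _ "u' \<oplus>\<^bsub>?C\<^esub> v'"]) auto
    next
      fix c u assume "u \<in> h ` carrier ?C"
      then obtain u' where "u' \<in> carrier ?C" "u = h u'" by blast
      then show "c \<odot> u \<in> h ` carrier ?C" using hl(3)[of u' c] by (intro image_eqI[of _ _ "c \<odot>\<^bsub>?C\<^esub> u'"]) auto
    qed
    have "S \<subseteq> h ` carrier ?C"
    proof
      fix s assume s: "s \<in> S"
      show "s \<in> h ` carrier ?C"
        using inl_h[OF s] C_in[OF A'_in[OF inl_in[OF s]]] by (metis imageI)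
    qed
    moreover have "b ` ?Y \<subseteq> h ` carrier ?C"
    proof
      fix y assume "y \<in> b ` ?Y"
      then obtain i where i: "i \<in> ?Y" "y = b i" by blast
      show "y \<in> h ` carrier ?C"
        using inr_h[OF i(1)] C_in[OF A'_in[OF inr_in[OF i(1)]]] i(2) by (metis imageI)
    qed
    then have "J \<subseteq> h ` carrier ?C" using fspan_minimal[OF sub] b(2) by blast
    ultimately have "fspan A (S \<union> J) \<subseteq> h ` carrier ?C" by (intro fspan_minimal[OF sub]) blast
    moreover have "fspan A (S \<union> J) = carrier A" using wm by (simp add: wedderburn_malcev_def)
    ultimately have "x \<in> h ` carrier ?C" using x by auto
    then show ?thesis by (elim imageE) auto
  qed
  ultimately show ?thesis using that[OF C.assoc_algebra_axioms h(1) K(1)] by blast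
qed

text \<open>An identity of the quotient by \<open>K\<^sup>2\<close> takes values in
  \<open>K\<^sup>2\<close> on the relatively free algebra, and the surjection of that algebra onto
  \<open>A\<close> carries \<open>K\<^sup>2\<close> into \<open>J\<^sup>2\<close>. Lifting a
  substitution through the surjection transfers this to \<open>A\<close>.\<close>

lemma identity_calA_mod_2:
  assumes f: "f \<in> identities (algebra_calA_mod A \<C> 2)" and \<phi>: "\<And>n. \<phi> n \<in> carrier A"
  shows "evaluate A \<phi> f \<in> subspace_mult A J J"
proof -
  obtain h where C: "assoc_algebra (algebra_calA A \<C>)" and h: "alg_hom (algebra_calA A \<C>) A h"
    and K: "alg_ideal (algebra_calA A \<C>) (ideal_K A \<C>)" and KJ: "\<And>x. x \<in> ideal_K A \<C> \<Longrightarrow> h x \<in> J"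
    and surj: "\<And>x. x \<in> carrier A \<Longrightarrow> \<exists>y\<in>carrier (algebra_calA A \<C>). h y = x"
    using calA_hom by blast
  let ?C = "algebra_calA A \<C>"
  interpret C: assoc_algebra ?C by (rule C)
  have A: "assoc_algebra A" by unfold_locales
  let ?K2 = "subspace_mult ?C (ideal_K A \<C>) (ideal_K A \<C>)"
  note K2 = C.ideal_mult_ideal[OF K K]
  note Kc = C.subspaceD(1,2)[OF C.alg_idealD(1)[OF K]]
  let ?Q = "algebra_calA_mod A \<C> 2"
  have Q_eq: "?Q = quotient_algebra ?C ?K2" by (simp add: algebra_calA_mod_def numeral_2_eq_2)
  have Q: "assoc_algebra ?Q" unfolding Q_eq by (rule C.quotient_assoc_algebra[OF K2])
  have \<pi>: "alg_hom ?C ?Q (\<lambda>x. ?K2 +>\<^bsub>?C\<^esub> x)" unfolding Q_eq by (rule C.quotient_alg_hom[OF K2])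
  have "\<forall>n. \<exists>y\<in>carrier ?C. h y = \<phi> n" using surj \<phi> by blast
  then obtain \<chi> where \<chi>: "\<And>n. \<chi> n \<in> carrier ?C" "\<And>n. h (\<chi> n) = \<phi> n" by metis
  have "?K2 +>\<^bsub>?C\<^esub> evaluate ?C \<chi> f = evaluate ?Q (\<lambda>n. ?K2 +>\<^bsub>?C\<^esub> \<chi> n) f"
    by (rule alg_hom_evaluate[OF C Q \<pi> \<chi>(1)])
  also have "\<dots> = \<zero>\<^bsub>?Q\<^esub>"
    by (rule identitiesD[OF f]) (rule linear_homD(1)[OF alg_homD(1)[OF \<pi>] \<chi>(1)])
  also have "\<dots> = ?K2 +>\<^bsub>?C\<^esub> \<zero>\<^bsub>?C\<^esub>"
    unfolding Q_eq using C.quotient_zero[OF C.alg_idealD(1)[OF K2]] by simp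
  finally have "evaluate ?C \<chi> f \<ominus>\<^bsub>?C\<^esub> \<zero>\<^bsub>?C\<^esub> \<in> ?K2"
    using C.coset_eq_iff[OF C.alg_idealD(1)[OF K2] C.evaluate_closed[of \<chi> f, OF \<chi>(1)] C.M.zero_closed] by blast
  then have ev: "evaluate ?C \<chi> f \<in> ?K2" using C.evaluate_closed[of \<chi> f, OF \<chi>(1)] by simp
  have "?K2 \<subseteq> {x \<in> carrier ?C. h x \<in> subspace_mult A J J}"
  proof (rule C.subspace_mult_minimal)
    show "subspace class_ring {x \<in> carrier ?C. h x \<in> subspace_mult A J J} ?C"
      by (rule linear_hom_vimage_subspace[OF C.fvectorspace_axioms fvectorspace_axioms alg_homD(1)[OF h]
            subspace_mult_subspace[OF radical_subset radical_subset]])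
    fix u v assume uv: "u \<in> ideal_K A \<C>" "v \<in> ideal_K A \<C>"
    then show "u \<otimes>\<^bsub>?C\<^esub> v \<in> {x \<in> carrier ?C. h x \<in> subspace_mult A J J}"
      using Kc(2) KJ alg_homD(2)[OF h] prod_in_subspace_mult[OF radical_subset radical_subset] by simp
  qed
  then have "h (evaluate ?C \<chi> f) \<in> subspace_mult A J J" using ev by blast
  moreover have "h (evaluate ?C \<chi> f) = evaluate A (\<lambda>n. h (\<chi> n)) f"
    by (rule alg_hom_evaluate[OF C A h \<chi>(1)])
  ultimately show ?thesis by (simp add: \<chi>(2))
qed

end

section \<open>Exponential codimension growth\<close>

text \<open>The functional with index \<open>k\<close> picks out the coefficient of
  \<open>q k\<close> in a linear relation, so every relation is trivial.\<close>

lemma (in fvectorspace) dual_family_card: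
  assumes fd: fin_dim and q: "\<And>i. i \<in> I \<Longrightarrow> q i \<in> carrier A"
    and \<psi>: "\<And>i. i \<in> I \<Longrightarrow> linear_functional A (\<psi> i)"
    and dual: "\<And>i k. \<lbrakk>i \<in> I; k \<in> I\<rbrakk> \<Longrightarrow> \<psi> k (q i) = (if i = k then 1 else 0)"
  shows "card I \<le> dim"
proof -
  have inj: "inj_on q I"
  proof (rule inj_onI)
    fix i k assume ik: "i \<in> I" "k \<in> I" "q i = q k"
    have "\<psi> i (q i) = \<psi> i (q k)" using ik(3) by (rule arg_cong)
    then show "i = k" unfolding dual[OF ik(1,1)] dual[OF ik(2,1)] by (simp split: if_splits)
  qed
  have "lin_indpt (q ` I)"
  proof
    assume "lin_dep (q ` I)"
    then obtain F a v where F: "finite F" "F \<subseteq> q ` I" "lincomb a F = \<zero>" "v \<in> F" "a v \<noteq> 0"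
      unfolding lin_dep_def by auto
    then obtain k where k: "k \<in> I" "v = q k" by blast
    note lf = linear_functionalD[OF \<psi>[OF k(1)]]
    have Fc: "F \<subseteq> carrier A" using F(2) q by blast
    have "0 = \<psi> k (lincomb a F)" using F(3) lf by simp
    also have "\<dots> = (\<Sum>u\<in>F. a u * \<psi> k u)"
      unfolding lincomb_def using Fc lf
      by (subst linear_functional_finsum[OF \<psi>[OF k(1)]]) (auto intro!: sum.cong)
    also have "\<dots> = (\<Sum>u\<in>F. if u = v then a v else 0)"
    proof (rule sum.cong[OF refl])
      fix u assume "u \<in> F"
      then obtain i where i: "i \<in> I" "u = q i" using F(2) by blast
      have "u = v \<longleftrightarrow> i = k" using i k inj by (auto dest: inj_onD)
      then show "a u * \<psi> k u = (if u = v then a v else 0)" using dual[OF i(1) k(1)] i k by auto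
    qed
    also have "\<dots> = a v" using F by simp
    finally show False using F(5) by simp
  qed
  then have "card (q ` I) \<le> dim" using q by (intro li_le_dim[OF fd]) auto
  then show ?thesis using card_image[OF inj] by simp
qed

lemma finite_multilinear_words: "finite {w :: nat list. distinct w \<and> set w = {..<n}}"
proof (rule finite_subset)
  show "{w. distinct w \<and> set w = {..<n}} \<subseteq> {w. set w \<subseteq> {..<n} \<and> length w = n}"
  proof
    fix w :: "nat list" assume "w \<in> {w. distinct w \<and> set w = {..<n}}"
    then have w: "distinct w" "set w = {..<n}" by simp_all
    have "length w = n" using distinct_card[OF w(1)] by (simp add: w(2))
    then show "w \<in> {w. set w \<subseteq> {..<n} \<and> length w = n}" using w(2) by simp
  qed
  show "finite {w :: nat list. set w \<subseteq> {..<n} \<and> length w = n}" by (rule finite_lists_length_eq) simp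
qed

context assoc_algebra begin

text \<open>The quotient is spanned by the classes of the finitely many multilinear words. Its
  finite dimension is recorded because independent sets are bounded by \<open>fdim\<close> only in
  that case.\<close>

lemma multilinear_quotient:
  fixes n :: nat
  defines "V \<equiv> (FX :: ('f, nat list \<Rightarrow>\<^sub>0 'f) module)\<lparr>carrier := multilinear n\<rparr>"
  assumes n: "n \<ge> 1"
  shows "fvectorspace V" "subspace class_ring (multilinear n \<inter> identities A) V"
    "finite_dimensional (quotient_algebra V (multilinear n \<inter> identities A))"
proof -
  let ?Ws = "{w. distinct w \<and> set w = {..<n}}"
  let ?W = "multilinear n \<inter> identities A"
  have ml: "multilinear n = {p :: nat list \<Rightarrow>\<^sub>0 'f. Poly_Mapping.keys p \<subseteq> ?Ws}"
    by (auto simp: multilinear_def)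
  show V: "fvectorspace V" unfolding V_def ml by (rule word_support_vectorspace)
  interpret V: fvectorspace V by (rule V)
  have Vs: "carrier V = multilinear n" "add V = (+)" "zero V = 0" "smult V = (\<lambda>c. Poly_Mapping.map ((*) c))"
    by (simp_all add: V_def)
  show W: "subspace class_ring ?W V"
  proof (rule V.subspaceI)
    show "\<zero>\<^bsub>V\<^esub> \<in> ?W" using V.M.zero_closed by (simp add: Vs identities_iff)
  next
    fix x y assume xy: "x \<in> ?W" "y \<in> ?W"
    then have "x \<oplus>\<^bsub>V\<^esub> y \<in> multilinear n" using V.M.a_closed[of x y] by (simp add: Vs)
    moreover have "x + y \<in> identities A"
      using xy keys_add[of x y] by (auto simp: identities_iff evaluate_add)
    ultimately show "x \<oplus>\<^bsub>V\<^esub> y \<in> ?W" by (simp add: Vs)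
  next
    fix c x assume x: "x \<in> ?W"
    then have "c \<odot>\<^bsub>V\<^esub> x \<in> multilinear n" using V.smult_in[of x c] by (simp add: Vs)
    moreover have "Poly_Mapping.map ((*) c) x \<in> identities A"
      using x keys_scale[of c x] by (auto simp: identities_iff evaluate_scale)
    ultimately show "c \<odot>\<^bsub>V\<^esub> x \<in> ?W" by (simp add: Vs)
  qed (auto simp: Vs)
  let ?Q = "quotient_algebra V ?W"
  interpret Q: fvectorspace ?Q by (rule V.quotient_fvectorspace[OF W])
  note \<pi> = V.quotient_linear_hom[OF W]
  let ?G = "(\<lambda>w. ?W +>\<^bsub>V\<^esub> Poly_Mapping.single w 1) ` ?Ws"
  have single: "Poly_Mapping.single w c \<in> carrier V" if "w \<in> ?Ws" for w c
    using that by (auto simp: Vs ml)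
  have G: "?G \<subseteq> carrier ?Q" using single linear_homD(1)[OF \<pi>] by blast
  note span = Q.subspaceD[OF Q.fspan_subspace[OF G]]
  have "?W +>\<^bsub>V\<^esub> p \<in> fspan ?Q ?G" if p: "p \<in> carrier V" for p
  proof -
    have "Poly_Mapping.keys p \<subseteq> ?Ws" using p by (simp add: Vs ml)
    then show ?thesis
    proof (induction p rule: monomial_induct)
      case zero
      then show ?case
        using span(3) linear_hom_zero[OF V Q.fvectorspace_axioms \<pi>] by (simp add: Vs)
    next
      case (add q w c)
      have q: "q \<in> carrier V" using add.hyps by (simp add: Vs ml)
      have "Poly_Mapping.single w c = c \<odot>\<^bsub>V\<^esub> Poly_Mapping.single w 1" by (simp add: Vs)
      then have "?W +>\<^bsub>V\<^esub> Poly_Mapping.single w c \<in> fspan ?Q ?G"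
        using linear_homD(3)[OF \<pi> single[OF add.hyps(2)], of c 1] span(5) Q.fspan_base[OF G] add.hyps(2) by auto
      then show ?case
        using linear_homD(2)[OF \<pi> q single[OF add.hyps(2)], of c] add.IH span(4) by (simp add: Vs)
    qed
  qed
  then have "carrier ?Q \<subseteq> fspan ?Q ?G" unfolding V.quotient_carrier[OF W] by blast
  then have "fspan ?Q ?G = carrier ?Q" using span(1) by blast
  then show "finite_dimensional ?Q"
    unfolding Q.fin_dim_def using G finite_multilinear_words by (intro exI[of _ ?G]) auto
qed

text \<open>The words \<open>x\<^sub>i\<^sub>1 \<cdots> x\<^sub>i\<^sub>k y x\<^sub>j\<^sub>1 \<cdots> x\<^sub>j\<^sub>l\<close> with increasing indices in \<open>I\<close> and its complement are
  separated by the substitutions of \<open>e\<close> for the variables of a set \<open>K\<close> and \<open>f\<close> for the others.\<close>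

lemma exponential_codimension:
  assumes fd: fin_dim and in_A: "e \<in> carrier A" "f \<in> carrier A" "x \<in> carrier A"
    and ef: "e \<otimes> f = \<zero>" "f \<otimes> e = \<zero>" and ex: "e \<otimes> x = x" and xf: "x \<otimes> f = x"
    and x: "x \<noteq> \<zero>" and n: "n \<ge> 1"
  shows "2 ^ (n - 1) \<le> codimension A n"
proof -
  \<comment> \<open>The last variable plays the part of y. The remaining \<open>n - 1\<close>
    variables are distributed over its two sides, which gives the exponent of 2.\<close>
  define m where "m = n - 1"
  have n_eq: "n = Suc m" using n by (simp add: m_def)
  have fx: "f \<otimes> x = \<zero>" using mult_assoc[of f e x] ef ex in_A by simp
  have xe: "x \<otimes> e = \<zero>" using mult_assoc[of x f e] ef xf in_A by simp
  define word where "word I = sorted_list_of_set I @ m # sorted_list_of_set ({..<m} - I)" for I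
  define \<phi> where "\<phi> K l = (if l = m then x else if l \<in> K then e else f)" for K and l :: nat
  have \<phi>: "\<phi> K l \<in> carrier A" for K l using in_A by (simp add: \<phi>_def)
  \<comment> \<open>To the right of \<open>x\<close> only \<open>f\<close> survives, since
    \<open>xf = x\<close> and \<open>xe = 0\<close>.\<close>
  have suffix: "word_product A (map (\<phi> K) (m # w)) = (if set w \<inter> K = {} then x else \<zero>)"
    if "m \<notin> set w" for K w
  proof -
    have "x \<otimes> word_product A (map (\<phi> K) w) = (if set w \<inter> K = {} then x else \<zero>)" if "w \<noteq> []" "m \<notin> set w"
      using that
    proof (induction w)
      case (Cons l w)
      have l: "\<phi> K l = (if l \<in> K then e else f)" using Cons.prems by (auto simp: \<phi>_def)
      show ?case
      proof (cases "w = []")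
        case False
        have "x \<otimes> word_product A (map (\<phi> K) (l # w)) = (x \<otimes> \<phi> K l) \<otimes> word_product A (map (\<phi> K) w)"
          using False in_A \<phi> by (simp add: word_product_Cons mult_assoc)
        then show ?thesis using Cons False l xe xf by (auto simp: \<phi>)
      qed (use l xe xf in auto)
    qed simp
    then show ?thesis using that by (cases "w = []") (auto simp: word_product_Cons \<phi>_def)
  qed
  \<comment> \<open>To the left of \<open>x\<close> only \<open>e\<close> survives, since
    \<open>ex = x\<close> and \<open>fx = 0\<close>.\<close>
  have prefix: "word_product A (map (\<phi> K) (v @ w)) = (if set v \<subseteq> K then t else \<zero>)"
    if "word_product A (map (\<phi> K) w) = t" "t \<in> {x, \<zero>}" "w \<noteq> []" "m \<notin> set v" for K v w t
    using that(4)
  proof (induction v)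
    case (Cons l v)
    have l: "\<phi> K l = (if l \<in> K then e else f)" using Cons.prems by (auto simp: \<phi>_def)
    have "word_product A (map (\<phi> K) ((l # v) @ w)) = \<phi> K l \<otimes> (if set v \<subseteq> K then t else \<zero>)"
      using Cons that(3) by (simp add: word_product_Cons)
    then show ?case using that(2) l in_A ex fx by auto
  qed (use that in simp)
  have word_value: "word_product A (map (\<phi> K) (word I)) = (if I = K then x else \<zero>)"
    if "I \<subseteq> {..<m}" "K \<subseteq> {..<m}" for I K
  proof -
    have fin: "finite I" "finite ({..<m} - I)" "m \<notin> I" using that finite_subset by auto
    have "word_product A (map (\<phi> K) (m # sorted_list_of_set ({..<m} - I))) =
        (if ({..<m} - I) \<inter> K = {} then x else \<zero>)"
      using suffix[of "sorted_list_of_set ({..<m} - I)" K] fin by simp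
    from prefix[OF this, of "sorted_list_of_set I"]
    have "word_product A (map (\<phi> K) (word I)) =
        (if I \<subseteq> K then (if ({..<m} - I) \<inter> K = {} then x else \<zero>) else \<zero>)"
      using fin that by (auto simp: word_def)
    also have "\<dots> = (if I = K then x else \<zero>)" using that by auto
    finally show ?thesis .
  qed
  have word_ml: "distinct (word I) \<and> set (word I) = {..<n}" if "I \<subseteq> {..<m}" for I
    using that finite_subset[OF that] by (auto simp: word_def n_eq)
  let ?V = "(FX :: ('f, nat list \<Rightarrow>\<^sub>0 'f) module)\<lparr>carrier := multilinear n\<rparr>"
  let ?W = "multilinear n \<inter> identities A"
  let ?Q = "quotient_algebra ?V ?W"
  note V = multilinear_quotient(1)[OF n] and W = multilinear_quotient(2)[OF n] and Qfd = multilinear_quotient(3)[OF n]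
  interpret V: fvectorspace ?V by (rule V)
  interpret Q: fvectorspace ?Q by (rule V.quotient_fvectorspace[OF W])
  obtain \<chi> where \<chi>: "linear_functional A \<chi>" "\<chi> x = 1"
    using separating_functional[OF fd subspace_zero in_A(3)] x by blast
  note lf = linear_functionalD[OF \<chi>(1)]
  have "\<exists>h. linear_hom ?Q A h \<and> (\<forall>p\<in>carrier ?V. h (?W +>\<^bsub>?V\<^esub> p) = evaluate A (\<phi> K) p)" for K
  proof -
    have "linear_hom ?V A (evaluate A (\<phi> K))"
      by (rule linear_homI) (simp_all add: evaluate_closed[OF \<phi>] evaluate_add[OF \<phi>] evaluate_scale[OF \<phi>])
    from V.quotient_lift[OF W this fvectorspace_axioms] identitiesD[of _ A "\<phi> K"] \<phi>
    show ?thesis by (metis IntD2)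
  qed
  then obtain h where h: "\<And>K. linear_hom ?Q A (h K)"
      "\<And>K p. p \<in> carrier ?V \<Longrightarrow> h K (?W +>\<^bsub>?V\<^esub> p) = evaluate A (\<phi> K) p"
    by metis
  have in_V: "Poly_Mapping.single (word I) 1 \<in> carrier ?V" if "I \<in> Pow {..<m}" for I
    using word_ml[of I] that by (auto simp: multilinear_def)
  have "card (Pow {..<m}) \<le> Q.dim"
  proof (rule Q.dual_family_card[OF Qfd])
    show "?W +>\<^bsub>?V\<^esub> Poly_Mapping.single (word I) 1 \<in> carrier ?Q" if "I \<in> Pow {..<m}" for I
      using linear_homD(1)[OF V.quotient_linear_hom[OF W] in_V[OF that]] .
    show "linear_functional ?Q (\<lambda>q. \<chi> (h K q))" for K
      using linear_homD[OF h(1)[of K]] lf by (auto simp: linear_functional_def)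
    show "\<chi> (h K (?W +>\<^bsub>?V\<^esub> Poly_Mapping.single (word I) 1)) = (if I = K then 1 else 0)"
      if "I \<in> Pow {..<m}" "K \<in> Pow {..<m}" for I K
      using h(2)[OF in_V[OF that(1)], of K] word_value[of I K] that \<chi>(2) lf(3) in_A
      by (auto simp: evaluate_single[OF \<phi>])
  qed
  then show ?thesis by (simp add: codimension_def card_Pow m_def)
qed

lemma not_polynomial_growth:
  assumes "fin_dim" "e \<in> carrier A" "f \<in> carrier A" "x \<in> carrier A"
    and "e \<otimes> f = \<zero>" "f \<otimes> e = \<zero>" "e \<otimes> x = x" "x \<otimes> f = x" "x \<noteq> \<zero>"
  shows "\<not> polynomial_growth A"
proof
  assume "polynomial_growth A"
  then obtain a b :: real where ab: "a > 0" "b > 0"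
    "\<And>n. n \<ge> 1 \<Longrightarrow> real (codimension A n) \<le> a * real n powr b" by (auto simp: polynomial_growth_def)
  have bound: "2 ^ n / 2 \<le> a * real n powr b" if n: "n \<ge> 1" for n
  proof -
    have "real (2 ^ (n - 1)) \<le> real (codimension A n)"
      using exponential_codimension[OF assms n] by (simp only: of_nat_le_iff)
    moreover have "2 ^ n / 2 = real (2 ^ (n - 1))" using n by (cases n) auto
    ultimately show ?thesis using ab(3)[OF n] by linarith
  qed
  \<comment> \<open>An integral exponent not below \<open>b\<close>, for which the limit of a
    natural power over the exponential is available, taken at \<open>n ln 2\<close>.\<close>
  define N where "N = nat \<lceil>b\<rceil>"
  have "filterlim (\<lambda>n. real n * ln 2) at_top sequentially"
    by (rule filterlim_at_top_mult_tendsto_pos[OF tendsto_const _ filterlim_real_sequentially]) simp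
  then have "(\<lambda>n. (real n * ln 2) ^ N / exp (real n * ln 2)) \<longlonglongrightarrow> 0"
    by (rule filterlim_compose[OF tendsto_power_div_exp_0])
  \<comment> \<open>The threshold is chosen so that \<open>ln 2 ^ N\<close> cancels and the
    inequality becomes \<open>a * real n ^ N < 2 ^ n / 2\<close>, against the bound for the
    codimensions.\<close>
  then have "eventually (\<lambda>n. (real n * ln 2) ^ N / exp (real n * ln 2) < ln 2 ^ N / (2 * a)) sequentially"
    by (rule order_tendstoD(2)) (use ab(1) in simp)
  then obtain n where n: "n \<ge> 1" "(real n * ln 2) ^ N / exp (real n * ln 2) < ln 2 ^ N / (2 * a)"
    using eventually_conj[OF eventually_ge_at_top[of "1 :: nat"]] eventually_happens'[OF sequentially_bot]
    by (metis (mono_tags, lifting))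
  have "exp (real n * ln 2) = (2 :: real) ^ n"
    by (simp add: exp_of_nat_mult)
  then have "a * real n ^ N < 2 ^ n / 2"
    using n(2) ab(1) by (simp add: power_mult_distrib field_simps)
  have "real n powr b \<le> real n powr real N"
    using n(1) ab(2) by (intro powr_mono) (auto simp: N_def)
  moreover have "real n powr real N = real n ^ N" using n(1) by (simp add: powr_realpow)
  ultimately have "a * real n powr b \<le> a * real n ^ N"
    using ab(1) by (intro mult_left_mono) simp_all
  with \<open>a * real n ^ N < 2 ^ n / 2\<close> have "a * real n powr b < 2 ^ n / 2" by linarith
  then show False using bound[OF n(1)] by simp
qed

end

section \<open>Simple algebras\<close>

context assoc_algebra begin

text \<open>Horner evaluation of a polynomial at \<open>b\<close>, with \<open>e\<close> standing in
  for the unit that \<open>A\<close> may lack.\<close>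

definition poly_action :: "'a \<Rightarrow> 'a \<Rightarrow> 'f poly \<Rightarrow> 'a" where
  "poly_action e b p = fold_coeffs (\<lambda>c y. c \<odot> e \<oplus> b \<otimes> y) p \<zero>"

context
  fixes e b assumes e: "e \<in> carrier A" and b: "b \<in> carrier A"
begin

lemma poly_action_0 [simp]: "poly_action e b 0 = \<zero>"
  by (simp add: poly_action_def)

lemma poly_action_pCons: "poly_action e b (pCons c p) = c \<odot> e \<oplus> b \<otimes> poly_action e b p"
proof (cases "c = 0 \<and> p = 0")
  case True
  then show ?thesis using e b by simp
next
  case False
  then have "fold_coeffs (\<lambda>c y. c \<odot> e \<oplus> b \<otimes> y) (pCons c p) =
      (\<lambda>y. c \<odot> e \<oplus> b \<otimes> y) \<circ> fold_coeffs (\<lambda>c y. c \<odot> e \<oplus> b \<otimes> y) p"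
    by (cases "p = 0") simp_all
  then show ?thesis by (simp add: poly_action_def)
qed

lemma poly_action_closed [simp]: "poly_action e b p \<in> carrier A"
  by (induction p) (use e b in \<open>simp_all add: poly_action_pCons\<close>)

lemma poly_action_add: "poly_action e b (p + q) = poly_action e b p \<oplus> poly_action e b q"
proof (induction p arbitrary: q)
  case (pCons c p)
  obtain d r where q: "q = pCons d r" by (cases q)
  show ?case unfolding q using e b pCons.IH[of r]
    by (simp add: poly_action_pCons add_smult mult_add_right M.a_ac)
qed simp

lemma poly_action_smult: "poly_action e b (Polynomial.smult c p) = c \<odot> poly_action e b p"
  by (induction p) (use e b in \<open>simp_all add: poly_action_pCons smult_add mult_smult mult_smult_right\<close>)

lemma poly_action_unit:
  assumes "e \<otimes> e = e" "e \<otimes> b = b" "b \<otimes> e = b"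
  shows "e \<otimes> poly_action e b p = poly_action e b p"
  using assms e b by (induction p) (simp_all add: poly_action_pCons bilinear flip: mult_assoc)

text \<open>Among the spaces of values of all multiples of a nonzero \<open>q\<close>, take a
  minimal one. Multiplying \<open>q\<close> by the variable X does not shrink it, so
  \<open>q\<close> and some \<open>q X r\<close> act alike and \<open>q (1 - X r)\<close> acts as
  zero. This is a nonzero polynomial because \<open>1 - X r\<close> has the value 1 at 0.\<close>

lemma annihilating_polynomial:
  assumes fd: fin_dim
  obtains p where "p \<noteq> 0" "poly_action e b p = \<zero>"
proof -
  let ?U = "\<lambda>q. (\<lambda>r. poly_action e b (q * r)) ` UNIV"
  have sub: "subspace class_ring (?U q) A" for q
  proof (rule subspaceI)
    show "\<zero> \<in> ?U q" by (rule image_eqI[of _ _ 0]) simp_all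
  next
    fix y z assume "y \<in> ?U q" "z \<in> ?U q"
    then obtain r s where "y = poly_action e b (q * r)" "z = poly_action e b (q * s)" by blast
    then have "y \<oplus> z = poly_action e b (q * (r + s))" by (simp add: distrib_left poly_action_add)
    then show "y \<oplus> z \<in> ?U q" by blast
  next
    fix c y assume "y \<in> ?U q"
    then obtain r where "y = poly_action e b (q * r)" by blast
    then have "c \<odot> y = poly_action e b (q * Polynomial.smult c r)" by (simp add: poly_action_smult)
    then show "c \<odot> y \<in> ?U q" by blast
  qed auto
  obtain M where M: "M \<in> ?U ` {q. q \<noteq> 0}" "\<And>W. \<lbrakk>W \<in> ?U ` {q. q \<noteq> 0}; W \<subseteq> M\<rbrakk> \<Longrightarrow> W = M"
  proof (rule minimal_subspace[OF fd, of "?U 1" "?U ` {q. q \<noteq> 0}"])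
    show "?U 1 \<in> ?U ` {q. q \<noteq> 0}" by (rule imageI) simp
    show "subspace class_ring W A" if "W \<in> ?U ` {q. q \<noteq> 0}" for W using that sub by blast
  qed (rule that)
  then obtain q where q: "q \<noteq> 0" "M = ?U q" by blast
  have "?U (q * [:0, 1:]) \<in> ?U ` {q. q \<noteq> 0}" using q(1) by (intro imageI) simp
  moreover have "?U (q * [:0, 1:]) \<subseteq> M" unfolding q(2) by (auto simp: mult.assoc simp del: mult_pCons_left mult_pCons_right)
  ultimately have "?U (q * [:0, 1:]) = ?U q" using M(2) q(2) by blast
  moreover have "poly_action e b (q * 1) \<in> ?U q" by blast
  ultimately obtain r where r: "poly_action e b (q * 1) = poly_action e b (q * [:0, 1:] * r)" by blast
  have "poly_action e b (q * (1 - [:0, 1:] * r)) = poly_action e b (q * 1 + Polynomial.smult (- 1) (q * [:0, 1:] * r))"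
    by (simp only: right_diff_distrib mult.assoc smult_minus_left smult_1_left add_uminus_conv_diff)
  also have "\<dots> = poly_action e b (q * 1) \<oplus> (- 1) \<odot> poly_action e b (q * [:0, 1:] * r)"
    by (simp only: poly_action_add poly_action_smult)
  also have "\<dots> = \<zero>" unfolding r neg_eq_smult[OF poly_action_closed, symmetric] by (rule M.r_neg) simp
  finally have "poly_action e b (q * (1 - [:0, 1:] * r)) = \<zero>" .
  moreover have "1 - [:0, 1:] * r \<noteq> 0"
  proof
    assume "1 - [:0, 1:] * r = 0"
    then have "poly (1 - [:0, 1:] * r) 0 = 0" by simp
    then show False by simp
  qed
  ultimately show ?thesis using that[of "q * (1 - [:0, 1:] * r)"] q(1) by (metis mult_eq_0_iff)
qed

end

text \<open>The last alternative says that \<open>A\<close> contains a copy of the upper triangular \<open>2 \<times> 2\<close> matrices.\<close>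

lemma simple_algebra_dichotomy:
  assumes fd: fin_dim and simple: "simple_algebra A"
    and closed: "\<And>p :: 'f poly. degree p > 0 \<Longrightarrow> \<exists>c. poly p c = 0"
  shows "(\<exists>e\<in>carrier A. e \<noteq> \<zero> \<and> e \<otimes> e = e \<and> (\<forall>s\<in>carrier A. \<exists>c. s = c \<odot> e)) \<or>
    (\<exists>e\<in>carrier A. \<exists>f\<in>carrier A. \<exists>x\<in>carrier A.
      e \<otimes> f = \<zero> \<and> f \<otimes> e = \<zero> \<and> e \<otimes> x = x \<and> x \<otimes> f = x \<and> x \<noteq> \<zero>)"
proof -
  have ideal: "I = {\<zero>} \<or> I = carrier A" if "alg_ideal A I" for I
    using simple that by (simp add: simple_algebra_def)
  obtain a0 b0 where a0: "a0 \<in> carrier A" "b0 \<in> carrier A" "a0 \<otimes> b0 \<noteq> \<zero>"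
    using simple by (auto simp: simple_algebra_def)
  have left_ann: "a = \<zero>" if a: "a \<in> carrier A" "\<And>s. s \<in> carrier A \<Longrightarrow> a \<otimes> s = \<zero>" for a
  proof -
    let ?I = "{a \<in> carrier A. \<forall>s\<in>carrier A. a \<otimes> s = \<zero>}"
    have "alg_ideal A ?I"
      by (rule alg_idealI[OF subspaceI]) (auto simp: bilinear mult_assoc)
    moreover have "?I \<noteq> carrier A" using a0 by auto
    ultimately have "?I = {\<zero>}" using ideal by blast
    moreover have "a \<in> ?I" using a by simp
    ultimately show ?thesis by simp
  qed
  have right_ann: "a = \<zero>" if a: "a \<in> carrier A" "\<And>s. s \<in> carrier A \<Longrightarrow> s \<otimes> a = \<zero>" for a
  proof -
    let ?I = "{a \<in> carrier A. \<forall>s\<in>carrier A. s \<otimes> a = \<zero>}"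
    have "alg_ideal A ?I"
      by (rule alg_idealI[OF subspaceI]) (auto simp: bilinear simp flip: mult_assoc)
    moreover have "?I \<noteq> carrier A" using a0 by auto
    ultimately have "?I = {\<zero>}" using ideal by blast
    moreover have "a \<in> ?I" using a by simp
    ultimately show ?thesis by simp
  qed
  \<comment> \<open>The idempotent is sought in a minimal left ideal \<open>L\<close>. Simplicity
    gives \<open>LA = A\<close>, so an element killing \<open>L\<close> from the left kills all of
    \<open>A\<close> and is zero.\<close>
  have "carrier A \<in> {L. left_ideal A L \<and> L \<noteq> {\<zero>}}" using left_ideal_carrier a0 by auto
  then obtain L where L: "left_ideal A L" "L \<noteq> {\<zero>}"
    and min: "\<And>M. \<lbrakk>left_ideal A M; M \<noteq> {\<zero>}; M \<subseteq> L\<rbrakk> \<Longrightarrow> M = L"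
  proof (rule minimal_subspace[OF fd])
    show "subspace class_ring W A" if "W \<in> {L. left_ideal A L \<and> L \<noteq> {\<zero>}}" for W
      using that left_idealD(1) by blast
  qed auto
  note Lc = subspaceD[OF left_idealD(1)[OF L(1)]]
  have LA: "subspace_mult A L (carrier A) = carrier A"
  proof -
    have "alg_ideal A (subspace_mult A L (carrier A))"
      by (rule left_right_ideal_mult[OF L(1) subspace_carrier]) simp
    moreover have "subspace_mult A L (carrier A) \<noteq> {\<zero>}"
    proof
      assume "subspace_mult A L (carrier A) = {\<zero>}"
      then have "\<forall>l\<in>L. \<forall>s\<in>carrier A. l \<otimes> s = \<zero>" using subspace_mult_eq_zero_iff[OF Lc(1)] by simp
      then have "L \<subseteq> {\<zero>}" using left_ann Lc(2) by blast
      then show False using L(2) Lc(3) by blast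
    qed
    ultimately show ?thesis using ideal by blast
  qed
  have kill_left: "a = \<zero>" if a: "a \<in> carrier A" "\<And>l. l \<in> L \<Longrightarrow> a \<otimes> l = \<zero>" for a
  proof (rule left_ann[OF a(1)])
    have "subspace class_ring {y \<in> carrier A. a \<otimes> y = \<zero>} A"
      by (rule subspaceI) (use a(1) in \<open>auto simp: bilinear\<close>)
    then have "subspace_mult A L (carrier A) \<subseteq> {y \<in> carrier A. a \<otimes> y = \<zero>}"
    proof (rule subspace_mult_minimal)
      fix l s assume "l \<in> L" "s \<in> carrier A"
      then show "l \<otimes> s \<in> {y \<in> carrier A. a \<otimes> y = \<zero>}"
        using a mult_assoc[of a l s] Lc(2) by simp
    qed
    then show "a \<otimes> s = \<zero>" if "s \<in> carrier A" for s using LA that by blast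
  qed
  obtain x where x: "x \<in> L" "\<exists>l\<in>L. l \<otimes> x \<noteq> \<zero>"
  proof -
    obtain l where l: "l \<in> L" "l \<noteq> \<zero>" using L(2) Lc(3) by blast
    then obtain x where "x \<in> L" "l \<otimes> x \<noteq> \<zero>" using kill_left[of l] Lc(2) by blast
    then show ?thesis using that l(1) by blast
  qed
  have xA: "x \<in> carrier A" using x(1) Lc(2) by simp
  \<comment> \<open>By minimality, right multiplication by \<open>x\<close> is a bijection of
    \<open>L\<close>: its image is \<open>L\<close>, and its kernel \<open>?Z\<close> below is zero.
    The preimage \<open>e\<close> of \<open>x\<close> satisfies \<open>(ee - e)x = 0\<close> and is
    therefore idempotent.\<close>
  have Lx: "(\<lambda>l. l \<otimes> x) ` L = L"
  proof (rule min)
    show "left_ideal A ((\<lambda>l. l \<otimes> x) ` L)" by (rule left_multiples_left_ideal[OF L(1) xA])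
    show "(\<lambda>l. l \<otimes> x) ` L \<noteq> {\<zero>}" using x(2) by blast
    show "(\<lambda>l. l \<otimes> x) ` L \<subseteq> L" using left_idealD(2)[OF L(1)] x(1) Lc(2) by blast
  qed
  then obtain e where e: "e \<in> L" "e \<otimes> x = x" using x(1) by (metis imageE)
  have eA [simp]: "e \<in> carrier A" using e(1) Lc(2) by simp
  have xne: "x \<noteq> \<zero>" using x(2) Lc(2) by auto
  let ?Z = "{l \<in> L. l \<otimes> x = \<zero>}"
  have Z: "?Z = {\<zero>}"
  proof (rule ccontr)
    assume ne: "?Z \<noteq> {\<zero>}"
    have "left_ideal A ?Z"
      by (rule left_idealI[OF subspaceI])
        (use xA Lc left_idealD(2)[OF L(1)] in \<open>auto simp: bilinear mult_assoc\<close>)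
    then have "?Z = L" using ne by (intro min) auto
    then show False using x(2) by blast
  qed
  have ee: "e \<otimes> e = e"
  proof -
    have "e \<otimes> e \<ominus> e \<in> L" using e(1) left_idealD(2)[OF L(1)] Lc(7) by simp
    moreover have "(e \<otimes> e \<ominus> e) \<otimes> x = \<zero>" using xA e(2) by (simp add: bilinear mult_assoc)
    ultimately have "e \<otimes> e \<ominus> e = \<zero>" using Z by blast
    then show ?thesis by (simp add: diff_eq_zero_iff)
  qed
  have ene: "e \<noteq> \<zero>" using e(2) xne xA by auto
  have right_multiples: "(\<lambda>s. s \<otimes> d) ` carrier A = L" if d: "d \<in> L" "d \<noteq> \<zero>" "e \<otimes> d = d" for d
  proof (rule min)
    show "left_ideal A ((\<lambda>s. s \<otimes> d) ` carrier A)"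
      using d(1) Lc(2) by (intro left_multiples_left_ideal left_ideal_carrier) simp
    have "d \<in> (\<lambda>s. s \<otimes> d) ` carrier A" using d(3) eA by (metis imageI)
    then show "(\<lambda>s. s \<otimes> d) ` carrier A \<noteq> {\<zero>}" using d(2) by blast
    show "(\<lambda>s. s \<otimes> d) ` carrier A \<subseteq> L" using left_idealD(2)[OF L(1)] d(1) by blast
  qed
  have Le: "l \<otimes> e = l" if l: "l \<in> L" for l
  proof -
    obtain s where "s \<in> carrier A" "l = s \<otimes> e" using right_multiples[OF e(1) ene ee] l by blast
    then show ?thesis using ee by (simp add: mult_assoc)
  qed
  have division: "\<exists>s\<in>carrier A. s \<otimes> d = e" if "d \<in> L" "d \<noteq> \<zero>" "e \<otimes> d = d" for d
    using right_multiples[OF that] e(1) by (metis imageE)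
  text \<open>Since \<open>F\<close> is algebraically closed, the division algebra \<open>eAe\<close> is \<open>Fe\<close>.\<close>
  have scalar: "\<exists>c. d = c \<odot> e" if d: "d \<in> carrier A" "e \<otimes> d = d" "d \<otimes> e = d" for d
  proof -
    have dL: "d \<in> L" using left_idealD(2)[OF L(1) d(1) e(1)] d(3) by simp
    have root: "\<exists>c. d = c \<odot> e" if "p \<noteq> 0" "poly_action e d p = \<zero>" for p
      using that
    proof (induction "degree p" arbitrary: p rule: less_induct)
      case less
      show ?case
      proof (cases "degree p = 0")
        case True
        then obtain c where "p = [:c:]" by (rule degree_eq_zeroE)
        then have "c \<odot> e = \<zero>" "c \<noteq> 0" using less.prems d(1) by (simp_all add: poly_action_pCons)
        then show ?thesis using ene smult_eq_zero_iff[OF eA] by simp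
      next
        case False
        then obtain c where "poly p c = 0" using closed by blast
        then obtain q where q: "p = [:- c, 1:] * q" by (metis dvdE poly_eq_0_iff_dvd)
        then have qne: "q \<noteq> 0" using less.prems by auto
        have deg: "degree q < degree p" unfolding q using qne by (subst degree_mult_eq) auto
        let ?y = "poly_action e d q"
        have y: "?y \<in> carrier A" using d(1) by simp
        have ey: "e \<otimes> ?y = ?y" by (rule poly_action_unit[OF eA d(1) ee d(2,3)])
        have "p = Polynomial.smult (- c) q + pCons 0 q" by (simp add: q)
        then have "poly_action e d p = (- c) \<odot> ?y \<oplus> (0 \<odot> e \<oplus> d \<otimes> ?y)"
          by (simp only: poly_action_add[OF eA d(1)] poly_action_smult[OF eA d(1)] poly_action_pCons[OF eA d(1)])
        also have "\<dots> = (- c) \<odot> ?y \<oplus> d \<otimes> ?y" using d(1) y by simp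
        also have "\<dots> = (d \<ominus> c \<odot> e) \<otimes> ?y"
          using d(1) y ey by (simp add: bilinear uminus_smult a_minus_def M.a_comm)
        finally have z: "(d \<ominus> c \<odot> e) \<otimes> ?y = \<zero>" using less.prems by simp
        show ?thesis
        proof (cases "?y = \<zero>")
          case True
          show ?thesis by (rule less.hyps[OF deg qne True])
        next
          case yne: False
          have "d \<ominus> c \<odot> e = \<zero>"
          proof (rule ccontr)
            assume ne: "d \<ominus> c \<odot> e \<noteq> \<zero>"
            have "d \<ominus> c \<odot> e \<in> L" using dL e(1) Lc(5,7) by blast
            moreover have "e \<otimes> (d \<ominus> c \<odot> e) = d \<ominus> c \<odot> e" using d ee by (simp add: bilinear)
            ultimately obtain s where s: "s \<in> carrier A" "s \<otimes> (d \<ominus> c \<odot> e) = e"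
              using division ne by blast
            have "?y = (s \<otimes> (d \<ominus> c \<odot> e)) \<otimes> ?y" using s(2) ey by simp
            also have "\<dots> = s \<otimes> ((d \<ominus> c \<odot> e) \<otimes> ?y)" using s(1) d(1) y by (intro mult_assoc) simp_all
            also have "\<dots> = \<zero>" using z s(1) by simp
            finally show False using yne by simp
          qed
          then show ?thesis using d(1) by (auto simp: diff_eq_zero_iff)
        qed
      qed
    qed
    obtain p where "p \<noteq> 0" "poly_action e d p = \<zero>" by (rule annihilating_polynomial[OF eA d(1) fd])
    then show ?thesis by (rule root)
  qed
  show ?thesis
  proof (cases "\<forall>s\<in>carrier A. e \<otimes> s = (e \<otimes> s) \<otimes> e")
    case True
    have "\<exists>c. s = c \<odot> e" if s: "s \<in> carrier A" for s
    proof -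
      have es: "\<exists>c. e \<otimes> a = c \<odot> e" if a: "a \<in> carrier A" for a
        using a True ee by (intro scalar) (simp_all flip: mult_assoc)
      \<comment> \<open>In this case \<open>eA = Fe\<close>. As \<open>l = le\<close>, the product
        \<open>(la)t = l(ea)t\<close> is a multiple of \<open>l(et) = 0\<close>, so all of
        \<open>A = LA\<close> kills \<open>t\<close>. Hence \<open>s = es\<close> lies in
        \<open>Fe\<close>.\<close>
      let ?t = "s \<ominus> e \<otimes> s"
      have tA: "?t \<in> carrier A" using s by simp
      have et: "e \<otimes> ?t = \<zero>" using s ee by (simp add: bilinear flip: mult_assoc)
      have "?t = \<zero>"
      proof (rule right_ann[OF tA])
        have "subspace class_ring {y \<in> carrier A. y \<otimes> ?t = \<zero>} A"
          by (rule subspaceI) (use tA in \<open>auto simp: mult_add_left mult_smult_left\<close>)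
        then have "subspace_mult A L (carrier A) \<subseteq> {y \<in> carrier A. y \<otimes> ?t = \<zero>}"
        proof (rule subspace_mult_minimal)
          fix l a assume la: "l \<in> L" "a \<in> carrier A"
          obtain c where c: "e \<otimes> a = c \<odot> e" using es la(2) by blast
          have "(l \<otimes> a) \<otimes> ?t = l \<otimes> (e \<otimes> (a \<otimes> ?t))"
            using la Lc(2) tA Le[OF la(1)] mult_assoc[of l e "a \<otimes> ?t"] by (simp add: mult_assoc)
          also have "e \<otimes> (a \<otimes> ?t) = c \<odot> (e \<otimes> ?t)"
            using la tA c mult_assoc[of e a ?t] by (simp add: mult_smult_left)
          finally show "l \<otimes> a \<in> {y \<in> carrier A. y \<otimes> ?t = \<zero>}" using et la Lc(2) by simp
        qed
        then show "y \<otimes> ?t = \<zero>" if "y \<in> carrier A" for y using LA that by blast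
      qed
      then have "s = e \<otimes> s" using s by (simp add: diff_eq_zero_iff)
      then show ?thesis using es[OF s] by simp
    qed
    then show ?thesis using eA ene ee by blast
  next
    case False
    then obtain s where s: "s \<in> carrier A" "e \<otimes> s \<noteq> (e \<otimes> s) \<otimes> e" by blast
    \<comment> \<open>A nonzero element of \<open>eA(1 - e)\<close>, which becomes the off-diagonal
      matrix unit. Below, \<open>v\<close> is built in \<open>(1 - e)A\<close> with
      \<open>uv = e\<close>; then \<open>f = vu\<close> is orthogonal to \<open>e\<close> and
      \<open>uf = u\<close>.\<close>
    define u where "u = e \<otimes> s \<ominus> (e \<otimes> s) \<otimes> e"
    have uA: "u \<in> carrier A" using s by (simp add: u_def)
    have une: "u \<noteq> \<zero>" using s by (simp add: u_def diff_eq_zero_iff)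
    have eu: "e \<otimes> u = u" using s ee by (simp add: u_def bilinear flip: mult_assoc)
    have ue: "u \<otimes> e = \<zero>" using s ee by (simp add: u_def bilinear mult_assoc)
    obtain l where l: "l \<in> L" "u \<otimes> l \<noteq> \<zero>" using kill_left[OF uA] une by blast
    have lA: "l \<in> carrier A" using l(1) Lc(2) by simp
    obtain c where c: "u \<otimes> l = c \<odot> e"
      using scalar[of "u \<otimes> l"] uA lA eu Le[OF l(1)] by (auto simp: mult_assoc simp flip: mult_assoc[of e])
    then have "c \<noteq> 0" using l(2) by auto
    define v where "v = inverse c \<odot> l \<ominus> e \<otimes> (inverse c \<odot> l)"
    have vA: "v \<in> carrier A" using lA by (simp add: v_def)
    have uv: "u \<otimes> v = e"
    proof -
      have "u \<otimes> (e \<otimes> (inverse c \<odot> l)) = \<zero>" using uA lA ue mult_assoc[of u e "inverse c \<odot> l"] by simp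
      moreover have "u \<otimes> (inverse c \<odot> l) = e"
        using uA lA c \<open>c \<noteq> 0\<close> by (simp add: bilinear flip: mult_smult)
      ultimately show ?thesis using uA lA by (simp add: v_def mult_minus_right)
    qed
    have ev: "e \<otimes> v = \<zero>" using lA ee by (simp add: v_def mult_minus_right flip: mult_assoc)
    have "e \<otimes> (v \<otimes> u) = \<zero>" using ev uA vA mult_assoc[of e v u] by simp
    moreover have "(v \<otimes> u) \<otimes> e = \<zero>" using ue uA vA mult_assoc[of v u e] by simp
    moreover have "u \<otimes> (v \<otimes> u) = u" using uv eu uA vA mult_assoc[of u v u] by simp
    moreover have "v \<otimes> u \<in> carrier A" using uA vA by simp
    ultimately show ?thesis using eA uA eu une by blast
  qed
qed

end

section \<open>Algebras of polynomial growth\<close>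

lemma wedderburn_malcev_component:
  fixes A :: "('f :: field, 'a) module" (structure)
  assumes A: "assoc_algebra A" and wm: "wedderburn_malcev A \<C>" and S: "S \<in> \<C>"
  shows "subspace class_ring S A" "assoc_algebra (A\<lparr>carrier := S\<rparr>)" "simple_algebra (A\<lparr>carrier := S\<rparr>)"
proof -
  interpret assoc_algebra A by (rule A)
  show 1: "subspace class_ring S A" "simple_algebra (A\<lparr>carrier := S\<rparr>)"
    using wm S by (simp_all add: wedderburn_malcev_def)
  have "S <#> S \<subseteq> S" using wm S by (simp add: wedderburn_malcev_def)
  then have "x \<otimes> y \<in> S" if "x \<in> S" "y \<in> S" for x y using that by (auto simp: set_mult_def)
  then show "assoc_algebra (A\<lparr>carrier := S\<rparr>)" by (rule subalgebra[OF 1(1)])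
qed

text \<open>A larger simple component would contain a copy of the upper triangular 2 x 2 matrices,
  whose presence makes the codimensions of \<open>A\<close> grow exponentially.\<close>

lemma polynomial_growth_component:
  fixes A :: "('f :: alg_closed_field, 'a) module" (structure)
  assumes A: "assoc_algebra A" and fd: "finite_dimensional A" and pg: "polynomial_growth A"
    and wm: "wedderburn_malcev A \<C>" and S: "S \<in> \<C>"
  obtains e where "e \<in> S" "e \<noteq> \<zero>" "e \<otimes> e = e" "S = range (\<lambda>c. c \<odot> e)"
proof -
  interpret assoc_algebra A by (rule A)
  note S' = wedderburn_malcev_component[OF A wm S]
  note Sc = subspaceD[OF S'(1)]
  interpret S: assoc_algebra "A\<lparr>carrier := S\<rparr>" by (rule S'(2))
  have "\<exists>c. poly p c = 0" if "degree p > 0" for p :: "'f poly"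
    using alg_closed_imp_poly_has_root[OF that] .
  from S.simple_algebra_dichotomy[OF subspace_is_fin_dim[OF fd S'(1)] S'(3) this]
  show ?thesis
  proof
    assume "\<exists>e\<in>carrier (A\<lparr>carrier := S\<rparr>). e \<noteq> \<zero>\<^bsub>A\<lparr>carrier := S\<rparr>\<^esub> \<and> e \<otimes>\<^bsub>A\<lparr>carrier := S\<rparr>\<^esub> e = e \<and>
      (\<forall>s\<in>carrier (A\<lparr>carrier := S\<rparr>). \<exists>c. s = c \<odot>\<^bsub>A\<lparr>carrier := S\<rparr>\<^esub> e)"
    then obtain e where "e \<in> S" "e \<noteq> \<zero>" "e \<otimes> e = e" "\<And>s. s \<in> S \<Longrightarrow> \<exists>c. s = c \<odot> e" by auto
    then show ?thesis using that Sc(5) by blast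
  next
    assume "\<exists>e\<in>carrier (A\<lparr>carrier := S\<rparr>). \<exists>f\<in>carrier (A\<lparr>carrier := S\<rparr>). \<exists>x\<in>carrier (A\<lparr>carrier := S\<rparr>).
      e \<otimes>\<^bsub>A\<lparr>carrier := S\<rparr>\<^esub> f = \<zero>\<^bsub>A\<lparr>carrier := S\<rparr>\<^esub> \<and> f \<otimes>\<^bsub>A\<lparr>carrier := S\<rparr>\<^esub> e = \<zero>\<^bsub>A\<lparr>carrier := S\<rparr>\<^esub> \<and>
      e \<otimes>\<^bsub>A\<lparr>carrier := S\<rparr>\<^esub> x = x \<and> x \<otimes>\<^bsub>A\<lparr>carrier := S\<rparr>\<^esub> f = x \<and> x \<noteq> \<zero>\<^bsub>A\<lparr>carrier := S\<rparr>\<^esub>"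
    then obtain e f x where "e \<in> S" "f \<in> S" "x \<in> S" "e \<otimes> f = \<zero>" "f \<otimes> e = \<zero>" "e \<otimes> x = x" "x \<otimes> f = x" "x \<noteq> \<zero>"
      by auto
    then show ?thesis using not_polynomial_growth[OF fd, of e f x] Sc(2) pg by blast
  qed
qed

text \<open>If \<open>e\<^sub>1Ae\<^sub>2 = e\<^sub>2Ae\<^sub>1 = 0\<close>, then no monomial with a nonzero value involves both \<open>e\<^sub>1\<close> and \<open>e\<^sub>2\<close>.\<close>

lemma (in assoc_algebra) orthogonal_word_product:
  assumes e1: "e1 \<in> carrier A" and e2: "e2 \<in> carrier A" and b: "\<And>n. b n \<in> carrier A"
    and e12: "e1 \<otimes> e2 = \<zero>" "\<And>c. c \<in> carrier A \<Longrightarrow> (e1 \<otimes> c) \<otimes> e2 = \<zero>"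
    and e21: "e2 \<otimes> e1 = \<zero>" "\<And>c. c \<in> carrier A \<Longrightarrow> (e2 \<otimes> c) \<otimes> e1 = \<zero>"
    and w: "w \<noteq> []"
  defines "W \<equiv> \<lambda>\<phi>. word_product A (map \<phi> w)"
  shows "W (\<lambda>n. b n \<oplus> (\<alpha> n \<odot> e1 \<oplus> \<beta> n \<odot> e2)) = (W (\<lambda>n. b n \<oplus> \<alpha> n \<odot> e1) \<oplus> W (\<lambda>n. b n \<oplus> \<beta> n \<odot> e2)) \<ominus> W b"
proof -
  let ?W = "\<lambda>w \<phi>. word_product A (map \<phi> w)"
  let ?\<phi>1 = "\<lambda>n. b n \<oplus> \<alpha> n \<odot> e1" and ?\<phi>2 = "\<lambda>n. b n \<oplus> \<beta> n \<odot> e2"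
  let ?\<phi> = "\<lambda>n. b n \<oplus> (\<alpha> n \<odot> e1 \<oplus> \<beta> n \<odot> e2)"
  have cl: "?W w b \<in> carrier A" "?W w ?\<phi>1 \<in> carrier A" "?W w ?\<phi>2 \<in> carrier A" "?W w ?\<phi> \<in> carrier A" for w
    using b e1 e2 by (simp_all add: word_closed)
  \<comment> \<open>The difference collects the terms with at least one factor \<open>g\<close>.
    Behind \<open>f\<close>, with or without an element in between, such a term contains a vanishing
    product from \<open>f\<close> to \<open>g\<close>. Both versions are carried along so that the
    induction closes.\<close>
  have kill: "f \<otimes> (?W w (\<lambda>n. b n \<oplus> \<gamma> n \<odot> g) \<ominus> ?W w b) = \<zero> \<and>
      (\<forall>c\<in>carrier A. (f \<otimes> c) \<otimes> (?W w (\<lambda>n. b n \<oplus> \<gamma> n \<odot> g) \<ominus> ?W w b) = \<zero>)"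
    if f: "f \<in> carrier A" and g: "g \<in> carrier A" and fg: "f \<otimes> g = \<zero>" "\<And>c. c \<in> carrier A \<Longrightarrow> (f \<otimes> c) \<otimes> g = \<zero>"
    for f g \<gamma> w
  proof (induction w)
    case Nil
    then show ?case using f by simp
  next
    case (Cons x w)
    have gc: "?W w (\<lambda>n. b n \<oplus> \<gamma> n \<odot> g) \<in> carrier A" for w using b g by (simp add: word_closed)
    show ?case
    proof (cases "w = []")
      case True
      have "(b x \<oplus> \<gamma> x \<odot> g) \<ominus> b x = \<gamma> x \<odot> g" using b g by (intro add_diff_cancel_left) simp_all
      then show ?thesis using True f g fg by (simp add: mult_smult_right)
    next
      case False
      let ?D = "?W w (\<lambda>n. b n \<oplus> \<gamma> n \<odot> g) \<ominus> ?W w b" and ?V = "?W w (\<lambda>n. b n \<oplus> \<gamma> n \<odot> g)"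
      have D: "?W (x # w) (\<lambda>n. b n \<oplus> \<gamma> n \<odot> g) \<ominus> ?W (x # w) b = b x \<otimes> ?D \<oplus> \<gamma> x \<odot> (g \<otimes> ?V)"
        using False b g gc[of w] cl(1)[of w]
        by (simp add: word_product_Cons bilinear group_norm)
      have *: "h \<otimes> (b x \<otimes> ?D \<oplus> \<gamma> x \<odot> (g \<otimes> ?V)) = (h \<otimes> b x) \<otimes> ?D \<oplus> \<gamma> x \<odot> ((h \<otimes> g) \<otimes> ?V)"
        if "h \<in> carrier A" for h
        using that b g gc[of w] cl(1)[of w] by (simp add: mult_add_right mult_smult_right mult_assoc)
      have "f \<otimes> (b x \<otimes> ?D \<oplus> \<gamma> x \<odot> (g \<otimes> ?V)) = \<zero>"
        using *[OF f] Cons.IH b fg(1) gc[of w] by simp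
      moreover have "(f \<otimes> c) \<otimes> (b x \<otimes> ?D \<oplus> \<gamma> x \<odot> (g \<otimes> ?V)) = \<zero>" if c: "c \<in> carrier A" for c
      proof -
        have "(f \<otimes> c) \<otimes> b x = f \<otimes> (c \<otimes> b x)" using f c b by (simp add: mult_assoc)
        then have "((f \<otimes> c) \<otimes> b x) \<otimes> ?D = \<zero>" using Cons.IH c b by simp
        then show ?thesis using *[of "f \<otimes> c"] f c fg(2)[OF c] gc[of w] by simp
      qed
      ultimately show ?thesis unfolding D by blast
    qed
  qed
  have "?W w ?\<phi> = (?W w ?\<phi>1 \<oplus> ?W w ?\<phi>2) \<ominus> ?W w b"
    using w
  proof (induction w)
    case (Cons x w)
    show ?case
    proof (cases "w = []")
      case True
      then show ?thesis using b[of x] e1 e2 by (simp add: group_norm)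
    next
      case False
      let ?B = "?W w b" and ?P = "?W w ?\<phi>1" and ?Q = "?W w ?\<phi>2"
      have k1: "e1 \<otimes> (?Q \<ominus> ?B) = \<zero>" using kill[OF e1 e2 e12] by blast
      have k2: "e2 \<otimes> (?P \<ominus> ?B) = \<zero>" using kill[OF e2 e1 e21] by blast
      \<comment> \<open>In front of the remaining word, \<open>e1\<close> does not see the
        \<open>e2\<close> parts, nor \<open>e2\<close> the \<open>e1\<close> parts. The value at
        \<open>b\<close> is subtracted because both summands contain it.\<close>
      have k1': "e1 \<otimes> ?Q = e1 \<otimes> ?B" "e2 \<otimes> ?P = e2 \<otimes> ?B"
        using k1 k2 e1 e2 cl[of w] by (simp_all add: mult_minus_right diff_eq_zero_iff)
      have "?W (x # w) ?\<phi> = ?\<phi> x \<otimes> ((?P \<oplus> ?Q) \<ominus> ?B)"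
        using False Cons.IH by (simp add: word_product_Cons)
      also have "\<dots> = b x \<otimes> ((?P \<oplus> ?Q) \<ominus> ?B) \<oplus> (\<alpha> x \<odot> (e1 \<otimes> ((?P \<oplus> ?Q) \<ominus> ?B)) \<oplus> \<beta> x \<odot> (e2 \<otimes> ((?P \<oplus> ?Q) \<ominus> ?B)))"
        using b[of x] e1 e2 cl[of w] by (simp add: mult_add_left mult_smult_left)
      also have "e1 \<otimes> ((?P \<oplus> ?Q) \<ominus> ?B) = e1 \<otimes> ?P"
        using e1 cl[of w] k1'(1) by (simp add: mult_add_right mult_neg_right a_minus_def M.a_assoc M.r_neg)
      also have "e2 \<otimes> ((?P \<oplus> ?Q) \<ominus> ?B) = e2 \<otimes> ?Q"
        using e2 cl[of w] k1'(2) by (simp add: mult_add_right mult_minus_right add_diff_cancel_left)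
      also have "b x \<otimes> ((?P \<oplus> ?Q) \<ominus> ?B) \<oplus> (\<alpha> x \<odot> (e1 \<otimes> ?P) \<oplus> \<beta> x \<odot> (e2 \<otimes> ?Q)) =
          (?\<phi>1 x \<otimes> ?P \<oplus> ?\<phi>2 x \<otimes> ?Q) \<ominus> b x \<otimes> ?B"
        using b[of x] e1 e2 cl[of w] by (simp add: bilinear a_minus_def M.a_ac)
      finally show ?thesis using False by (simp add: word_product_Cons)
    qed
  qed simp
  then show ?thesis by (simp add: W_def)
qed

lemma (in assoc_algebra) orthogonal_evaluate:
  assumes e1: "e1 \<in> carrier A" and e2: "e2 \<in> carrier A" and b: "\<And>n. b n \<in> carrier A"
    and e12: "e1 \<otimes> e2 = \<zero>" "\<And>c. c \<in> carrier A \<Longrightarrow> (e1 \<otimes> c) \<otimes> e2 = \<zero>"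
    and e21: "e2 \<otimes> e1 = \<zero>" "\<And>c. c \<in> carrier A \<Longrightarrow> (e2 \<otimes> c) \<otimes> e1 = \<zero>"
    and fd: fin_dim and p: "p \<in> carrier FX"
  shows "evaluate A (\<lambda>n. b n \<oplus> (\<alpha> n \<odot> e1 \<oplus> \<beta> n \<odot> e2)) p =
    (evaluate A (\<lambda>n. b n \<oplus> \<alpha> n \<odot> e1) p \<oplus> evaluate A (\<lambda>n. b n \<oplus> \<beta> n \<odot> e2) p) \<ominus> evaluate A b p"
    (is "?l = ?r")
proof -
  have in_A: "b n \<oplus> (\<alpha> n \<odot> e1 \<oplus> \<beta> n \<odot> e2) \<in> carrier A" "b n \<oplus> \<alpha> n \<odot> e1 \<in> carrier A"
    "b n \<oplus> \<beta> n \<odot> e2 \<in> carrier A" for n using b e1 e2 by simp_all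
  note ec = evaluate_closed[of "\<lambda>n. b n \<oplus> (\<alpha> n \<odot> e1 \<oplus> \<beta> n \<odot> e2)" p, OF in_A(1)]
    evaluate_closed[of "\<lambda>n. b n \<oplus> \<alpha> n \<odot> e1" p, OF in_A(2)]
    evaluate_closed[of "\<lambda>n. b n \<oplus> \<beta> n \<odot> e2" p, OF in_A(3)] evaluate_closed[of b p, OF b]
  have cl: "?l \<in> carrier A" "?r \<in> carrier A"
    using ec by simp_all
  show ?thesis
  proof (rule eq_if_functionals_agree[OF fd cl])
    fix \<psi> assume \<psi>: "linear_functional A \<psi>"
    note lf = linear_functionalD[OF \<psi>]
    have ev: "\<psi> (evaluate A \<phi> p) = word_sum p (\<lambda>w. \<psi> (word_product A (map \<phi> w)))"
      if "\<And>n. \<phi> n \<in> carrier A" for \<phi>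
      unfolding word_sum_def by (rule linear_functional_evaluate[of \<phi>, OF that \<psi>])
    have "\<psi> ?l = word_sum p (\<lambda>w. \<psi> (word_product A (map (\<lambda>n. b n \<oplus> \<alpha> n \<odot> e1) w)) +
        \<psi> (word_product A (map (\<lambda>n. b n \<oplus> \<beta> n \<odot> e2) w)) + (- 1) * \<psi> (word_product A (map b w)))"
      unfolding ev[of "\<lambda>n. b n \<oplus> (\<alpha> n \<odot> e1 \<oplus> \<beta> n \<odot> e2)", OF in_A(1)]
    proof (rule word_sum_cong)
      fix w assume "w \<in> Poly_Mapping.keys p"
      then have "w \<noteq> []" using p by auto
      from orthogonal_word_product[of e1 e2 b w \<alpha> \<beta>, OF e1 e2 b e12 e21 this]
      show "\<psi> (word_product A (map (\<lambda>n. b n \<oplus> (\<alpha> n \<odot> e1 \<oplus> \<beta> n \<odot> e2)) w)) =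
        \<psi> (word_product A (map (\<lambda>n. b n \<oplus> \<alpha> n \<odot> e1) w)) +
        \<psi> (word_product A (map (\<lambda>n. b n \<oplus> \<beta> n \<odot> e2) w)) + (- 1) * \<psi> (word_product A (map b w))"
        using word_closed[of "\<lambda>n. b n \<oplus> \<alpha> n \<odot> e1" w, OF in_A(2)]
          word_closed[of "\<lambda>n. b n \<oplus> \<beta> n \<odot> e2" w, OF in_A(3)] word_closed[of b w, OF b]
        by (simp add: lf)
    qed
    also have "\<dots> = \<psi> (evaluate A (\<lambda>n. b n \<oplus> \<alpha> n \<odot> e1) p) + \<psi> (evaluate A (\<lambda>n. b n \<oplus> \<beta> n \<odot> e2) p)
        + (- 1) * \<psi> (evaluate A b p)"
      unfolding word_sum_add word_sum_scale ev[of "\<lambda>n. b n \<oplus> \<alpha> n \<odot> e1", OF in_A(2)]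
        ev[of "\<lambda>n. b n \<oplus> \<beta> n \<odot> e2", OF in_A(3)] ev[of b, OF b] ..
    also have "\<dots> = \<psi> ?r"
      using ec by (simp add: lf)
    finally show "\<psi> ?l = \<psi> ?r" .
  qed
qed

lemma (in assoc_algebra) omit_summand_assoc:
  assumes wm: "wedderburn_malcev A \<C>"
  shows "assoc_algebra (omit_summand A \<C> V)" "\<Union>(\<C> - {V}) \<union> jacobson_radical A \<subseteq> carrier A"
proof -
  let ?G = "\<Union>(\<C> - {V}) \<union> jacobson_radical A"
  have sub: "T \<subseteq> carrier A" if "T \<in> \<C>" for T
  proof -
    have "subspace class_ring T A" using wm that by (simp add: wedderburn_malcev_def)
    then show ?thesis by (rule subspaceD(1))
  qed
  then show G: "?G \<subseteq> carrier A" using radical_subset by blast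
  note S = subspaceD[OF fspan_subspace[OF G]] and base = fspan_base[OF G]
  have "x \<otimes> y \<in> fspan A ?G" if xy: "x \<in> ?G" "y \<in> ?G" for x y
  proof (cases "x \<in> jacobson_radical A \<or> y \<in> jacobson_radical A")
    case True
    then have "x \<otimes> y \<in> jacobson_radical A" using alg_idealD(2,3)[OF radical_ideal] xy G by blast
    then show ?thesis by (intro base) simp
  next
    case False
    then obtain T U where TU: "T \<in> \<C>" "U \<in> \<C>" "T \<noteq> V" "x \<in> T" "y \<in> U" using xy by blast
    have prod: "x \<otimes> y \<in> T <#> U" using TU by (auto simp: set_mult_def)
    have "T <#> U \<subseteq> T \<or> T <#> U \<subseteq> {\<zero>}"
      using wm TU(1,2) by (cases "T = U") (simp_all add: wedderburn_malcev_def)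
    then show ?thesis
    proof
      assume "T <#> U \<subseteq> T"
      from subsetD[OF this prod] show ?thesis using TU(1,3) by (intro base) blast
    next
      assume "T <#> U \<subseteq> {\<zero>}" from subsetD[OF this prod] show ?thesis using S(3) by simp
    qed
  qed
  note mult = fspan_mult_closed[OF G this]
  show "assoc_algebra (omit_summand A \<C> V)"
    unfolding omit_summand_def by (rule subalgebra[OF fspan_subspace[OF G] mult])
qed

text \<open>With a single component, the condition on omitted summands in \<open>fundamental\<close>
  becomes one on the identities of the radical.\<close>

lemma (in assoc_algebra) omit_all_components:
  "omit_summand A {S} S = A\<lparr>carrier := jacobson_radical A\<rparr>"
  by (simp add: omit_summand_def fspan_of_subspace[OF radical_subspace])

text \<open>With two components \<open>Fe\<^sub>1\<close> and \<open>Fe\<^sub>2\<close>, polynomial growth forces \<open>e\<^sub>1Ae\<^sub>2 = e\<^sub>2Ae\<^sub>1 = 0\<close>, so that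
  \<open>Id(A)\<close> is the intersection of the identities of the two algebras with one component omitted.\<close>

lemma one_component:
  fixes A :: "('f :: alg_closed_field, 'a) module" (structure)
  assumes A: "assoc_algebra A" and fd: "finite_dimensional A" and nn: "\<not> nilpotent_algebra A"
    and fund: "fundamental A" and pg: "polynomial_growth A" and s: "s_index A = 2"
  obtains S e f where "wedderburn_malcev A {S}" "e \<in> S" "e \<noteq> \<zero>" "e \<otimes> e = e" "S = range (\<lambda>c. c \<odot> e)"
    "f \<in> identities (A\<lparr>carrier := jacobson_radical A\<rparr>)" "f \<in> identities (algebra_calA_mod A {S} 2)"
    "f \<notin> identities A"
proof -
  interpret assoc_algebra A by (rule A)
  let ?J = "jacobson_radical A"
  have Jne: "?J \<noteq> carrier A" using nilpotent_if_radical_is_all[OF fd] nn by blast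
  \<comment> \<open>A zero radical would give \<open>s_index\<close> 0. So the radical is a proper
    nonzero ideal, \<open>A\<close> is not simple, and the second clause of
    \<open>fundamental\<close> applies.\<close>
  have Jnz: "?J \<noteq> {\<zero>}"
  proof
    assume J: "?J = {\<zero>}"
    have "s_index A = 0" unfolding s_index_def by (rule Least_eq_0) (simp add: J)
    then show False using s by simp
  qed
  have "\<not> simple_algebra A" using Jne Jnz radical_ideal by (auto simp: simple_algebra_def)
  then obtain \<C> where wm: "wedderburn_malcev A \<C>"
    and sub: "identities A \<subset> (\<Inter>S\<in>\<C>. identities (omit_summand A \<C> S)) \<inter> identities (algebra_calA_mod A \<C> 2)"
    using fund s by (auto simp: fundamental_def)
  obtain f where f: "f \<notin> identities A" "\<And>S. S \<in> \<C> \<Longrightarrow> f \<in> identities (omit_summand A \<C> S)"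
      "f \<in> identities (algebra_calA_mod A \<C> 2)"
    using sub by blast
  have fFX: "f \<in> carrier FX" using f(3) by (simp add: identities_iff)
  note comp = polynomial_growth_component[OF A fd pg wm]
  have "\<C> \<noteq> {}"
  proof
    assume "\<C> = {}"
    then have "carrier A = fspan A ({\<zero>} \<union> ?J)"
      using wm by (simp add: wedderburn_malcev_def semisimple_part_def fspan_empty)
    also have "{\<zero>} \<union> ?J = ?J" using subspaceD(3)[OF radical_subspace] by blast
    finally show False using Jne fspan_of_subspace[OF radical_subspace] by simp
  qed
  then obtain S where S: "S \<in> \<C>" by blast
  have "T = S" if T: "T \<in> \<C>" for T
  proof (rule ccontr)
    assume TS: "T \<noteq> S"
    obtain e1 where e1: "e1 \<in> S" "e1 \<noteq> \<zero>" "e1 \<otimes> e1 = e1" "S = range (\<lambda>c. c \<odot> e1)" by (rule comp[OF S])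
    obtain e2 where e2: "e2 \<in> T" "e2 \<noteq> \<zero>" "e2 \<otimes> e2 = e2" "T = range (\<lambda>c. c \<odot> e2)" by (rule comp[OF T])
    have e1A: "e1 \<in> carrier A" using e1(1) subspaceD(2)[OF wedderburn_malcev_component(1)[OF A wm S]] by blast
    have e2A: "e2 \<in> carrier A" using e2(1) subspaceD(2)[OF wedderburn_malcev_component(1)[OF A wm T]] by blast
    have orth: "e1 \<otimes> e2 = \<zero>" "e2 \<otimes> e1 = \<zero>"
    proof -
      have 1: "S <#> T \<subseteq> {\<zero>}" "T <#> S \<subseteq> {\<zero>}" using wm S T TS by (simp_all add: wedderburn_malcev_def)
      have "e1 \<otimes> e2 \<in> S <#> T" "e2 \<otimes> e1 \<in> T <#> S" using e1(1) e2(1) by (auto simp: set_mult_def)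
      then show "e1 \<otimes> e2 = \<zero>" "e2 \<otimes> e1 = \<zero>" using subsetD[OF 1(1)] subsetD[OF 1(2)] by simp_all
    qed
    \<comment> \<open>A nonzero product \<open>gch\<close> would link the two idempotents, as the
      element \<open>x\<close> in \<open>not_polynomial_growth\<close> does.\<close>
    have no: "(g \<otimes> c) \<otimes> h = \<zero>" if "g \<in> carrier A" "h \<in> carrier A" "c \<in> carrier A" "g \<otimes> g = g" "h \<otimes> h = h"
      "g \<otimes> h = \<zero>" "h \<otimes> g = \<zero>" for g h c
    proof (rule ccontr)
      assume ne: "(g \<otimes> c) \<otimes> h \<noteq> \<zero>"
      have "g \<otimes> ((g \<otimes> c) \<otimes> h) = (g \<otimes> c) \<otimes> h"
        using that(1-4) by (simp flip: mult_assoc)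
      moreover have "((g \<otimes> c) \<otimes> h) \<otimes> h = (g \<otimes> c) \<otimes> h"
        using that(1-3,5) by (simp add: mult_assoc)
      ultimately show False
        using not_polynomial_growth[OF fd that(1,2) _ that(6,7) _ _ ne] pg that(1-3) by simp
    qed
    note oc = omit_summand_assoc(2)[OF wm]
    \<comment> \<open>Contained in both algebras that omit \<open>S\<close> or \<open>T\<close>. A
      substitution into \<open>A\<close> splits into a part in \<open>U\<close> plus multiples of
      \<open>e1\<close> and \<open>e2\<close>, and dropping either multiple lands where
      \<open>f\<close> is an identity.\<close>
    define U where "U = fspan A (\<Union>(\<C> - {S, T}) \<union> ?J)"
    have Uc: "\<Union>(\<C> - {S, T}) \<union> ?J \<subseteq> carrier A" using oc[of S] by blast
    have Us: "subspace class_ring U A" unfolding U_def by (rule fspan_subspace[OF Uc])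
    have U_in: "U \<subseteq> carrier (omit_summand A \<C> V)" if "V \<in> {S, T}" for V
    proof -
      have "\<Union>(\<C> - {S, T}) \<union> ?J \<subseteq> \<Union>(\<C> - {V}) \<union> ?J" using that by blast
      from fspan_mono[OF this oc] show ?thesis by (simp add: U_def omit_summand_def)
    qed
    have e1_in: "e1 \<in> carrier (omit_summand A \<C> T)"
      using fspan_base[OF oc, of e1 T] e1(1) S TS by (auto simp: omit_summand_def)
    have e2_in: "e2 \<in> carrier (omit_summand A \<C> S)"
      using fspan_base[OF oc, of e2 S] e2(1) T TS by (auto simp: omit_summand_def)
    have vanish: "evaluate A \<phi> f = \<zero>" if V: "V \<in> \<C>" and \<phi>: "\<And>n. \<phi> n \<in> carrier (omit_summand A \<C> V)" for V \<phi>
    proof -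
      have O: "assoc_algebra (A\<lparr>carrier := fspan A (\<Union>(\<C> - {V}) \<union> ?J)\<rparr>)"
        using omit_summand_assoc(1)[OF wm, of V] by (simp add: omit_summand_def)
      have "evaluate A \<phi> f = evaluate (omit_summand A \<C> V) \<phi> f"
        unfolding omit_summand_def
        by (rule evaluate_subalgebra[OF A O, symmetric]) (use fspan_closed[OF oc] \<phi> in \<open>simp_all add: omit_summand_def\<close>)
      also have "\<dots> = \<zero>" using identitiesD[of f "omit_summand A \<C> V" \<phi>, OF f(2)[OF V] \<phi>] by (simp add: omit_summand_def)
      finally show ?thesis .
    qed
    have "evaluate A \<phi> f = \<zero>" if \<phi>: "\<And>n. \<phi> n \<in> carrier A" for \<phi>
    proof -
      note Ss = wedderburn_malcev_component(1)[OF A wm S] and Ts = wedderburn_malcev_component(1)[OF A wm T]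
      have STc: "S \<union> T \<subseteq> carrier A" using subspaceD(1)[OF Ss] subspaceD(1)[OF Ts] by blast
      let ?ST = "fspan A (S \<union> T)"
      have STs: "subspace class_ring ?ST A" by (rule fspan_subspace[OF STc])
      have UST: "U \<union> ?ST \<subseteq> carrier A" using subspaceD(1)[OF Us] subspaceD(1)[OF STs] by blast
      have all: "subspace class_ring (fspan A (U \<union> ?ST)) A" by (rule fspan_subspace[OF UST])
      have "V \<subseteq> U \<union> ?ST" if "V \<in> \<C>" for V
        using that fspan_superset[OF STc] fspan_superset[OF Uc] by (auto simp: U_def)
      then have "\<Union>\<C> \<subseteq> fspan A (U \<union> ?ST)" using fspan_superset[OF UST] by blast
      then have "semisimple_part A \<C> \<subseteq> fspan A (U \<union> ?ST)"
        unfolding semisimple_part_def by (rule fspan_minimal[OF all])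
      moreover have "?J \<subseteq> fspan A (U \<union> ?ST)"
        using fspan_superset[OF Uc] fspan_superset[OF UST] by (auto simp: U_def)
      ultimately have "fspan A (semisimple_part A \<C> \<union> ?J) \<subseteq> fspan A (U \<union> ?ST)"
        by (intro fspan_minimal[OF all]) blast
      then have in_sum: "\<phi> n \<in> fspan A (U \<union> ?ST)" for n
        using wm \<phi>[of n] by (auto simp: wedderburn_malcev_def)
      have "\<exists>u a b. u \<in> U \<and> \<phi> n = u \<oplus> (a \<odot> e1 \<oplus> b \<odot> e2)" for n
      proof -
        obtain u y where uy: "u \<in> U" "y \<in> ?ST" "\<phi> n = u \<oplus> y"
          by (rule fspan_Un_subspaces[OF Us STs in_sum])
        obtain c d where "c \<in> S" "d \<in> T" "y = c \<oplus> d" by (rule fspan_Un_subspaces[OF Ss Ts uy(2)])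
        then show ?thesis using uy e1(4) e2(4) by blast
      qed
      then obtain u \<alpha> \<beta> where u: "\<And>n. u n \<in> U" and eq: "\<And>n. \<phi> n = u n \<oplus> (\<alpha> n \<odot> e1 \<oplus> \<beta> n \<odot> e2)" by metis
      have uA: "u n \<in> carrier A" for n using u subspaceD(2)[OF Us] by blast
      have cl: "x \<oplus> c \<odot> y \<in> carrier (omit_summand A \<C> V)"
        if "x \<in> carrier (omit_summand A \<C> V)" "y \<in> carrier (omit_summand A \<C> V)" for x c y V
        using subspaceD(4,5)[OF fspan_subspace[OF oc[of V]]] that by (simp add: omit_summand_def)
      have "evaluate A (\<lambda>n. u n \<oplus> \<alpha> n \<odot> e1) f = \<zero>"
        by (rule vanish[OF T]) (use cl e1_in U_in[of T] u in blast)
      moreover have "evaluate A (\<lambda>n. u n \<oplus> \<beta> n \<odot> e2) f = \<zero>"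
        by (rule vanish[OF S]) (use cl e2_in U_in[of S] u in blast)
      moreover have "evaluate A u f = \<zero>" by (rule vanish[OF S]) (use U_in[of S] u in blast)
      moreover have "\<phi> = (\<lambda>n. u n \<oplus> (\<alpha> n \<odot> e1 \<oplus> \<beta> n \<odot> e2))" using eq by blast
      ultimately show ?thesis
        using orthogonal_evaluate[of e1 e2 u f \<alpha> \<beta>, OF e1A e2A uA orth(1) no[OF e1A e2A _ e1(3) e2(3) orth]
            orth(2) no[OF e2A e1A _ e2(3) e1(3) orth(2,1)] fd fFX] by simp
    qed
    then show False using f(1) fFX by (simp add: identities_iff del: free_algebra_simps)
  qed
  then have "\<C> = {S}" using S by blast
  obtain e where e: "e \<in> S" "e \<noteq> \<zero>" "e \<otimes> e = e" "S = range (\<lambda>c. c \<odot> e)" by (rule comp[OF S])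
  show ?thesis
    using that[OF _ e, of f] wm f(1,3) f(2)[OF S] omit_all_components[of S] \<open>\<C> = {S}\<close> by simp
qed

section \<open>Corners contained in the square of the radical\<close>

context peirce_algebra begin

abbreviation J2 where "J2 \<equiv> subspace_mult A J J"

lemma J_subset: "J \<subseteq> carrier A"
  using subspaceD(1)[OF J_subspace] .

lemmas J2_subspace = subspace_mult_subspace[OF J_subset J_subset]

lemma J_mult_J2:
  assumes "j \<in> J" "y \<in> J2" shows "j \<otimes> y = \<zero>" "y \<otimes> j = \<zero>"
proof -
  have "subspace class_ring {y \<in> carrier A. j \<otimes> y = \<zero> \<and> y \<otimes> j = \<zero>} A"
    by (rule subspaceI) (use assms(1) in \<open>auto simp: bilinear\<close>)
  then have "J2 \<subseteq> {y \<in> carrier A. j \<otimes> y = \<zero> \<and> y \<otimes> j = \<zero>}"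
    by (rule subspace_mult_minimal) (use assms(1) cube cube' in auto)
  then show "j \<otimes> y = \<zero>" "y \<otimes> j = \<zero>" using assms(2) by auto
qed

lemma J2_subset_J: "J2 \<subseteq> J"
  by (rule subspace_mult_minimal[OF J_subspace]) (use alg_idealD(2)[OF J_ideal] in auto)

text \<open>If \<open>J\<^sub>1\<^sub>0 \<subseteq> J\<^sup>2\<close>, then \<open>J\<^sub>1\<^sub>0 = J\<^sub>1\<^sub>1J\<^sub>1\<^sub>0 + J\<^sub>1\<^sub>0J\<^sub>0\<^sub>0 \<subseteq> J\<^sup>3 = 0\<close>.\<close>

lemma J10_not_in_J2:
  assumes sub: "J10 \<subseteq> J2" and v: "v \<in> J10" shows "v = \<zero>"
proof -
  \<comment> \<open>The equation says that \<open>y\<close> has no component in the corner (1,0).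
    For \<open>y = ab\<close> and \<open>s = b(1 - e)\<close> this component is
    \<open>eas = ea(1 - e)s + ea(es)\<close>. Both \<open>ea(1 - e)\<close> and \<open>es\<close>
    lie in \<open>J10\<close>, hence in \<open>J\<^sup>2\<close>, and are killed by
    \<open>J\<close>.\<close>
  have "subspace class_ring {y \<in> carrier A. e \<otimes> y = (e \<otimes> y) \<otimes> e} A"
    by (rule subspaceI) (auto simp: bilinear)
  then have "J2 \<subseteq> {y \<in> carrier A. e \<otimes> y = (e \<otimes> y) \<otimes> e}"
  proof (rule subspace_mult_minimal)
    fix a b assume ab: "a \<in> J" "b \<in> J"
    note I = alg_idealD(2,3)[OF J_ideal e_in]
    have ee: "e \<otimes> (e \<otimes> y) = e \<otimes> y" "(y \<otimes> e) \<otimes> e = y \<otimes> e" if "y \<in> carrier A" for y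
      using mult_assoc[of e e y] mult_assoc[of y e e] e_idem that by simp_all
    let ?s = "b \<ominus> b \<otimes> e"
    have s: "?s \<in> J" using ab I subspaceD(7)[OF J_subspace] by simp
    have se: "?s \<otimes> e = \<zero>" using ab ee by (simp add: bilinear)
    have "e \<otimes> ?s \<in> J10" using s se I ee mult_assoc[of e ?s e] by (simp add: J10_def)
    then have t: "(e \<otimes> a) \<otimes> (e \<otimes> ?s) = \<zero>" using sub I(1)[OF ab(1)] J_mult_J2(1) by blast
    let ?g = "e \<otimes> a \<ominus> (e \<otimes> a) \<otimes> e"
    have "?g \<in> J10"
      using ab I subspaceD(7)[OF J_subspace] ee by (simp add: J10_def mult_minus_right mult_minus_left flip: mult_assoc)
    then have g: "?g \<otimes> ?s = \<zero>" using sub s J_mult_J2(2) by blast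
    have "(e \<otimes> a) \<otimes> ?s = ?g \<otimes> ?s \<oplus> ((e \<otimes> a) \<otimes> e) \<otimes> ?s"
      using ab s by (simp add: mult_minus_left diff_add_cancel)
    also have "((e \<otimes> a) \<otimes> e) \<otimes> ?s = (e \<otimes> a) \<otimes> (e \<otimes> ?s)" using ab s by (simp add: mult_assoc)
    finally have "(e \<otimes> a) \<otimes> ?s = \<zero>" using g t by simp
    then have "(e \<otimes> a) \<otimes> b \<ominus> (e \<otimes> a) \<otimes> (b \<otimes> e) = \<zero>" using ab by (simp add: mult_minus_right)
    then show "a \<otimes> b \<in> {y \<in> carrier A. e \<otimes> y = (e \<otimes> y) \<otimes> e}"
      using ab ee by (simp add: diff_eq_zero_iff mult_assoc e_idem)
  qed
  then have "e \<otimes> v = (e \<otimes> v) \<otimes> e" using sub v by blast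
  then show ?thesis using corner_e(3,4)[OF v] by simp
qed

text \<open>Mirror image of \<open>J10_not_in_J2\<close>, with \<open>(1 - e)a\<close> in the role
  of \<open>b(1 - e)\<close>.\<close>

lemma J01_not_in_J2:
  assumes sub: "J01 \<subseteq> J2" and w: "w \<in> J01" shows "w = \<zero>"
proof -
  have "subspace class_ring {y \<in> carrier A. y \<otimes> e = e \<otimes> (y \<otimes> e)} A"
    by (rule subspaceI) (auto simp: bilinear)
  then have "J2 \<subseteq> {y \<in> carrier A. y \<otimes> e = e \<otimes> (y \<otimes> e)}"
  proof (rule subspace_mult_minimal)
    fix a b assume ab: "a \<in> J" "b \<in> J"
    note I = alg_idealD(2,3)[OF J_ideal e_in]
    have ee: "e \<otimes> (e \<otimes> y) = e \<otimes> y" "(y \<otimes> e) \<otimes> e = y \<otimes> e" if "y \<in> carrier A" for y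
      using mult_assoc[of e e y] mult_assoc[of y e e] e_idem that by simp_all
    let ?s = "a \<ominus> e \<otimes> a"
    have s: "?s \<in> J" using ab I subspaceD(7)[OF J_subspace] by simp
    have es: "e \<otimes> ?s = \<zero>" using ab ee by (simp add: bilinear)
    have "?s \<otimes> e \<in> J01" using s es I ee mult_assoc[of e ?s e] by (simp add: J01_def)
    then have t: "(?s \<otimes> e) \<otimes> (b \<otimes> e) = \<zero>" using sub I(2)[OF ab(2)] J_mult_J2(2) by blast
    let ?g = "b \<otimes> e \<ominus> e \<otimes> (b \<otimes> e)"
    have "?g \<in> J01"
      using ab I subspaceD(7)[OF J_subspace] ee by (simp add: J01_def mult_minus_right mult_minus_left mult_assoc)
    then have g: "?s \<otimes> ?g = \<zero>" using sub s J_mult_J2(1) by blast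
    have "?s \<otimes> (b \<otimes> e) = ?s \<otimes> ?g \<oplus> ?s \<otimes> (e \<otimes> (b \<otimes> e))"
      using ab s by (simp add: mult_minus_right diff_add_cancel)
    also have "?s \<otimes> (e \<otimes> (b \<otimes> e)) = (?s \<otimes> e) \<otimes> (b \<otimes> e)" using ab s by (simp add: mult_assoc)
    finally have "?s \<otimes> (b \<otimes> e) = \<zero>" using g t by simp
    then have "a \<otimes> (b \<otimes> e) \<ominus> (e \<otimes> a) \<otimes> (b \<otimes> e) = \<zero>" using ab by (simp add: mult_minus_left)
    then show "a \<otimes> b \<in> {y \<in> carrier A. y \<otimes> e = e \<otimes> (y \<otimes> e)}"
      using ab ee by (simp add: diff_eq_zero_iff mult_assoc e_idem)
  qed
  then have "w \<otimes> e = e \<otimes> (w \<otimes> e)" using sub w by blast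
  then show ?thesis using corner_e(5,6)[OF w] by simp
qed

end

section \<open>The detector algebra\<close>

lemma optional_summand_assoc: "assoc_algebra M \<Longrightarrow> assoc_algebra (optional_summand \<epsilon> M)"
  by (simp add: optional_summand_def zero_subalgebra)

lemma identities_optional_summand:
  assumes "assoc_algebra M"
  shows "identities (optional_summand \<epsilon> M) = (if \<epsilon> = 0 then carrier FX else identities M)"
  by (simp only: optional_summand_def identities_zero_subalgebra[OF assms] split: if_split) simp

lemma model_assoc:
  "assoc_algebra A1" "assoc_algebra A1_star" "assoc_algebra A2" "assoc_algebra A4"
  "assoc_algebra A4_star" "assoc_algebra A5" "assoc_algebra A6"
  unfolding models by (rule model2_assoc model3_assoc; simp)+

lemma identities_detector_algebra:
  "p \<in> identities (detector_algebra A e) \<longleftrightarrow> p \<in> carrier FX \<and>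
    (eps1 A e \<noteq> 0 \<longrightarrow> p \<in> identities A1) \<and> (eps1_star A e \<noteq> 0 \<longrightarrow> p \<in> identities A1_star) \<and>
    (eps2 A e \<noteq> 0 \<longrightarrow> p \<in> identities A2) \<and> (eps4 A e \<noteq> 0 \<longrightarrow> p \<in> identities A4) \<and>
    (eps4_star A e \<noteq> 0 \<longrightarrow> p \<in> identities A4_star) \<and> (eps5 A e \<noteq> 0 \<longrightarrow> p \<in> identities A5) \<and>
    (eps6 A e \<noteq> 0 \<longrightarrow> p \<in> identities A6)"
proof -
  note opt = model_assoc[THEN optional_summand_assoc]
  have FX: "p \<in> carrier FX" if "p \<in> identities B" for B :: "('f :: field, 'd) module" and p
    using that by (simp add: identities_iff)
  show ?thesis
    unfolding detector_algebra_def
    by (simp add: identities_direct_sum direct_sum_assoc_algebra opt identities_optional_summand model_assoc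
        del: free_algebra_simps) (auto dest: FX simp del: free_algebra_simps)
qed

lemma diag_vanish_linear_vanish:
  fixes p :: "'x list \<Rightarrow>\<^sub>0 'f :: field_char_0"
  shows "diag_vanish p \<Longrightarrow> linear_vanish P P p"
  by (simp add: linear_vanish_def diag_vanish_linear)

context fin_dim_peirce_algebra begin

context
  assumes J: "J = jacobson_radical A"
begin

lemma peirce_corners:
  "peirce A e 1 1 = J11" "peirce A e 1 0 = J10" "peirce A e 0 1 = J01" "peirce A e 0 0 = J00"
  unfolding peirce_def J[symmetric] corner_defs by auto

lemma corner_subset: "J11 \<subseteq> carrier A" "J10 \<subseteq> carrier A" "J01 \<subseteq> carrier A" "J00 \<subseteq> carrier A"
  using corner_in by blast+

lemma eps_zero_iff:
  "eps1 A e = 0 \<longleftrightarrow> J10 = {\<zero>}" "eps1_star A e = 0 \<longleftrightarrow> J01 = {\<zero>}"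
  "eps2 A e = 0 \<longleftrightarrow> (\<forall>x\<in>J11. \<forall>y\<in>J11. x \<otimes> y = y \<otimes> x)"
  "eps4 A e = 0 \<longleftrightarrow> (\<forall>x\<in>J10. \<forall>y\<in>J00. x \<otimes> y = \<zero>)"
  "eps4_star A e = 0 \<longleftrightarrow> (\<forall>x\<in>J00. \<forall>y\<in>J01. x \<otimes> y = \<zero>)"
  "eps5 A e = 0 \<longleftrightarrow> (\<forall>x\<in>J01. \<forall>y\<in>J10. x \<otimes> y = \<zero>)"
  "eps6 A e = 0 \<longleftrightarrow> (\<forall>x\<in>J10. \<forall>y\<in>J01. x \<otimes> y = \<zero>)"
proof -
  note m = subspace_mult_eq_zero_iff[OF corner_subset(2) corner_subset(4)]
    subspace_mult_eq_zero_iff[OF corner_subset(4) corner_subset(3)]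
    subspace_mult_eq_zero_iff[OF corner_subset(3) corner_subset(2)]
    subspace_mult_eq_zero_iff[OF corner_subset(2) corner_subset(3)]
  show "eps1 A e = 0 \<longleftrightarrow> J10 = {\<zero>}" "eps1_star A e = 0 \<longleftrightarrow> J01 = {\<zero>}"
    by (simp_all only: eps1_def eps1_star_def delta_def peirce_corners) simp_all
  show "eps4 A e = 0 \<longleftrightarrow> (\<forall>x\<in>J10. \<forall>y\<in>J00. x \<otimes> y = \<zero>)"
    "eps4_star A e = 0 \<longleftrightarrow> (\<forall>x\<in>J00. \<forall>y\<in>J01. x \<otimes> y = \<zero>)"
    "eps5 A e = 0 \<longleftrightarrow> (\<forall>x\<in>J01. \<forall>y\<in>J10. x \<otimes> y = \<zero>)"
    "eps6 A e = 0 \<longleftrightarrow> (\<forall>x\<in>J10. \<forall>y\<in>J01. x \<otimes> y = \<zero>)"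
    unfolding eps4_def eps4_star_def eps5_def eps6_def delta_def peirce_corners m[symmetric] by simp_all
  let ?C = "{u \<otimes> v \<ominus> v \<otimes> u | u v. u \<in> J11 \<and> v \<in> J11}"
  have C: "?C \<subseteq> carrier A" using corner_in(1) by auto
  have "fspan A ?C = {\<zero>} \<longleftrightarrow> (\<forall>x\<in>J11. \<forall>y\<in>J11. x \<otimes> y = y \<otimes> x)"
  proof
    assume z: "fspan A ?C = {\<zero>}"
    show "\<forall>x\<in>J11. \<forall>y\<in>J11. x \<otimes> y = y \<otimes> x"
    proof (intro ballI)
      fix x y assume xy: "x \<in> J11" "y \<in> J11"
      then have "x \<otimes> y \<ominus> y \<otimes> x \<in> fspan A ?C" by (intro fspan_base[OF C]) blast
      then have "x \<otimes> y \<ominus> y \<otimes> x = \<zero>" using z by blast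
      then show "x \<otimes> y = y \<otimes> x" using xy corner_in(1) by (simp add: diff_eq_zero_iff)
    qed
  next
    assume "\<forall>x\<in>J11. \<forall>y\<in>J11. x \<otimes> y = y \<otimes> x"
    then have "?C \<subseteq> {\<zero>}" using corner_in(1) by (auto simp: diff_eq_zero_iff)
    then show "fspan A ?C = {\<zero>}" by (rule fspan_zero)
  qed
  then show "eps2 A e = 0 \<longleftrightarrow> (\<forall>x\<in>J11. \<forall>y\<in>J11. x \<otimes> y = y \<otimes> x)"
    unfolding eps2_def delta_def peirce_corners subspace_comm_def by simp
qed

text \<open>A nonzero parameter provides elements witnessing it, and functionals turn an identity of
  \<open>A\<close> at multiples of these elements into the entries of the model. The factors of a
  nonzero product are themselves nonzero, which supplies the linear entries that the 3 x 3 models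
  require as well.\<close>

lemma identities_subset_detector: "identities A \<subseteq> identities (detector_algebra A e)"
proof
  fix p assume p: "p \<in> identities A"
  then have pF: "p \<in> carrier FX" by (simp add: identities_iff)
  note diag = identity_diag_vanish[OF p]
  note eq = diag_vanish_linear_vanish[OF diag]
  note iff = models model2_identity_iff[OF pF] model3_identity_iff[OF pF]
  have l10: "linear_vanish 1 0 p" if "v \<in> J10" "v \<noteq> \<zero>" for v using identity_linear_vanish_10[OF p that] .
  have l01: "linear_vanish 0 1 p" if "w \<in> J01" "w \<noteq> \<zero>" for w using identity_linear_vanish_01[OF p that] .
  have nz: "x \<noteq> \<zero> \<and> y \<noteq> \<zero>" if "x \<otimes> y \<noteq> \<zero>" "x \<in> carrier A" "y \<in> carrier A" for x y using that by auto
  have "p \<in> identities A1" if e: "eps1 A e \<noteq> 0"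
  proof -
    obtain v where "v \<in> J10" "v \<noteq> \<zero>" using e zero_corner(2) unfolding eps_zero_iff by blast
    then show ?thesis using diag l10 by (simp add: iff)
  qed
  moreover have "p \<in> identities A1_star" if e: "eps1_star A e \<noteq> 0"
  proof -
    obtain v where "v \<in> J01" "v \<noteq> \<zero>" using e zero_corner(3) unfolding eps_zero_iff by blast
    then show ?thesis using diag l01 by (simp add: iff)
  qed
  moreover have "p \<in> identities A2" if e: "eps2 A e \<noteq> 0"
  proof -
    obtain x y where "x \<in> J11" "y \<in> J11" "x \<otimes> y \<noteq> y \<otimes> x" using e unfolding eps_zero_iff by blast
    from identity_bilinear_vanish_111[OF p this] show ?thesis using diag eq by (simp add: iff)
  qed
  moreover have "p \<in> identities A4" if e: "eps4 A e \<noteq> 0"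
  proof -
    obtain x y where xy: "x \<in> J10" "y \<in> J00" "x \<otimes> y \<noteq> \<zero>" using e unfolding eps_zero_iff by blast
    then have "x \<noteq> \<zero>" using nz corner_in by blast
    then show ?thesis using identity_bilinear_vanish_100[OF p xy] diag eq l10[OF xy(1)] by (simp add: iff)
  qed
  moreover have "p \<in> identities A4_star" if e: "eps4_star A e \<noteq> 0"
  proof -
    obtain x y where xy: "x \<in> J00" "y \<in> J01" "x \<otimes> y \<noteq> \<zero>" using e unfolding eps_zero_iff by blast
    then have "y \<noteq> \<zero>" using nz corner_in by blast
    then show ?thesis using identity_bilinear_vanish_001[OF p xy] diag eq l01[OF xy(2)] by (simp add: iff)
  qed
  moreover have "p \<in> identities A5" if e: "eps5 A e \<noteq> 0"
  proof -
    obtain x y where xy: "x \<in> J01" "y \<in> J10" "x \<otimes> y \<noteq> \<zero>" using e unfolding eps_zero_iff by blast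
    then have "x \<noteq> \<zero>" "y \<noteq> \<zero>" using nz corner_in by blast+
    then show ?thesis
      using identity_bilinear_vanish_010[OF p xy] diag eq l01[OF xy(1)] l10[OF xy(2)] by (simp add: iff)
  qed
  moreover have "p \<in> identities A6" if e: "eps6 A e \<noteq> 0"
  proof -
    obtain x y where xy: "x \<in> J10" "y \<in> J01" "x \<otimes> y \<noteq> \<zero>" using e unfolding eps_zero_iff by blast
    then have "x \<noteq> \<zero>" "y \<noteq> \<zero>" using nz corner_in by blast+
    then show ?thesis
      using identity_bilinear_vanish_101[OF p xy] diag eq l10[OF xy(1)] l01[OF xy(2)] by (simp add: iff)
  qed
  ultimately show "p \<in> identities (detector_algebra A e)"
    unfolding identities_detector_algebra using pF by blast
qed

text \<open>The hypothesis \<open>eps\<close> places at least one 3 x 3 model in the detector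
  algebra. It yields \<open>diag_vanish\<close> and, through its bilinear entry at \<alpha> = 0, the
  products inside \<open>J00\<close>, which no parameter records. The other entries come from the
  summands one by one.\<close>

lemma detector_subset_identities:
  assumes eps: "eps2 A e \<noteq> 0 \<or> eps4 A e \<noteq> 0 \<or> eps4_star A e \<noteq> 0 \<or> eps5 A e \<noteq> 0 \<or> eps6 A e \<noteq> 0"
  shows "identities (detector_algebra A e) \<subseteq> identities A"
proof
  fix p assume "p \<in> identities (detector_algebra A e)"
  note p = this[unfolded identities_detector_algebra]
  then have pF: "p \<in> carrier FX" by blast
  note iff = models model2_identity_iff[OF pF] model3_identity_iff[OF pF]
  obtain P Q R where PQR: "diag_vanish p" "bilinear_vanish P Q R p"
    using eps p by (auto simp: iff)
  show "p \<in> identities A"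
  proof (rule identity_criterion[OF pF PQR(1)])
    show "J10 = {\<zero>} \<or> linear_vanish 1 0 p" using p eps_zero_iff(1) by (auto simp: iff)
    show "J01 = {\<zero>} \<or> linear_vanish 0 1 p" using p eps_zero_iff(2) by (auto simp: iff)
    show "(\<forall>x\<in>J11. \<forall>y\<in>J11. x \<otimes> y = y \<otimes> x) \<or> bilinear_vanish 1 1 1 p"
      using p eps_zero_iff(3) by (cases "eps2 A e = 0") (auto simp: iff)
    show "(\<forall>x\<in>J10. \<forall>y\<in>J00. x \<otimes> y = \<zero>) \<or> bilinear_vanish 1 0 0 p"
      using p eps_zero_iff(4) by (cases "eps4 A e = 0") (auto simp: iff)
    show "(\<forall>x\<in>J00. \<forall>y\<in>J01. x \<otimes> y = \<zero>) \<or> bilinear_vanish 0 0 1 p"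
      using p eps_zero_iff(5) by (cases "eps4_star A e = 0") (auto simp: iff)
    show "(\<forall>x\<in>J01. \<forall>y\<in>J10. x \<otimes> y = \<zero>) \<or> bilinear_vanish 0 1 0 p"
      using p eps_zero_iff(6) by (cases "eps5 A e = 0") (auto simp: iff)
    show "(\<forall>x\<in>J10. \<forall>y\<in>J01. x \<otimes> y = \<zero>) \<or> bilinear_vanish 1 0 1 p"
      using p eps_zero_iff(7) by (cases "eps6 A e = 0") (auto simp: iff)
    show "word_sum p (bilinear_entry (\<lambda>_. 0) (\<lambda>_. 0) (\<lambda>_. 0) \<Gamma>) = 0" for \<Gamma>
      by (rule bilinear_vanish_zero[OF PQR(2)])
  qed
qed

text \<open>If all products detected by the parameters vanish, then an identity of \<open>J\<close> whose values on
  \<open>A\<close> lie in \<open>J\<^sup>2\<close> is an identity of \<open>A\<close>.\<close>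

lemma detector_parameter_nonzero:
  assumes fJ: "f \<in> identities (A\<lparr>carrier := J\<rparr>)" and fJ2: "\<And>\<phi>. (\<And>n. \<phi> n \<in> carrier A) \<Longrightarrow> evaluate A \<phi> f \<in> J2"
    and fA: "f \<notin> identities A"
  shows "eps2 A e \<noteq> 0 \<or> eps4 A e \<noteq> 0 \<or> eps4_star A e \<noteq> 0 \<or> eps5 A e \<noteq> 0 \<or> eps6 A e \<noteq> 0"
proof (rule ccontr)
  assume "\<not> ?thesis"
  note z = this[unfolded de_Morgan_disj not_not eps_zero_iff]
  have fF: "f \<in> carrier FX" using fJ by (simp add: identities_iff)
  \<comment> \<open>Values of \<open>f\<close> lie in \<open>J\<close>, so a functional that kills
    \<open>J\<close> and is 1 at \<open>e\<close> sees only the diagonal entry.\<close>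
  have diag: "diag_vanish f"
    unfolding diag_vanish_def
  proof
    fix \<alpha> :: "nat \<Rightarrow> 'f"
    obtain \<psi> where \<psi>: "linear_functional A \<psi>" "\<psi> e = 1" "\<And>x. x \<in> J \<Longrightarrow> \<psi> x = 0"
      using separating_functional[OF fd J_subspace e_in e_notin] by blast
    have "evaluate A (\<lambda>x. \<alpha> x \<odot> e) f \<in> J" using fJ2[of "\<lambda>x. \<alpha> x \<odot> e"] J2_subset_J by auto
    then show "word_sum f (diag_entry \<alpha>) = 0"
      using functional_evaluate_diag[OF fF \<psi>(1), of \<alpha>] \<psi>(2,3) by simp
  qed
  have l10: "J10 = {\<zero>} \<or> linear_vanish 1 0 f"
  proof (rule disjCI)
    assume nl: "\<not> linear_vanish 1 0 f"
    \<comment> \<open>If some \<open>v\<close> in \<open>J10\<close> were outside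
      \<open>J\<^sup>2\<close>, a functional killing \<open>J\<^sup>2\<close> but not
      \<open>v\<close> would read off the linear entry as zero. So a nonvanishing entry puts all of
      \<open>J10\<close> into \<open>J\<^sup>2\<close>, which is possible only for
      \<open>J10 = {\<zero>}\<close>.\<close>
    have "J10 \<subseteq> J2"
    proof (rule ccontr)
      assume "\<not> J10 \<subseteq> J2"
      then obtain v where v: "v \<in> J10" "v \<notin> J2" by blast
      obtain \<psi> where \<psi>: "linear_functional A \<psi>" "\<psi> v = 1" "\<And>x. x \<in> J2 \<Longrightarrow> \<psi> x = 0"
        using separating_functional[OF fd J2_subspace corner_in(2)[OF v(1)] v(2)] by blast
      have "word_sum f (linear_entry (\<lambda>x. 1 * \<alpha> x) (\<lambda>x. 0 * \<alpha> x) \<beta>) = 0" for \<alpha> \<beta>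
        using functional_evaluate_10[OF fF \<psi>(1) v(1), of \<alpha> \<beta>] \<psi>(2) diag corner_in(2)[OF v(1)]
          \<psi>(3)[OF fJ2[of "\<lambda>x. \<alpha> x \<odot> e \<oplus> \<beta> x \<odot> v"]] by (simp add: diag_vanish_def)
      then show False using nl by (simp add: linear_vanish_def)
    qed
    then show "J10 = {\<zero>}" using J10_not_in_J2 zero_corner(2) by blast
  qed
  have l01: "J01 = {\<zero>} \<or> linear_vanish 0 1 f"
  proof (rule disjCI)
    assume nl: "\<not> linear_vanish 0 1 f"
    have "J01 \<subseteq> J2"
    proof (rule ccontr)
      assume "\<not> J01 \<subseteq> J2"
      then obtain v where v: "v \<in> J01" "v \<notin> J2" by blast
      obtain \<psi> where \<psi>: "linear_functional A \<psi>" "\<psi> v = 1" "\<And>x. x \<in> J2 \<Longrightarrow> \<psi> x = 0"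
        using separating_functional[OF fd J2_subspace corner_in(3)[OF v(1)] v(2)] by blast
      have "word_sum f (linear_entry (\<lambda>x. 0 * \<alpha> x) (\<lambda>x. 1 * \<alpha> x) \<beta>) = 0" for \<alpha> \<beta>
        using functional_evaluate_01[OF fF \<psi>(1) v(1), of \<alpha> \<beta>] \<psi>(2) diag corner_in(3)[OF v(1)]
          \<psi>(3)[OF fJ2[of "\<lambda>x. \<alpha> x \<odot> e \<oplus> \<beta> x \<odot> v"]] by (simp add: diag_vanish_def)
      then show False using nl by (simp add: linear_vanish_def)
    qed
    then show "J01 = {\<zero>}" using J01_not_in_J2 zero_corner(3) by blast
  qed
  have "f \<in> identities A"
  proof (rule identity_criterion[OF fF diag l10 l01])
    \<comment> \<open>The assumed vanishing of the parameters says nothing about products inside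
      \<open>J00\<close>; here the substitution stays in \<open>J\<close>, where \<open>f\<close> is
      an identity.\<close>
    fix \<psi> and z :: "nat \<Rightarrow> 'a" assume \<psi>: "linear_functional A \<psi>" and zJ: "\<And>x. z x \<in> J00"
    have "evaluate A z f = evaluate (A\<lparr>carrier := J\<rparr>) z f"
      by (rule evaluate_subalgebra[symmetric, OF assoc_algebra_axioms ideal_subalgebra[OF J_ideal] J_subset corner_J(4)[OF zJ]])
    also have "\<dots> = \<zero>" using identitiesD[of f "A\<lparr>carrier := J\<rparr>" z, OF fJ] corner_J(4)[OF zJ] by simp
    finally have "evaluate A z f = \<zero>" .
    moreover have "word_sum f (diag_entry (\<lambda>_. 0)) = 0" using diag by (simp add: diag_vanish_def)
    ultimately show "word_sum f (bilinear_entry (\<lambda>_. 0) (\<lambda>_. 0) (\<lambda>_. 0) (\<lambda>x y. \<psi> (z x \<otimes> z y))) = 0"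
      using functional_evaluate[of \<psi> "\<lambda>_. \<zero>" "\<lambda>_. \<zero>" "\<lambda>_. \<zero>" z f "\<lambda>_. 0", OF \<psi> zero_corner(1,2,3) zJ fF]
        corner_in(4)[OF zJ] linear_functionalD(3)[OF \<psi>] diag_vanish_linear(1)[OF diag] by simp
  qed (use z in blast)+
  then show False using fA by blast
qed

end
end

lemma one_dim_decomposition_peirce:
  fixes A :: "('f :: field_char_0, 'a) module" (structure)
  assumes A: "assoc_algebra A" and fd: "finite_dimensional A" and s: "s_index A = 2"
    and e: "one_dim_decomposition A e"
  shows "fin_dim_peirce_algebra A e (jacobson_radical A)"
proof -
  interpret assoc_algebra A by (rule A)
  let ?J = "jacobson_radical A"
  obtain S where S: "wedderburn_malcev A {S}" "fdim (A\<lparr>carrier := S\<rparr>) = 1" "e \<in> S"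
    "\<And>x. x \<in> S \<Longrightarrow> e \<otimes> x = x" using e by (auto simp: one_dim_decomposition_def)
  note comp = wedderburn_malcev_component[OF A S(1), of S, simplified]
  note Sc = subspaceD[OF comp(1)]
  have ss: "semisimple_part A {S} = S" by (simp add: semisimple_part_def fspan_of_subspace[OF comp(1)])
  have eA: "e \<in> carrier A" using S(3) Sc(2) by blast
  obtain x y where xy: "x \<in> S" "y \<in> S" "x \<otimes> y \<noteq> \<zero>" using comp(3) by (auto simp: simple_algebra_def)
  have ene: "e \<noteq> \<zero>" using S(4)[OF xy(1)] xy Sc(2) by auto
  \<comment> \<open>Dimension one provides a single spanning vector \<open>b\<close>; as
    \<open>e\<close> is a nonzero multiple of it, \<open>e\<close> spans the same line.\<close>
  have S_eq: "\<exists>c. x = c \<odot> e" if x: "x \<in> S" for x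
  proof -
    obtain B where B: "finite B" "B \<subseteq> S" "fspan A B = S" "card B = 1"
      using subspace_fin_dim[OF fd comp(1)] S(2) by metis
    then obtain b where b: "B = {b}" by (meson card_1_singletonE)
    have bA: "b \<in> carrier A" using B(2) b Sc(2) by blast
    have Sb: "S = range (\<lambda>c. c \<odot> b)" using B(3) fspan_singleton[OF bA] b by simp
    then obtain c d where cd: "e = c \<odot> b" "x = d \<odot> b" using S(3) x by blast
    then have "c \<noteq> 0" using ene bA by auto
    then have "x = (d * inverse c) \<odot> e" using cd bA by (simp add: mult.assoc flip: mult_smult)
    then show ?thesis ..
  qed
  show ?thesis
  proof unfold_locales
    show "e \<in> carrier A" by (rule eA)
    show "e \<otimes> e = e" using S(3,4) by blast
    show "alg_ideal A ?J" by (rule radical_ideal)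
    show "e \<notin> ?J"
    proof
      assume "e \<in> ?J"
      moreover have "S \<inter> ?J = {\<zero>}" using S(1) ss by (simp add: wedderburn_malcev_def)
      ultimately show False using S(3) ene by blast
    qed
    show "\<exists>c. \<exists>j\<in>?J. x = c \<odot> e \<oplus> j" if x: "x \<in> carrier A" for x
    proof -
      have "x \<in> fspan A (S \<union> ?J)" using S(1) ss x by (simp add: wedderburn_malcev_def)
      then obtain u j where "u \<in> S" "j \<in> ?J" "x = u \<oplus> j" by (rule fspan_Un_subspaces[OF comp(1) radical_subspace])
      then show ?thesis using S_eq by blast
    qed
    show "(x \<otimes> y) \<otimes> z = \<zero>" if "x \<in> ?J" "y \<in> ?J" "z \<in> ?J" for x y z
      by (rule radical_cube_zero[OF fd s that])
    show fin_dim by (rule fd)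
  qed
qed

text \<open>The parameters are computed from an idempotent \<open>e\<close>. The claim is made for
  every admissible one, and existence is asserted separately so that the universal statement is not
  vacuous.\<close>

theorem theorem5p1:
  fixes A :: "('f :: {alg_closed_field, field_char_0}, 'a) module"
  assumes "assoc_algebra A"
    and "finite_dimensional A"
    and "\<not> nilpotent_algebra A"
    and "fundamental A"
    and "polynomial_growth A"
    and "s_index A = 2"
  shows "(\<exists>e. one_dim_decomposition A e) \<and>
    (\<forall>e. one_dim_decomposition A e \<longrightarrow>
      A \<sim>\<^sub>T detector_algebra A e \<and>
      eps2 A e + eps4 A e + eps4_star A e + eps5 A e + eps6 A e \<ge> 1)"
proof -
  interpret assoc_algebra A by (rule assms(1))
  obtain S e f where wm: "wedderburn_malcev A {S}"
    and e: "e \<in> S" "e \<noteq> \<zero>\<^bsub>A\<^esub>" "e \<otimes>\<^bsub>A\<^esub> e = e" "S = range (\<lambda>c. c \<odot>\<^bsub>A\<^esub> e)"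
    and f: "f \<in> identities (A\<lparr>carrier := jacobson_radical A\<rparr>)"
      "f \<in> identities (algebra_calA_mod A {S} 2)" "f \<notin> identities A"
    by (rule one_component[OF assms])
  have split: "split_algebra A {S}"
    using assms(1,2) wm by (simp add: split_algebra_def split_algebra_axioms_def)
  have S: "subspace class_ring S A" using wm by (simp add: wedderburn_malcev_def)
  have eA: "e \<in> carrier A" using subspaceD(2)[OF S e(1)] .
  have "one_dim_decomposition A e"
    unfolding one_dim_decomposition_def
  proof (intro exI conjI ballI)
    show "wedderburn_malcev A {S}" "e \<in> S" by (fact wm, fact e(1))
    show "e \<otimes>\<^bsub>A\<^esub> x = x" "x \<otimes>\<^bsub>A\<^esub> e = x" if "x \<in> S" for x
      using that e(3) eA unfolding e(4) by (auto simp: bilinear)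
    interpret S: fvectorspace "A\<lparr>carrier := S\<rparr>" by (rule subspace_fvectorspace[OF S])
    have "fspan (A\<lparr>carrier := S\<rparr>) {e} = S"
      using S.fspan_singleton[of e] e(1,4) by simp
    then show "fdim (A\<lparr>carrier := S\<rparr>) = 1"
      by (intro S.dim1I[of e]) (use e in simp_all)
  qed
  moreover have "A \<sim>\<^sub>T detector_algebra A e' \<and>
      eps2 A e' + eps4 A e' + eps4_star A e' + eps5 A e' + eps6 A e' \<ge> 1"
    if e': "one_dim_decomposition A e'" for e'
  proof -
    interpret P: fin_dim_peirce_algebra A e' "jacobson_radical A"
      by (rule one_dim_decomposition_peirce[OF assms(1,2,6) e'])
    \<comment> \<open>The polynomial \<open>f\<close> was found for the component \<open>S\<close>,
      but being an identity of \<open>J\<close>, having values in \<open>J\<^sup>2\<close> and not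
      being an identity of \<open>A\<close> are properties without reference to \<open>S\<close>. It
      therefore serves every \<open>e'\<close>.\<close>
    have eps: "eps2 A e' \<noteq> 0 \<or> eps4 A e' \<noteq> 0 \<or> eps4_star A e' \<noteq> 0 \<or> eps5 A e' \<noteq> 0 \<or> eps6 A e' \<noteq> 0"
      by (rule P.detector_parameter_nonzero[OF refl f(1) split_algebra.identity_calA_mod_2[OF split f(2)] f(3)])
    then show ?thesis
      unfolding T_equivalent_def
      using P.identities_subset_detector[OF refl] P.detector_subset_identities[OF refl eps] by auto
  qed
  ultimately show ?thesis by blast
qed

end
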